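(* Let $\mathcal{A}$ be a locally finite dimensional (lofd) category over $\Bbbk$ with radical square zero and quiver $\mathcal{Q}=\mathcal{Q}_{\mathcal{A}}$. Then the complexes $\mathbf{F}(M)$ with $M\in\operatorname{ind}\operatorname{rep}(\Bbbk\mathcal{Q}^{\Box})$ and the complexes $\beta(N)$ with $N\in\mathcal{X}(\mathcal{A})$ together constitute an exhaustive list of pairwise non-isomorphic indecomposable objects of $\mathcal{D}^b(\mathcal{A})$.
   Context: $\Bbbk$ is an algebraically closed field; $\operatorname{ind}\mathcal{C}$ denotes a set of representatives of the isomorphism classes of indecomposable objects of $\mathcal{C}$. **Lofd categories.** A $\Bbbk$-category $\mathcal{A}$ is locally finite dimensional (lofd) if (i) all spaces $\mathcal{A}(x,y)$ are finite dimensional; (ii) $\mathcal{A}$ is additive and all idempotents split; (iii) for each object $x$ the set $\{y\in\operatorname{ind}\mathcal{A}\mid \mathcal{A}(x,y)\neq 0\text{ or }\mathcal{A}(y,x)\neq 0\}$ is finite. Every lofd category is equivalent to $\operatorname{add}\Bbbk\mathcal{Q}/\mathcal{I}$ with $\mathcal{Q}=\mathcal{Q}_{\mathcal{A}}$ a locally finite quiver (finitely many arrows start or stop at each vertex) and $\mathcal{I}$ an admissible ideal of the path category $\Bbbk\mathcal{Q}$; here $\operatorname{add}\mathcal{C}$ is the minimal additive category with split idempotents containing $\mathcal{C}$. Radical square zero means $\operatorname{rad}^2\mathcal{A}=0$, i.e. $\mathcal{I}$ is the ideal generated by all paths of length 2; we identify $\mathcal{A}$ with $\operatorname{add}\Bbbk\mathcal{Q}/\mathcal{I}$.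 **Modules and derived category.** $\mathcal{A}$-mod is the category of functors $M:\mathcal{A}\to\Bbbk\text{-vec}$ (finite dimensional spaces) with $\{x\in\operatorname{ind}\mathcal{A}\mid Mx\ne0\}$ finite, and $\mathcal{D}^b(\mathcal{A})$ is its bounded derived category. Put $\mathcal{A}^x=\mathcal{A}(x,-)$, a projective module; for an arrow $\alpha:x\to y$ let $\mathcal{A}^\alpha:\mathcal{A}^y\to\mathcal{A}^x$ be the induced morphism $f\mapsto f\alpha$. Complexes are written $d_n:P_n\to P_{n-1}$. $\mathcal{D}^b(\mathcal{A})$ is identified with $\mathcal{K}^{-,b}(\mathcal{A})$, the category of right bounded complexes ($P_n=0$ for $n\ll0$) of finitely generated projective modules with nonzero homology in only finitely many degrees, modulo homotopy; $\mathcal{K}^b(\mathcal{A})$ is the subcategory of bounded complexes of finitely generated projectives modulo homotopy. A complex of projectives is minimal if $\operatorname{im}d_n\subseteq\operatorname{rad}P_{n-1}$ for all $n$; $\mathcal{P}^b_{\min}(\mathcal{A})$ is the category of minimal bounded complexes of finitely generated projective $\mathcal{A}$-modules. For $M\in\mathcal{D}^b(\mathcal{A})$, $P_M$ denotes its minimal projective resolution. **The truncation $\beta$ and the set $\mathcal{X}(\mathcal{A})$.** For a nonzero bounded complex $P$ of finitely generated projectives let $t$ be the minimal number such that $P_i=0$ for $i>t$. Then $\beta(P)$ is the complex with $\beta(P)_i=P_i$ for $i\le t$, $\beta(P)_{t+1}=\operatorname{Ker}d_t$, $\beta(P)_i=0$ for $i>t+1$, with the differentials of $P$ in degrees $\le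 t$ and the inclusion $\operatorname{Ker}d_t\hookrightarrow P_t$ in degree $t+1$. Let $\overline{\mathcal{X}(\mathcal{A})}=\{M\in\operatorname{ind}\mathcal{P}^b_{\min}(\mathcal{A})\mid P_{\beta(M)}\notin\mathcal{K}^b(\mathcal{A})\}$, with the equivalence relation $M\sim N$ iff $P_{\beta(M)}\cong P_{\beta(N)}$ in $\mathcal{K}^{-,b}(\mathcal{A})$. $\mathcal{X}(\mathcal{A})$ is a fixed set of representatives of the equivalence classes. **The quiver $\mathcal{Q}^{\Box}$ and $\mathbf{F}$.** $\mathcal{Q}^{\Box}$ has vertex set $\mathcal{Q}_0\times\mathbb{Z}$ and arrow set $\mathcal{Q}_1\times\mathbb{Z}$, where for $\alpha:a\to b$ in $\mathcal{Q}$ the arrow $(\alpha,i)$ goes from $(b,i)$ to $(a,i-1)$. $\operatorname{rep}(\Bbbk\mathcal{Q}^{\Box})$ is the category of representations of $\mathcal{Q}^{\Box}$ by finite dimensional spaces with finite support. For such $M$, given by spaces $M(x,n)$ and maps $M(\alpha,n):M(y,n)\to M(x,n-1)$ for arrows $\alpha:x\to y$, the complex $\mathbf{F}(M)=(P_\bullet,d_\bullet)$ is defined by $P_n=\bigoplus_{x\in\mathcal{Q}_0}\mathcal{A}^x\otimes M(x,n)$ and $d_n=\sum_{\alpha:x\to y}\mathcal{A}^\alpha\otimes M(\alpha,n)$, the sum running over all arrows $\alpha\in\mathcal{Q}_1$. *)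

theory Defs
  imports
    "HOL-Computational_Algebra.Polynomial"
    "HOL-Library.Function_Algebras"
    "Graph_Theory.Digraph"
    "Jordan_Normal_Form.Matrix"
begin

section \<open>Preadditive categories\<close>

text \<open>Hom-sets of different pairs of objects may overlap, so composition, sum and zero carry the
  objects as arguments: \<open>Cmp C x y z g f\<close> is the composite of \<open>f : x \<rightarrow> y\<close> followed by
  \<open>g : y \<rightarrow> z\<close>.\<close>

record ('o, 'm) precat =
  Obj :: "'o set"
  Hom :: "'o \<Rightarrow> 'o \<Rightarrow> 'm set"
  Idn :: "'o \<Rightarrow> 'm"
  Cmp :: "'o \<Rightarrow> 'o \<Rightarrow> 'o \<Rightarrow> 'm \<Rightarrow> 'm \<Rightarrow> 'm"
  Sum :: "'o \<Rightarrow> 'o \<Rightarrow> 'm \<Rightarrow> 'm \<Rightarrow> 'm"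
  Zer :: "'o \<Rightarrow> 'o \<Rightarrow> 'm"

definition zero_object :: "('o, 'm) precat \<Rightarrow> 'o \<Rightarrow> bool" where
  "zero_object C x \<longleftrightarrow> x \<in> Obj C \<and> Idn C x = Zer C x x"

definition isomorphic :: "('o, 'm) precat \<Rightarrow> 'o \<Rightarrow> 'o \<Rightarrow> bool" where
  "isomorphic C x y \<longleftrightarrow> x \<in> Obj C \<and> y \<in> Obj C \<and>
     (\<exists>f \<in> Hom C x y. \<exists>g \<in> Hom C y x.
        Cmp C x y x g f = Idn C x \<and> Cmp C y x y f g = Idn C y)"

definition is_direct_sum :: "('o, 'm) precat \<Rightarrow> 'o \<Rightarrow> 'o \<Rightarrow> 'o \<Rightarrow> bool" where
  "is_direct_sum C x y z \<longleftrightarrow> x \<in> Obj C \<and> y \<in> Obj C \<and> z \<in> Obj C \<and>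
     (\<exists>i1 \<in> Hom C y x. \<exists>i2 \<in> Hom C z x. \<exists>p1 \<in> Hom C x y. \<exists>p2 \<in> Hom C x z.
        Cmp C y x y p1 i1 = Idn C y \<and> Cmp C z x z p2 i2 = Idn C z \<and>
        Cmp C z x y p1 i2 = Zer C z y \<and> Cmp C y x z p2 i1 = Zer C y z \<and>
        Sum C x x (Cmp C x y x i1 p1) (Cmp C x z x i2 p2) = Idn C x)"

definition indecomposable :: "('o, 'm) precat \<Rightarrow> 'o \<Rightarrow> bool" where
  "indecomposable C x \<longleftrightarrow> x \<in> Obj C \<and> \<not> zero_object C x \<and>
     (\<forall>y z. is_direct_sum C x y z \<longrightarrow> zero_object C y \<or> zero_object C z)"

definition exhaustive_list_of_indecomposables ::
    "('o, 'm) precat \<Rightarrow> 'j set \<Rightarrow> ('j \<Rightarrow> 'o) \<Rightarrow> bool" where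
  "exhaustive_list_of_indecomposables C J L \<longleftrightarrow>
     (\<forall>j \<in> J. indecomposable C (L j)) \<and>
     (\<forall>i \<in> J. \<forall>j \<in> J. i \<noteq> j \<longrightarrow> \<not> isomorphic C (L i) (L j)) \<and>
     (\<forall>x. indecomposable C x \<longrightarrow> (\<exists>j \<in> J. isomorphic C x (L j)))"

text \<open>\<open>is_ind C S\<close>: the set \<open>S\<close> is a possible choice of \<open>ind C\<close>.\<close>

definition is_ind :: "('o, 'm) precat \<Rightarrow> 'o set \<Rightarrow> bool" where
  "is_ind C S \<longleftrightarrow> exhaustive_list_of_indecomposables C S (\<lambda>x. x)"


section \<open>Locally finite dimensional categories\<close>

definition fin_dim :: "('k::field \<Rightarrow> 'v::ab_group_add \<Rightarrow> 'v) \<Rightarrow> 'v set \<Rightarrow> bool" where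
  "fin_dim sc V \<longleftrightarrow> (\<exists>B. finite B \<and> module.span sc B = V)"

text \<open>The morphism spaces are subspaces of one ambient vector space \<open>'m\<close>. This is no
  restriction, as the ambient space can be taken to be the direct sum of all morphism spaces.\<close>

locale k_category = vector_space scale
  for scale :: "'k::field \<Rightarrow> 'm::ab_group_add \<Rightarrow> 'm" +
  fixes A :: "('o, 'm) precat"
  assumes Hom_subspace: "\<lbrakk>x \<in> Obj A; y \<in> Obj A\<rbrakk> \<Longrightarrow> subspace (Hom A x y)"
    and Sum_eq: "\<lbrakk>x \<in> Obj A; y \<in> Obj A; f \<in> Hom A x y; g \<in> Hom A x y\<rbrakk>
          \<Longrightarrow> Sum A x y f g = f + g"
    and Zer_eq: "\<lbrakk>x \<in> Obj A; y \<in> Obj A\<rbrakk> \<Longrightarrow> Zer A x y = 0"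
    and Idn_Hom: "x \<in> Obj A \<Longrightarrow> Idn A x \<in> Hom A x x"
    and Cmp_Hom: "\<lbrakk>x \<in> Obj A; y \<in> Obj A; z \<in> Obj A; f \<in> Hom A x y; g \<in> Hom A y z\<rbrakk>
          \<Longrightarrow> Cmp A x y z g f \<in> Hom A x z"
    and Cmp_Idn_right: "\<lbrakk>x \<in> Obj A; y \<in> Obj A; f \<in> Hom A x y\<rbrakk>
          \<Longrightarrow> Cmp A x x y f (Idn A x) = f"
    and Cmp_Idn_left: "\<lbrakk>x \<in> Obj A; y \<in> Obj A; f \<in> Hom A x y\<rbrakk>
          \<Longrightarrow> Cmp A x y y (Idn A y) f = f"
    and Cmp_assoc: "\<lbrakk>w \<in> Obj A; x \<in> Obj A; y \<in> Obj A; z \<in> Obj A;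
          f \<in> Hom A w x; g \<in> Hom A x y; h \<in> Hom A y z\<rbrakk>
          \<Longrightarrow> Cmp A w x z (Cmp A x y z h g) f = Cmp A w y z h (Cmp A w x y g f)"
    and Cmp_add_left: "\<lbrakk>x \<in> Obj A; y \<in> Obj A; z \<in> Obj A;
          f \<in> Hom A x y; g \<in> Hom A y z; g' \<in> Hom A y z\<rbrakk>
          \<Longrightarrow> Cmp A x y z (g + g') f = Cmp A x y z g f + Cmp A x y z g' f"
    and Cmp_add_right: "\<lbrakk>x \<in> Obj A; y \<in> Obj A; z \<in> Obj A;
          f \<in> Hom A x y; f' \<in> Hom A x y; g \<in> Hom A y z\<rbrakk>
          \<Longrightarrow> Cmp A x y z g (f + f') = Cmp A x y z g f + Cmp A x y z g f'"
    and Cmp_scale_left: "\<lbrakk>x \<in> Obj A; y \<in> Obj A; z \<in> Obj A; f \<in> Hom A x y; g \<in> Hom A y z\<rbrakk>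
          \<Longrightarrow> Cmp A x y z (scale c g) f = scale c (Cmp A x y z g f)"
    and Cmp_scale_right: "\<lbrakk>x \<in> Obj A; y \<in> Obj A; z \<in> Obj A; f \<in> Hom A x y; g \<in> Hom A y z\<rbrakk>
          \<Longrightarrow> Cmp A x y z g (scale c f) = scale c (Cmp A x y z g f)"

locale lofd_category = k_category scale A
  for scale :: "'k::field \<Rightarrow> 'm::ab_group_add \<Rightarrow> 'm" and A :: "('o, 'm) precat" +
  assumes Hom_fin_dim: "\<lbrakk>x \<in> Obj A; y \<in> Obj A\<rbrakk> \<Longrightarrow> fin_dim scale (Hom A x y)"
    and ex_zero_object: "\<exists>x. zero_object A x"
    and ex_direct_sum: "\<lbrakk>y \<in> Obj A; z \<in> Obj A\<rbrakk> \<Longrightarrow> \<exists>x. is_direct_sum A x y z"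
    and idempotents_split: "\<lbrakk>x \<in> Obj A; e \<in> Hom A x x; Cmp A x x x e e = e\<rbrakk>
          \<Longrightarrow> \<exists>y \<in> Obj A. \<exists>p \<in> Hom A x y. \<exists>i \<in> Hom A y x.
                Cmp A x y x i p = e \<and> Cmp A y x y p i = Idn A y"
    and finite_neighbours: "\<lbrakk>is_ind A I; x \<in> Obj A\<rbrakk>
          \<Longrightarrow> finite {y \<in> I. Hom A x y \<noteq> {0} \<or> Hom A y x \<noteq> {0}}"

definition rad :: "('o, 'm::ab_group_add) precat \<Rightarrow> 'o \<Rightarrow> 'o \<Rightarrow> 'm set" where
  "rad A x y = {f \<in> Hom A x y. \<forall>g \<in> Hom A y x. \<exists>h \<in> Hom A x x.
     Cmp A x x x h (Idn A x - Cmp A x y x g f) = Idn A x \<and>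
     Cmp A x x x (Idn A x - Cmp A x y x g f) h = Idn A x}"

definition rad_sq ::
    "('k::field \<Rightarrow> 'm::ab_group_add \<Rightarrow> 'm) \<Rightarrow> ('o, 'm) precat \<Rightarrow> 'o \<Rightarrow> 'o \<Rightarrow> 'm set" where
  "rad_sq scale A x z =
     module.span scale {Cmp A x y z g f | y f g. y \<in> Obj A \<and> f \<in> rad A x y \<and> g \<in> rad A y z}"

definition radical_square_zero ::
    "('k::field \<Rightarrow> 'm::ab_group_add \<Rightarrow> 'm) \<Rightarrow> ('o, 'm) precat \<Rightarrow> bool" where
  "radical_square_zero scale A \<longleftrightarrow> (\<forall>x \<in> Obj A. \<forall>y \<in> Obj A. rad_sq scale A x y = {0})"

text \<open>A quiver is a \<open>pre_digraph\<close> satisfying \<open>wf_digraph\<close> (loops and multiple arrows allowed).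
  \<open>is_quiver_of scale A Q \<rho>\<close>: the vertices of \<open>Q\<close> are representatives of the indecomposable
  objects of \<open>A\<close>, and \<open>\<rho>\<close> sends the arrows from \<open>x\<close> to \<open>y\<close> to elements of \<open>rad A x y\<close> whose
  residue classes form a basis of \<open>rad A x y\<close> modulo \<open>rad_sq scale A x y\<close>. For \<open>rad\<^sup>2 = 0\<close> such a
  \<open>\<rho>\<close> is the same as an identification of \<open>A\<close> with the additive hull of the path category of
  \<open>Q\<close> modulo all paths of length 2, which is the identity on \<open>Q\<close>.\<close>

definition is_quiver_of ::
    "('k::field \<Rightarrow> 'm::ab_group_add \<Rightarrow> 'm) \<Rightarrow> ('o, 'm) precat \<Rightarrow> ('o, 'a) pre_digraph
      \<Rightarrow> ('a \<Rightarrow> 'm) \<Rightarrow> bool" where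
  "is_quiver_of scale A Q \<rho> \<longleftrightarrow> wf_digraph Q \<and> is_ind A (verts Q) \<and>
     (\<forall>x \<in> verts Q. \<forall>y \<in> verts Q.
        let arr = {\<alpha> \<in> arcs Q. tail Q \<alpha> = x \<and> head Q \<alpha> = y} in
          inj_on \<rho> arr \<and> \<rho> ` arr \<subseteq> rad A x y \<and>
          \<not> module.dependent scale (\<rho> ` arr) \<and>
          module.span scale (\<rho> ` arr) \<inter> rad_sq scale A x y = {0} \<and>
          module.span scale (\<rho> ` arr \<union> rad_sq scale A x y) = rad A x y)"


section \<open>Modules\<close>

text \<open>The finite dimensional spaces \<open>\<bbbk>-vec\<close> in which modules take their values are the finite
  dimensional subspaces of \<open>('o, 'm) uvec\<close> (with pointwise operations). Every finite dimensional
  space is isomorphic to one of these unless \<open>'m = 0\<close>, when all modules vanish anyway. This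
  universe is chosen because it contains the values of sums of representable
  functors \<open>A(x, -)\<close>, the summands being indexed by an object and a natural number.\<close>

type_synonym ('o, 'm) uvec = "'o \<Rightarrow> nat \<Rightarrow> 'm"

definition uscale :: "('k \<Rightarrow> 'm \<Rightarrow> 'm) \<Rightarrow> 'k \<Rightarrow> ('o, 'm) uvec \<Rightarrow> ('o, 'm) uvec" where
  "uscale scale c v = (\<lambda>x i. scale c (v x i))"

lemma vector_space_uscale:
  assumes "vector_space scale"
  shows "vector_space (uscale scale)"
  using assms unfolding vector_space_def uscale_def by (simp add: fun_eq_iff)

text \<open>\<open>Act M x y f : Sp M x \<rightarrow> Sp M y\<close> is the value of the functor \<open>M\<close> at \<open>f : x \<rightarrow> y\<close>.\<close>

record ('o, 'm) amod =
  Sp :: "'o \<Rightarrow> ('o, 'm) uvec set"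
  Act :: "'o \<Rightarrow> 'o \<Rightarrow> 'm \<Rightarrow> ('o, 'm) uvec \<Rightarrow> ('o, 'm) uvec"

definition linear_map ::
    "('k \<Rightarrow> 'v::plus \<Rightarrow> 'v) \<Rightarrow> 'v set \<Rightarrow> 'v set \<Rightarrow> ('v \<Rightarrow> 'v) \<Rightarrow> bool" where
  "linear_map sc V W f \<longleftrightarrow> f ` V \<subseteq> W \<and>
     (\<forall>u \<in> V. \<forall>v \<in> V. f (u + v) = f u + f v) \<and> (\<forall>c. \<forall>v \<in> V. f (sc c v) = sc c (f v))"

definition is_amod ::
    "('k::field \<Rightarrow> 'm::ab_group_add \<Rightarrow> 'm) \<Rightarrow> ('o, 'm) precat \<Rightarrow> ('o, 'm) amod \<Rightarrow> bool" where
  "is_amod scale A M \<longleftrightarrow>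
     (\<forall>x \<in> Obj A. module.subspace (uscale scale) (Sp M x) \<and> fin_dim (uscale scale) (Sp M x)) \<and>
     (\<forall>x \<in> Obj A. \<forall>y \<in> Obj A. \<forall>f \<in> Hom A x y.
        linear_map (uscale scale) (Sp M x) (Sp M y) (Act M x y f)) \<and>
     (\<forall>x \<in> Obj A. \<forall>v \<in> Sp M x. Act M x x (Idn A x) v = v) \<and>
     (\<forall>x \<in> Obj A. \<forall>y \<in> Obj A. \<forall>z \<in> Obj A. \<forall>f \<in> Hom A x y. \<forall>g \<in> Hom A y z. \<forall>v \<in> Sp M x.
        Act M x z (Cmp A x y z g f) v = Act M y z g (Act M x y f v)) \<and>
     (\<forall>x \<in> Obj A. \<forall>y \<in> Obj A. \<forall>f \<in> Hom A x y. \<forall>g \<in> Hom A x y. \<forall>v \<in> Sp M x.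
        Act M x y (f + g) v = Act M x y f v + Act M x y g v) \<and>
     (\<forall>x \<in> Obj A. \<forall>y \<in> Obj A. \<forall>f \<in> Hom A x y. \<forall>c. \<forall>v \<in> Sp M x.
        Act M x y (scale c f) v = uscale scale c (Act M x y f v)) \<and>
     (\<forall>I. is_ind A I \<longrightarrow> finite {x \<in> I. Sp M x \<noteq> {0}})"

text \<open>Natural transformations are extended by zero outside the spaces \<open>Sp M x\<close>, so that they are
  equal as soon as they agree there.\<close>

type_synonym ('o, 'm) amap = "'o \<Rightarrow> ('o, 'm) uvec \<Rightarrow> ('o, 'm) uvec"

definition amap_hom ::
    "('k::field \<Rightarrow> 'm::ab_group_add \<Rightarrow> 'm) \<Rightarrow> ('o, 'm) precat \<Rightarrow> ('o, 'm) amod \<Rightarrow> ('o, 'm) amod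
      \<Rightarrow> ('o, 'm) amap set" where
  "amap_hom scale A M N = {\<eta>.
     (\<forall>x \<in> Obj A. linear_map (uscale scale) (Sp M x) (Sp N x) (\<eta> x)) \<and>
     (\<forall>x \<in> Obj A. \<forall>y \<in> Obj A. \<forall>f \<in> Hom A x y. \<forall>v \<in> Sp M x.
        \<eta> y (Act M x y f v) = Act N x y f (\<eta> x v)) \<and>
     (\<forall>x v. x \<notin> Obj A \<or> v \<notin> Sp M x \<longrightarrow> \<eta> x v = 0)}"

definition Mod ::
    "('k::field \<Rightarrow> 'm::ab_group_add \<Rightarrow> 'm) \<Rightarrow> ('o, 'm) precat
      \<Rightarrow> (('o, 'm) amod, ('o, 'm) amap) precat" where
  "Mod scale A = \<lparr>
     Obj = {M. is_amod scale A M},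
     Hom = amap_hom scale A,
     Idn = (\<lambda>M x v. if x \<in> Obj A \<and> v \<in> Sp M x then v else 0),
     Cmp = (\<lambda>L M N \<eta> \<theta> x v. \<eta> x (\<theta> x v)),
     Sum = (\<lambda>M N \<eta> \<theta> x v. \<eta> x v + \<theta> x v),
     Zer = (\<lambda>M N x v. 0) \<rparr>"

definition is_zero_amod :: "('o, 'm::zero) precat \<Rightarrow> ('o, 'm) amod \<Rightarrow> bool" where
  "is_zero_amod A M \<longleftrightarrow> (\<forall>x \<in> Obj A. Sp M x = {0})"

definition zero_amod :: "('o, 'm::zero) amod" where
  "zero_amod = \<lparr>Sp = (\<lambda>x. {0}), Act = (\<lambda>x y f v. 0)\<rparr>"

definition ker_amod ::
    "('o, 'm::zero) amod \<Rightarrow> ('o, 'm) amap \<Rightarrow> ('o, 'm) amod" where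
  "ker_amod M \<eta> = \<lparr>Sp = (\<lambda>x. {v \<in> Sp M x. \<eta> x v = 0}), Act = Act M\<rparr>"

definition submodule ::
    "('k::field \<Rightarrow> 'm::ab_group_add \<Rightarrow> 'm) \<Rightarrow> ('o, 'm) precat \<Rightarrow> ('o, 'm) amod
      \<Rightarrow> ('o \<Rightarrow> ('o, 'm) uvec set) \<Rightarrow> bool" where
  "submodule scale A M N \<longleftrightarrow>
     (\<forall>x \<in> Obj A. N x \<subseteq> Sp M x \<and> module.subspace (uscale scale) (N x)) \<and>
     (\<forall>x \<in> Obj A. \<forall>y \<in> Obj A. \<forall>f \<in> Hom A x y. Act M x y f ` N x \<subseteq> N y)"

definition maximal_submodule ::
    "('k::field \<Rightarrow> 'm::ab_group_add \<Rightarrow> 'm) \<Rightarrow> ('o, 'm) precat \<Rightarrow> ('o, 'm) amod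
      \<Rightarrow> ('o \<Rightarrow> ('o, 'm) uvec set) \<Rightarrow> bool" where
  "maximal_submodule scale A M N \<longleftrightarrow>
     submodule scale A M N \<and> (\<exists>x \<in> Obj A. N x \<noteq> Sp M x) \<and>
     (\<forall>N'. submodule scale A M N' \<and> (\<forall>x \<in> Obj A. N x \<subseteq> N' x) \<longrightarrow>
        (\<forall>x \<in> Obj A. N' x = N x) \<or> (\<forall>x \<in> Obj A. N' x = Sp M x))"

definition rad_amod ::
    "('k::field \<Rightarrow> 'm::ab_group_add \<Rightarrow> 'm) \<Rightarrow> ('o, 'm) precat \<Rightarrow> ('o, 'm) amod
      \<Rightarrow> 'o \<Rightarrow> ('o, 'm) uvec set" where
  "rad_amod scale A M x = {v \<in> Sp M x. \<forall>N. maximal_submodule scale A M N \<longrightarrow> v \<in> N x}"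

definition finitely_generated ::
    "('k::field \<Rightarrow> 'm::ab_group_add \<Rightarrow> 'm) \<Rightarrow> ('o, 'm) precat \<Rightarrow> ('o, 'm) amod \<Rightarrow> bool" where
  "finitely_generated scale A M \<longleftrightarrow>
     (\<exists>G. finite G \<and> G \<subseteq> Sigma (Obj A) (Sp M) \<and>
        (\<forall>N. submodule scale A M N \<and> (\<forall>(x, v) \<in> G. v \<in> N x) \<longrightarrow> (\<forall>x \<in> Obj A. N x = Sp M x)))"

definition projective ::
    "('k::field \<Rightarrow> 'm::ab_group_add \<Rightarrow> 'm) \<Rightarrow> ('o, 'm) precat \<Rightarrow> ('o, 'm) amod \<Rightarrow> bool" where
  "projective scale A P \<longleftrightarrow> P \<in> Obj (Mod scale A) \<and>
     (\<forall>M \<in> Obj (Mod scale A). \<forall>N \<in> Obj (Mod scale A).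
        \<forall>e \<in> Hom (Mod scale A) M N. \<forall>f \<in> Hom (Mod scale A) P N.
          (\<forall>x \<in> Obj A. e x ` Sp M x = Sp N x) \<longrightarrow>
          (\<exists>g \<in> Hom (Mod scale A) P M. Cmp (Mod scale A) P M N e g = f))"


section \<open>Complexes\<close>

text \<open>Complexes are graded homologically: \<open>Df X n : Tm X n \<rightarrow> Tm X (n - 1)\<close>.\<close>

record ('o, 'm) cplx =
  Tm :: "int \<Rightarrow> ('o, 'm) amod"
  Df :: "int \<Rightarrow> ('o, 'm) amap"

type_synonym ('o, 'm) cmap = "int \<Rightarrow> ('o, 'm) amap"

definition is_complex ::
    "('k::field \<Rightarrow> 'm::ab_group_add \<Rightarrow> 'm) \<Rightarrow> ('o, 'm) precat \<Rightarrow> ('o, 'm) cplx \<Rightarrow> bool" where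
  "is_complex scale A X \<longleftrightarrow>
     (\<forall>n. Tm X n \<in> Obj (Mod scale A) \<and> Df X n \<in> Hom (Mod scale A) (Tm X n) (Tm X (n - 1)) \<and>
        Cmp (Mod scale A) (Tm X (n + 1)) (Tm X n) (Tm X (n - 1)) (Df X n) (Df X (n + 1)) =
          Zer (Mod scale A) (Tm X (n + 1)) (Tm X (n - 1)))"

definition is_fgp_complex ::
    "('k::field \<Rightarrow> 'm::ab_group_add \<Rightarrow> 'm) \<Rightarrow> ('o, 'm) precat \<Rightarrow> ('o, 'm) cplx \<Rightarrow> bool" where
  "is_fgp_complex scale A X \<longleftrightarrow> is_complex scale A X \<and>
     (\<forall>n. projective scale A (Tm X n) \<and> finitely_generated scale A (Tm X n))"

definition right_bounded :: "('o, 'm::zero) precat \<Rightarrow> ('o, 'm) cplx \<Rightarrow> bool" where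
  "right_bounded A X \<longleftrightarrow> (\<exists>b. \<forall>n < b. is_zero_amod A (Tm X n))"

definition bounded_complex :: "('o, 'm::zero) precat \<Rightarrow> ('o, 'm) cplx \<Rightarrow> bool" where
  "bounded_complex A X \<longleftrightarrow>
     (\<exists>b. \<forall>n < b. is_zero_amod A (Tm X n)) \<and> (\<exists>t. \<forall>n > t. is_zero_amod A (Tm X n))"

definition cycles :: "('o, 'm::zero) cplx \<Rightarrow> int \<Rightarrow> 'o \<Rightarrow> ('o, 'm) uvec set" where
  "cycles X n x = {v \<in> Sp (Tm X n) x. Df X n x v = 0}"

definition boundaries :: "('o, 'm) cplx \<Rightarrow> int \<Rightarrow> 'o \<Rightarrow> ('o, 'm) uvec set" where
  "boundaries X n x = Df X (n + 1) x ` Sp (Tm X (n + 1)) x"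

definition bounded_homology :: "('o, 'm::zero) precat \<Rightarrow> ('o, 'm) cplx \<Rightarrow> bool" where
  "bounded_homology A X \<longleftrightarrow> finite {n. \<exists>x \<in> Obj A. cycles X n x \<noteq> boundaries X n x}"

definition minimal_complex ::
    "('k::field \<Rightarrow> 'm::ab_group_add \<Rightarrow> 'm) \<Rightarrow> ('o, 'm) precat \<Rightarrow> ('o, 'm) cplx \<Rightarrow> bool" where
  "minimal_complex scale A X \<longleftrightarrow>
     (\<forall>n. \<forall>x \<in> Obj A. Df X n x ` Sp (Tm X n) x \<subseteq> rad_amod scale A (Tm X (n - 1)) x)"

definition chain_maps ::
    "('k::field \<Rightarrow> 'm::ab_group_add \<Rightarrow> 'm) \<Rightarrow> ('o, 'm) precat \<Rightarrow> ('o, 'm) cplx \<Rightarrow> ('o, 'm) cplx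
      \<Rightarrow> ('o, 'm) cmap set" where
  "chain_maps scale A X Y = {f. \<forall>n. f n \<in> Hom (Mod scale A) (Tm X n) (Tm Y n) \<and>
     Cmp (Mod scale A) (Tm X n) (Tm Y n) (Tm Y (n - 1)) (Df Y n) (f n) =
     Cmp (Mod scale A) (Tm X n) (Tm X (n - 1)) (Tm Y (n - 1)) (f (n - 1)) (Df X n)}"

definition complexes ::
    "('k::field \<Rightarrow> 'm::ab_group_add \<Rightarrow> 'm) \<Rightarrow> ('o, 'm) precat \<Rightarrow> ('o, 'm) cplx set
      \<Rightarrow> (('o, 'm) cplx, ('o, 'm) cmap) precat" where
  "complexes scale A S = \<lparr>
     Obj = S,
     Hom = chain_maps scale A,
     Idn = (\<lambda>X n. Idn (Mod scale A) (Tm X n)),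
     Cmp = (\<lambda>X Y Z g f n. Cmp (Mod scale A) (Tm X n) (Tm Y n) (Tm Z n) (g n) (f n)),
     Sum = (\<lambda>X Y f g n. Sum (Mod scale A) (Tm X n) (Tm Y n) (f n) (g n)),
     Zer = (\<lambda>X Y n. Zer (Mod scale A) (Tm X n) (Tm Y n)) \<rparr>"

definition homotopic ::
    "('k::field \<Rightarrow> 'm::ab_group_add \<Rightarrow> 'm) \<Rightarrow> ('o, 'm) precat \<Rightarrow> ('o, 'm) cplx \<Rightarrow> ('o, 'm) cplx
      \<Rightarrow> ('o, 'm) cmap \<Rightarrow> ('o, 'm) cmap \<Rightarrow> bool" where
  "homotopic scale A X Y f g \<longleftrightarrow>
     (\<exists>h. (\<forall>n. h n \<in> Hom (Mod scale A) (Tm X n) (Tm Y (n + 1))) \<and>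
          (\<forall>n x v. f n x v - g n x v = Df Y (n + 1) x (h n x v) + h (n - 1) x (Df X n x v)))"

definition homotopy_class ::
    "('k::field \<Rightarrow> 'm::ab_group_add \<Rightarrow> 'm) \<Rightarrow> ('o, 'm) precat \<Rightarrow> ('o, 'm) cplx \<Rightarrow> ('o, 'm) cplx
      \<Rightarrow> ('o, 'm) cmap \<Rightarrow> ('o, 'm) cmap set" where
  "homotopy_class scale A X Y f = {g \<in> chain_maps scale A X Y. homotopic scale A X Y f g}"

definition homotopy_category ::
    "('k::field \<Rightarrow> 'm::ab_group_add \<Rightarrow> 'm) \<Rightarrow> ('o, 'm) precat \<Rightarrow> ('o, 'm) cplx set
      \<Rightarrow> (('o, 'm) cplx, ('o, 'm) cmap set) precat" where
  "homotopy_category scale A S = (let C = complexes scale A S in \<lparr>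
     Obj = S,
     Hom = (\<lambda>X Y. homotopy_class scale A X Y ` chain_maps scale A X Y),
     Idn = (\<lambda>X. homotopy_class scale A X X (Idn C X)),
     Cmp = (\<lambda>X Y Z G F. \<Union>f \<in> F. \<Union>g \<in> G. homotopy_class scale A X Z (Cmp C X Y Z g f)),
     Sum = (\<lambda>X Y F G. \<Union>f \<in> F. \<Union>g \<in> G. homotopy_class scale A X Y (Sum C X Y f g)),
     Zer = (\<lambda>X Y. homotopy_class scale A X Y (Zer C X Y)) \<rparr>)"

text \<open>\<open>K\<^sup>-\<^sup>,\<^sup>b(A)\<close>, which is identified with the bounded derived category of \<open>Mod scale A\<close>.\<close>

definition K_minus_b ::
    "('k::field \<Rightarrow> 'm::ab_group_add \<Rightarrow> 'm) \<Rightarrow> ('o, 'm) precat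
      \<Rightarrow> (('o, 'm) cplx, ('o, 'm) cmap set) precat" where
  "K_minus_b scale A = homotopy_category scale A
     {X. is_fgp_complex scale A X \<and> right_bounded A X \<and> bounded_homology A X}"

definition K_b ::
    "('k::field \<Rightarrow> 'm::ab_group_add \<Rightarrow> 'm) \<Rightarrow> ('o, 'm) precat
      \<Rightarrow> (('o, 'm) cplx, ('o, 'm) cmap set) precat" where
  "K_b scale A = homotopy_category scale A {X. is_fgp_complex scale A X \<and> bounded_complex A X}"

definition P_b_min ::
    "('k::field \<Rightarrow> 'm::ab_group_add \<Rightarrow> 'm) \<Rightarrow> ('o, 'm) precat
      \<Rightarrow> (('o, 'm) cplx, ('o, 'm) cmap) precat" where
  "P_b_min scale A = complexes scale A
     {X. is_fgp_complex scale A X \<and> bounded_complex A X \<and> minimal_complex scale A X}"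

definition quasi_iso ::
    "('o, 'm::ab_group_add) precat \<Rightarrow> ('o, 'm) cplx \<Rightarrow> ('o, 'm) cplx \<Rightarrow> ('o, 'm) cmap \<Rightarrow> bool" where
  "quasi_iso A X Y f \<longleftrightarrow> (\<forall>n. \<forall>x \<in> Obj A.
     (\<forall>v \<in> cycles X n x. f n x v \<in> boundaries Y n x \<longrightarrow> v \<in> boundaries X n x) \<and>
     (\<forall>w \<in> cycles Y n x. \<exists>v \<in> cycles X n x. w - f n x v \<in> boundaries Y n x))"

definition is_min_proj_resolution ::
    "('k::field \<Rightarrow> 'm::ab_group_add \<Rightarrow> 'm) \<Rightarrow> ('o, 'm) precat \<Rightarrow> ('o, 'm) cplx \<Rightarrow> ('o, 'm) cplx
      \<Rightarrow> bool" where
  "is_min_proj_resolution scale A M P \<longleftrightarrow>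
     P \<in> Obj (K_minus_b scale A) \<and> minimal_complex scale A P \<and>
     (\<exists>f \<in> chain_maps scale A P M. quasi_iso A P M f)"

text \<open>\<open>P\<^sub>M\<close>. It is unique up to isomorphism of complexes, so nothing depends on the choice.\<close>

definition min_proj_resolution ::
    "('k::field \<Rightarrow> 'm::ab_group_add \<Rightarrow> 'm) \<Rightarrow> ('o, 'm) precat \<Rightarrow> ('o, 'm) cplx \<Rightarrow> ('o, 'm) cplx"
  where
  "min_proj_resolution scale A M = (SOME P. is_min_proj_resolution scale A M P)"


section \<open>The truncation and the set \<open>\<X>(A)\<close>\<close>

definition top_degree :: "('o, 'm::zero) precat \<Rightarrow> ('o, 'm) cplx \<Rightarrow> int" where
  "top_degree A X = (LEAST t. \<forall>n > t. is_zero_amod A (Tm X n))"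

definition \<beta> :: "('o, 'm::zero) precat \<Rightarrow> ('o, 'm) cplx \<Rightarrow> ('o, 'm) cplx" where
  "\<beta> A X = (let t = top_degree A X in \<lparr>
     Tm = (\<lambda>n. if n \<le> t then Tm X n
               else if n = t + 1 then ker_amod (Tm X t) (Df X t)
               else zero_amod),
     Df = (\<lambda>n. if n \<le> t then Df X n
               else if n = t + 1 then
                 (\<lambda>x v. if x \<in> Obj A \<and> v \<in> Sp (ker_amod (Tm X t) (Df X t)) x then v else 0)
               else (\<lambda>x v. 0)) \<rparr>)"

definition X_bar ::
    "('k::field \<Rightarrow> 'm::ab_group_add \<Rightarrow> 'm) \<Rightarrow> ('o, 'm) precat \<Rightarrow> ('o, 'm) cplx set
      \<Rightarrow> ('o, 'm) cplx set" where
  "X_bar scale A S = {M \<in> S. min_proj_resolution scale A (\<beta> A M) \<notin> Obj (K_b scale A)}"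

definition X_equiv ::
    "('k::field \<Rightarrow> 'm::ab_group_add \<Rightarrow> 'm) \<Rightarrow> ('o, 'm) precat \<Rightarrow> ('o, 'm) cplx \<Rightarrow> ('o, 'm) cplx
      \<Rightarrow> bool" where
  "X_equiv scale A M N \<longleftrightarrow> isomorphic (K_minus_b scale A)
     (min_proj_resolution scale A (\<beta> A M)) (min_proj_resolution scale A (\<beta> A N))"

text \<open>\<open>is_X scale A S X\<close>: where \<open>S\<close> is the chosen set \<open>ind P_b_min\<close>, the set \<open>X\<close> is a possible
  choice of \<open>\<X>(A)\<close>.\<close>

definition is_X ::
    "('k::field \<Rightarrow> 'm::ab_group_add \<Rightarrow> 'm) \<Rightarrow> ('o, 'm) precat \<Rightarrow> ('o, 'm) cplx set
      \<Rightarrow> ('o, 'm) cplx set \<Rightarrow> bool" where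
  "is_X scale A S X \<longleftrightarrow> X \<subseteq> X_bar scale A S \<and>
     (\<forall>M \<in> X_bar scale A S. \<exists>!N. N \<in> X \<and> X_equiv scale A M N)"


section \<open>Representations of quivers\<close>

text \<open>Finite dimensional spaces are taken in the form \<open>\<bbbk>\<^sup>d\<close>, and linear maps as matrices acting on
  column vectors.\<close>

record ('v, 'a, 'k) qrep =
  Dim :: "'v \<Rightarrow> nat"
  Mat :: "'a \<Rightarrow> 'k mat"

definition is_qrep :: "('v, 'a) pre_digraph \<Rightarrow> ('v, 'a, 'k) qrep \<Rightarrow> bool" where
  "is_qrep G M \<longleftrightarrow> finite {v \<in> verts G. Dim M v \<noteq> 0} \<and>
     (\<forall>a \<in> arcs G. Mat M a \<in> carrier_mat (Dim M (head G a)) (Dim M (tail G a)))"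

definition qrep_hom ::
    "('v, 'a) pre_digraph \<Rightarrow> ('v, 'a, 'k::field) qrep \<Rightarrow> ('v, 'a, 'k) qrep \<Rightarrow> ('v \<Rightarrow> 'k mat) set"
  where
  "qrep_hom G M N = {\<phi>.
     (\<forall>v \<in> verts G. \<phi> v \<in> carrier_mat (Dim N v) (Dim M v)) \<and>
     (\<forall>v. v \<notin> verts G \<longrightarrow> \<phi> v = 0\<^sub>m 0 0) \<and>
     (\<forall>a \<in> arcs G. \<phi> (head G a) * Mat M a = Mat N a * \<phi> (tail G a))}"

definition Rep ::
    "('v, 'a) pre_digraph \<Rightarrow> (('v, 'a, 'k::field) qrep, 'v \<Rightarrow> 'k mat) precat" where
  "Rep G = \<lparr>
     Obj = {M. is_qrep G M},
     Hom = qrep_hom G,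
     Idn = (\<lambda>M v. if v \<in> verts G then 1\<^sub>m (Dim M v) else 0\<^sub>m 0 0),
     Cmp = (\<lambda>L M N \<psi> \<phi> v. \<psi> v * \<phi> v),
     Sum = (\<lambda>M N \<phi> \<psi> v. \<phi> v + \<psi> v),
     Zer = (\<lambda>M N v. if v \<in> verts G then 0\<^sub>m (Dim N v) (Dim M v) else 0\<^sub>m 0 0) \<rparr>"

definition box_quiver :: "('v, 'a) pre_digraph \<Rightarrow> ('v \<times> int, 'a \<times> int) pre_digraph" where
  "box_quiver Q = \<lparr>
     verts = verts Q \<times> UNIV,
     arcs = arcs Q \<times> UNIV,
     tail = (\<lambda>(\<alpha>, i). (head Q \<alpha>, i)),
     head = (\<lambda>(\<alpha>, i). (tail Q \<alpha>, i - 1)) \<rparr>"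


section \<open>The functor \<open>F\<close>\<close>

text \<open>\<open>A\<^sup>x \<otimes> \<bbbk>\<^sup>d\<close> is realised as the \<open>d\<close>-fold sum of \<open>A\<^sup>x = A(x, -)\<close>: an element of
  \<open>P\<^sub>n(z) = \<Oplus>\<^sub>x A(x, z) \<otimes> \<bbbk>\<^bsup>Dim M (x, n)\<^esup>\<close> is a family \<open>v\<close> with \<open>v x i \<in> A(x, z)\<close> for all
  vertices \<open>x\<close> and \<open>i < Dim M (x, n)\<close>, and \<open>v x i = 0\<close> for all other indices.\<close>

definition F_term ::
    "('o, 'm::zero) precat \<Rightarrow> ('o, 'a) pre_digraph \<Rightarrow> ('o \<times> int, 'a \<times> int, 'k) qrep \<Rightarrow> int
      \<Rightarrow> ('o, 'm) amod" where
  "F_term A Q M n = \<lparr>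
     Sp = (\<lambda>z. {v. \<forall>x i. if x \<in> verts Q \<and> i < Dim M (x, n) then v x i \<in> Hom A x z
                         else v x i = 0}),
     Act = (\<lambda>z z' f v x i. if x \<in> verts Q \<and> i < Dim M (x, n) then Cmp A x z z' f (v x i)
                           else 0) \<rparr>"

text \<open>For an arrow \<open>\<alpha> : x \<rightarrow> y\<close>, the map \<open>A\<^sup>\<alpha> \<otimes> M(\<alpha>, n)\<close> sends \<open>f \<otimes> e\<^sub>i\<close>, with
  \<open>f \<in> A(y, z)\<close>, to the sum over \<open>j\<close> of \<open>M(\<alpha>, n)\<^sub>j\<^sub>i (f \<circ> \<alpha>) \<otimes> e\<^sub>j\<close>.\<close>

definition F_diff ::
    "('k \<Rightarrow> 'm::ab_group_add \<Rightarrow> 'm) \<Rightarrow> ('o, 'm) precat \<Rightarrow> ('o, 'a) pre_digraph \<Rightarrow> ('a \<Rightarrow> 'm)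
      \<Rightarrow> ('o \<times> int, 'a \<times> int, 'k) qrep \<Rightarrow> int \<Rightarrow> ('o, 'm) amap" where
  "F_diff scale A Q \<rho> M n z v =
     (if z \<in> Obj A \<and> v \<in> Sp (F_term A Q M n) z then
        (\<lambda>x j. if x \<in> verts Q \<and> j < Dim M (x, n - 1) then
                 (\<Sum>\<alpha> \<in> {\<alpha> \<in> arcs Q. tail Q \<alpha> = x}.
                    let y = head Q \<alpha> in
                      \<Sum>i < Dim M (y, n).
                        scale (Mat M (\<alpha>, n) $$ (j, i)) (Cmp A x y z (v y i) (\<rho> \<alpha>)))
               else 0)
      else 0)"

definition F_complex ::
    "('k \<Rightarrow> 'm::ab_group_add \<Rightarrow> 'm) \<Rightarrow> ('o, 'm) precat \<Rightarrow> ('o, 'a) pre_digraph \<Rightarrow> ('a \<Rightarrow> 'm)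
      \<Rightarrow> ('o \<times> int, 'a \<times> int, 'k) qrep \<Rightarrow> ('o, 'm) cplx" where
  "F_complex scale A Q \<rho> M = \<lparr>Tm = F_term A Q M, Df = F_diff scale A Q \<rho> M\<rparr>"

end

theory Submission
  imports Defs
begin

text \<open>Over a category with radical square zero, a morphism between sums of the modules \<open>A\<^sup>x\<close> has a top
  component, a matrix over the ground field for each vertex, and a component in the radical, a matrix for each arrow.
  Composites of two radical components vanish. Splitting off contractible summands, every complex in
  \<open>K\<^sup>-\<^sup>,\<^sup>b(A)\<close> becomes minimal, hence isomorphic to \<open>F(M)\<close> for a possibly unbounded representation \<open>M\<close> of
  the box quiver, and taking tops is inverse to \<open>F\<close> up to homotopy. So \<open>K\<^sup>-\<^sup>,\<^sup>b(A)\<close> has the same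
  indecomposables as the category of these representations. \<open>F(M)\<close> is exact in all degrees \<open>\<ge> t\<close> precisely
  when \<open>M\<close> is determined above \<open>t\<close> by its truncation, as a coinduced representation. An unbounded indecomposable
  therefore corresponds to a bounded one, its truncation at a large degree \<open>t\<close>, and \<open>F(M)\<close> is
  the minimal resolution of \<open>\<beta>\<close> of that truncation.\<close>

text \<open>The comparison with representations is not an equivalence: a chain map may have a
  radical component that is not null-homotopic, and taking tops forgets it. What carries the
  argument is a pair of functors in opposite directions, \<open>cphi\<close> and
  \<open>ctop\<close>, that both preserve identities, composites, zeros and sums. Together with
  density this already matches isomorphism classes, direct sums and indecomposables. Tops are well
  defined on homotopy classes because the differentials of \<open>F(M)\<close> are radical, so that
  null-homotopic maps have zero top. Two points shape the treatment of truncations.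
  \<open>min_proj_resolution\<close> is an arbitrary choice, so a five-lemma argument has to show
  that every minimal resolution of \<open>\<beta> A N\<close> comes from one and the same coinduced
  representation. And a bounded indecomposable whose maps out of the top degree have a common kernel
  is concentrated in that degree; its truncation is exact, the resolution is zero, and it is
  excluded by the condition that defines \<open>X_bar\<close>.\<close>

type_synonym ('o, 'a, 'k) brep = "('o \<times> int, 'a \<times> int, 'k) qrep"

section \<open>Preadditive categories\<close>

text \<open>Sums come without inverses here, so absorption by \<open>Zer\<close> does not follow
  from distributivity and has axioms of its own. The laws are those that conjugation of direct sum
  data by isomorphisms calls for.\<close>

locale preadditive =
  fixes C :: "('o, 'm) precat"
  assumes Idn_in: "x : Obj C ==> Idn C x : Hom C x x"
    and Cmp_in: "[| x : Obj C; y : Obj C; z : Obj C; f : Hom C x y; g : Hom C y z |]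
          ==> Cmp C x y z g f : Hom C x z"
    and id_right: "[| x : Obj C; y : Obj C; f : Hom C x y |] ==> Cmp C x x y f (Idn C x) = f"
    and id_left: "[| x : Obj C; y : Obj C; f : Hom C x y |] ==> Cmp C x y y (Idn C y) f = f"
    and assoc: "[| w : Obj C; x : Obj C; y : Obj C; z : Obj C;
          f : Hom C w x; g : Hom C x y; h : Hom C y z |]
          ==> Cmp C w x z (Cmp C x y z h g) f = Cmp C w y z h (Cmp C w x y g f)"
    and zero_left: "[| x : Obj C; y : Obj C; z : Obj C; f : Hom C x y |]
          ==> Cmp C x y z (Zer C y z) f = Zer C x z"
    and zero_right: "[| x : Obj C; y : Obj C; z : Obj C; g : Hom C y z |]
          ==> Cmp C x y z g (Zer C x y) = Zer C x z"
    and Sum_in: "[| x : Obj C; y : Obj C; f : Hom C x y; g : Hom C x y |]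
          ==> Sum C x y f g : Hom C x y"
    and distrib_left: "[| x : Obj C; y : Obj C; z : Obj C; f : Hom C x y;
          g : Hom C y z; g' : Hom C y z |]
          ==> Cmp C x y z (Sum C y z g g') f = Sum C x z (Cmp C x y z g f) (Cmp C x y z g' f)"
    and distrib_right: "[| x : Obj C; y : Obj C; z : Obj C; f : Hom C x y; f' : Hom C x y;
          g : Hom C y z |]
          ==> Cmp C x y z g (Sum C x y f f') = Sum C x z (Cmp C x y z g f) (Cmp C x y z g f')"
begin

lemma isomorphic_refl: "x : Obj C ==> isomorphic C x x" unfolding isomorphic_def using Idn_in id_left by blast

lemma isomorphic_sym: "isomorphic C x y ==> isomorphic C y x" unfolding isomorphic_def by blast

text \<open>Once an identity \<open>g f = h\<close> is supplied for the last premise, this is a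
  rewrite rule that contracts the pair inside a right-nested composite, where associativity alone
  would leave it hidden.\<close>

lemma cmp_reduce:
  assumes "w : Obj C" "x : Obj C" "y : Obj C" "z : Obj C"
    "k : Hom C w x" "f : Hom C x y" "g : Hom C y z" "Cmp C x y z g f = h"
  shows "Cmp C w y z g (Cmp C w x y f k) = Cmp C w x z h k" using assms assoc by metis

lemma cmp_inverse:
  assumes o: "x : Obj C" "y : Obj C" "z : Obj C"
    and h: "u : Hom C x y" "u' : Hom C y x" "v : Hom C y z" "v' : Hom C z y"
    and e: "Cmp C x y x u' u = Idn C x" "Cmp C y z y v' v = Idn C y"
  shows "Cmp C x z x (Cmp C z y x u' v') (Cmp C x y z v u) = Idn C x"
proof -
  have "Cmp C x z x (Cmp C z y x u' v') (Cmp C x y z v u) =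
      Cmp C x y x u' (Cmp C x z y v' (Cmp C x y z v u))" using o h by (simp add: assoc Cmp_in)
  also have "Cmp C x z y v' (Cmp C x y z v u) = u" using o h e by (simp add: cmp_reduce[OF _ _ _ _ _ _ _ e(2)] id_left)
  finally show ?thesis using e by simp
qed

lemma isomorphic_trans: "isomorphic C x y ==> isomorphic C y z ==> isomorphic C x z"
proof -
  assume xy: "isomorphic C x y" and yz: "isomorphic C y z"
  then have o: "x : Obj C" "y : Obj C" "z : Obj C" by (auto simp: isomorphic_def)
  obtain u u' where u: "u : Hom C x y" "u' : Hom C y x" "Cmp C x y x u' u = Idn C x"
    "Cmp C y x y u u' = Idn C y" using xy unfolding isomorphic_def by blast
  obtain v v' where v: "v : Hom C y z" "v' : Hom C z y" "Cmp C y z y v' v = Idn C y"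
    "Cmp C z y z v v' = Idn C z" using yz unfolding isomorphic_def by blast
  show "isomorphic C x z" unfolding isomorphic_def
    using o u v cmp_inverse[of x y z u u' v v'] cmp_inverse[of z y x v' v u' u] Cmp_in by blast
qed

lemma zero_object_isomorphic:
  assumes "isomorphic C x y" "zero_object C x"
  shows "zero_object C y"
proof -
  from assms(1) obtain f g where o: "x : Obj C" "y : Obj C" and
    fg: "f : Hom C x y" "g : Hom C y x" "Cmp C y x y f g = Idn C y" unfolding isomorphic_def by blast
  have "g = Cmp C y x x (Zer C x x) g" using assms(2) id_left o fg by (metis zero_object_def)
  then have "g = Zer C y x" using zero_left o fg by simp
  then show ?thesis using fg o zero_right by (metis zero_object_def)
qed

text \<open>All four structure maps are conjugated by the given isomorphisms. The sum identity
  becomes \<open>a (i1 p1 + i2 p2) a'\<close>, and distributivity on both sides brings it to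
  \<open>a a' = 1\<close>.\<close>

lemma direct_sum_isomorphic:
  assumes ds: "is_direct_sum C x y z"
    and "isomorphic C x x'" "isomorphic C y y'" "isomorphic C z z'"
  shows "is_direct_sum C x' y' z'"
proof -
  obtain i1 i2 p1 p2 where h: "i1 : Hom C y x" "i2 : Hom C z x" "p1 : Hom C x y" "p2 : Hom C x z"
    and e: "Cmp C y x y p1 i1 = Idn C y" "Cmp C z x z p2 i2 = Idn C z"
      "Cmp C z x y p1 i2 = Zer C z y" "Cmp C y x z p2 i1 = Zer C y z"
      "Sum C x x (Cmp C x y x i1 p1) (Cmp C x z x i2 p2) = Idn C x" using ds unfolding is_direct_sum_def by blast
  have o: "x : Obj C" "y : Obj C" "z : Obj C" "x' : Obj C" "y' : Obj C" "z' : Obj C"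
    using assms by (auto simp: is_direct_sum_def isomorphic_def)
  obtain a a' where a: "a : Hom C x x'" "a' : Hom C x' x" "Cmp C x x' x a' a = Idn C x"
    "Cmp C x' x x' a a' = Idn C x'" using assms(2) unfolding isomorphic_def by blast
  obtain b b' where b: "b : Hom C y y'" "b' : Hom C y' y" "Cmp C y y' y b' b = Idn C y"
    "Cmp C y' y y' b b' = Idn C y'" using assms(3) unfolding isomorphic_def by blast
  obtain c c' where c: "c : Hom C z z'" "c' : Hom C z' z" "Cmp C z z' z c' c = Idn C z"
    "Cmp C z' z z' c c' = Idn C z'" using assms(4) unfolding isomorphic_def by blast
  define j1 where "j1 = Cmp C y' x x' a (Cmp C y' y x i1 b')"
  define j2 where "j2 = Cmp C z' x x' a (Cmp C z' z x i2 c')"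
  define q1 where "q1 = Cmp C x' y y' b (Cmp C x' x y p1 a')"
  define q2 where "q2 = Cmp C x' z z' c (Cmp C x' x z p2 a')"
  note m = o h a(1,2) b(1,2) c(1,2)
  note R = cmp_reduce[OF _ _ _ _ _ _ _ a(3)] cmp_reduce[OF _ _ _ _ _ _ _ b(3)]
    cmp_reduce[OF _ _ _ _ _ _ _ c(3)] cmp_reduce[OF _ _ _ _ _ _ _ e(1)]
    cmp_reduce[OF _ _ _ _ _ _ _ e(2)] cmp_reduce[OF _ _ _ _ _ _ _ e(3)]
    cmp_reduce[OF _ _ _ _ _ _ _ e(4)] id_left id_right
  note ax = assoc Cmp_in R zero_left zero_right
  have hom: "j1 : Hom C y' x'" "j2 : Hom C z' x'" "q1 : Hom C x' y'" "q2 : Hom C x' z'"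
    using m unfolding j1_def j2_def q1_def q2_def by (simp_all add: Cmp_in)
  have 1: "Cmp C y' x' y' q1 j1 = Idn C y'" "Cmp C z' x' z' q2 j2 = Idn C z'"
    "Cmp C z' x' y' q1 j2 = Zer C z' y'" "Cmp C y' x' z' q2 j1 = Zer C y' z'"
    using m b(4) c(4) unfolding j1_def j2_def q1_def q2_def by (simp_all add: ax)
  have s1: "Cmp C x' y' x' j1 q1 = Cmp C x' x x' a (Cmp C x' x x (Cmp C x y x i1 p1) a')"
    using m unfolding j1_def q1_def by (simp add: ax)
  have s2: "Cmp C x' z' x' j2 q2 = Cmp C x' x x' a (Cmp C x' x x (Cmp C x z x i2 p2) a')"
    using m unfolding j2_def q2_def by (simp add: ax)
  have "Sum C x' x' (Cmp C x' y' x' j1 q1) (Cmp C x' z' x' j2 q2) =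
     Cmp C x' x x' a (Cmp C x' x x (Sum C x x (Cmp C x y x i1 p1) (Cmp C x z x i2 p2)) a')"
    unfolding s1 s2 using m by (simp add: distrib_left distrib_right Cmp_in Sum_in)
  also have "... = Idn C x'" unfolding e(5) using m a(4) by (simp add: id_left)
  finally show ?thesis unfolding is_direct_sum_def using o hom 1 by blast
qed

lemma indecomposable_isomorphic:
  assumes "isomorphic C x y" "indecomposable C x"
  shows "indecomposable C y"
proof -
  have y: "y : Obj C" using assms(1) by (simp add: isomorphic_def)
  have "is_direct_sum C x u v" if ds: "is_direct_sum C y u v" for u v
  proof -
    have "u : Obj C" "v : Obj C" using ds by (auto simp: is_direct_sum_def)
    then show ?thesis using direct_sum_isomorphic[OF ds isomorphic_sym[OF assms(1)]] isomorphic_refl by blast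
  qed
  then show ?thesis using assms(2) y zero_object_isomorphic isomorphic_sym[OF assms(1)] unfolding indecomposable_def by blast
qed

end

text \<open>Two functors \<open>G : D \<rightarrow> C\<close> and \<open>U\<close> in the opposite direction, defined only on the image of
  the object map \<open>E\<close>.\<close>

locale functor_pair = preadditive C
  for C :: "('c, 'm) precat" +
  fixes D :: "('d, 'n) precat" and E :: "'d => 'c"
    and G :: "'d => 'd => 'n => 'm" and U :: "'d => 'd => 'm => 'n"
  assumes E_obj: "M : Obj D ==> E M : Obj C"
    and G_hom: "[| M : Obj D; N : Obj D; \<phi> : Hom D M N |] ==> G M N \<phi> : Hom C (E M) (E N)"
    and G_idn: "M : Obj D ==> G M M (Idn D M) = Idn C (E M)"
    and G_zer: "[| M : Obj D; N : Obj D |] ==> G M N (Zer D M N) = Zer C (E M) (E N)"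
    and G_cmp: "[| L : Obj D; M : Obj D; N : Obj D; \<phi> : Hom D L M; \<psi> : Hom D M N |]
      ==> G L N (Cmp D L M N \<psi> \<phi>) = Cmp C (E L) (E M) (E N) (G M N \<psi>) (G L M \<phi>)"
    and G_sum: "[| M : Obj D; N : Obj D; \<phi> : Hom D M N; \<psi> : Hom D M N |]
      ==> G M N (Sum D M N \<phi> \<psi>) = Sum C (E M) (E N) (G M N \<phi>) (G M N \<psi>)"
    and U_hom: "[| M : Obj D; N : Obj D; f : Hom C (E M) (E N) |] ==> U M N f : Hom D M N"
    and U_idn: "M : Obj D ==> U M M (Idn C (E M)) = Idn D M"
    and U_zer: "[| M : Obj D; N : Obj D |] ==> U M N (Zer C (E M) (E N)) = Zer D M N"
    and U_cmp: "[| L : Obj D; M : Obj D; N : Obj D; f : Hom C (E L) (E M); g : Hom C (E M) (E N) |]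
      ==> U L N (Cmp C (E L) (E M) (E N) g f) = Cmp D L M N (U M N g) (U L M f)"
    and U_sum: "[| M : Obj D; N : Obj D; f : Hom C (E M) (E N); g : Hom C (E M) (E N) |]
      ==> U M N (Sum C (E M) (E N) f g) = Sum D M N (U M N f) (U M N g)"
    and D_cmp: "[| L : Obj D; M : Obj D; N : Obj D; \<phi> : Hom D L M; \<psi> : Hom D M N |]
      ==> Cmp D L M N \<psi> \<phi> : Hom D L N"
    and dense: "c : Obj C ==> EX M:Obj D. isomorphic C c (E M)"
begin

lemma isomorphic_iff:
  assumes o: "M : Obj D" "N : Obj D"
  shows "isomorphic C (E M) (E N) \<longleftrightarrow> isomorphic D M N"
proof
  assume "isomorphic C (E M) (E N)"
  then obtain f g where fg: "f : Hom C (E M) (E N)" "g : Hom C (E N) (E M)"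
    "Cmp C (E M) (E N) (E M) g f = Idn C (E M)" "Cmp C (E N) (E M) (E N) f g = Idn C (E N)" unfolding isomorphic_def by blast
  have "Cmp D M N M (U N M g) (U M N f) = Idn D M" "Cmp D N M N (U M N f) (U N M g) = Idn D N"
    using fg o by (metis U_cmp U_idn)+
  then show "isomorphic D M N" unfolding isomorphic_def using o fg U_hom by blast
next
  assume "isomorphic D M N"
  then obtain f g where fg: "f : Hom D M N" "g : Hom D N M"
    "Cmp D M N M g f = Idn D M" "Cmp D N M N f g = Idn D N" unfolding isomorphic_def by blast
  have "Cmp C (E M) (E N) (E M) (G N M g) (G M N f) = Idn C (E M)"
    "Cmp C (E N) (E M) (E N) (G M N f) (G N M g) = Idn C (E N)" using fg o by (metis G_cmp G_idn)+
  then show "isomorphic C (E M) (E N)" unfolding isomorphic_def using o fg G_hom E_obj by blast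
qed

lemma zero_object_iff: "M : Obj D ==> zero_object C (E M) \<longleftrightarrow> zero_object D M"
  unfolding zero_object_def using U_idn U_zer G_idn G_zer E_obj by metis

lemma is_direct_sum_iff:
  assumes o: "M : Obj D" "M1 : Obj D" "M2 : Obj D"
  shows "is_direct_sum C (E M) (E M1) (E M2) \<longleftrightarrow> is_direct_sum D M M1 M2"
proof
  assume "is_direct_sum C (E M) (E M1) (E M2)"
  then obtain i1 i2 p1 p2 where h: "i1 : Hom C (E M1) (E M)" "i2 : Hom C (E M2) (E M)"
      "p1 : Hom C (E M) (E M1)" "p2 : Hom C (E M) (E M2)"
    and e: "Cmp C (E M1) (E M) (E M1) p1 i1 = Idn C (E M1)"
      "Cmp C (E M2) (E M) (E M2) p2 i2 = Idn C (E M2)"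
      "Cmp C (E M2) (E M) (E M1) p1 i2 = Zer C (E M2) (E M1)"
      "Cmp C (E M1) (E M) (E M2) p2 i1 = Zer C (E M1) (E M2)"
      "Sum C (E M) (E M) (Cmp C (E M) (E M1) (E M) i1 p1) (Cmp C (E M) (E M2) (E M) i2 p2)
        = Idn C (E M)" unfolding is_direct_sum_def by blast
  have "Sum D M M (Cmp D M M1 M (U M1 M i1) (U M M1 p1)) (Cmp D M M2 M (U M2 M i2) (U M M2 p2))
     = U M M (Sum C (E M) (E M) (Cmp C (E M) (E M1) (E M) i1 p1) (Cmp C (E M) (E M2) (E M) i2 p2))"
    using h o by (simp add: U_cmp U_sum Cmp_in E_obj)
  then have "Sum D M M (Cmp D M M1 M (U M1 M i1) (U M M1 p1)) (Cmp D M M2 M (U M2 M i2) (U M M2 p2))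
     = Idn D M" using e o by (simp add: U_idn)
  moreover have "Cmp D M1 M M1 (U M M1 p1) (U M1 M i1) = Idn D M1"
      "Cmp D M2 M M2 (U M M2 p2) (U M2 M i2) = Idn D M2"
      "Cmp D M2 M M1 (U M M1 p1) (U M2 M i2) = Zer D M2 M1"
      "Cmp D M1 M M2 (U M M2 p2) (U M1 M i1) = Zer D M1 M2" using h o e by (metis U_cmp U_idn U_zer)+
  ultimately show "is_direct_sum D M M1 M2" unfolding is_direct_sum_def using o h U_hom by blast
next
  assume "is_direct_sum D M M1 M2"
  then obtain i1 i2 p1 p2 where h: "i1 : Hom D M1 M" "i2 : Hom D M2 M"
      "p1 : Hom D M M1" "p2 : Hom D M M2"
    and e: "Cmp D M1 M M1 p1 i1 = Idn D M1"
      "Cmp D M2 M M2 p2 i2 = Idn D M2"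
      "Cmp D M2 M M1 p1 i2 = Zer D M2 M1"
      "Cmp D M1 M M2 p2 i1 = Zer D M1 M2"
      "Sum D M M (Cmp D M M1 M i1 p1) (Cmp D M M2 M i2 p2) = Idn D M" unfolding is_direct_sum_def by blast
  have "Sum C (E M) (E M) (Cmp C (E M) (E M1) (E M) (G M1 M i1) (G M M1 p1))
      (Cmp C (E M) (E M2) (E M) (G M2 M i2) (G M M2 p2))
     = G M M (Sum D M M (Cmp D M M1 M i1 p1) (Cmp D M M2 M i2 p2))" using h o by (simp add: G_cmp G_sum D_cmp)
  then have "Sum C (E M) (E M) (Cmp C (E M) (E M1) (E M) (G M1 M i1) (G M M1 p1))
      (Cmp C (E M) (E M2) (E M) (G M2 M i2) (G M M2 p2)) = Idn C (E M)" using e o by (simp add: G_idn)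
  moreover have "Cmp C (E M1) (E M) (E M1) (G M M1 p1) (G M1 M i1) = Idn C (E M1)"
      "Cmp C (E M2) (E M) (E M2) (G M M2 p2) (G M2 M i2) = Idn C (E M2)"
      "Cmp C (E M2) (E M) (E M1) (G M M1 p1) (G M2 M i2) = Zer C (E M2) (E M1)"
      "Cmp C (E M1) (E M) (E M2) (G M M2 p2) (G M1 M i1) = Zer C (E M1) (E M2)" using h o e by (metis G_cmp G_idn G_zer)+
  ultimately show "is_direct_sum C (E M) (E M1) (E M2)" unfolding is_direct_sum_def using o h G_hom E_obj by blast
qed

text \<open>Summands of \<open>E M\<close> found in \<open>C\<close> need not be of the form
  \<open>E N\<close>. Density replaces each by an isomorphic one that is, and
  \<open>direct_sum_isomorphic\<close> carries the decomposition along before it is reflected to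
  \<open>D\<close>.\<close>

lemma indecomposable_iff:
  assumes M: "M : Obj D"
  shows "indecomposable C (E M) \<longleftrightarrow> indecomposable D M"
proof
  assume "indecomposable C (E M)"
  then show "indecomposable D M" unfolding indecomposable_def
    by (metis M is_direct_sum_def is_direct_sum_iff zero_object_iff)
next
  assume D: "indecomposable D M"
  have "zero_object C y \<or> zero_object C z" if ds: "is_direct_sum C (E M) y z" for y z
  proof -
    obtain M1 M2 where M12: "M1 : Obj D" "M2 : Obj D" "isomorphic C y (E M1)" "isomorphic C z (E M2)"
      using dense ds unfolding is_direct_sum_def by blast
    have "is_direct_sum C (E M) (E M1) (E M2)" using direct_sum_isomorphic[OF ds isomorphic_refl M12(3,4)] M E_obj by blast
    then have "is_direct_sum D M M1 M2" using is_direct_sum_iff M M12 by blast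
    then have "zero_object D M1 \<or> zero_object D M2" using D unfolding indecomposable_def by blast
    then have "zero_object C (E M1) \<or> zero_object C (E M2)" using zero_object_iff M12 by blast
    then show ?thesis using zero_object_isomorphic isomorphic_sym M12 by blast
  qed
  then show "indecomposable C (E M)" using D M E_obj zero_object_iff unfolding indecomposable_def by blast
qed

end

section \<open>Matrices\<close>

lemma mat_assoc: "dim_col A = dim_row B ==> dim_col B = dim_row C ==> A * B * C = A * (B * C)"
  for A :: "'k::field mat" by (metis assoc_mult_mat carrier_matI)

text \<open>Matrix counterpart of \<open>cmp_reduce\<close>; the formats are stated through
  \<open>dim_row\<close> and \<open>dim_col\<close> so that the simplifier can discharge them while
  rewriting.\<close>

lemma mat_reduce: "A * B = C ==> dim_col A = dim_row B ==> dim_col B = dim_row X ==> A * (B * X) = C * X"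
  for A :: "'k::field mat" using mat_assoc[of A B X] by simp

lemma mat_mult_minus: "dim_col A = dim_row B ==> dim_row C = dim_row B ==> dim_col B = dim_col C
    ==> A * (B - C) = A * B - A * C"
  for A :: "'k::field mat" by (metis mult_minus_distrib_mat carrier_matI)

lemma mat_minus_mult: "dim_col A = dim_row C ==> dim_row A = dim_row B ==> dim_col A = dim_col B
    ==> (A - B) * C = A * C - B * C"
  for A :: "'k::field mat" by (metis minus_mult_distrib_mat carrier_matI)

text \<open>\<open>L\<close> lists a basis of the column space and \<open>R\<close> the coordinates
  of the columns in it. A right inverse of \<open>R\<close> selects the columns that were taken into
  the basis; a left inverse of \<open>L\<close> consists of coordinates with respect to an extension
  of that basis.\<close>

lemma rank_factorization:
  fixes D :: "'k::field mat"
  assumes D: "D : carrier_mat m n"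
  obtains r L R L' R' where "L : carrier_mat m r" "R : carrier_mat r n"
    "L' : carrier_mat r m" "R' : carrier_mat n r" "D = L * R" "L' * L = 1\<^sub>m r" "R * R' = 1\<^sub>m r"
proof -
  \<comment> \<open>Columns are regarded as functions on all of \<open>nat\<close>, zero from
    \<open>m\<close> on, so that bases and coordinates of one fixed vector space are at
    hand.\<close>
  interpret V: vector_space "%c (f :: nat => 'k) i. c * f i" by unfold_locales (auto simp: fun_eq_iff algebra_simps)
  define c where "c j = (%i. if i < m then D $$ (i, j) else 0)" for j
  obtain B where B: "B \<subseteq> c ` {..<n}" "V.independent B" "c ` {..<n} \<subseteq> V.span B"
    using V.maximal_independent_subset[of "c ` {..<n}"] by blast
  have fB: "finite B" using B(1) finite_subset by blast
  define r where "r = card B"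
  obtain e where e: "bij_betw e {0..<r} B" using ex_bij_betw_nat_finite[OF fB] r_def by blast
  have eB: "e k : B" if "k < r" for k using e that unfolding bij_betw_def by auto
  have einj: "e k = e l \<longleftrightarrow> k = l" if "k < r" "l < r" for k l
    using e that unfolding bij_betw_def inj_on_def by auto
  define s where "s b = (SOME j. j < n & c j = b)" for b
  have s: "s b < n & c (s b) = b" if b: "b : B" for b
  proof -
    have "EX j. j < n & c j = b" using B(1) b by blast
    then show ?thesis unfolding s_def by (rule someI_ex)
  qed
  \<comment> \<open>\<open>E\<close> is a basis of the whole function space; the coordinates of the
    unit vectors \<open>\<delta> i\<close> along the members of \<open>B\<close> make up
    \<open>L'\<close>.\<close>
  define E where "E = V.extend_basis B"
  have E: "B \<subseteq> E" "V.independent E" "V.span E = UNIV"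
    unfolding E_def using V.extend_basis_superset V.independent_extend_basis V.span_extend_basis B(2) by blast+
  define \<delta> where "\<delta> i = (%l. if l = i then 1 else 0 :: 'k)" for i :: nat
  define L where "L = mat m r (%(i, k). e k i)"
  define R where "R = mat r n (%(k, j). V.representation B (c j) (e k))"
  define R' where "R' = mat n r (%(j, k). if j = s (e k) then 1 else 0 :: 'k)"
  define L' where "L' = mat r m (%(k, i). V.representation E (\<delta> i) (e k))"
  have sum_fun: "(\<Sum>a\<in>X. g a) i = (\<Sum>a\<in>X. g a i)" for X :: "'z set" and g :: "'z => nat => 'k" and i
    by (induction X rule: infinite_finite_induct) auto
  have "D = L * R"
  proof (rule eq_matI)
    fix i j assume "i < dim_row (L * R)" "j < dim_col (L * R)"
    then have ij: "i < m" "j < n" by (auto simp: L_def R_def)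
    have "c j = (\<Sum>b\<in>B. (%i. V.representation B (c j) b * b i))"
      using V.sum_representation_eq[OF B(2) _ fB subset_refl, of "c j"] B(3) ij by auto
    then have "c j i = (\<Sum>b\<in>B. V.representation B (c j) b * b i)" using sum_fun[of "%b i. V.representation B (c j) b * b i" B i] by simp
    also have "... = (\<Sum>k=0..<r. V.representation B (c j) (e k) * e k i)"
      using sum.reindex_bij_betw[OF e, of "%b. V.representation B (c j) b * b i"] by simp
    finally show "D $$ (i, j) = (L * R) $$ (i, j)" using ij by (simp add: L_def R_def scalar_prod_def c_def mult.commute)
  qed (use D in \<open>auto simp: L_def R_def\<close>)
  moreover have "R * R' = 1\<^sub>m r"
  proof (rule eq_matI)
    fix k l assume "k < dim_row (1\<^sub>m r :: 'k mat)" "l < dim_col (1\<^sub>m r :: 'k mat)"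
    then have kl: "k < r" "l < r" by auto
    have "(R * R') $$ (k, l) = (\<Sum>j=0..<n. V.representation B (c j) (e k) * (if j = s (e l) then 1 else 0))"
      using kl by (simp add: R_def R'_def scalar_prod_def)
    also have "... = (\<Sum>j=0..<n. if j = s (e l) then V.representation B (c j) (e k) else 0)" by (intro sum.cong) auto
    also have "... = V.representation B (e l) (e k)" using s[OF eB[OF kl(2)]] by (subst sum.delta) auto
    also have "... = (if k = l then 1 else 0)" using V.representation_basis[OF B(2) eB[OF kl(2)]] einj[OF kl] by auto
    finally show "(R * R') $$ (k, l) = 1\<^sub>m r $$ (k, l)" using kl by simp
  qed (auto simp: R_def R'_def)
  moreover have "L' * L = 1\<^sub>m r"
  proof (rule eq_matI)
    fix k l assume "k < dim_row (1\<^sub>m r :: 'k mat)" "l < dim_col (1\<^sub>m r :: 'k mat)"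
    then have kl: "k < r" "l < r" by auto
    obtain j where j: "j < n" "c j = e l" using s[OF eB[OF kl(2)]] by blast
    have "e l = (\<Sum>i=0..<m. (%x. e l i * \<delta> i x))"
    proof
      fix x
      have "(\<Sum>i=0..<m. e l i * \<delta> i x) = (\<Sum>i=0..<m. if i = x then e l i else 0)"
        by (intro sum.cong) (auto simp: \<delta>_def)
      also have "... = e l x" by (subst sum.delta) (auto simp: j(2)[symmetric] c_def)
      finally show "e l x = (\<Sum>i=0..<m. (%x. e l i * \<delta> i x)) x" by (simp add: sum_fun)
    qed
    then have "V.representation E (e l) (e k) = V.representation E (\<Sum>i=0..<m. (%x. e l i * \<delta> i x)) (e k)" by simp
    also have "... = (\<Sum>i=0..<m. e l i * V.representation E (\<delta> i) (e k))"
      using E by (simp add: V.representation_sum V.representation_scale)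
    also have "... = (L' * L) $$ (k, l)" using kl by (auto simp: L_def L'_def scalar_prod_def mult.commute)
    finally show "(L' * L) $$ (k, l) = 1\<^sub>m r $$ (k, l)"
      using V.representation_basis[OF E(2), of "e l"] E(1) eB[OF kl(2)] einj[OF kl] kl by auto
  qed (auto simp: L_def L'_def)
  ultimately show ?thesis using that[of L r R L' R'] by (auto simp: L_def R_def L'_def R'_def)
qed

lemma idempotent_mat_split:
  fixes E :: "'k::field mat"
  assumes E: "E : carrier_mat n n" "E * E = E"
  obtains r I P where "I : carrier_mat n r" "P : carrier_mat r n" "E = I * P" "P * I = 1\<^sub>m r"
proof -
  obtain r I P I' P' where f: "I : carrier_mat n r" "P : carrier_mat r n"
    "I' : carrier_mat r n" "P' : carrier_mat n r" "E = I * P" "I' * I = 1\<^sub>m r" "P * P' = 1\<^sub>m r"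
    using rank_factorization[OF E(1)] .
  note d = f(1-4)[THEN carrier_matD(1)] f(1-4)[THEN carrier_matD(2)]
  \<comment> \<open>\<open>E E = E\<close> reads \<open>I P I P = I P\<close>; the left inverse of
    \<open>I\<close> and the right inverse of \<open>P\<close> cancel the outer factors and leave
    \<open>P I = 1\<close>.\<close>
  have "I' * (E * E * P') = I' * (E * P')" using E(2) by simp
  then have "P * I = 1\<^sub>m r"
    unfolding f(5) using d by (simp add: mat_assoc mat_reduce[OF f(6)] mat_reduce[OF f(7)] f(6,7))
  then show ?thesis using that f by blast
qed

text \<open>A complex of vector spaces is the sum of its homology, of dimension \<open>r n\<close>,
  and a contractible complex with contraction \<open>H\<close>. The side conditions
  \<open>H I = 0\<close> and \<open>P H = 0\<close> are what later keeps the perturbed retraction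
  strict.\<close>

lemma mat_complex_contraction:
  fixes D :: "int => 'k::field mat" and v :: "int => nat"
  assumes D: "!!n. D n : carrier_mat (v (n - 1)) (v n)"
    and DD: "!!n. D n * D (n + 1) = 0\<^sub>m (v (n - 1)) (v (n + 1))"
  shows "EX r H I P. ALL n. H n : carrier_mat (v (n + 1)) (v n) & I n : carrier_mat (v n) (r n) &
    P n : carrier_mat (r n) (v n) & P n * I n = 1\<^sub>m (r n) &
    I n * P n = 1\<^sub>m (v n) - D (n + 1) * H n - H (n - 1) * D n &
    D n * I n = 0\<^sub>m (v (n - 1)) (r n) & P n * D (n + 1) = 0\<^sub>m (r n) (v (n + 1)) &
    H n * I n = 0\<^sub>m (v (n + 1)) (r n) & P (n + 1) * H n = 0\<^sub>m (r (n + 1)) (v n)"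
proof -
  \<comment> \<open>A generalized inverse of each differential: for a rank factorization
    \<open>L R\<close> take \<open>R' L'\<close>.\<close>
  have "EX G. G : carrier_mat (v n) (v (n - 1)) & D n * (G * D n) = D n" for n
  proof -
    obtain r L R L' R' where f: "L : carrier_mat (v (n - 1)) r" "R : carrier_mat r (v n)"
      "L' : carrier_mat r (v (n - 1))" "R' : carrier_mat (v n) r" "D n = L * R"
      "L' * L = 1\<^sub>m r" "R * R' = 1\<^sub>m r" using rank_factorization[OF D] .
    note d = f(1-4)[THEN carrier_matD(1)] f(1-4)[THEN carrier_matD(2)]
    have "D n * ((R' * L') * D n) = D n"
      unfolding f(5) using d by (simp add: mat_assoc mat_reduce[OF f(6)] mat_reduce[OF f(7)])
    then show ?thesis using f by (intro exI[of _ "R' * L'"]) auto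
  qed
  then obtain G where G: "!!n. G n : carrier_mat (v n) (v (n - 1))"
    and DGD: "!!n. D n * (G n * D n) = D n" by metis
  \<comment> \<open>\<open>e\<close> projects onto the image of the incoming differential,
    \<open>Q\<close> is the complementary projection, and \<open>K\<close> projects onto the kernel
    of the outgoing one.\<close>
  define e where "e n = D (n + 1) * G (n + 1)" for n
  define Q where "Q n = 1\<^sub>m (v n) - e n" for n
  define K where "K n = 1\<^sub>m (v n) - G n * D n" for n
  have d: "dim_row (D n) = v (n - 1)" "dim_col (D n) = v n" "dim_row (G n) = v n"
      "dim_col (G n) = v (n - 1)" for n using D[of n] G[of n] by auto
  have d': "dim_row (e n) = v n" "dim_col (e n) = v n" "dim_row (Q n) = v n" "dim_col (Q n) = v n"
    "dim_row (K n) = v n" "dim_col (K n) = v n" for n by (auto simp: e_def Q_def K_def d)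
  have D': "dim_row (D (1 + n)) = v n" "dim_col (G (1 + n)) = v n" for n by (auto simp: d)
  note dims = d d' D'
  have z: "A - A = 0\<^sub>m (dim_row A) (dim_col A)" for A :: "'k mat" by auto
  have z': "dim_row A = a ==> dim_col A = b ==> A - 0\<^sub>m a b = A" for A :: "'k mat" and a b by auto
  have zz: "dim_row A = a ==> 0\<^sub>m b a * A = 0\<^sub>m b (dim_col A)"
    "dim_col A = a ==> A * 0\<^sub>m a b = 0\<^sub>m (dim_row A) b" for A :: "'k mat" and a b
    using left_mult_zero_mat right_mult_zero_mat carrier_matI by metis+
  have oo: "dim_row A = a ==> 1\<^sub>m a * A = A" "dim_col A = a ==> A * 1\<^sub>m a = A" for A :: "'k mat" and a
    using left_mult_one_mat right_mult_one_mat carrier_matI by metis+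
  note S = mat_mult_minus mat_minus_mult z z' zz oo dims mat_assoc
  have DK: "D n * K n = 0\<^sub>m (v (n - 1)) (v n)" for n unfolding K_def by (simp add: S DGD)
  have De: "D n * e n = 0\<^sub>m (v (n - 1)) (v n)" for n unfolding e_def by (simp add: mat_reduce[OF DD] S)
  have DQ: "D n * Q n = D n" for n unfolding Q_def by (simp add: S De)
  have eD: "e n * D (n + 1) = D (n + 1)" for n unfolding e_def by (simp add: S DGD)
  have eD': "e (n - 1) * D n = D n" for n using eD[of "n - 1"] by simp
  have ee: "e n * e n = e n" for n using mat_reduce[OF eD[of n], of "G (n + 1)"] by (simp add: e_def[symmetric] S)
  have Qe: "Q n * e n = 0\<^sub>m (v n) (v n)" and eQ: "e n * Q n = 0\<^sub>m (v n) (v n)" for n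
    unfolding Q_def by (simp_all add: S ee)
  have QD: "Q n * D (n + 1) = 0\<^sub>m (v n) (v (n + 1))" for n unfolding Q_def by (simp add: S eD)
  have Ke: "K n * e n = e n" for n unfolding K_def by (simp add: S De)
  have KD: "K n * D (n + 1) = D (n + 1)" for n unfolding K_def by (simp add: S DD)
  have KQ: "K n * Q n = K n - e n" for n unfolding Q_def by (simp add: S Ke)
  have KK: "K n * K n = K n" for n
  proof -
    have "K n * K n = (1\<^sub>m (v n) - G n * D n) * K n" by (simp only: K_def)
    also have "... = K n" by (simp add: S DK)
    finally show ?thesis .
  qed
  \<comment> \<open>Cutting the generalized inverse down by \<open>Q\<close> and \<open>e\<close>
    leaves \<open>D H = e\<close> intact and forces the side conditions; \<open>p = Q K\<close> then
    projects onto a complement of the boundaries in the cycles.\<close>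
  define H where "H n = Q (n + 1) * (G (n + 1) * e n)" for n
  define p where "p n = Q n * K n" for n
  have d2: "dim_row (H n) = v (n + 1)" "dim_col (H n) = v n" "dim_row (p n) = v n" "dim_col (p n) = v n" for n
    by (auto simp: H_def p_def dims)
  have DH: "D (n + 1) * H n = e n" for n
  proof -
    have "D (n + 1) * H n = D (n + 1) * (G (n + 1) * e n)" unfolding H_def by (simp add: mat_reduce[OF DQ] S)
    also have "... = e n * e n" by (simp add: e_def S)
    finally show ?thesis by (simp add: ee)
  qed
  have HD: "H (n - 1) * D n = Q n * (G n * D n)" for n unfolding H_def by (simp add: S eD')
  have pp: "p n * p n = p n" for n unfolding p_def by (simp add: S mat_reduce[OF KQ] KK mat_reduce[OF Qe] )
  have psum: "p n = 1\<^sub>m (v n) - D (n + 1) * H n - H (n - 1) * D n" for n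
  proof -
    have "p n = Q n - Q n * (G n * D n)" by (simp add: p_def K_def S)
    then show ?thesis unfolding DH HD by (simp only: Q_def)
  qed
  have "EX r I P. I : carrier_mat (v n) r & P : carrier_mat r (v n) & p n = I * P & P * I = 1\<^sub>m r" for n
    using idempotent_mat_split[OF _ pp, of n "v n"] d2 by (metis carrier_matI)
  then obtain r I P where IP: "!!n. I n : carrier_mat (v n) (r n)" "!!n. P n : carrier_mat (r n) (v n)"
    "!!n. p n = I n * P n" "!!n. P n * I n = 1\<^sub>m (r n)" by metis
  have d3: "dim_row (I n) = v n" "dim_col (I n) = r n" "dim_row (P n) = r n" "dim_col (P n) = v n" for n
    using IP(1)[of n] IP(2)[of n] by auto
  have I: "I n = p n * I n" and P: "P n = P n * p n" for n by (simp_all add: IP(3) S d3 IP(4) mat_reduce[OF IP(4)])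
  have Dp: "D n * p n = 0\<^sub>m (v (n - 1)) (v n)" for n unfolding p_def by (simp add: mat_reduce[OF DQ] S DK)
  have pD: "p n * D (n + 1) = 0\<^sub>m (v n) (v (n + 1))" for n unfolding p_def by (simp add: S KD QD)
  have Hp: "H n * p n = 0\<^sub>m (v (n + 1)) (v n)" for n unfolding p_def H_def by (simp add: S mat_reduce[OF eQ])
  have KGe: "K (n + 1) * (G (n + 1) * e n) = 0\<^sub>m (v (n + 1)) (v n)" for n
  proof -
    have "D (n + 1) * (G (n + 1) * e n) = e n" using ee[of n] by (simp add: e_def S)
    then show ?thesis unfolding K_def by (simp add: S)
  qed
  have pH: "p (n + 1) * H n = 0\<^sub>m (v (n + 1)) (v n)" for n
    unfolding p_def H_def by (simp add: S mat_reduce[OF KQ] KGe mat_reduce[OF Qe])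
  have "D n * I n = 0\<^sub>m (v (n - 1)) (r n)" for n by (subst I) (simp add: mat_reduce[OF Dp] d2 d3 zz dims)
  moreover have "H n * I n = 0\<^sub>m (v (n + 1)) (r n)" for n by (subst I) (simp add: mat_reduce[OF Hp] d2 d3 zz dims)
  moreover have "P n * D (n + 1) = 0\<^sub>m (r n) (v (n + 1))" for n by (subst P) (simp add: mat_assoc pD d2 d3 zz dims)
  moreover have "P (n + 1) * H n = 0\<^sub>m (r (n + 1)) (v n)" for n by (subst P) (simp add: mat_assoc pH d2 d3 zz dims)
  ultimately show ?thesis using IP psum d2 by (intro exI[of _ r] exI[of _ H] exI[of _ I] exI[of _ P]) auto
qed

text \<open>One unknown \<open>X\<close> has to serve all indices \<open>a\<close> at once, so
  solvability is asked of the simultaneous system, one column at a time. Keeping the family indexed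
  by \<open>S\<close> avoids stacking the coefficients into a block matrix.\<close>

lemma mat_solve_cols:
  fixes M :: "'s => 'k::field mat"
  assumes M: "!!a. a : S ==> M a : carrier_mat (p a) d" "!!a. a : S ==> W a : carrier_mat (p a) n"
    and sol: "!!i. i < n ==> EX c:carrier_vec d. ALL a:S. M a *\<^sub>v c = col (W a) i"
  obtains X where "X : carrier_mat d n" "!!a. a : S ==> M a * X = W a"
proof -
  obtain c where c: "!!i. i < n ==> c i : carrier_vec d"
    "!!i a. i < n ==> a : S ==> M a *\<^sub>v c i = col (W a) i" using sol by metis
  define X where "X = mat d n (%(i, j). c j $ i)"
  have colX: "col X j = c j" if "j < n" for j using c(1)[OF that] that unfolding X_def by (auto simp: col_def)
  have X: "X : carrier_mat d n" by (simp add: X_def)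
  have "M a * X = W a" if a: "a : S" for a
  proof (rule mat_col_eqI)
    fix j assume "j < dim_col (W a)"
    then have j: "j < n" using M(2)[OF a] by auto
    then show "col (M a * X) j = col (W a) j" using col_mult2[OF M(1)[OF a] X j] c(2)[OF j a] colX[OF j] by simp
  qed (use M[OF a] X in auto)
  then show ?thesis using that X by blast
qed

section \<open>Endomorphism rings and the radical\<close>

text \<open>Supplies the decreasing measure of \<open>object_induct\<close>; the finite spanning set
  \<open>F\<close> ensures that \<open>dim\<close> counts a finite basis.\<close>

lemma (in vector_space) dim_less_of_subspace:
  assumes "subspace S" "S \<subseteq> T" "t : T" "t ~: S" "T \<subseteq> span F" "finite F"
  shows "dim S < dim T"
proof -
  obtain B where B: "B \<subseteq> S" "independent B" "S \<subseteq> span B" "card B = dim S" using basis_exists by blast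
  obtain C where C: "C \<subseteq> T" "independent C" "T \<subseteq> span C" "card C = dim T" using basis_exists by blast
  have fC: "finite C" using independent_span_bound[OF assms(6) C(2)] C(1) assms(5) by blast
  have fB: "finite B" using independent_span_bound[OF assms(6) B(2)] B(1) assms(2,5) by blast
  have t: "t ~: span B" using span_minimal[OF B(1) assms(1)] assms(4) by blast
  then have "independent (insert t B)" using B(2) independent_insertI by blast
  then have "card (insert t B) <= card C" using independent_span_bound[OF fC] B(1) C(3) assms(2,3) by blast
  moreover have "t ~: B" using t span_base by blast
  ultimately show ?thesis using fB B(4) C(4) by simp
qed

section \<open>Calculus in the morphism spaces and the ideal property of the radical\<close>

context k_category
begin

lemma Hom_zero: "x : Obj A ==> y : Obj A ==> 0 : Hom A x y" using Hom_subspace subspace_0 by blast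

lemma Hom_add: "x : Obj A ==> y : Obj A ==> f : Hom A x y ==> g : Hom A x y ==> f + g : Hom A x y"
  using Hom_subspace subspace_add by blast

lemma Hom_diff: "x : Obj A ==> y : Obj A ==> f : Hom A x y ==> g : Hom A x y ==> f - g : Hom A x y"
  using Hom_subspace subspace_diff by blast

lemma Hom_scale: "x : Obj A ==> y : Obj A ==> f : Hom A x y ==> scale c f : Hom A x y"
  using Hom_subspace subspace_scale by blast

lemma Hom_sum: "x : Obj A ==> y : Obj A ==> (!!i. i : I ==> f i : Hom A x y) ==> sum f I : Hom A x y"
  using Hom_subspace subspace_sum by blast

lemma Cmp_zero_left: "[| x : Obj A; y : Obj A; z : Obj A; f : Hom A x y |] ==> Cmp A x y z 0 f = 0"
  using Cmp_scale_left[of x y z f 0 0] Hom_zero by simp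

lemma Cmp_zero_right: "[| x : Obj A; y : Obj A; z : Obj A; g : Hom A y z |] ==> Cmp A x y z g 0 = 0"
  using Cmp_scale_right[of x y z 0 g 0] Hom_zero by simp

lemma Cmp_diff_left: "[| x : Obj A; y : Obj A; z : Obj A; f : Hom A x y; g : Hom A y z; g' : Hom A y z |]
    ==> Cmp A x y z (g - g') f = Cmp A x y z g f - Cmp A x y z g' f"
  using Cmp_add_left[of x y z f "g - g'" g'] by (simp add: Hom_diff)

lemma Cmp_diff_right: "[| x : Obj A; y : Obj A; z : Obj A; f : Hom A x y; f' : Hom A x y; g : Hom A y z |]
    ==> Cmp A x y z g (f - f') = Cmp A x y z g f - Cmp A x y z g f'"
  using Cmp_add_right[of x y z "f - f'" f' g] by (simp add: Hom_diff)

lemma Cmp_sum_right: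
  assumes "x : Obj A" "y : Obj A" "z : Obj A" "g : Hom A y z" "!!i. i : I ==> f i : Hom A x y"
  shows "Cmp A x y z g (sum f I) = (\<Sum>i\<in>I. Cmp A x y z g (f i))" using assms(5)
  by (induction I rule: infinite_finite_induct)
    (use assms in \<open>auto simp: Cmp_zero_right Cmp_add_right Hom_sum\<close>)

sublocale preadditive A by unfold_locales
    (auto simp: Idn_Hom Cmp_Hom Cmp_Idn_right Cmp_Idn_left Cmp_assoc Zer_eq Sum_eq Cmp_zero_left
      Cmp_zero_right Cmp_add_left Cmp_add_right Hom_add)

definition invertible :: "'o => 'm => bool" where
  "invertible x f \<longleftrightarrow> (EX h:Hom A x x. Cmp A x x x h f = Idn A x & Cmp A x x x f h = Idn A x)"

lemma rad_altdef: "rad A x y = {f : Hom A x y. ALL g:Hom A y x. invertible x (Idn A x - Cmp A x y x g f)}"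
  unfolding rad_def invertible_def by auto

lemma invertible_Cmp:
  assumes "x : Obj A" "f : Hom A x x" "g : Hom A x x" "invertible x f" "invertible x g"
  shows "invertible x (Cmp A x x x f g)"
proof -
  obtain f' g' where h: "f' : Hom A x x" "g' : Hom A x x" "Cmp A x x x f' f = Idn A x" "Cmp A x x x f f' = Idn A x"
    "Cmp A x x x g' g = Idn A x" "Cmp A x x x g g' = Idn A x" using assms unfolding invertible_def by blast
  show ?thesis unfolding invertible_def
    using cmp_inverse[of x x x g g' f f'] cmp_inverse[of x x x f' f g' g] assms h Cmp_Hom by blast
qed

lemma rad_Hom: "f : rad A x y ==> f : Hom A x y" unfolding rad_def by simp

lemma rad_Cmp_left:
  assumes "x : Obj A" "y : Obj A" "z : Obj A" "f : rad A x y" "h : Hom A y z"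
  shows "Cmp A x y z h f : rad A x z"
proof -
  have "Cmp A x z x g (Cmp A x y z h f) = Cmp A x y x (Cmp A y z x g h) f" if "g : Hom A z x" for g
    using that assms rad_Hom by (simp add: Cmp_assoc)
  then show ?thesis using assms unfolding rad_altdef by (simp add: Cmp_Hom)
qed

text \<open>The definition of \<open>rad\<close> tests endomorphisms of the source only, so a change
  of source is not formal. It rests on the fact that \<open>1 - s k\<close> is invertible when
  \<open>1 - k s\<close> is, with inverse \<open>1 + s u k\<close> for \<open>u\<close> the inverse
  of \<open>1 - k s\<close>.\<close>

lemma rad_Cmp_right:
  assumes o: "x : Obj A" "y : Obj A" "w : Obj A" and f: "f : rad A x y" and k: "k : Hom A w x"
  shows "Cmp A w x y f k : rad A w y"
proof -
  have fH: "f : Hom A x y" using f rad_Hom by blast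
  have "invertible w (Idn A w - Cmp A w y w g (Cmp A w x y f k))" if g: "g : Hom A y w" for g
  proof -
    define s where "s = Cmp A x y w g f"
    have s: "s : Hom A x w" using s_def o g fH Cmp_Hom by simp
    have ks: "Cmp A x w x k s = Cmp A x y x (Cmp A y w x k g) f" unfolding s_def using o g fH k by (simp add: Cmp_assoc)
    have "invertible x (Idn A x - Cmp A x w x k s)" unfolding ks using f o g k Cmp_Hom unfolding rad_altdef by blast
    then obtain u where u: "u : Hom A x x" "Cmp A x x x u (Idn A x - Cmp A x w x k s) = Idn A x"
      "Cmp A x x x (Idn A x - Cmp A x w x k s) u = Idn A x" unfolding invertible_def by blast
    note m = o g fH k s u(1) Cmp_Hom Idn_Hom
    have 1: "u - Cmp A x x x u (Cmp A x w x k s) = Idn A x" using u(2) m by (simp add: Cmp_diff_right Cmp_Idn_right)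
    have 2: "u - Cmp A x w x k (Cmp A x x w s u) = Idn A x" using u(3) m by (simp add: Cmp_diff_left Cmp_Idn_left Cmp_assoc)
    define U where "U = Idn A w + Cmp A w x w s (Cmp A w x x u k)"
    have e: "Cmp A w y w g (Cmp A w x y f k) = Cmp A w x w s k" unfolding s_def using m by (simp add: Cmp_assoc)
    have U: "U : Hom A w w" unfolding U_def using m by (simp add: Hom_add)
    have "Cmp A w w w U (Idn A w - Cmp A w x w s k) = Idn A w + Cmp A w x w s (Cmp A w x x u k)
       - Cmp A w x w s k - Cmp A w x w s (Cmp A w x x (Cmp A x x x u (Cmp A x w x k s)) k)"
      unfolding U_def using m by (simp add: Cmp_diff_right Cmp_add_left Hom_add Cmp_Idn_left Cmp_Idn_right Cmp_assoc algebra_simps)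
    also have "... = Idn A w + Cmp A w x w s (Cmp A w x x (u - Cmp A x x x u (Cmp A x w x k s)) k) - Cmp A w x w s k"
      using m by (simp add: Cmp_diff_right Cmp_diff_left)
    also have "... = Idn A w" unfolding 1 using m by (simp add: Cmp_Idn_left)
    finally have 3: "Cmp A w w w U (Idn A w - Cmp A w x w s k) = Idn A w" .
    have "Cmp A w w w (Idn A w - Cmp A w x w s k) U = Idn A w + Cmp A w x w s (Cmp A w x x u k)
       - Cmp A w x w s k - Cmp A w x w s (Cmp A w x x (Cmp A x w x k (Cmp A x x w s u)) k)"
      unfolding U_def using m by (simp add: Cmp_diff_left Cmp_add_right Hom_add Cmp_Idn_left Cmp_Idn_right Cmp_assoc algebra_simps)
    also have "... = Idn A w + Cmp A w x w s (Cmp A w x x (u - Cmp A x w x k (Cmp A x x w s u)) k) - Cmp A w x w s k"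
      using m by (simp add: Cmp_diff_right Cmp_diff_left)
    also have "... = Idn A w" unfolding 2 using m by (simp add: Cmp_Idn_left)
    finally show ?thesis unfolding e invertible_def using U 3 by blast
  qed
  then show ?thesis unfolding rad_altdef using o fH k Cmp_Hom by simp
qed

lemma rad_add:
  assumes o: "x : Obj A" "y : Obj A" and f: "f : rad A x y" "f' : rad A x y"
  shows "f + f' : rad A x y"
proof -
  have fH: "f : Hom A x y" "f' : Hom A x y" using f rad_Hom by blast+
  have "invertible x (Idn A x - Cmp A x y x g (f + f'))" if g: "g : Hom A y x" for g
  proof -
    define s where "s = Idn A x - Cmp A x y x g f"
    have i1: "invertible x s" unfolding s_def using f(1) g unfolding rad_altdef by blast
    then obtain u where u: "u : Hom A x x" "Cmp A x x x u s = Idn A x" "Cmp A x x x s u = Idn A x"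
      unfolding invertible_def by blast
    have sH: "s : Hom A x x" unfolding s_def using o g fH by (simp add: Hom_diff Idn_Hom Cmp_Hom)
    note m = o g fH sH u(1) Cmp_Hom Idn_Hom
    \<comment> \<open>\<open>1 - g (f + f') = s (1 - u g f')\<close>, a product of two invertible
      elements.\<close>
    define t where "t = Idn A x - Cmp A x y x (Cmp A y x x u g) f'"
    have i2: "invertible x t" unfolding t_def using f(2) m unfolding rad_altdef by blast
    have tH: "t : Hom A x x" unfolding t_def using m by (simp add: Hom_diff)
    have "Cmp A x x x s t = s - Cmp A x x x s (Cmp A x x x u (Cmp A x y x g f'))"
      unfolding t_def using m by (simp add: Cmp_diff_right Cmp_Idn_right Cmp_assoc)
    also have "... = s - Cmp A x y x g f'" using m u(3) by (simp add: cmp_reduce[OF _ _ _ _ _ _ _ u(3)] Cmp_Idn_left)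
    also have "... = Idn A x - Cmp A x y x g (f + f')" unfolding s_def using m by (simp add: Cmp_add_right)
    finally show ?thesis using invertible_Cmp[OF o(1) sH tH i1 i2] by simp
  qed
  then show ?thesis unfolding rad_altdef using o fH Hom_add by simp
qed

lemma invertible_Idn: "x : Obj A ==> invertible x (Idn A x)" unfolding invertible_def using Idn_Hom Cmp_Idn_left by blast

lemma rad_subspace:
  assumes o: "x : Obj A" "y : Obj A"
  shows "subspace (rad A x y)"
proof (rule subspaceI)
  show "0 : rad A x y" unfolding rad_altdef using o by (simp add: Hom_zero Cmp_zero_right invertible_Idn)
  show "scale c f : rad A x y" if f: "f : rad A x y" for c f
  proof -
    have "Cmp A x x y f (scale c (Idn A x)) = scale c f"
      using o f rad_Hom by (simp add: Cmp_scale_right Idn_Hom Cmp_Idn_right)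
    then show ?thesis using rad_Cmp_right[OF o o(1) f, of "scale c (Idn A x)"] o by (simp add: Hom_scale Idn_Hom)
  qed
qed (use rad_add o in blast)

primrec pw :: "'o => 'm => nat => 'm" where
  "pw x f 0 = Idn A x"
| "pw x f (Suc n) = Cmp A x x x f (pw x f n)"

lemma pw_Hom: "x : Obj A ==> f : Hom A x x ==> pw x f n : Hom A x x" by (induction n) (auto simp: Idn_Hom Cmp_Hom)

text \<open>Substitution of an endomorphism into a polynomial, by Horner's rule. It turns out to be
  a ring homomorphism into the endomorphisms of \<open>x\<close>, so that identities between powers
  can be derived in a commutative ring.\<close>

definition ev :: "'o => 'm => 'k poly => 'm" where
  "ev x f p = fold_coeffs (%a h. scale a (Idn A x) + Cmp A x x x f h) p 0"

lemma ev_0: "ev x f 0 = 0" by (simp add: ev_def)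

context
  fixes x f
  assumes x: "x : Obj A" and f: "f : Hom A x x"
begin

lemma ev_pCons: "ev x f (pCons a p) = scale a (Idn A x) + Cmp A x x x f (ev x f p)"
  using x f by (cases "p = 0 & a = 0") (auto simp: ev_def Cmp_zero_right)

lemma ev_Hom: "ev x f p : Hom A x x"
  by (induction p) (use x f in \<open>auto simp: ev_0 ev_pCons Hom_zero Hom_add Hom_scale Idn_Hom Cmp_Hom\<close>)

lemma ev_add: "ev x f (p + q) = ev x f p + ev x f q" by (induction p q rule: poly_induct2)
    (use x f in \<open>auto simp: ev_0 ev_pCons Cmp_add_right ev_Hom scale_left_distrib algebra_simps\<close>)

lemma ev_smult: "ev x f (Polynomial.smult c p) = scale c (ev x f p)" by (induction p)
    (use x f in \<open>auto simp: ev_0 ev_pCons Cmp_scale_right ev_Hom scale_right_distrib\<close>)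

lemma ev_mult: "ev x f (p * q) = Cmp A x x x (ev x f p) (ev x f q)" by (induction p)
    (use x f in \<open>auto simp: ev_0 ev_pCons ev_add ev_smult Cmp_add_left Cmp_scale_left ev_Hom Cmp_Idn_left
      Cmp_zero_left Cmp_assoc Hom_scale Idn_Hom Cmp_Hom\<close>)

lemma ev_1: "ev x f 1 = Idn A x" using x f by (simp add: one_pCons ev_pCons ev_0 Cmp_zero_right)

lemma ev_diff: "ev x f (p - q) = ev x f p - ev x f q" using ev_add[of "p - q" q] by simp

lemma ev_power: "ev x f (p ^ n) = pw x (ev x f p) n" by (induction n) (auto simp: ev_1 ev_mult)

lemma ev_X: "ev x f [:0, 1:] = f" using x f by (simp add: ev_pCons ev_0 Cmp_zero_right Cmp_Idn_right)

lemma ev_linear: "ev x f [:- c, 1:] = f - scale c (Idn A x)"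
  using x f by (simp add: ev_pCons ev_0 Cmp_zero_right Cmp_Idn_right)

text \<open>In a finite-dimensional endomorphism space some power of \<open>f\<close> lies in the
  span of the lower ones, since otherwise the powers would form arbitrarily large independent sets.
  The resulting relation has coefficient 1 at that power, hence is a nonzero polynomial.\<close>

lemma annihilating_poly:
  assumes "fin_dim scale (Hom A x x)"
  shows "EX p. p ~= 0 & ev x f p = 0"
proof -
  obtain B where B: "finite B" "span B = Hom A x x" using assms unfolding fin_dim_def by blast
  have "EX n. pw x f n : span (pw x f ` {..<n})"
  proof (rule ccontr)
    assume n: "\<nexists>n. pw x f n : span (pw x f ` {..<n})"
    have "independent (pw x f ` {..<n}) & card (pw x f ` {..<n}) = n" for n
    proof (induction n)
      case (Suc n)
      have n': "pw x f n ~: span (pw x f ` {..<n})" using n by simp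
      then have "pw x f n ~: pw x f ` {..<n}" using span_base by metis
      then show ?case using Suc n' by (simp add: lessThan_Suc independent_insertI)
    qed (simp add: independent_empty)
    moreover have "pw x f ` {..<n} \<subseteq> span B" for n using B pw_Hom x f by auto
    ultimately have "n <= card B" for n using independent_span_bound[OF B(1)] by metis
    then show False using not_less_eq_eq by blast
  qed
  then obtain n where n: "pw x f n : span (pw x f ` {..<n})" by blast
  define T where "T = {ev x f q | q. ALL i>=n. coeff q i = 0}"
  have pwT: "pw x f i = ev x f (monom 1 i)" for i by (simp add: monom_altdef ev_power ev_X)
  have "subspace T"
  proof (rule subspaceI)
    have "0 = ev x f 0 & (ALL i>=n. coeff (0 :: 'k poly) i = 0)" by (simp add: ev_0)
    then show "0 : T" unfolding T_def by blast
    show "a + b : T" if "a : T" "b : T" for a b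
    proof -
      obtain p q where "a = ev x f p" "b = ev x f q" "ALL i>=n. coeff p i = 0" "ALL i>=n. coeff q i = 0"
        using \<open>a : T\<close> \<open>b : T\<close> unfolding T_def by blast
      then have "a + b = ev x f (p + q) & (ALL i>=n. coeff (p + q) i = 0)" by (simp add: ev_add)
      then show ?thesis unfolding T_def by blast
    qed
    show "scale c a : T" if "a : T" for c a
    proof -
      obtain p where "a = ev x f p" "ALL i>=n. coeff p i = 0" using \<open>a : T\<close> unfolding T_def by blast
      then have "scale c a = ev x f (Polynomial.smult c p) & (ALL i>=n. coeff (Polynomial.smult c p) i = 0)"
        by (simp add: ev_smult)
      then show ?thesis unfolding T_def by blast
    qed
  qed
  moreover have "pw x f ` {..<n} \<subseteq> T" unfolding T_def using pwT by auto
  ultimately have "pw x f n : T" using n span_minimal by blast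
  then obtain q where q: "pw x f n = ev x f q" "coeff q n = 0" unfolding T_def by auto
  have "coeff (monom 1 n - q) n = 1" using q(2) by simp
  then have "monom 1 n - q ~= 0" by (metis coeff_0 zero_neq_one)
  moreover have "ev x f (monom 1 n - q) = 0" using q(1) pwT by (simp add: ev_diff)
  ultimately show ?thesis by blast
qed

text \<open>The geometric series is the inverse; it is evaluated from the polynomial identity for
  \<open>1 - X ^ n\<close>.\<close>

lemma invertible_one_minus_nilpotent:
  assumes "pw x f n = 0"
  shows "invertible x (Idn A x - f)"
proof -
  define s :: "'k poly" where "s = (\<Sum>i<n. [:0, 1:] ^ i)"
  have s: "(1 - [:0, 1:]) * s = 1 - [:0, 1:] ^ n" unfolding s_def using one_diff_power_eq[of "[:0, 1:] :: 'k poly" n] by simp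
  have "ev x f ((1 - [:0, 1:]) * s) = Idn A x" unfolding s using assms by (simp only: ev_diff ev_1 ev_power ev_X) simp
  moreover have "ev x f (1 - [:0, 1:]) = Idn A x - f" by (simp only: ev_diff ev_1 ev_X)
  ultimately have "Cmp A x x x (Idn A x - f) (ev x f s) = Idn A x"
    "Cmp A x x x (ev x f s) (Idn A x - f) = Idn A x"
    using ev_mult[of "1 - [:0, 1:]" s] ev_mult[of s "1 - [:0, 1:]"] by (simp_all only: mult.commute)
  then show ?thesis unfolding invertible_def using ev_Hom by blast
qed

end

end

text \<open>Synthetic division gives \<open>q = (X - c) s + q(c)\<close> with \<open>q(c)\<close> a
  unit, which is the identity for exponent 1. Multiplying it with the identity for \<open>n\<close>
  and collecting terms raises the exponent by one.\<close>

lemma bezout_linear_power: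
  fixes q :: "'k::field poly"
  assumes "poly q c ~= 0"
  shows "EX a b. a * [:- c, 1:] ^ n + b * q = 1"
proof (induction n)
  case 0
  show ?case by (rule exI[of _ 1], rule exI[of _ 0]) simp
next
  case (Suc n)
  then obtain a b where ab: "a * [:- c, 1:] ^ n + b * q = 1" by blast
  define s where "s = synthetic_div q c"
  have q: "q + Polynomial.smult c s = pCons (poly q c) s" unfolding s_def by (rule synthetic_div_correct)
  have q': "q = [:- c, 1:] * s + [:poly q c:]" using q by (simp add: algebra_simps)
  define d where "d = inverse (poly q c)"
  have one: "Polynomial.smult (- d) s * [:- c, 1:] + [:d:] * q = 1"
  proof -
    define L where "L = [:- c, 1:]"
    have "[:d:] * q = Polynomial.smult d (s * L) + 1"
      by (subst q', fold L_def) (use assms in \<open>simp add: d_def smult_add_right one_pCons mult.commute\<close>)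
    then show ?thesis by (simp add: L_def[symmetric])
  qed
  have "1 = (a * [:- c, 1:] ^ n + b * q) * (Polynomial.smult (- d) s * [:- c, 1:] + [:d:] * q)"
    by (simp only: ab one mult_1_left)
  also have "... = (a * Polynomial.smult (- d) s) * [:- c, 1:] ^ Suc n
      + (b * (Polynomial.smult (- d) s * [:- c, 1:] + [:d:] * q) + a * [:- c, 1:] ^ n * [:d:]) * q"
    by (simp only: algebra_simps power_Suc)
  finally show ?case by metis
qed

section \<open>Endomorphism rings of indecomposable objects are local\<close>

context lofd_category
begin

text \<open>Both \<open>e\<close> and \<open>1 - e\<close> split, and their images form a direct sum
  decomposition of \<open>x\<close>, so one of the images is a zero object.\<close>

lemma idempotent_of_indecomposable:
  assumes x: "indecomposable A x" and e: "e : Hom A x x" "Cmp A x x x e e = e"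
  shows "e = 0 \<or> e = Idn A x"
proof -
  have o: "x : Obj A" using x by (simp add: indecomposable_def)
  define e' where "e' = Idn A x - e"
  have e': "e' : Hom A x x" "Cmp A x x x e' e' = e'" "Cmp A x x x e' e = 0" "Cmp A x x x e e' = 0"
    unfolding e'_def using o e by (simp_all add: Hom_diff Idn_Hom Cmp_diff_left Cmp_diff_right Cmp_Idn_left Cmp_Idn_right)
  obtain y p i where y: "y : Obj A" "p : Hom A x y" "i : Hom A y x" "Cmp A x y x i p = e" "Cmp A y x y p i = Idn A y"
    using idempotents_split[OF o e] by blast
  obtain z p' i' where z: "z : Obj A" "p' : Hom A x z" "i' : Hom A z x" "Cmp A x z x i' p' = e'" "Cmp A z x z p' i' = Idn A z"
    using idempotents_split[OF o e'(1,2)] by blast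
  note m = o y(1-3) z(1-3) e(1) e'(1) Cmp_Hom Idn_Hom
  \<comment> \<open>The structure maps absorb their idempotents; hence the mixed composites contain
    \<open>e e' = 0\<close> or \<open>e' e = 0\<close>.\<close>
  have i: "i = Cmp A y x x e i" and i': "i' = Cmp A z x x e' i'"
    unfolding y(4)[symmetric] z(4)[symmetric] using m y(5) z(5) by (simp_all add: Cmp_assoc Cmp_Idn_right)
  have p: "p = Cmp A x x y p e" and p': "p' = Cmp A x x z p' e'" unfolding y(4)[symmetric] z(4)[symmetric] using m y(5) z(5)
    by (simp_all add: cmp_reduce[OF _ _ _ _ _ _ _ y(5)] cmp_reduce[OF _ _ _ _ _ _ _ z(5)] Cmp_Idn_left)
  have 1: "Cmp A z x y p i' = 0"
    by (subst p, subst i') (use m e'(4) in \<open>simp add: Cmp_assoc cmp_reduce[OF _ _ _ _ _ _ _ e'(4)] Cmp_zero_left Cmp_zero_right\<close>)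
  have 2: "Cmp A y x z p' i = 0"
    by (subst p', subst i) (use m e'(3) in \<open>simp add: Cmp_assoc cmp_reduce[OF _ _ _ _ _ _ _ e'(3)] Cmp_zero_left Cmp_zero_right\<close>)
  have "Sum A x x (Cmp A x y x i p) (Cmp A x z x i' p') = Idn A x"
    unfolding y(4) z(4) using m(1) e(1) e'(1) by (simp add: Sum_eq e'_def)
  moreover have "Cmp A z x y p i' = Zer A z y" "Cmp A y x z p' i = Zer A y z" using 1 2 y(1) z(1) by (simp_all add: Zer_eq)
  ultimately have "is_direct_sum A x y z" unfolding is_direct_sum_def using o y z by blast
  then consider "zero_object A y" | "zero_object A z" using x unfolding indecomposable_def by blast
  then show ?thesis
  proof cases
    case 1
    then have "p = 0" using Cmp_Idn_left[of x y p] Cmp_zero_left[of x y y p] m by (simp add: zero_object_def Zer_eq)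
    then show ?thesis using y(4) m by (simp add: Cmp_zero_right)
  next
    case 2
    then have "p' = 0" using Cmp_Idn_left[of x z p'] Cmp_zero_left[of x z z p'] m by (simp add: zero_object_def Zer_eq)
    then have "e' = 0" using z(4) m by (simp add: Cmp_zero_right)
    then show ?thesis by (simp add: e'_def)
  qed
qed

lemma Idn_nonzero: "indecomposable A x ==> Idn A x ~= 0" unfolding indecomposable_def zero_object_def using Zer_eq by auto

text \<open>Composing with \<open>g\<close> lowers the exponent of a vanishing power by one, down to
  \<open>Idn A x = 0\<close>, which indecomposability forbids.\<close>

lemma nilpotent_not_left_invertible:
  assumes x: "indecomposable A x" and f: "f : Hom A x x" "pw x f n = 0"
    and g: "g : Hom A x x" "Cmp A x x x g f = Idn A x"
  shows False using f(2)
proof (induction n)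
  case 0
  then show ?case using Idn_nonzero[OF x] by simp
next
  case (Suc n)
  have o: "x : Obj A" using x by (simp add: indecomposable_def)
  have "pw x f n = Cmp A x x x g (pw x f (Suc n))"
    using o f g pw_Hom[OF o f(1)] by (simp add: cmp_reduce[OF _ _ _ _ _ _ _ g(2)] Cmp_Idn_left)
  then show ?case using Suc g o by (simp add: Cmp_zero_right)
qed

end

locale lofd_category_alg_closed = lofd_category scale A
  for scale :: "'k::alg_closed_field => 'm::ab_group_add => 'm" and A :: "('o, 'm) precat"
begin

text \<open>Let \<open>p\<close> be an annihilating polynomial of least degree, \<open>c\<close> a
  root of it, which exists over an algebraically closed field, and \<open>p = (X - c)^n q\<close>
  with \<open>q(c)\<close> nonzero. A Bezout identity makes \<open>b q\<close> idempotent modulo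
  \<open>p\<close>, so its value at \<open>f\<close> is 0 or 1. The value 0 would let
  \<open>q\<close> annihilate \<open>f\<close>, against minimality; the value 1 gives
  \<open>(f - c)^n = 0\<close>.\<close>

lemma nilpotent_part:
  assumes x: "indecomposable A x" and f: "f : Hom A x x"
  shows "EX c n. pw x (f - scale c (Idn A x)) n = 0"
proof -
  have o: "x : Obj A" using x by (simp add: indecomposable_def)
  note ev = ev_mult[OF o f] ev_add[OF o f] ev_1[OF o f] ev_Hom[OF o f] ev_diff[OF o f]
  obtain p where p: "p ~= 0" "ev x f p = 0" and min: "!!q. q ~= 0 ==> ev x f q = 0 ==> degree p <= degree q"
    using annihilating_poly[OF o f Hom_fin_dim[OF o o]] ex_has_least_nat[of "%p. p ~= 0 & ev x f p = 0" _ degree] by blast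
  have "degree p > 0"
  proof (rule ccontr)
    assume "\<not> degree p > 0"
    then obtain c where c: "p = [:c:]" using degree_eq_zeroE by blast
    have "ev x f p = scale c (Idn A x)" unfolding c using o f by (simp add: ev_pCons[OF o f] ev_0 Cmp_zero_right)
    then show False using p c Idn_nonzero[OF x] by simp
  qed
  then obtain c where c: "poly p c = 0" using alg_closed_imp_poly_has_root by blast
  define n where "n = order c p"
  have n: "n ~= 0" using c p(1) order_root n_def by blast
  obtain q where q: "p = [:- c, 1:] ^ n * q" "\<not> [:- c, 1:] dvd q" using order_decomp[OF p(1), of c] n_def by blast
  have "poly q c ~= 0" using q(2) poly_eq_0_iff_dvd by blast
  then obtain a b where ab: "a * [:- c, 1:] ^ n + b * q = 1" using bezout_linear_power by blast
  define e where "e = ev x f (b * q)"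
  have e1: "e = Idn A x - ev x f (a * [:- c, 1:] ^ n)" unfolding e_def using ab ev by (metis add_diff_cancel_left')
  have "b * q * (b * q) = b * q - a * b * p"
  proof -
    have "b * q * (b * q) + a * b * p = (a * [:- c, 1:] ^ n + b * q) * (b * q)" by (simp add: q(1) algebra_simps)
    then show ?thesis by (simp add: ab eq_diff_eq)
  qed
  then have "Cmp A x x x e e = e" unfolding e_def using p(2) o
    by (metis ev_mult[OF o f] ev_diff[OF o f] Cmp_zero_right[OF o o o ev_Hom[OF o f]] diff_zero)
  then consider "e = 0" | "e = Idn A x" using idempotent_of_indecomposable[OF x, of e] e_def ev_Hom[OF o f] by blast
  then show ?thesis
  proof cases
    case 1
    have "ev x f q = 0"
    proof -
      have "q = a * p + b * q * q"
      proof -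
        have "q = (a * [:- c, 1:] ^ n + b * q) * q" by (simp add: ab)
        then show ?thesis by (simp add: q(1) algebra_simps)
      qed
      then have "ev x f q = Cmp A x x x (ev x f a) (ev x f p) + Cmp A x x x e (ev x f q)" unfolding e_def using ev by metis
      then show ?thesis using 1 p(2) o ev_Hom[OF o f] by (simp add: Cmp_zero_left Cmp_zero_right)
    qed
    moreover have "q ~= 0" using p(1) q(1) by auto
    moreover have "degree p = n + degree q"
      using p(1) q(1) \<open>q ~= 0\<close> by (simp add: degree_mult_eq degree_linear_power)
    ultimately show ?thesis using min[of q] n by simp
  next
    case 2
    have "[:- c, 1:] ^ n * (b * q) = b * p" by (simp add: q(1) algebra_simps)
    then have "Cmp A x x x (ev x f ([:- c, 1:] ^ n)) e = Cmp A x x x (ev x f b) (ev x f p)"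
      unfolding e_def by (metis ev_mult[OF o f])
    then have "ev x f ([:- c, 1:] ^ n) = 0" using 2 p(2) o ev_Hom[OF o f] by (simp add: Cmp_Idn_right Cmp_zero_right)
    then show ?thesis using ev_power[OF o f] ev_linear[OF o f] by metis
  qed
qed

text \<open>Failure of membership provides \<open>g\<close> with \<open>1 - g f\<close> not
  invertible. Now \<open>g f\<close> is a scalar \<open>c\<close> plus a nilpotent, and
  \<open>c = 0\<close> would make \<open>1 - g f\<close> invertible by the geometric series. So
  \<open>g f\<close> itself is invertible, and its inverse corrects \<open>g\<close>.\<close>

lemma rad_or_split_mono:
  assumes x: "indecomposable A x" and y: "y : Obj A" and f: "f : Hom A x y" "f ~: rad A x y"
  obtains g where "g : Hom A y x" "Cmp A x y x g f = Idn A x"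
proof -
  have o: "x : Obj A" using x by (simp add: indecomposable_def)
  obtain g where g: "g : Hom A y x" "\<not> invertible x (Idn A x - Cmp A x y x g f)" using f unfolding rad_altdef by blast
  define k where "k = Cmp A x y x g f"
  have k: "k : Hom A x x" unfolding k_def using o y f g Cmp_Hom by blast
  obtain c n where c: "pw x (k - scale c (Idn A x)) n = 0" using nilpotent_part[OF x k] by blast
  have "c ~= 0" using invertible_one_minus_nilpotent[OF o k] c g(2) by (auto simp: k_def)
  define d where "d = - inverse c"
  define N where "N = scale d (k - scale c (Idn A x))"
  have kc: "k - scale c (Idn A x) : Hom A x x" using k o by (simp add: Hom_diff Hom_scale Idn_Hom)
  have NH: "N : Hom A x x" unfolding N_def using kc o by (simp add: Hom_scale)
  have "pw x N n = scale (d ^ n) (pw x (k - scale c (Idn A x)) n)" for n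
    by (induction n) (use o kc pw_Hom in \<open>auto simp: N_def Cmp_scale_left Cmp_scale_right Hom_scale\<close>)
  then have "pw x N n = 0" using c by simp
  then obtain u where u: "u : Hom A x x" "Cmp A x x x u (Idn A x - N) = Idn A x"
    using invertible_one_minus_nilpotent[OF o NH] unfolding invertible_def by blast
  have "Idn A x - N = scale (inverse c) k"
    unfolding N_def d_def using \<open>c ~= 0\<close> by (simp add: scale_right_diff_distrib)
  then have "Cmp A x y x (scale (inverse c) (Cmp A y x x u g)) f = Idn A x"
    using u o y f g k by (simp add: k_def Cmp_scale_left Cmp_scale_right Cmp_Hom Cmp_assoc)
  then show ?thesis using that[of "scale (inverse c) (Cmp A y x x u g)"] o y g u Hom_scale Cmp_Hom by blast
qed

lemma Idn_notin_rad: "indecomposable A x ==> Idn A x ~: rad A x x"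
proof
  assume x: "indecomposable A x" and r: "Idn A x : rad A x x"
  have o: "x : Obj A" using x by (simp add: indecomposable_def)
  have "invertible x (Idn A x - Cmp A x x x (Idn A x) (Idn A x))" using r o Idn_Hom unfolding rad_altdef by blast
  then show False unfolding invertible_def using o Idn_nonzero[OF x] by (auto simp: Cmp_Idn_left Idn_Hom Cmp_zero_right)
qed

text \<open>A nilpotent endomorphism of an indecomposable object has no left inverse, so by
  \<open>rad_or_split_mono\<close> it is radical. The residue field of the local ring is thus the
  ground field.\<close>

lemma endomorphism_decomposition:
  assumes x: "indecomposable A x" and f: "f : Hom A x x"
  shows "EX c. f - scale c (Idn A x) : rad A x x"
proof -
  have o: "x : Obj A" using x by (simp add: indecomposable_def)
  obtain c n where c: "pw x (f - scale c (Idn A x)) n = 0" using nilpotent_part[OF x f] by blast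
  have H: "f - scale c (Idn A x) : Hom A x x" using f o by (simp add: Hom_diff Hom_scale Idn_Hom)
  then have "f - scale c (Idn A x) : rad A x x"
    using rad_or_split_mono[OF x o] nilpotent_not_left_invertible[OF x _ c] by metis
  then show ?thesis by blast
qed

text \<open>A non-radical \<open>f\<close> has a left inverse \<open>g\<close>, and
  \<open>f g\<close> is an idempotent of \<open>y\<close>: it can be 0 only if \<open>x\<close>
  vanishes, and 1 only if \<open>f\<close> is an isomorphism.\<close>

lemma Hom_eq_rad:
  assumes x: "indecomposable A x" and y: "indecomposable A y" and "\<not> isomorphic A x y"
  shows "Hom A x y = rad A x y"
proof -
  have o: "x : Obj A" "y : Obj A" using x y by (simp_all add: indecomposable_def)
  have "f : rad A x y" if f: "f : Hom A x y" for f
  proof (rule ccontr)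
    assume "f ~: rad A x y"
    then obtain g where g: "g : Hom A y x" "Cmp A x y x g f = Idn A x" using rad_or_split_mono[OF x o(2) f] by blast
    define e where "e = Cmp A y x y f g"
    have e: "e : Hom A y y" unfolding e_def using o f g Cmp_Hom by blast
    have "Cmp A y y y e e = e" unfolding e_def using o f g
      by (simp add: Cmp_assoc Cmp_Hom cmp_reduce[OF _ _ _ _ _ _ _ g(2)] Cmp_Idn_left)
    then consider "e = 0" | "e = Idn A y" using idempotent_of_indecomposable[OF y e] by blast
    then show False
    proof cases
      case 1
      have "Idn A x = Cmp A x y x (Cmp A y y x g e) f" unfolding e_def using o f g
        by (simp add: Cmp_assoc Cmp_Hom cmp_reduce[OF _ _ _ _ _ _ _ g(2)] Cmp_Idn_left)
      then show False using 1 o f g Idn_nonzero[OF x] by (simp add: Cmp_zero_right Cmp_zero_left)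
    next
      case 2
      then show False using assms(3) o f g unfolding isomorphic_def e_def by blast
    qed
  qed
  then show ?thesis using rad_Hom by blast
qed

end

context lofd_category
begin

text \<open>Decomposing terminates because every object that occurs is a retract of the fixed object
  \<open>z\<close>, through \<open>i\<close> and \<open>p\<close>, and the space
  \<open>E i p y\<close> of endomorphisms of \<open>z\<close> fixed by composition with
  \<open>i p\<close> loses dimension whenever a nonzero summand is split off.\<close>

lemma object_induct [consumes 1, case_names zero indecomposable sum]:
  assumes z: "z : Obj A"
    and zero: "!!y. zero_object A y ==> P y"
    and ind: "!!y. indecomposable A y ==> P y"
    and sum: "!!x y w. is_direct_sum A x y w ==> P y ==> P w ==> P x"
  shows "P z"
proof -
  define E where "E i p y = {f : Hom A z z. Cmp A z z z (Cmp A z y z i p) f = f}" for i p y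
  have main: "P y" if "y : Obj A" "p : Hom A z y" "i : Hom A y z" "Cmp A y z y p i = Idn A y" for i p y using that
  proof (induction "dim (E i p y)" arbitrary: i p y rule: less_induct)
    case less
    note y = less.prems
    have step: "P u" if ds: "u : Obj A" "w : Obj A" "q1 : Hom A y u" "j1 : Hom A u y" "q2 : Hom A y w" "j2 : Hom A w y"
       "Cmp A u y u q1 j1 = Idn A u" "Cmp A w y w q2 j2 = Idn A w" "Cmp A u y w q2 j1 = 0"
       and nz: "\<not> zero_object A w" for u w q1 j1 q2 j2
    proof -
      define i' p' where "i' = Cmp A u y z i j1" and "p' = Cmp A z y u q1 p"
      note m = z y(1-3) ds(1-6) Cmp_Hom Idn_Hom
      have ip: "i' : Hom A u z" "p' : Hom A z u" "Cmp A u z u p' i' = Idn A u"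
        unfolding i'_def p'_def using m ds(7) by (simp_all add: Cmp_assoc cmp_reduce[OF _ _ _ _ _ _ _ y(4)] Cmp_Idn_left)
      let ?e = "Cmp A z y z i p" and ?e' = "Cmp A z u z i' p'"
      have e: "?e : Hom A z z" "?e' : Hom A z z" using m ip by simp_all
      have ee: "Cmp A z z z ?e ?e = ?e" "Cmp A z z z ?e ?e' = ?e'"
        unfolding i'_def p'_def using m by (simp_all add: Cmp_assoc cmp_reduce[OF _ _ _ _ _ _ _ y(4)] Cmp_Idn_left)
      have "subspace (E i' p' u)" unfolding E_def
        using z e by (intro subspaceI) (auto simp: Hom_zero Hom_add Hom_scale Cmp_zero_right Cmp_add_right Cmp_scale_right)
      moreover have "E i' p' u \<subseteq> E i p y"
        unfolding E_def using z e cmp_reduce[OF _ _ _ _ _ _ _ ee(2)] by (smt (verit) Collect_mono_iff)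
      moreover have "?e : E i p y" unfolding E_def using e ee by blast
      \<comment> \<open>Membership would give \<open>j1 q1 = 1\<close>, hence
        \<open>q2 = q2 j1 q1 = 0\<close> and \<open>Idn A w = q2 j2 = 0\<close>, although
        \<open>w\<close> is not a zero object.\<close>
      moreover have "?e ~: E i' p' u"
      proof
        assume "?e : E i' p' u"
        then have "Cmp A z z z ?e' ?e = ?e" unfolding E_def by blast
        then have "Cmp A y z y p (Cmp A y z z (Cmp A z z z ?e' ?e) i) = Cmp A y z y p (Cmp A y z z ?e i)" by simp
        then have "Cmp A y u y j1 q1 = Idn A y" unfolding i'_def p'_def using m y(4)
          by (simp add: Cmp_assoc cmp_reduce[OF _ _ _ _ _ _ _ y(4)] Cmp_Idn_left Cmp_Idn_right)
        then have "Cmp A y y w q2 (Cmp A y u y j1 q1) = q2" using m by (simp add: Cmp_Idn_right)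
        then have "q2 = 0" using m by (simp add: cmp_reduce[OF _ _ _ _ _ _ _ ds(9)] Cmp_zero_left)
        then have "Idn A w = 0" using ds(8) m by (simp add: Cmp_zero_left)
        then show False using nz ds(2) by (simp add: zero_object_def Zer_eq)
      qed
      moreover obtain F where "finite F" "span F = Hom A z z" using Hom_fin_dim[OF z z] unfolding fin_dim_def by blast
      moreover have "E i p y \<subseteq> Hom A z z" unfolding E_def by blast
      ultimately have "dim (E i' p' u) < dim (E i p y)" using dim_less_of_subspace by blast
      then show "P u" using less.hyps ip ds(1) by blast
    qed
    show "P y"
    proof (cases "zero_object A y \<or> indecomposable A y")
      case True
      then show ?thesis using zero ind by blast
    next
      case False
      then obtain u w where uw: "is_direct_sum A y u w" "\<not> zero_object A u" "\<not> zero_object A w"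
        using y(1) unfolding indecomposable_def by blast
      then obtain j1 j2 q1 q2 where h: "u : Obj A" "w : Obj A" "j1 : Hom A u y" "j2 : Hom A w y" "q1 : Hom A y u" "q2 : Hom A y w"
        "Cmp A u y u q1 j1 = Idn A u" "Cmp A w y w q2 j2 = Idn A w" "Cmp A w y u q1 j2 = Zer A w u" "Cmp A u y w q2 j1 = Zer A u w"
        unfolding is_direct_sum_def by blast
      then have "P u" "P w" using step[of u w q1 j1 q2 j2] step[of w u q2 j2 q1 j1] uw by (simp_all add: Zer_eq)
      then show ?thesis using sum uw by blast
    qed
  qed
  show ?thesis using main[of z "Idn A z" "Idn A z"] z Idn_Hom Cmp_Idn_left by blast
qed

end

section \<open>Modules\<close>

lemma sum_fun2: "(\<Sum>a\<in>X. g a) x i = (\<Sum>a\<in>X. g a x i)"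
  for g :: "'z => 'o => nat => 'm::ab_group_add" by (induction X rule: infinite_finite_induct) auto

lemma uscale_apply: "uscale sc c v x i = sc c (v x i)" by (simp add: uscale_def)

context k_category
begin

abbreviation "amod \<equiv> is_amod scale A"
abbreviation "mhom \<equiv> amap_hom scale A"

sublocale U: vector_space "uscale scale" using vector_space_axioms by (rule vector_space_uscale)

context
  fixes M assumes M: "amod M"
begin

lemma amod_subspace: "x : Obj A ==> U.subspace (Sp M x)" using M unfolding is_amod_def by simp

lemma amod_0: "x : Obj A ==> 0 : Sp M x" using amod_subspace U.subspace_0 by blast

lemma amod_add: "x : Obj A ==> u : Sp M x ==> v : Sp M x ==> u + v : Sp M x" using amod_subspace U.subspace_add by blast

lemma amod_diff: "x : Obj A ==> u : Sp M x ==> v : Sp M x ==> u - v : Sp M x" using amod_subspace U.subspace_diff by blast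

lemma amod_scale: "x : Obj A ==> v : Sp M x ==> uscale scale c v : Sp M x" using amod_subspace U.subspace_scale by blast

lemma amod_sum: "x : Obj A ==> (!!i. i : I ==> g i : Sp M x) ==> sum g I : Sp M x"
  using amod_subspace U.subspace_sum by blast

lemma Act_in: "x : Obj A ==> y : Obj A ==> f : Hom A x y ==> v : Sp M x ==> Act M x y f v : Sp M y"
  using M unfolding is_amod_def linear_map_def by (simp add: image_subset_iff)

lemma Act_add: "x : Obj A ==> y : Obj A ==> f : Hom A x y ==> u : Sp M x ==> v : Sp M x
    ==> Act M x y f (u + v) = Act M x y f u + Act M x y f v"
  using M unfolding is_amod_def linear_map_def by (simp add: image_subset_iff)

lemma Act_scale: "x : Obj A ==> y : Obj A ==> f : Hom A x y ==> v : Sp M x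
    ==> Act M x y f (uscale scale c v) = uscale scale c (Act M x y f v)"
  using M unfolding is_amod_def linear_map_def by (simp add: image_subset_iff)

lemma Act_Idn: "x : Obj A ==> v : Sp M x ==> Act M x x (Idn A x) v = v" using M unfolding is_amod_def by simp

lemma Act_Cmp: "x : Obj A ==> y : Obj A ==> z : Obj A ==> f : Hom A x y ==> g : Hom A y z ==> v : Sp M x
    ==> Act M x z (Cmp A x y z g f) v = Act M y z g (Act M x y f v)" using M unfolding is_amod_def by simp

lemma Act_fadd: "x : Obj A ==> y : Obj A ==> f : Hom A x y ==> g : Hom A x y ==> v : Sp M x
    ==> Act M x y (f + g) v = Act M x y f v + Act M x y g v" using M unfolding is_amod_def by simp

lemma Act_fscale: "x : Obj A ==> y : Obj A ==> f : Hom A x y ==> v : Sp M x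
    ==> Act M x y (scale c f) v = uscale scale c (Act M x y f v)" using M unfolding is_amod_def by simp

lemma amod_finite: "is_ind A I ==> finite {x : I. Sp M x ~= {0}}" using M unfolding is_amod_def by simp

lemma amod_fin_dim: "x : Obj A ==> fin_dim (uscale scale) (Sp M x)" using M unfolding is_amod_def by simp

lemma Act_0: "x : Obj A ==> y : Obj A ==> f : Hom A x y ==> Act M x y f 0 = 0" using Act_scale[of x y f 0 0] amod_0 by simp

lemma Act_f0: "x : Obj A ==> y : Obj A ==> v : Sp M x ==> Act M x y 0 v = 0" using Act_fscale[of x y 0 v 0] Hom_zero by simp

lemma Act_diff: "x : Obj A ==> y : Obj A ==> f : Hom A x y ==> u : Sp M x ==> v : Sp M x
    ==> Act M x y f (u - v) = Act M x y f u - Act M x y f v" using Act_add[of x y f "u - v" v] amod_diff by simp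

lemma Act_sum:
  assumes "x : Obj A" "y : Obj A" "f : Hom A x y" "!!i. i : I ==> g i : Sp M x"
  shows "Act M x y f (sum g I) = (\<Sum>i\<in>I. Act M x y f (g i))" using assms(4)
  by (induction I rule: infinite_finite_induct) (use assms in \<open>auto simp: Act_0 Act_add amod_sum\<close>)

end

lemma mhom_in: "f : mhom M N ==> x : Obj A ==> v : Sp M x ==> f x v : Sp N x" unfolding amap_hom_def linear_map_def by blast

lemma mhom_add: "f : mhom M N ==> x : Obj A ==> u : Sp M x ==> v : Sp M x ==> f x (u + v) = f x u + f x v"
  unfolding amap_hom_def linear_map_def by blast

lemma mhom_scale: "f : mhom M N ==> x : Obj A ==> v : Sp M x ==> f x (uscale scale c v) = uscale scale c (f x v)"
  unfolding amap_hom_def linear_map_def by blast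

lemma mhom_nat: "f : mhom M N ==> x : Obj A ==> y : Obj A ==> h : Hom A x y ==> v : Sp M x
    ==> f y (Act M x y h v) = Act N x y h (f x v)" unfolding amap_hom_def by blast

lemma mhom_out: "f : mhom M N ==> x ~: Obj A \<or> v ~: Sp M x ==> f x v = 0" unfolding amap_hom_def by blast

lemma mhom_0:
  assumes f: "f : mhom M N" shows "f x 0 = 0"
proof (cases "x : Obj A & 0 : Sp M x")
  case True
  then show ?thesis using mhom_scale[OF f, of x 0 0] by simp
qed (use mhom_out[OF f, of x 0] in blast)

lemma mhom_diff:
  assumes M: "amod M" and f: "f : mhom M N" and "x : Obj A" "u : Sp M x" "v : Sp M x"
  shows "f x (u - v) = f x u - f x v" using mhom_add[OF f, of x "u - v" v] amod_diff[OF M] assms by simp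

lemma mhom_sum:
  assumes M: "amod M" and f: "f : mhom M N" and "x : Obj A" "!!i. i : I ==> g i : Sp M x"
  shows "f x (sum g I) = (\<Sum>i\<in>I. f x (g i))" using assms(4) by (induction I rule: infinite_finite_induct)
    (use assms(3) in \<open>auto simp: mhom_0[OF f] mhom_add[OF f] amod_sum[OF M]\<close>)

lemma mhom_eqI:
  assumes "f : mhom M N" "g : mhom M N" "!!x v. x : Obj A ==> v : Sp M x ==> f x v = g x v"
  shows "f = g"
proof (rule ext, rule ext)
  fix x v
  show "f x v = g x v" using assms mhom_out[of f] mhom_out[of g] by (cases "x : Obj A & v : Sp M x") auto
qed

lemma mhomI:
  assumes "!!x v. x : Obj A ==> v : Sp M x ==> f x v : Sp N x"
    "!!x u v. x : Obj A ==> u : Sp M x ==> v : Sp M x ==> f x (u + v) = f x u + f x v"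
    "!!x c v. x : Obj A ==> v : Sp M x ==> f x (uscale scale c v) = uscale scale c (f x v)"
    "!!x y h v. x : Obj A ==> y : Obj A ==> h : Hom A x y ==> v : Sp M x ==> f y (Act M x y h v) = Act N x y h (f x v)"
    "!!x v. x ~: Obj A \<or> v ~: Sp M x ==> f x v = 0"
  shows "f : mhom M N" using assms unfolding amap_hom_def linear_map_def by blast

lemma mhom_comp:
  assumes f: "f : mhom L M" and g: "g : mhom M N"
  shows "(%x v. g x (f x v)) : mhom L N" by (intro mhomI)
    (auto simp: mhom_in[OF f] mhom_in[OF g] mhom_add[OF f] mhom_add[OF g] mhom_scale[OF f] mhom_scale[OF g]
      mhom_nat[OF f] mhom_nat[OF g] mhom_out[OF f] mhom_0[OF g])

lemma mhom_plus:
  assumes N: "amod N" and f: "f : mhom M N" and g: "g : mhom M N"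
  shows "(%x v. f x v + g x v) : mhom M N" by (intro mhomI)
    (auto simp: mhom_in[OF f] mhom_in[OF g] mhom_add[OF f] mhom_add[OF g] mhom_scale[OF f] mhom_scale[OF g]
      mhom_nat[OF f] mhom_nat[OF g] mhom_out[OF f] mhom_out[OF g] amod_add[OF N] Act_add[OF N]
      U.scale_right_distrib)

lemma mhom_minus:
  assumes N: "amod N" and f: "f : mhom M N" and g: "g : mhom M N"
  shows "(%x v. f x v - g x v) : mhom M N" by (intro mhomI)
    (auto simp: mhom_in[OF f] mhom_in[OF g] mhom_add[OF f] mhom_add[OF g] mhom_scale[OF f] mhom_scale[OF g]
      mhom_nat[OF f] mhom_nat[OF g] mhom_out[OF f] mhom_out[OF g] amod_diff[OF N] Act_diff[OF N]
      U.scale_right_diff_distrib)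

lemma mhom_zero_map: "amod N ==> (%x v. 0) : mhom M N" by (intro mhomI) (auto simp: amod_0 Act_0)

definition mid :: "('o, 'm) amod => ('o, 'm) amap" where
  "mid M = (%x v. if x : Obj A & v : Sp M x then v else 0)"

lemma mhom_mid: "amod M ==> mid M : mhom M M" unfolding mid_def by (intro mhomI) (auto simp: amod_add amod_scale Act_in)

lemma mid_apply [simp]: "x : Obj A ==> v : Sp M x ==> mid M x v = v" by (simp add: mid_def)

lemma Mod_simps [simp]:
  "Obj (Mod scale A) = {M. amod M}" "Hom (Mod scale A) = mhom" "Idn (Mod scale A) = mid"
  "Cmp (Mod scale A) L M N g f = (%x v. g x (f x v))" "Sum (Mod scale A) M N f h = (%x v. f x v + h x v)"
  "Zer (Mod scale A) M N = (%x v. 0)" unfolding Mod_def mid_def by (auto simp: fun_eq_iff)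

lemma submodule_image:
  assumes "amod M" "f : mhom M N"
  shows "submodule scale A N (%x. f x ` Sp M x)" unfolding submodule_def
proof (intro conjI ballI)
  fix x assume x: "x : Obj A"
  show "f x ` Sp M x \<subseteq> Sp N x" using x assms mhom_in by blast
  show "U.subspace (f x ` Sp M x)"
  proof (rule U.subspaceI)
    show "0 : f x ` Sp M x" using imageI[OF amod_0[OF assms(1) x], of "f x"] mhom_0[OF assms(2), of x] by simp
    show "u + v : f x ` Sp M x" if "u : f x ` Sp M x" "v : f x ` Sp M x" for u v
      using that mhom_add[OF assms(2) x, symmetric] amod_add[OF assms(1) x] by auto
    show "uscale scale c v : f x ` Sp M x" if "v : f x ` Sp M x" for c v
      using that mhom_scale[OF assms(2) x, symmetric] amod_scale[OF assms(1) x] by auto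
  qed
next
  fix x y h assume "x : Obj A" "y : Obj A" "h : Hom A x y"
  then show "Act N x y h ` f x ` Sp M x \<subseteq> f y ` Sp M y"
    using mhom_nat[OF assms(2), symmetric] Act_in[OF assms(1)] by auto
qed

lemma submodule_kernel:
  assumes "amod M" "f : mhom M N" "amod N"
  shows "submodule scale A M (%x. {v : Sp M x. f x v = 0})" unfolding submodule_def by (intro conjI ballI U.subspaceI)
    (use assms in \<open>auto simp: amod_0 amod_add amod_scale mhom_0[OF assms(2)] mhom_add[OF assms(2)]
      mhom_scale[OF assms(2)] mhom_nat[OF assms(2)] Act_in Act_0\<close>)

lemma submodule_Act: "submodule scale A M N ==> x : Obj A ==> y : Obj A ==> f : Hom A x y ==> v : N x
    ==> Act M x y f v : N y" unfolding submodule_def by blast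

lemma submodule_in: "submodule scale A M N ==> x : Obj A ==> v : N x ==> v : Sp M x" unfolding submodule_def by blast

lemma submodule_subspace: "submodule scale A M N ==> x : Obj A ==> U.subspace (N x)" unfolding submodule_def by blast

lemma submodule_self: "amod M ==> submodule scale A M (Sp M)" unfolding submodule_def using amod_subspace Act_in by blast

end

section \<open>Identities and arrows as a basis of the morphisms between vertices\<close>

locale radical_square_zero_category = lofd_category_alg_closed scale A
  for scale :: "'k::alg_closed_field => 'm::ab_group_add => 'm" and A :: "('o, 'm) precat" +
  fixes Q :: "('o, 'a) pre_digraph" and \<rho> :: "'a => 'm"
  assumes rsz: "radical_square_zero scale A" and quiver: "is_quiver_of scale A Q \<rho>"
begin

definition arr :: "'o => 'o => 'a set" where
  "arr x y = {q : arcs Q. tail Q q = x & head Q q = y}"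

lemma is_ind_verts: "is_ind A (verts Q)" using quiver unfolding is_quiver_of_def by blast

lemma vert_ind: "x : verts Q ==> indecomposable A x"
  using is_ind_verts unfolding is_ind_def exhaustive_list_of_indecomposables_def by blast

lemma vert_Obj [simp]: "x : verts Q ==> x : Obj A" using vert_ind unfolding indecomposable_def by blast

lemma vert_iso: "x : verts Q ==> y : verts Q ==> isomorphic A x y ==> x = y"
  using is_ind_verts unfolding is_ind_def exhaustive_list_of_indecomposables_def by blast

lemma ex_vert: "indecomposable A y ==> EX x:verts Q. isomorphic A y x"
  using is_ind_verts unfolding is_ind_def exhaustive_list_of_indecomposables_def by blast

lemma wf_Q: "wf_digraph Q" using quiver unfolding is_quiver_of_def by blast

lemma arc_verts [simp]: "q : arcs Q ==> tail Q q : verts Q" "q : arcs Q ==> head Q q : verts Q"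
  using wf_Q by (auto simp: wf_digraph_def)

lemma rad_rad:
  assumes o: "x : Obj A" "y : Obj A" "z : Obj A" and "f : rad A x y" "g : rad A y z"
  shows "Cmp A x y z g f = 0"
proof -
  have "Cmp A x y z g f : rad_sq scale A x z" unfolding rad_sq_def by (rule span_base) (use assms in blast)
  then show ?thesis using rsz o unfolding radical_square_zero_def by blast
qed

text \<open>Since \<open>rad_sq\<close> vanishes, residue classes modulo it are elements, and the
  arrows become a basis of the radical itself.\<close>

lemma arr_props:
  assumes "x : verts Q" "y : verts Q"
  shows "inj_on \<rho> (arr x y)" "\<rho> ` arr x y \<subseteq> rad A x y" "independent (\<rho> ` arr x y)"
    "span (\<rho> ` arr x y) = rad A x y"
proof -
  note q = quiver[unfolded is_quiver_of_def, THEN conjunct2, THEN conjunct2, rule_format, OF assms,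
      unfolded Let_def arr_def[symmetric]]
  show "inj_on \<rho> (arr x y)" "\<rho> ` arr x y \<subseteq> rad A x y" "independent (\<rho> ` arr x y)" using q by blast+
  have "rad_sq scale A x y = {0}" using rsz assms unfolding radical_square_zero_def by simp
  then show "span (\<rho> ` arr x y) = rad A x y" using q by (simp add: span_insert_0)
qed

lemma rho_rad: "q : arcs Q ==> \<rho> q : rad A (tail Q q) (head Q q)"
  using arr_props(2)[of "tail Q q" "head Q q"] by (auto simp: arr_def)

lemma rho_Hom: "q : arcs Q ==> \<rho> q : Hom A (tail Q q) (head Q q)" using rho_rad rad_Hom by blast

lemma Hom_rad: "x : verts Q ==> y : verts Q ==> x ~= y ==> Hom A x y = rad A x y" using Hom_eq_rad vert_ind vert_iso by blast

definition hbasis :: "'o => 'o => 'm set" where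
  "hbasis x y = (if x = y then {Idn A x} else {}) \<union> \<rho> ` arr x y"

lemma Idn_notin: "x : verts Q ==> Idn A x ~: rad A x x" using Idn_notin_rad vert_ind by blast

text \<open>For \<open>x = y\<close> an endomorphism is a scalar plus a radical morphism, and the
  identity is not radical. For different vertices all morphisms are radical, as distinct vertices
  are not isomorphic.\<close>

lemma hbasis:
  assumes x: "x : verts Q" and y: "y : verts Q"
  shows "independent (hbasis x y)" "span (hbasis x y) = Hom A x y"
proof -
  have "independent (hbasis x y) & span (hbasis x y) = Hom A x y"
  proof (cases "x = y")
    case True
    have "independent (hbasis x x)" unfolding hbasis_def
      using arr_props(3)[OF x x] arr_props(4)[OF x x] Idn_notin[OF x] by (simp add: independent_insertI)
    moreover have "Hom A x x \<subseteq> span (hbasis x x)"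
    proof
      fix f assume "f : Hom A x x"
      then obtain c where "f - scale c (Idn A x) : rad A x x" using endomorphism_decomposition vert_ind x by blast
      then have "f - scale c (Idn A x) : span (\<rho> ` arr x x)" using arr_props(4)[OF x x] by simp
      then have "f - scale c (Idn A x) : span (hbasis x x)"
        unfolding hbasis_def using span_mono[of "\<rho> ` arr x x"] by (meson Un_upper2 subsetD)
      moreover have "scale c (Idn A x) : span (hbasis x x)" unfolding hbasis_def by (simp add: span_base span_scale)
      ultimately have "(f - scale c (Idn A x)) + scale c (Idn A x) : span (hbasis x x)" by (rule span_add)
      then show "f : span (hbasis x x)" by simp
    qed
    moreover have "hbasis x x \<subseteq> Hom A x x" unfolding hbasis_def
      using arr_props(2)[OF x x] rad_Hom Idn_Hom x by auto
    then have "span (hbasis x x) \<subseteq> Hom A x x" using span_minimal Hom_subspace x by simp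
    ultimately show ?thesis using True by auto
  next
    case False
    then show ?thesis unfolding hbasis_def using arr_props[OF x y] Hom_rad[OF x y] by simp
  qed
  then show "independent (hbasis x y)" "span (hbasis x y) = Hom A x y" by blast+
qed

lemma finite_arr:
  assumes "x : verts Q" "y : verts Q" shows "finite (arr x y)"
proof -
  obtain B where B: "finite B" "span B = Hom A x y" using Hom_fin_dim[of x y] assms unfolding fin_dim_def by auto
  have "finite (\<rho> ` arr x y)"
    using independent_span_bound[OF B(1) arr_props(3)[OF assms]] arr_props(2)[OF assms] rad_Hom B(2) by blast
  then show ?thesis using arr_props(1)[OF assms] finite_imageD by blast
qed

lemma rho_nonzero: "q : arcs Q ==> \<rho> q ~= 0"
  using arr_props(3)[of "tail Q q" "head Q q"] dependent_zero[of "\<rho> ` arr (tail Q q) (head Q q)"]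
  by (force simp: arr_def)

text \<open>Arrows are nonzero morphisms, so their other ends are among the finitely many neighbours
  of \<open>x\<close>, and two vertices are joined by finitely many arrows.\<close>

lemma finite_star:
  assumes "x : verts Q"
  shows "finite {q : arcs Q. tail Q q = x}" "finite {q : arcs Q. head Q q = x}"
proof -
  define Y where "Y = {y : verts Q. Hom A x y ~= {0} \<or> Hom A y x ~= {0}}"
  have Y: "finite Y" unfolding Y_def using finite_neighbours[OF is_ind_verts] assms by simp
  have "{q : arcs Q. tail Q q = x} \<subseteq> (\<Union>y\<in>Y. arr x y)"
    unfolding Y_def arr_def using rho_Hom rho_nonzero by fastforce
  moreover have "{q : arcs Q. head Q q = x} \<subseteq> (\<Union>y\<in>Y. arr y x)"
    unfolding Y_def arr_def using rho_Hom rho_nonzero by fastforce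
  moreover have "finite (\<Union>y\<in>Y. arr x y)" "finite (\<Union>y\<in>Y. arr y x)"
    using Y finite_arr assms by (auto simp: Y_def)
  ultimately show "finite {q : arcs Q. tail Q q = x}" "finite {q : arcs Q. head Q q = x}" using finite_subset by blast+
qed

text \<open>The coefficient of the identity, that is, the residue class of an endomorphism in the
  ground field; \<open>\<kappa>\<close> gives the coefficients at the arrows.\<close>

definition \<tau> :: "'o => 'm => 'k" where
  "\<tau> x f = representation (hbasis x x) f (Idn A x)"

definition \<kappa> :: "'a => 'm => 'k" where
  "\<kappa> q f = representation (hbasis (tail Q q) (head Q q)) f (\<rho> q)"

context
  fixes x assumes x: "x : verts Q"
begin

lemma tau_add: "f : Hom A x x ==> g : Hom A x x ==> \<tau> x (f + g) = \<tau> x f + \<tau> x g"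
  unfolding \<tau>_def using representation_add hbasis[OF x x] by simp

lemma tau_scale: "f : Hom A x x ==> \<tau> x (scale c f) = c * \<tau> x f"
  unfolding \<tau>_def using representation_scale hbasis[OF x x] by simp

lemma tau_Idn: "\<tau> x (Idn A x) = 1"
  unfolding \<tau>_def using representation_basis[OF hbasis(1)[OF x x], of "Idn A x"] by (simp add: hbasis_def)

lemma tau_rad: "f : rad A x x ==> \<tau> x f = 0"
proof -
  assume f: "f : rad A x x"
  have "\<rho> ` arr x x \<subseteq> hbasis x x" by (auto simp: hbasis_def)
  then have "representation (hbasis x x) f = representation (\<rho> ` arr x x) f"
    using representation_extend[OF hbasis(1)[OF x x], of f "\<rho> ` arr x x"] f arr_props(4)[OF x x] by simp
  moreover have "representation (\<rho> ` arr x x) f (Idn A x) = 0"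
    using representation_ne_zero arr_props(2)[OF x x] Idn_notin[OF x] by blast
  ultimately show ?thesis by (simp add: \<tau>_def)
qed

lemma tau_0: "\<tau> x 0 = 0" using tau_scale[of "Idn A x" 0] Idn_Hom x by simp

lemma tau_sum: "(!!i. i : I ==> f i : Hom A x x) ==> \<tau> x (sum f I) = (\<Sum>i\<in>I. \<tau> x (f i))"
  by (induction I rule: infinite_finite_induct) (use x in \<open>auto simp: tau_0 tau_add Hom_sum\<close>)

end

lemma arr_D: "q : arr x y ==> x : verts Q & y : verts Q & q : arcs Q & tail Q q = x & head Q q = y" by (auto simp: arr_def)

lemma kappa_add: "q : arr x y ==> f : Hom A x y ==> g : Hom A x y ==> \<kappa> q (f + g) = \<kappa> q f + \<kappa> q g"
  unfolding \<kappa>_def using representation_add hbasis arr_D by (metis (no_types, lifting))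

lemma kappa_scale: "q : arr x y ==> f : Hom A x y ==> \<kappa> q (scale c f) = c * \<kappa> q f"
  unfolding \<kappa>_def using representation_scale hbasis arr_D by (metis (no_types, lifting))

lemma kappa_0: "q : arr x y ==> \<kappa> q 0 = 0" using kappa_scale[of q x y 0 0] arr_D[of q x y] Hom_zero by simp

lemma kappa_sum: "q : arr x y ==> (!!i. i : I ==> f i : Hom A x y) ==> \<kappa> q (sum f I) = (\<Sum>i\<in>I. \<kappa> q (f i))"
  by (induction I rule: infinite_finite_induct) (use arr_D in \<open>auto simp: kappa_0 kappa_add Hom_sum\<close>)

lemma kappa_Idn: "q : arr x x ==> \<kappa> q (Idn A x) = 0"
proof -
  assume a: "q : arr x x"
  then have x: "x : verts Q" using arr_D by blast
  have "\<rho> q ~= Idn A x" using a arr_props(2)[OF x x] Idn_notin[OF x] by auto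
  then show ?thesis unfolding \<kappa>_def
    using representation_basis[OF hbasis(1)[OF x x], of "Idn A x"] arr_D[OF a] by (simp add: hbasis_def)
qed

lemma kappa_rho: "q : arr x y ==> \<gamma> : arr x y ==> \<kappa> q (\<rho> \<gamma>) = (if q = \<gamma> then 1 else 0)"
proof -
  assume a: "q : arr x y" and b: "\<gamma> : arr x y"
  then have v: "x : verts Q" "y : verts Q" using arr_D by blast+
  have "\<rho> q = \<rho> \<gamma> \<longleftrightarrow> q = \<gamma>" using arr_props(1)[OF v] a b by (meson inj_on_eq_iff)
  then show ?thesis unfolding \<kappa>_def
    using representation_basis[OF hbasis(1)[OF v], of "\<rho> \<gamma>"] arr_D[OF a] b by (auto simp: hbasis_def)
qed

lemma Hom_expand:
  assumes x: "x : verts Q" and y: "y : verts Q" and f: "f : Hom A x y"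
  shows "f = (if x = y then scale (\<tau> x f) (Idn A x) else 0) + (\<Sum>q\<in>arr x y. scale (\<kappa> q f) (\<rho> q))"
proof -
  have fin: "finite (hbasis x y)" unfolding hbasis_def using finite_arr[OF x y] by simp
  have "f = (\<Sum>b\<in>hbasis x y. scale (representation (hbasis x y) f b) b)"
    using sum_representation_eq[OF hbasis(1)[OF x y] _ fin subset_refl] f hbasis(2)[OF x y] by simp
  also have "... = (\<Sum>b\<in>(if x = y then {Idn A x} else {}). scale (representation (hbasis x y) f b) b) +
     (\<Sum>b\<in>\<rho> ` arr x y. scale (representation (hbasis x y) f b) b)" unfolding hbasis_def
  proof (rule sum.union_disjoint)
    show "(if x = y then {Idn A x} else {}) \<inter> \<rho> ` arr x y = {}"
      using arr_props(2)[OF x y] Idn_notin[OF x] by auto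
  qed (use finite_arr[OF x y] in auto)
  also have "(\<Sum>b\<in>\<rho> ` arr x y. scale (representation (hbasis x y) f b) b) = (\<Sum>q\<in>arr x y. scale (\<kappa> q f) (\<rho> q))"
    unfolding sum.reindex[OF arr_props(1)[OF x y]] by (intro sum.cong) (auto simp: \<kappa>_def arr_def)
  also have "(\<Sum>b\<in>(if x = y then {Idn A x} else {}). scale (representation (hbasis x y) f b) b) =
     (if x = y then scale (\<tau> x f) (Idn A x) else 0)" by (simp add: \<tau>_def)
  finally show ?thesis .
qed

lemma Hom_eqI:
  assumes "x : verts Q" "y : verts Q" "f : Hom A x y" "g : Hom A x y"
    and "x = y ==> \<tau> x f = \<tau> x g" "!!q. q : arr x y ==> \<kappa> q f = \<kappa> q g"
  shows "f = g" by (subst Hom_expand[OF assms(1-3)], subst Hom_expand[OF assms(1,2,4)]) (use assms(5,6) in auto)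

lemma Hom_rad_part:
  assumes x: "x : verts Q" and y: "y : verts Q" and f: "f : Hom A x y"
  shows "x ~= y ==> f : rad A x y" "x = y ==> f - scale (\<tau> x f) (Idn A x) : rad A x x"
    "x = y ==> f : rad A x y \<longleftrightarrow> \<tau> x f = 0"
proof -
  show "x ~= y ==> f : rad A x y" using Hom_rad[OF x y] f by simp
  have r: "(\<Sum>q\<in>arr x y. scale (\<kappa> q f) (\<rho> q)) : rad A x y"
    using rad_subspace[of x y] x y arr_props(2)[OF x y] by (intro subspace_sum subspace_scale) auto
  show *: "f - scale (\<tau> x f) (Idn A x) : rad A x x" if "x = y"
  proof -
    have "f - scale (\<tau> x f) (Idn A x) = (\<Sum>q\<in>arr x y. scale (\<kappa> q f) (\<rho> q))"
      using Hom_expand[OF x y f, symmetric] that by (simp add: diff_eq_eq add.commute)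
    then show ?thesis using r that by simp
  qed
  show "x = y ==> f : rad A x y \<longleftrightarrow> \<tau> x f = 0" using * tau_rad[OF x] by fastforce
qed

text \<open>Modulo the radical, composition is multiplication of scalars, and a composite through a
  different vertex is radical.\<close>

lemma tau_Cmp:
  assumes x: "x : verts Q" and y: "y : verts Q" and f: "f : Hom A x y" and g: "g : Hom A y x"
  shows "\<tau> x (Cmp A x y x g f) = (if x = y then \<tau> x g * \<tau> x f else 0)"
proof (cases "x = y")
  case True
  note f' = f[folded True] and g' = g[folded True]
  define r where "r = f - scale (\<tau> x f) (Idn A x)"
  have r: "r : rad A x x" unfolding r_def using Hom_rad_part(2)[OF x x f'] by simp
  have fr: "f = scale (\<tau> x f) (Idn A x) + r" unfolding r_def by simp
  have "Cmp A x x x g f = scale (\<tau> x f) g + Cmp A x x x g r"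
    by (subst fr) (use x g' r rad_Hom in \<open>simp add: Cmp_add_right Cmp_scale_right Hom_scale Idn_Hom Cmp_Idn_right\<close>)
  moreover have "\<tau> x (Cmp A x x x g r) = 0" using rad_Cmp_left[OF _ _ _ r g'] tau_rad[OF x] x by simp
  ultimately show ?thesis using True x g' r rad_Hom by (simp add: tau_add tau_scale Hom_scale Cmp_Hom)
next
  case False
  then show ?thesis using rad_Cmp_left[of x y x f g] Hom_rad[OF x y] tau_rad[OF x] x y f g by simp
qed

text \<open>Multiplication in a trivial extension: products of radical morphisms vanish, so the
  arrow part of \<open>g f\<close> is the scalar part of one factor times the arrow part of the
  other. The fact \<open>main\<close> treats a radical first factor; a general \<open>f\<close>
  differs from one by a multiple of the identity.\<close>

lemma kappa_Cmp:
  assumes a: "q : arr x z" and y: "y : verts Q" and f: "f : Hom A x y" and g: "g : Hom A y z"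
  shows "\<kappa> q (Cmp A x y z g f) = (if x = y then \<tau> x f * \<kappa> q g else 0) + (if y = z then \<tau> z g * \<kappa> q f else 0)"
proof -
  have x: "x : verts Q" and z: "z : verts Q" using a arr_D by blast+
  have main: "\<kappa> q (Cmp A x y z g r) = (if y = z then \<tau> z g * \<kappa> q r else 0)" if r: "r : rad A x y" for r
  proof (cases "y = z")
    case True
    note g' = g[folded True] and a' = a[folded True]
    define s where "s = g - scale (\<tau> y g) (Idn A y)"
    have s: "s : rad A y y" unfolding s_def using Hom_rad_part(2)[OF y y g'] by simp
    have gs: "g = scale (\<tau> y g) (Idn A y) + s" unfolding s_def by simp
    have "Cmp A x y y g r = scale (\<tau> y g) r" by (subst gs) (use x y r s rad_Hom rad_rad in
          \<open>simp add: Cmp_add_left Cmp_scale_left Hom_scale Idn_Hom Cmp_Idn_left\<close>)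
    then show ?thesis using True a' r rad_Hom by (simp add: kappa_scale[of q x y])
  next
    case False
    then show ?thesis using rad_rad[of x y z r g] r Hom_rad[OF y z] g x y z kappa_0[OF a] by simp
  qed
  show ?thesis
  proof (cases "x = y")
    case True
    note f' = f[folded True] and g' = g[folded True]
    define r where "r = f - scale (\<tau> x f) (Idn A x)"
    have r: "r : rad A x y" unfolding r_def True[symmetric] using Hom_rad_part(2)[OF x x f'] by simp
    have fr: "f = r + scale (\<tau> x f) (Idn A x)" unfolding r_def by simp
    have "Cmp A x y z g f = Cmp A x y z g r + scale (\<tau> x f) g" unfolding True[symmetric]
      by (subst fr) (use x z g' r[folded True] rad_Hom in \<open>simp add: Cmp_add_right Cmp_scale_right Hom_scale Idn_Hom Cmp_Idn_right\<close>)
    then have "\<kappa> q (Cmp A x y z g f) = (if y = z then \<tau> z g * \<kappa> q r else 0) + \<tau> x f * \<kappa> q g"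
      using main[OF r] kappa_add[OF a, of "Cmp A x y z g r" "scale (\<tau> x f) g"] kappa_scale[OF a]
        x y z g' g r rad_Hom Cmp_Hom Hom_scale by simp
    moreover have "\<kappa> q r = \<kappa> q f" if "y = z"
    proof -
      have a': "q : arr x x" using a that True by simp
      have rH: "r : Hom A x x" using r True rad_Hom by simp
      have "\<kappa> q (r + scale (\<tau> x f) (Idn A x)) = \<kappa> q r + \<tau> x f * \<kappa> q (Idn A x)"
        using kappa_add[OF a' rH, of "scale (\<tau> x f) (Idn A x)"] kappa_scale[OF a'] x Idn_Hom Hom_scale by simp
      then show ?thesis using fr kappa_Idn[OF a'] by simp
    qed
    ultimately show ?thesis using True by simp
  next
    case False
    then show ?thesis using main[of f] f Hom_rad[OF x y] by simp
  qed
qed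

text \<open>Reduces inclusions of submodules to vertices, where coordinates exist. An element at a
  direct sum is the sum of its components pushed back along the inclusions, and an indecomposable
  object is isomorphic to a vertex.\<close>

lemma submodule_le_verts:
  assumes M: "amod M" and C: "submodule scale A M C" and N: "submodule scale A M N"
    and v: "!!x. x : verts Q ==> C x \<subseteq> N x" and z: "z : Obj A"
  shows "C z \<subseteq> N z" using z
proof (induction z rule: object_induct)
  case (zero y)
  then have y: "y : Obj A" "Idn A y = 0" by (auto simp: zero_object_def Zer_eq)
  have "u = 0" if "u : C y" for u using Act_Idn[OF M y(1)] Act_f0[OF M y(1) y(1)] y submodule_in[OF C y(1) that] by metis
  moreover have "0 : N y" using submodule_subspace[OF N y(1)] U.subspace_0 by blast
  ultimately show ?case by blast
next
  case (indecomposable y)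
  then obtain x where x: "x : verts Q" "isomorphic A y x" using ex_vert by blast
  then obtain f g where fg: "f : Hom A y x" "g : Hom A x y" "Cmp A y x y g f = Idn A y" unfolding isomorphic_def by blast
  have y: "y : Obj A" using indecomposable by (simp add: indecomposable_def)
  show ?case
  proof
    fix u assume u: "u : C y"
    have uM: "u : Sp M y" using submodule_in[OF C y u] .
    have "Act M y x f u : N x" using submodule_Act[OF C y _ fg(1) u] v x(1) by auto
    then have "Act M x y g (Act M y x f u) : N y" using submodule_Act[OF N _ y fg(2)] x(1) by simp
    then show "u : N y" using Act_Cmp[OF M y _ y fg(1,2) uM] Act_Idn[OF M y uM] fg(3) x by simp
  qed
next
  case (sum x y w)
  then obtain i1 i2 p1 p2 where o: "x : Obj A" "y : Obj A" "w : Obj A" and h: "i1 : Hom A y x" "i2 : Hom A w x" "p1 : Hom A x y" "p2 : Hom A x w"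
    and e: "precat.Sum A x x (Cmp A x y x i1 p1) (Cmp A x w x i2 p2) = Idn A x" unfolding is_direct_sum_def by blast
  have e': "Cmp A x y x i1 p1 + Cmp A x w x i2 p2 = Idn A x" using e o h by (simp add: Sum_eq Cmp_Hom)
  show ?case
  proof
    fix u assume u: "u : C x"
    have uM: "u : Sp M x" using submodule_in[OF C o(1) u] .
    have 1: "Act M y x i1 (Act M x y p1 u) : N x"
      using submodule_Act[OF N o(2,1) h(1)] submodule_Act[OF C o(1,2) h(3) u] sum(2) by blast
    have 2: "Act M w x i2 (Act M x w p2 u) : N x"
      using submodule_Act[OF N o(3,1) h(2)] submodule_Act[OF C o(1,3) h(4) u] sum(3) by blast
    have "u = Act M x x (Cmp A x y x i1 p1 + Cmp A x w x i2 p2) u" unfolding e' using Act_Idn[OF M o(1) uM] by simp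
    also have "... = Act M y x i1 (Act M x y p1 u) + Act M w x i2 (Act M x w p2 u)"
      using Act_fadd[OF M o(1) o(1) _ _ uM] Act_Cmp[OF M] o h uM Cmp_Hom by simp
    finally show "u : N x" using U.subspace_add[OF submodule_subspace[OF N o(1)] 1 2] by simp
  qed
qed

section \<open>Sums of representable modules\<close>

text \<open>The module of \<open>F_term\<close>, detached from representation and degree, so that
  the terms of arbitrary complexes and the maps between them fit the same frame.\<close>

definition FT :: "('o => nat) => ('o, 'm) amod" where
  "FT V = \<lparr>Sp = (%z. {v. ALL x i. if x : verts Q & i < V x then v x i : Hom A x z else v x i = 0}),
     Act = (%z z' f v x i. if x : verts Q & i < V x then Cmp A x z z' f (v x i) else 0)\<rparr>"

definition supp :: "('o => nat) => 'o set" where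
  "supp V = {x : verts Q. V x ~= 0}"

lemma supp_verts: "x : supp V ==> x : verts Q" by (simp add: supp_def)

definition sg :: "'o => nat => 'm => ('o, 'm) uvec" where
  "sg x i h = (%x' i'. if x' = x & i' = i then h else 0)"

text \<open>The free generators: by Yoneda a map out of \<open>FT V\<close> is the same as a choice
  of images for them.\<close>

definition gen :: "'o => nat => ('o, 'm) uvec" where
  "gen x i = sg x i (Idn A x)"

lemma FT_Hom: "v : Sp (FT V) z ==> x : verts Q ==> i < V x ==> v x i : Hom A x z" unfolding FT_def by (auto split: if_splits)

lemma FT_out: "v : Sp (FT V) z ==> \<not> (x : verts Q & i < V x) ==> v x i = 0" unfolding FT_def by (auto split: if_splits)

lemma FT_I: "(!!x i. x : verts Q ==> i < V x ==> v x i : Hom A x z) ==>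
    (!!x i. \<not> (x : verts Q & i < V x) ==> v x i = 0) ==> v : Sp (FT V) z" unfolding FT_def by auto

lemma FT_Act: "Act (FT V) z z' f v x i = (if x : verts Q & i < V x then Cmp A x z z' f (v x i) else 0)" by (simp add: FT_def)

lemma FT_zero_iff: "(ALL x:Obj A. Sp (FT V) x = {0}) \<longleftrightarrow> supp V = {}"
proof
  assume *: "ALL x:Obj A. Sp (FT V) x = {0}"
  show "supp V = {}"
  proof (rule ccontr)
    assume "supp V ~= {}"
    then obtain x where x: "x : verts Q" "0 < V x" by (auto simp: supp_def)
    have "gen x 0 : Sp (FT V) x" using x Idn_Hom by (intro FT_I) (auto simp: gen_def sg_def Hom_zero)
    then have "gen x 0 = 0" using * x by auto
    then have "gen x 0 x 0 = 0" by simp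
    then show False using Idn_nonzero[OF vert_ind[OF x(1)]] by (simp add: gen_def sg_def)
  qed
next
  assume s: "supp V = {}"
  show "ALL x:Obj A. Sp (FT V) x = {0}"
  proof
    fix z assume "z : Obj A"
    have "v = 0" if "v : Sp (FT V) z" for v using s FT_out[OF that] by (auto simp: supp_def fun_eq_iff)
    moreover have "0 : Sp (FT V) z" using s by (intro FT_I) (auto simp: supp_def)
    ultimately show "Sp (FT V) z = {0}" by blast
  qed
qed

lemma FT_subspace: "z : Obj A ==> U.subspace (Sp (FT V) z)" by (intro U.subspaceI FT_I)
    (auto simp: FT_Hom FT_out Hom_zero Hom_add Hom_scale uscale_apply dest: FT_out)

lemma FT_sg_sum:
  assumes v: "v : Sp (FT V) z" and fin: "finite (supp V)"
  shows "v = (\<Sum>x\<in>supp V. \<Sum>i<V x. sg x i (v x i))"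
proof (rule ext, rule ext)
  fix y j
  have "(\<Sum>x\<in>supp V. \<Sum>i<V x. sg x i (v x i)) y j = (\<Sum>x\<in>supp V. \<Sum>i<V x. sg x i (v x i) y j)"
    by (simp add: sum_fun2)
  also have "... = (\<Sum>x\<in>supp V. if x = y then (\<Sum>i<V y. if i = j then v y j else 0) else 0)"
    by (intro sum.cong refl) (auto simp: sg_def intro!: sum.neutral sum.cong)
  also have "... = (if y : supp V & j < V y then v y j else 0)" using fin by (simp add: sum.delta)
  also have "... = v y j" using FT_out[OF v, of y j] by (auto simp: supp_def)
  finally show "v y j = (\<Sum>x\<in>supp V. \<Sum>i<V x. sg x i (v x i)) y j" by simp
qed

lemma sg_in: "z : Obj A ==> x : verts Q ==> i < V x ==> f : Hom A x z ==> sg x i f : Sp (FT V) z"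
  by (intro FT_I) (auto simp: sg_def Hom_zero)

lemma gen_in: "x : verts Q ==> i < V x ==> gen x i : Sp (FT V) x" unfolding gen_def by (intro sg_in) (auto simp: Idn_Hom)

lemma FT_fin_dim:
  assumes fin: "finite (supp V)" and z: "z : Obj A"
  shows "fin_dim (uscale scale) (Sp (FT V) z)"
proof -
  have "ALL x. x : verts Q --> (EX B. finite B & span B = Hom A x z)" using Hom_fin_dim z unfolding fin_dim_def by simp
  then obtain B where B: "!!x. x : verts Q ==> finite (B x)" "!!x. x : verts Q ==> span (B x) = Hom A x z" by metis
  define G where "G = (\<Union>x\<in>supp V. \<Union>i\<in>{..<V x}. sg x i ` B x)"
  have "finite G" unfolding G_def using fin B(1) supp_verts by auto
  moreover have "U.span G = Sp (FT V) z"
  proof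
    have "sg x i h : Sp (FT V) z" if "x : supp V" "i < V x" "h : B x" for x i h
      using sg_in[where V=V, OF z _ that(2), of h] B(2)[of x] supp_verts[OF that(1)] span_base[OF that(3)] by simp
    then have "G \<subseteq> Sp (FT V) z" unfolding G_def by auto
    then show "U.span G \<subseteq> Sp (FT V) z" using U.span_minimal FT_subspace z by blast
    have 1: "sg x i h : U.span G" if "x : supp V" "i < V x" "h : Hom A x z" for x i h
    proof -
      have "subspace {h. sg x i h : U.span G}"
      proof (rule subspaceI)
        have "sg x i 0 = 0" by (simp add: sg_def fun_eq_iff)
        then show "0 : {h. sg x i h : U.span G}" using U.span_zero by simp
        have "sg x i (a + b) = sg x i a + sg x i b" for a b by (simp add: sg_def fun_eq_iff)
        then show "a + b : {h. sg x i h : U.span G}" if "a : {h. sg x i h : U.span G}" "b : {h. sg x i h : U.span G}" for a b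
          using that U.span_add by simp
        have "sg x i (scale c a) = uscale scale c (sg x i a)" for c a by (simp add: sg_def fun_eq_iff uscale_apply)
        then show "scale c a : {h. sg x i h : U.span G}" if "a : {h. sg x i h : U.span G}" for c a
          using that U.span_scale by simp
      qed
      moreover have "sg x i h : G" if "h : B x" for h unfolding G_def using that \<open>x : supp V\<close> \<open>i < V x\<close> by blast
      then have "B x \<subseteq> {h. sg x i h : U.span G}" using U.span_base by auto
      ultimately have "span (B x) \<subseteq> {h. sg x i h : U.span G}" using span_minimal by blast
      then show ?thesis using B(2) that supp_verts by blast
    qed
    show "Sp (FT V) z \<subseteq> U.span G"
    proof
      fix v assume v: "v : Sp (FT V) z"
      have "(\<Sum>x\<in>supp V. \<Sum>i<V x. sg x i (v x i)) : U.span G"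
        using 1 FT_Hom[OF v] supp_verts by (intro U.span_sum) auto
      then show "v : U.span G" using FT_sg_sum[OF v fin] by simp
    qed
  qed
  ultimately show ?thesis unfolding fin_dim_def by blast
qed

lemma FT_amod:
  assumes fin: "finite (supp V)"
  shows "amod (FT V)" unfolding is_amod_def
proof (intro conjI ballI allI impI)
  fix x assume x: "x : Obj A"
  show "U.subspace (Sp (FT V) x)" "fin_dim (uscale scale) (Sp (FT V) x)" using x FT_subspace FT_fin_dim[OF fin] by blast+
  show "Act (FT V) x x (Idn A x) v = v" if "v : Sp (FT V) x" for v
    using FT_Hom[OF that] FT_out[OF that] x by (auto simp: fun_eq_iff FT_Act Cmp_Idn_left)
next
  fix x y f assume o: "x : Obj A" "y : Obj A" and f: "f : Hom A x y"
  show "linear_map (uscale scale) (Sp (FT V) x) (Sp (FT V) y) (Act (FT V) x y f)" unfolding linear_map_def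
  proof (intro conjI ballI allI)
    show "Act (FT V) x y f ` Sp (FT V) x \<subseteq> Sp (FT V) y"
      using o f by (intro image_subsetI FT_I) (auto simp: FT_Act Cmp_Hom FT_Hom)
    show "Act (FT V) x y f (u + v) = Act (FT V) x y f u + Act (FT V) x y f v"
      if "u : Sp (FT V) x" "v : Sp (FT V) x" for u v
      using o f FT_Hom[OF that(1)] FT_Hom[OF that(2)] by (auto simp: fun_eq_iff FT_Act Cmp_add_right)
    show "Act (FT V) x y f (uscale scale c v) = uscale scale c (Act (FT V) x y f v)"
      if "v : Sp (FT V) x" for c v using o f FT_Hom[OF that] by (auto simp: fun_eq_iff FT_Act Cmp_scale_right uscale_apply)
  qed
  fix v assume v: "v : Sp (FT V) x"
  show "Act (FT V) x y (scale c f) v = uscale scale c (Act (FT V) x y f v)" for c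
    using o f FT_Hom[OF v] by (auto simp: fun_eq_iff FT_Act Cmp_scale_left uscale_apply)
  show "Act (FT V) x y (f + g) v = Act (FT V) x y f v + Act (FT V) x y g v" if "g : Hom A x y" for g
    using o f that FT_Hom[OF v] by (auto simp: fun_eq_iff FT_Act Cmp_add_left)
  show "Act (FT V) x z (Cmp A x y z g f) v = Act (FT V) y z g (Act (FT V) x y f v)"
    if "z : Obj A" "g : Hom A y z" for z g using o f that FT_Hom[OF v] by (auto simp: fun_eq_iff FT_Act Cmp_assoc)
next
  fix I assume I: "is_ind A I"
  have IO: "I \<subseteq> Obj A" using I unfolding is_ind_def exhaustive_list_of_indecomposables_def indecomposable_def by blast
  \<comment> \<open>Finiteness of the support comes from \<open>finite_neighbours\<close>, applied
    to each of the finitely many vertices in \<open>supp V\<close>.\<close>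
  have "{z : I. Sp (FT V) z ~= {0}} \<subseteq> (\<Union>x\<in>supp V. {z : I. Hom A x z ~= {0} \<or> Hom A z x ~= {0}})"
  proof
    fix z assume z: "z : {z : I. Sp (FT V) z ~= {0}}"
    then have zO: "z : Obj A" using IO by blast
    then obtain v where v: "v : Sp (FT V) z" "v ~= 0" using z U.subspace_0[OF FT_subspace[OF zO, of V]] by blast
    then obtain x i where "v x i ~= 0" by (auto simp: fun_eq_iff)
    moreover from this have "x : verts Q" "i < V x" using FT_out[OF v(1)] by blast+
    moreover from this have "v x i : Hom A x z" using FT_Hom[OF v(1)] by blast
    ultimately show "z : (\<Union>x\<in>supp V. {z : I. Hom A x z ~= {0} \<or> Hom A z x ~= {0}})"
      using z by (auto simp: supp_def)
  qed
  moreover have "finite (\<Union>x\<in>supp V. {z : I. Hom A x z ~= {0} \<or> Hom A z x ~= {0}})"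
    using fin finite_neighbours[OF I] supp_verts by auto
  ultimately show "finite {z : I. Sp (FT V) z ~= {0}}" using finite_subset by blast
qed

lemma Act_gen: "z : Obj A ==> x : verts Q ==> i < V x ==> f : Hom A x z ==> Act (FT V) x z f (gen x i) = sg x i f"
  by (auto simp: fun_eq_iff FT_Act gen_def sg_def Cmp_Idn_right Cmp_zero_right)

lemma FT_expand:
  assumes "v : Sp (FT V) z" "finite (supp V)" "z : Obj A"
  shows "v = (\<Sum>x\<in>supp V. \<Sum>i<V x. Act (FT V) x z (v x i) (gen x i))"
proof -
  have "(\<Sum>x\<in>supp V. \<Sum>i<V x. Act (FT V) x z (v x i) (gen x i)) = (\<Sum>x\<in>supp V. \<Sum>i<V x. sg x i (v x i))"
    using assms FT_Hom[OF assms(1)] supp_verts Act_gen by (intro sum.cong refl) auto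
  then show ?thesis using FT_sg_sum[OF assms(1,2)] by simp
qed

lemma mhom_FT_expand:
  assumes f: "f : mhom (FT V) P" and fin: "finite (supp V)" and z: "z : Obj A" and v: "v : Sp (FT V) z"
  shows "f z v = (\<Sum>x\<in>supp V. \<Sum>i<V x. Act P x z (v x i) (f x (gen x i)))"
proof -
  have *: "Act (FT V) x z (v x i) (gen x i) : Sp (FT V) z" if "x : supp V" "i < V x" for x i
    using Act_gen[of z x i V] sg_in[of z x i V] FT_Hom[OF v] that supp_verts z by simp
  have "f z v = f z (\<Sum>x\<in>supp V. \<Sum>i<V x. Act (FT V) x z (v x i) (gen x i))" using FT_expand[OF v fin z] by simp
  also have "... = (\<Sum>x\<in>supp V. f z (\<Sum>i<V x. Act (FT V) x z (v x i) (gen x i)))"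
    by (intro mhom_sum[OF FT_amod[OF fin] f z] amod_sum[OF FT_amod[OF fin] z] *) auto
  also have "... = (\<Sum>x\<in>supp V. \<Sum>i<V x. f z (Act (FT V) x z (v x i) (gen x i)))"
    using * by (intro sum.cong refl mhom_sum[OF FT_amod[OF fin] f z]) auto
  also have "... = (\<Sum>x\<in>supp V. \<Sum>i<V x. Act P x z (v x i) (f x (gen x i)))"
    using mhom_nat[OF f] z gen_in FT_Hom[OF v] supp_verts by (intro sum.cong refl) auto
  finally show ?thesis .
qed

lemma mhom_FT_eqI:
  assumes f: "f : mhom (FT V) P" and g: "g : mhom (FT V) P" and fin: "finite (supp V)"
    and eq: "!!x i. x : verts Q ==> i < V x ==> f x (gen x i) = g x (gen x i)"
  shows "f = g"
proof (rule mhom_eqI[OF f g])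
  fix z v assume z: "z : Obj A" and v: "v : Sp (FT V) z"
  show "f z v = g z v" unfolding mhom_FT_expand[OF f fin z v] mhom_FT_expand[OF g fin z v]
    using eq supp_verts by (intro sum.cong refl) auto
qed

text \<open>The map out of \<open>FT V\<close> with prescribed images \<open>b\<close> of the
  generators, see \<open>yoneda_gen\<close>.\<close>

definition yoneda :: "('o => nat) => ('o, 'm) amod => ('o => nat => ('o, 'm) uvec) => ('o, 'm) amap" where
  "yoneda V P b = (%z v. if z : Obj A & v : Sp (FT V) z
     then \<Sum>x\<in>supp V. \<Sum>i<V x. Act P x z (v x i) (b x i) else 0)"

context
  fixes V P b
  assumes P: "amod P" and fin: "finite (supp V)"
    and b: "!!x i. x : verts Q ==> i < V x ==> b x i : Sp P x"
begin

lemma yoneda_hom: "yoneda V P b : mhom (FT V) P"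
proof (rule mhomI)
  fix z u v assume z: "z : Obj A" and u: "u : Sp (FT V) z" and v: "v : Sp (FT V) z"
  have "u + v : Sp (FT V) z" using amod_add[OF FT_amod[OF fin] z u v] .
  moreover have "(\<Sum>x\<in>supp V. \<Sum>i<V x. Act P x z ((u + v) x i) (b x i)) =
      (\<Sum>x\<in>supp V. \<Sum>i<V x. Act P x z (u x i) (b x i) + Act P x z (v x i) (b x i))"
    using z b supp_verts FT_Hom[OF u] FT_Hom[OF v] Act_fadd[OF P] by (intro sum.cong refl) auto
  ultimately show "yoneda V P b z (u + v) = yoneda V P b z u + yoneda V P b z v"
    unfolding yoneda_def using z u v by (simp add: sum.distrib)
next
  fix z c v assume z: "z : Obj A" and v: "v : Sp (FT V) z"
  have "uscale scale c v : Sp (FT V) z" using amod_scale[OF FT_amod[OF fin] z v] .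
  moreover have "(\<Sum>x\<in>supp V. \<Sum>i<V x. Act P x z (uscale scale c v x i) (b x i)) =
      (\<Sum>x\<in>supp V. \<Sum>i<V x. uscale scale c (Act P x z (v x i) (b x i)))"
    using z b supp_verts FT_Hom[OF v] Act_fscale[OF P] by (intro sum.cong refl) (auto simp: uscale_apply)
  ultimately show "yoneda V P b z (uscale scale c v) = uscale scale c (yoneda V P b z v)"
    unfolding yoneda_def using z v by (simp add: U.scale_sum_right)
  show "yoneda V P b z v : Sp P z"
    unfolding yoneda_def using z v b supp_verts FT_Hom[OF v] Act_in[OF P] by (auto intro!: amod_sum[OF P])
next
  fix z z' h v assume z: "z : Obj A" "z' : Obj A" and h: "h : Hom A z z'" and v: "v : Sp (FT V) z"
  have in': "Act (FT V) z z' h v : Sp (FT V) z'" using Act_in[OF FT_amod[OF fin] z h v] .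
  have m: "Act P x z (v x i) (b x i) : Sp P z" if "x : supp V" "i < V x" for x i
    using that z b supp_verts FT_Hom[OF v] Act_in[OF P] by simp
  have "Act P z z' h (\<Sum>x\<in>supp V. \<Sum>i<V x. Act P x z (v x i) (b x i)) =
      (\<Sum>x\<in>supp V. Act P z z' h (\<Sum>i<V x. Act P x z (v x i) (b x i)))"
    by (intro Act_sum[OF P z h] amod_sum[OF P z(1)] m) auto
  also have "... = (\<Sum>x\<in>supp V. \<Sum>i<V x. Act P z z' h (Act P x z (v x i) (b x i)))"
    by (intro sum.cong refl Act_sum[OF P z h] m) auto
  also have "... = (\<Sum>x\<in>supp V. \<Sum>i<V x. Act P x z' (Act (FT V) z z' h v x i) (b x i))"
    using z h b supp_verts FT_Hom[OF v] Act_Cmp[OF P] by (intro sum.cong refl) (auto simp: FT_Act)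
  finally show "yoneda V P b z' (Act (FT V) z z' h v) = Act P z z' h (yoneda V P b z v)"
    unfolding yoneda_def using z v in' by simp
qed (auto simp: yoneda_def)

lemma yoneda_gen:
  assumes x: "x : verts Q" and i: "i < V x"
  shows "yoneda V P b x (gen x i) = b x i"
proof -
  have "yoneda V P b x (gen x i) = (\<Sum>y\<in>supp V. \<Sum>j<V y. Act P y x (gen x i y j) (b y j))"
    unfolding yoneda_def using x gen_in[where V=V, OF x i] by simp
  also have "... = (\<Sum>y\<in>supp V. if y = x then (\<Sum>j<V x. if j = i then b x i else 0) else 0)"
  proof (rule sum.cong[OF refl])
    fix y assume y: "y : supp V"
    have "(\<Sum>j<V y. Act P y x (gen x i y j) (b y j)) = (\<Sum>j<V y. if y = x & j = i then b x i else 0)"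
      using y x b supp_verts by (intro sum.cong refl) (auto simp: gen_def sg_def Act_Idn[OF P] Act_f0[OF P])
    then show "(\<Sum>j<V y. Act P y x (gen x i y j) (b y j)) = (if y = x then (\<Sum>j<V x. if j = i then b x i else 0) else 0)"
      by auto
  qed
  also have "... = b x i" using x i fin by (simp add: sum.delta supp_def)
  finally show ?thesis .
qed

end

lemma FT_projective:
  assumes fin: "finite (supp V)"
  shows "projective scale A (FT V)" unfolding projective_def Mod_simps
proof (intro conjI ballI impI)
  show "FT V : {M. amod M}" using FT_amod[OF fin] by simp
  fix M N e f assume M: "M : {M. amod M}" and "N : {M. amod M}" and e: "e : mhom M N" and f: "f : mhom (FT V) N"
    and surj: "ALL x:Obj A. e x ` Sp M x = Sp N x"
  have "EX m. m : Sp M x & e x m = f x (gen x i)" if "x : verts Q" "i < V x" for x i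
    using surj mhom_in[OF f, of x "gen x i"] gen_in[where V=V, OF that] that by (metis imageE vert_Obj)
  then obtain b where b: "!!x i. x : verts Q ==> i < V x ==> b x i : Sp M x"
    "!!x i. x : verts Q ==> i < V x ==> e x (b x i) = f x (gen x i)" by metis
  have M': "amod M" using M by simp
  have h: "yoneda V M b : mhom (FT V) M" using yoneda_hom[OF M' fin b(1)] .
  have "(%x v. e x (yoneda V M b x v)) = f"
    by (rule mhom_FT_eqI[OF mhom_comp[OF h e] f fin]) (use b yoneda_gen[OF M' fin b(1)] in auto)
  then show "EX g:mhom (FT V) M. (%x v. e x (g x v)) = f" using h by blast
qed

lemma FT_finitely_generated:
  assumes fin: "finite (supp V)"
  shows "finitely_generated scale A (FT V)" unfolding finitely_generated_def
proof (intro exI conjI allI impI ballI)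
  let ?G = "\<Union>x\<in>supp V. \<Union>i\<in>{..<V x}. {(x, gen x i)}"
  show "finite ?G" using fin by auto
  show "?G \<subseteq> Sigma (Obj A) (Sp (FT V))" using supp_verts gen_in by auto
  fix N z assume N: "submodule scale A (FT V) N & (ALL (x, v):?G. v : N x)" and z: "z : Obj A"
  have N1: "submodule scale A (FT V) N" using N by blast
  have g: "gen x i : N x" if "x : supp V" "i < V x" for x i using N that by blast
  have "v : N z" if v: "v : Sp (FT V) z" for v
  proof -
    have "(\<Sum>x\<in>supp V. \<Sum>i<V x. Act (FT V) x z (v x i) (gen x i)) : N z"
      using submodule_Act[OF N1 _ z] g FT_Hom[OF v] supp_verts by (intro U.subspace_sum[OF submodule_subspace[OF N1 z]]) auto
    then show ?thesis using FT_expand[OF v fin z] by simp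
  qed
  then show "N z = Sp (FT V) z" using submodule_in[OF N1 z] by blast
qed

section \<open>Coordinates of elements and of morphisms\<close>

text \<open>Coordinates of an element at a vertex \<open>z\<close>: \<open>tv\<close> is its class
  modulo the radical, and \<open>av\<close> collects, for an arrow \<open>q\<close> ending at
  \<open>z\<close>, the coefficients of its radical part along \<open>q\<close>.\<close>

definition tv :: "('o => nat) => 'o => ('o, 'm) uvec => 'k vec" where
  "tv V z v = vec (V z) (%i. \<tau> z (v z i))"

definition av :: "('o => nat) => 'a => ('o, 'm) uvec => 'k vec" where
  "av V q v = vec (V (tail Q q)) (%i. \<kappa> q (v (tail Q q) i))"

lemma tv_dim [simp]: "dim_vec (tv V z v) = V z" and av_dim [simp]: "dim_vec (av V q v) = V (tail Q q)"
  by (simp_all add: tv_def av_def)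

lemma tv_carrier [simp]: "tv V z v : carrier_vec (V z)" and av_carrier [simp]: "av V q v : carrier_vec (V (tail Q q))"
  by (rule carrier_vecI, simp)+

lemma FT_eqI:
  assumes z: "z : verts Q" and v: "v : Sp (FT V) z" and w: "w : Sp (FT V) z"
    and t: "tv V z v = tv V z w" and a: "!!q. q : arcs Q ==> head Q q = z ==> av V q v = av V q w"
  shows "v = w"
proof (rule ext, rule ext)
  fix x i
  show "v x i = w x i"
  proof (cases "x : verts Q & i < V x")
    case True
    show ?thesis
    proof (rule Hom_eqI[OF _ z])
      show "x : verts Q" "v x i : Hom A x z" "w x i : Hom A x z" using True FT_Hom[OF v] FT_Hom[OF w] by blast+
      show "\<tau> x (v x i) = \<tau> x (w x i)" if "x = z"
        using arg_cong[OF t, of "%v. v $ i"] True that by (simp add: tv_def)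
      show "\<kappa> q (v x i) = \<kappa> q (w x i)" if "q : arr x z" for q
        using arg_cong[OF a[of q], of "%v. v $ i"] True arr_D[OF that] by (auto simp: av_def)
    qed
  next
    case False
    then show ?thesis using FT_out[OF v] FT_out[OF w] by metis
  qed
qed

text \<open>Identities and arrows are linearly independent, so all coordinates can be prescribed.
  With \<open>FT_eqI\<close> this identifies the space of \<open>FT V\<close> at \<open>z\<close>
  with the sum of the coordinate spaces of \<open>tv\<close> and of \<open>av\<close> for the arrows
  ending at \<open>z\<close>.\<close>

lemma FT_exists:
  assumes z: "z : verts Q"
  obtains v where "v : Sp (FT V) z" "!!i. i < V z ==> tv V z v $ i = c i"
    "!!q i. q : arcs Q ==> head Q q = z ==> i < V (tail Q q) ==> av V q v $ i = w q i"
proof -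
  define h where "h x i = (if x = z then scale (c i) (Idn A z) else 0) + (\<Sum>q\<in>arr x z. scale (w q i) (\<rho> q))" for x i
  have r: "(\<Sum>q\<in>arr x z. scale (w q i) (\<rho> q)) : rad A x z" if "x : verts Q" for x i
    using rad_subspace[of x z] that z arr_props(2)[OF that z] by (intro subspace_sum subspace_scale) auto
  have h: "h x i : Hom A x z" if "x : verts Q" for x i
    unfolding h_def using r[OF that] rad_Hom that z by (auto intro!: Hom_add Hom_scale Idn_Hom simp: Hom_zero)
  define v where "v x i = (if x : verts Q & i < V x then h x i else 0)" for x i
  have v: "v : Sp (FT V) z" by (intro FT_I) (use h in \<open>auto simp: v_def\<close>)
  moreover have "tv V z v $ i = c i" if "i < V z" for i using that z r[OF z] rad_Hom tau_rad[OF z]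
    by (simp add: tv_def v_def h_def tau_add[OF z] tau_scale[OF z] tau_Idn[OF z] Hom_scale Idn_Hom)
  moreover have "av V q v $ i = w q i" if a: "q : arcs Q" "head Q q = z" and i: "i < V (tail Q q)" for q i
  proof -
    let ?x = "tail Q q"
    have x: "?x : verts Q" using a by simp
    have aa: "q : arr ?x z" using a by (simp add: arr_def)
    have rH: "\<rho> \<gamma> : Hom A ?x z" if "\<gamma> : arr ?x z" for \<gamma>
      using rho_Hom[of \<gamma>] that by (auto simp: arr_def)
    have sH: "scale (w \<gamma> i) (\<rho> \<gamma>) : Hom A ?x z" if "\<gamma> : arr ?x z" for \<gamma>
      using rH[OF that] x z by (auto intro: Hom_scale)
    have "\<kappa> q (\<Sum>\<gamma>\<in>arr ?x z. scale (w \<gamma> i) (\<rho> \<gamma>)) = (\<Sum>\<gamma>\<in>arr ?x z. \<kappa> q (scale (w \<gamma> i) (\<rho> \<gamma>)))"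
      by (intro kappa_sum[OF aa] sH)
    also have "... = (\<Sum>\<gamma>\<in>arr ?x z. if \<gamma> = q then w q i else 0)"
      using kappa_scale[OF aa rH] kappa_rho[OF aa] by (intro sum.cong refl) auto
    also have "... = w q i" using aa finite_arr[OF x z] by (simp add: sum.delta)
    finally have 1: "\<kappa> q (\<Sum>\<gamma>\<in>arr ?x z. scale (w \<gamma> i) (\<rho> \<gamma>)) = w q i" .
    have "\<kappa> q (h ?x i) = \<kappa> q (if ?x = z then scale (c i) (Idn A z) else 0) + w q i"
      unfolding h_def using 1 kappa_add[OF aa, of "if ?x = z then scale (c i) (Idn A z) else 0"] r[OF x] rad_Hom x z
      by (auto simp: Hom_zero Hom_scale Idn_Hom)
    also have "\<kappa> q (if ?x = z then scale (c i) (Idn A z) else 0) = 0"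
      using kappa_0[OF aa] kappa_scale[OF aa, of "Idn A z"] kappa_Idn[of q z] aa z Idn_Hom by auto
    finally show ?thesis using x i by (simp add: av_def v_def)
  qed
  ultimately show ?thesis using that by blast
qed

context
  fixes z V u v
  assumes z: "z : verts Q" and u: "u : Sp (FT V) z" and v: "v : Sp (FT V) z"
begin

lemma tv_add: "tv V z (u + v) = tv V z u + tv V z v" using tau_add[OF z FT_Hom[OF u z] FT_Hom[OF v z]] by (auto simp: tv_def)

lemma av_add: "q : arcs Q ==> head Q q = z ==> av V q (u + v) = av V q u + av V q v"
  using kappa_add[of q "tail Q q" z] FT_Hom[OF u] FT_Hom[OF v] by (auto simp: av_def arr_def)

end

lemma tv_diff: "z : verts Q ==> u : Sp (FT V) z ==> v : Sp (FT V) z ==> tv V z (u - v) = tv V z u - tv V z v"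
proof -
  assume z: "z : verts Q" and u: "u : Sp (FT V) z" and v: "v : Sp (FT V) z"
  have d: "u - v : Sp (FT V) z" using U.subspace_diff[OF FT_subspace u v] z by simp
  have "tv V z u = tv V z (u - v) + tv V z v" using tv_add[OF z d v] by simp
  then show ?thesis by (auto simp: tv_def)
qed

lemma tv_0 [simp]: "z : verts Q ==> tv V z 0 = 0\<^sub>v (V z)" by (auto simp: tv_def tau_0)

lemma av_0 [simp]: "q : arcs Q ==> av V q 0 = 0\<^sub>v (V (tail Q q))"
  using kappa_0[of q "tail Q q" "head Q q"] by (auto simp: av_def arr_def)

lemma tv_gen: "z : verts Q ==> i < V z ==> tv V z (gen z i) = unit_vec (V z) i"
  by (auto simp: tv_def gen_def sg_def tau_Idn tau_0)

lemma av_gen: "q : arcs Q ==> av V q (gen (head Q q) i) = 0\<^sub>v (V (tail Q q))"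
  using kappa_0[of q "tail Q q" "head Q q"] kappa_Idn[of q "head Q q"] by (auto simp: av_def gen_def sg_def arr_def)

text \<open>A map is encoded by its values on generators: \<open>top\<close> is its matrix modulo
  the radical, one block per vertex, and \<open>arm\<close> is its matrix along an arrow. The latter
  leads from the head of the arrow to its tail because \<open>A(x, -)\<close> is contravariant in
  \<open>x\<close>.\<close>

definition top :: "('o => nat) => ('o => nat) => ('o, 'm) amap => 'o => 'k mat" where
  "top V W f z = mat (W z) (V z) (%(j, i). tv W z (f z (gen z i)) $ j)"

definition arm :: "('o => nat) => ('o => nat) => ('o, 'm) amap => 'a => 'k mat" where
  "arm V W f q = mat (W (tail Q q)) (V (head Q q)) (%(j, i). av W q (f (head Q q) (gen (head Q q) i)) $ j)"

lemma top_dim [simp]: "dim_row (top V W f z) = W z" "dim_col (top V W f z) = V z"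
  and arm_dim [simp]: "dim_row (arm V W f q) = W (tail Q q)" "dim_col (arm V W f q) = V (head Q q)"
  by (simp_all add: top_def arm_def)

lemma top_carrier [simp]: "top V W f z : carrier_mat (W z) (V z)"
  and arm_carrier [simp]: "arm V W f q : carrier_mat (W (tail Q q)) (V (head Q q))" by (simp_all add: top_def arm_def)

context
  fixes V W f
  assumes f: "f : mhom (FT V) (FT W)" and V: "finite (supp V)"
begin

lemma FT_component:
  assumes z: "z : verts Q" and v: "v : Sp (FT V) z" and x: "x : verts Q" and j: "j < W x"
  shows "f z v x j = (\<Sum>y\<in>supp V. \<Sum>i<V y. Cmp A x y z (v y i) (f y (gen y i) x j))"
  unfolding mhom_FT_expand[OF f V vert_Obj[OF z] v] sum_fun2 using x j by (simp add: FT_Act)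

lemma FT_gen_Hom: "y : verts Q ==> i < V y ==> x : verts Q ==> j < W x ==> f y (gen y i) x j : Hom A x y"
  using FT_Hom[OF mhom_in[OF f _ gen_in]] by simp

lemma tv_mhom:
  assumes z: "z : verts Q" and v: "v : Sp (FT V) z"
  shows "tv W z (f z v) = top V W f z *\<^sub>v tv V z v"
proof (rule eq_vecI)
  fix j assume "j < dim_vec (top V W f z *\<^sub>v tv V z v)"
  then have j: "j < W z" by simp
  have m: "Cmp A z y z (v y i) (f y (gen y i) z j) : Hom A z z" if "y : supp V" "i < V y" for y i
    using that FT_Hom[OF v] FT_gen_Hom[OF _ _ z j] supp_verts z by (intro Cmp_Hom[of z y z]) auto
  have "tv W z (f z v) $ j = \<tau> z (\<Sum>y\<in>supp V. \<Sum>i<V y. Cmp A z y z (v y i) (f y (gen y i) z j))"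
    using j FT_component[OF z v z j] by (simp add: tv_def)
  also have "... = (\<Sum>y\<in>supp V. \<tau> z (\<Sum>i<V y. Cmp A z y z (v y i) (f y (gen y i) z j)))"
    using m z by (intro tau_sum[OF z] Hom_sum) auto
  also have "... = (\<Sum>y\<in>supp V. \<Sum>i<V y. \<tau> z (Cmp A z y z (v y i) (f y (gen y i) z j)))"
    using m by (intro sum.cong refl tau_sum[OF z]) auto
  also have "... = (\<Sum>y\<in>supp V. if y = z then (\<Sum>i<V z. \<tau> z (v z i) * \<tau> z (f z (gen z i) z j)) else 0)"
  proof (rule sum.cong[OF refl])
    fix y assume y: "y : supp V"
    have "(\<Sum>i<V y. \<tau> z (Cmp A z y z (v y i) (f y (gen y i) z j))) =
       (\<Sum>i<V y. if z = y then \<tau> z (v y i) * \<tau> z (f y (gen y i) z j) else 0)"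
      using y FT_Hom[OF v] FT_gen_Hom[OF _ _ z j] supp_verts[OF y] z by (intro sum.cong refl tau_Cmp) auto
    then show "(\<Sum>i<V y. \<tau> z (Cmp A z y z (v y i) (f y (gen y i) z j))) =
       (if y = z then (\<Sum>i<V z. \<tau> z (v z i) * \<tau> z (f z (gen z i) z j)) else 0)" by auto
  qed
  also have "... = (\<Sum>i<V z. \<tau> z (v z i) * \<tau> z (f z (gen z i) z j))"
    using V z by (auto simp: sum.delta supp_def)
  also have "... = (top V W f z *\<^sub>v tv V z v) $ j"
    using j by (simp add: top_def tv_def scalar_prod_def mult.commute lessThan_atLeast0)
  finally show "tv W z (f z v) $ j = (top V W f z *\<^sub>v tv V z v) $ j" .
qed simp

text \<open>By \<open>kappa_Cmp\<close> only products with at most one radical factor survive: the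
  radical part of \<open>v\<close> meets the top of \<open>f\<close>, and the top of
  \<open>v\<close> meets the radical part of \<open>f\<close>.\<close>

lemma av_mhom:
  assumes a: "q : arcs Q" and v: "v : Sp (FT V) (head Q q)"
  shows "av W q (f (head Q q) v) = top V W f (tail Q q) *\<^sub>v av V q v + arm V W f q *\<^sub>v tv V (head Q q) v"
proof (rule eq_vecI)
  let ?z = "head Q q" and ?x = "tail Q q"
  fix j assume "j < dim_vec (top V W f ?x *\<^sub>v av V q v + arm V W f q *\<^sub>v tv V ?z v)"
  then have j: "j < W ?x" by simp
  have z: "?z : verts Q" and x: "?x : verts Q" and aa: "q : arr ?x ?z" using a by (auto simp: arr_def)
  have m: "Cmp A ?x y ?z (v y i) (f y (gen y i) ?x j) : Hom A ?x ?z" if "y : supp V" "i < V y" for y i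
    using that FT_Hom[OF v] FT_gen_Hom[OF _ _ x j] supp_verts x z by (intro Cmp_Hom[of ?x y ?z]) auto
  let ?p = "\<Sum>i<V ?x. \<tau> ?x (f ?x (gen ?x i) ?x j) * \<kappa> q (v ?x i)"
  let ?q = "\<Sum>i<V ?z. \<tau> ?z (v ?z i) * \<kappa> q (f ?z (gen ?z i) ?x j)"
  have "av W q (f ?z v) $ j = \<kappa> q (\<Sum>y\<in>supp V. \<Sum>i<V y. Cmp A ?x y ?z (v y i) (f y (gen y i) ?x j))"
    using j FT_component[OF z v x j] by (simp add: av_def)
  also have "... = (\<Sum>y\<in>supp V. \<kappa> q (\<Sum>i<V y. Cmp A ?x y ?z (v y i) (f y (gen y i) ?x j)))"
    using m x z by (intro kappa_sum[OF aa] Hom_sum) auto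
  also have "... = (\<Sum>y\<in>supp V. \<Sum>i<V y. \<kappa> q (Cmp A ?x y ?z (v y i) (f y (gen y i) ?x j)))"
    using m by (intro sum.cong refl kappa_sum[OF aa]) auto
  also have "... = (\<Sum>y\<in>supp V. (if y = ?x then ?p else 0) + (if y = ?z then ?q else 0))"
  proof (rule sum.cong[OF refl])
    fix y assume y: "y : supp V"
    have "(\<Sum>i<V y. \<kappa> q (Cmp A ?x y ?z (v y i) (f y (gen y i) ?x j))) =
       (\<Sum>i<V y. (if ?x = y then \<tau> ?x (f y (gen y i) ?x j) * \<kappa> q (v y i) else 0) +
          (if y = ?z then \<tau> ?z (v y i) * \<kappa> q (f y (gen y i) ?x j) else 0))"
      using y FT_Hom[OF v] FT_gen_Hom[OF _ _ x j] supp_verts[OF y] by (intro sum.cong refl kappa_Cmp[OF aa]) auto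
    then show "(\<Sum>i<V y. \<kappa> q (Cmp A ?x y ?z (v y i) (f y (gen y i) ?x j))) =
       (if y = ?x then ?p else 0) + (if y = ?z then ?q else 0)" by (auto simp: sum.distrib)
  qed
  also have "... = ?p + ?q" using V x z by (auto simp: sum.distrib sum.delta supp_def)
  also have "... = (top V W f ?x *\<^sub>v av V q v + arm V W f q *\<^sub>v tv V ?z v) $ j"
    using j by (simp add: top_def arm_def av_def tv_def scalar_prod_def mult.commute lessThan_atLeast0)
  finally show "av W q (f ?z v) $ j = (top V W f ?x *\<^sub>v av V q v + arm V W f q *\<^sub>v tv V ?z v) $ j" .
qed simp

end

lemma col_top: "z : verts Q ==> i < V z ==> col (top V W f z) i = tv W z (f z (gen z i))" by (auto simp: top_def)

lemma col_arm: "i < V (head Q q) ==> col (arm V W f q) i = av W q (f (head Q q) (gen (head Q q) i))" by (auto simp: arm_def)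

lemma mhom_coord_eqI:
  assumes f: "f : mhom (FT V) (FT W)" and g: "g : mhom (FT V) (FT W)" and fin: "finite (supp V)"
    and t: "!!z. z : verts Q ==> top V W f z = top V W g z" and a: "!!q. q : arcs Q ==> arm V W f q = arm V W g q"
  shows "f = g"
proof (rule mhom_FT_eqI[OF f g fin])
  fix z i assume z: "z : verts Q" and i: "i < V z"
  show "f z (gen z i) = g z (gen z i)"
  proof (rule FT_eqI[OF z])
    show "f z (gen z i) : Sp (FT W) z" "g z (gen z i) : Sp (FT W) z"
      using mhom_in[OF f] mhom_in[OF g] gen_in[where V=V, OF z i] z by simp_all
    show "tv W z (f z (gen z i)) = tv W z (g z (gen z i))" using col_top[where V=V, OF z i] t[OF z] by metis
    show "av W q (f z (gen z i)) = av W q (g z (gen z i))" if "q : arcs Q" "head Q q = z" for q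
      using col_arm[of i V q] a[OF that(1)] that i by metis
  qed
qed

text \<open>Images of generators can be chosen freely by Yoneda and have arbitrary coordinates by
  \<open>FT_exists\<close>. Together with \<open>mhom_coord_eqI\<close>, maps between sums of
  representables are the same as pairs of matrix families.\<close>

lemma mhom_exists:
  assumes V: "finite (supp V)" and W: "finite (supp W)"
    and F: "!!z. z : verts Q ==> F z : carrier_mat (W z) (V z)"
    and m: "!!q. q : arcs Q ==> m q : carrier_mat (W (tail Q q)) (V (head Q q))"
  obtains f where "f : mhom (FT V) (FT W)" "!!z. z : verts Q ==> top V W f z = F z"
    "!!q. q : arcs Q ==> arm V W f q = m q"
proof -
  have "ALL z i. EX v. z : verts Q --> v : Sp (FT W) z & (ALL j<W z. tv W z v $ j = F z $$ (j, i)) &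
     (ALL q j. q : arcs Q & head Q q = z & j < W (tail Q q) --> av W q v $ j = m q $$ (j, i))"
  proof (intro allI)
    fix z i
    show "EX v. z : verts Q --> v : Sp (FT W) z & (ALL j<W z. tv W z v $ j = F z $$ (j, i)) &
     (ALL q j. q : arcs Q & head Q q = z & j < W (tail Q q) --> av W q v $ j = m q $$ (j, i))"
    proof (cases "z : verts Q")
      case True
      obtain v where "v : Sp (FT W) z" "!!j. j < W z ==> tv W z v $ j = F z $$ (j, i)"
        "!!q j. q : arcs Q ==> head Q q = z ==> j < W (tail Q q) ==> av W q v $ j = m q $$ (j, i)"
        using FT_exists[OF True, of W "%j. F z $$ (j, i)" "%q j. m q $$ (j, i)"] by blast
      then show ?thesis by blast
    qed blast
  qed
  then obtain b where b: "!!z i. z : verts Q ==> b z i : Sp (FT W) z & (ALL j<W z. tv W z (b z i) $ j = F z $$ (j, i)) &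
     (ALL q j. q : arcs Q & head Q q = z & j < W (tail Q q) --> av W q (b z i) $ j = m q $$ (j, i))" by metis
  define f where "f = yoneda V (FT W) b"
  have bi: "b x i : Sp (FT W) x" if "x : verts Q" "i < V x" for x i using b that by blast
  have f: "f : mhom (FT V) (FT W)" unfolding f_def using yoneda_hom[OF FT_amod[OF W] V bi] .
  have g: "f x (gen x i) = b x i" if "x : verts Q" "i < V x" for x i
    unfolding f_def using yoneda_gen[OF FT_amod[OF W] V bi that] .
  have "top V W f z = F z" if "z : verts Q" for z
    using F[OF that] b[OF that] g[OF that] by (intro eq_matI) (auto simp: top_def)
  moreover have "arm V W f q = m q" if "q : arcs Q" for q
    using m[OF that] b[of "head Q q"] g[of "head Q q"] that by (intro eq_matI) (auto simp: arm_def)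
  ultimately show ?thesis using that f by blast
qed

lemma top_comp:
  assumes f: "f : mhom (FT U) (FT V)" and g: "g : mhom (FT V) (FT W)" and "finite (supp V)" and z: "z : verts Q"
  shows "top U W (%x v. g x (f x v)) z = top V W g z * top U V f z"
proof (rule mat_col_eqI)
  fix i assume "i < dim_col (top V W g z * top U V f z)"
  then have i: "i < U z" by simp
  show "col (top U W (%x v. g x (f x v)) z) i = col (top V W g z * top U V f z) i"
    unfolding col_mult2[OF top_carrier[of V W g z] top_carrier[of U V f z] i] col_top[where ?V = U, OF z i]
    using tv_mhom[OF g assms(3) z, of "f z (gen z i)"] mhom_in[OF f vert_Obj[OF z] gen_in[where V=U, OF z i]] by simp
qed simp_all

lemma arm_comp:
  assumes f: "f : mhom (FT U) (FT V)" and g: "g : mhom (FT V) (FT W)" and "finite (supp V)" and a: "q : arcs Q"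
  shows "arm U W (%x v. g x (f x v)) q = top V W g (tail Q q) * arm U V f q + arm V W g q * top U V f (head Q q)"
proof (rule mat_col_eqI)
  fix i assume "i < dim_col (top V W g (tail Q q) * arm U V f q + arm V W g q * top U V f (head Q q))"
  then have i: "i < U (head Q q)" by simp
  have c: "top V W g (tail Q q) * arm U V f q : carrier_mat (W (tail Q q)) (U (head Q q))"
    "arm V W g q * top U V f (head Q q) : carrier_mat (W (tail Q q)) (U (head Q q))"
    by (meson arm_carrier mult_carrier_mat top_carrier)+
  have z: "head Q q : verts Q" using a by simp
  show "col (arm U W (%x v. g x (f x v)) q) i = col (top V W g (tail Q q) * arm U V f q + arm V W g q * top U V f (head Q q)) i"
    unfolding col_add[OF c i] col_mult2[OF top_carrier[of V W g] arm_carrier[of U V f] i]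
      col_mult2[OF arm_carrier[of V W g] top_carrier[of U V f] i]
      col_top[where ?V = U, OF z i] col_arm[where ?V = U, OF i]
    using av_mhom[OF g assms(3) a, of "f (head Q q) (gen (head Q q) i)"]
      mhom_in[OF f vert_Obj[OF z] gen_in[where V=U, OF z i]] by simp
qed simp_all

lemma top_add:
  assumes f: "f : mhom (FT V) (FT W)" and g: "g : mhom (FT V) (FT W)" and z: "z : verts Q"
  shows "top V W (%x v. f x v + g x v) z = top V W f z + top V W g z"
  using tv_add[OF z mhom_in[OF f _ gen_in[where V=V, OF z]] mhom_in[OF g _ gen_in[where V=V, OF z]]] z
  by (intro eq_matI) (auto simp: top_def)

lemma top_diff:
  assumes f: "f : mhom (FT V) (FT W)" and g: "g : mhom (FT V) (FT W)" and z: "z : verts Q"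
  shows "top V W (%x v. f x v - g x v) z = top V W f z - top V W g z"
  using tv_diff[OF z mhom_in[OF f _ gen_in[where V=V, OF z]] mhom_in[OF g _ gen_in[where V=V, OF z]]] z
  by (intro eq_matI) (auto simp: top_def)

lemma arm_add:
  assumes f: "f : mhom (FT V) (FT W)" and g: "g : mhom (FT V) (FT W)" and a: "q : arcs Q"
  shows "arm V W (%x v. f x v + g x v) q = arm V W f q + arm V W g q"
  using av_add[OF _ mhom_in[OF f _ gen_in] mhom_in[OF g _ gen_in] a refl] a by (intro eq_matI) (auto simp: arm_def)

lemma top_zero: "z : verts Q ==> top V W (%x v. 0) z = 0\<^sub>m (W z) (V z)" by (intro eq_matI) (auto simp: top_def)

lemma arm_zero: "q : arcs Q ==> arm V W (%x v. 0) q = 0\<^sub>m (W (tail Q q)) (V (head Q q))"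
  by (intro eq_matI) (auto simp: arm_def)

lemma top_mid: "z : verts Q ==> top V V (mid (FT V)) z = 1\<^sub>m (V z)"
  using gen_in by (intro eq_matI) (auto simp: top_def tv_gen)

lemma arm_mid: "q : arcs Q ==> arm V V (mid (FT V)) q = 0\<^sub>m (V (tail Q q)) (V (head Q q))"
  using gen_in by (intro eq_matI) (auto simp: arm_def av_gen)

section \<open>Radical maps, an ideal with vanishing square\<close>

definition rad_map :: "('o => nat) => ('o => nat) => ('o, 'm) amap => bool" where
  "rad_map V W f \<longleftrightarrow> f : mhom (FT V) (FT W) & (ALL z:verts Q. top V W f z = 0\<^sub>m (W z) (V z))"

text \<open>Each summand in \<open>arm_comp\<close> contains the top of one of the two factors. The
  equation holds for all \<open>x\<close> and \<open>v\<close> because maps vanish outside the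
  modules.\<close>

lemma rad_map_comp_zero:
  assumes f: "rad_map U V f" and g: "rad_map V W g" and U: "finite (supp U)" and V: "finite (supp V)" and W: "finite (supp W)"
  shows "g x (f x v) = 0"
proof -
  have fh: "f : mhom (FT U) (FT V)" and gh: "g : mhom (FT V) (FT W)" using f g unfolding rad_map_def by blast+
  have "(%x v. g x (f x v)) = (%x v. 0)"
  proof (rule mhom_coord_eqI[OF mhom_comp[OF fh gh] mhom_zero_map[OF FT_amod[OF W]] U])
    fix z assume z: "z : verts Q"
    show "top U W (%x v. g x (f x v)) z = top U W (%x v. 0) z" unfolding top_comp[OF fh gh V z] top_zero[OF z] using f z
      unfolding rad_map_def by (simp add: right_mult_zero_mat[OF top_carrier])
  next
    fix q assume a: "q : arcs Q"
    show "arm U W (%x v. g x (f x v)) q = arm U W (%x v. 0) q" unfolding arm_comp[OF fh gh V a] arm_zero[OF a] using f g a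
      unfolding rad_map_def by (simp add: right_mult_zero_mat[OF arm_carrier] left_mult_zero_mat[OF arm_carrier])
  qed
  then show ?thesis by meson
qed

lemma rad_map_left:
  assumes f: "f : mhom (FT U) (FT V)" and g: "rad_map V W g" and V: "finite (supp V)"
  shows "rad_map U W (%x v. g x (f x v))"
  using g mhom_comp[OF f] top_comp[OF f _ V] unfolding rad_map_def by (auto simp: left_mult_zero_mat[OF top_carrier])

lemma rad_map_right:
  assumes f: "rad_map U V f" and g: "g : mhom (FT V) (FT W)" and V: "finite (supp V)"
  shows "rad_map U W (%x v. g x (f x v))"
  using f mhom_comp[OF _ g] top_comp[OF _ g V] unfolding rad_map_def by (auto simp: right_mult_zero_mat[OF top_carrier])

section \<open>Projective modules\<close>

lemma mhom_exists_top:
  assumes V: "finite (supp V)" and W: "finite (supp W)"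
    and F: "!!z. z : verts Q ==> F z : carrier_mat (W z) (V z)"
  shows "EX f:mhom (FT V) (FT W). ALL z:verts Q. top V W f z = F z"
proof (rule mhom_exists[OF V W F zero_carrier_mat])
  fix f assume "f : mhom (FT V) (FT W)" "!!z. z : verts Q ==> top V W f z = F z"
  then show ?thesis by (intro bexI[of _ f] ballI)
qed

text \<open>Generators are taken from finite spanning sets at the vertices; surjectivity at the
  other objects is \<open>submodule_le_verts\<close> for the image.\<close>

lemma FT_cover:
  assumes P: "amod P"
  obtains V \<pi> where "finite (supp V)" "\<pi> : mhom (FT V) P" "!!z. z : Obj A ==> \<pi> z ` Sp (FT V) z = Sp P z"
proof -
  \<comment> \<open>The clause for vanishing spaces keeps \<open>supp V\<close> inside the finite
    support of \<open>P\<close>.\<close>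
  have "EX (n :: nat) b. (Sp P x = {0} --> n = 0) & (ALL i<n. b i : Sp P x) & Sp P x = U.span (b ` {..<n})"
    if x: "x : verts Q" for x
  proof (cases "Sp P x = {0}")
    case True
    then show ?thesis by (intro exI[of _ 0] exI[of _ undefined]) simp
  next
    case False
    obtain B where B: "finite B" "U.span B = Sp P x" using amod_fin_dim[OF P vert_Obj[OF x]] unfolding fin_dim_def by blast
    obtain b where b: "bij_betw b {0..<card B} B" using ex_bij_betw_nat_finite[OF B(1)] by blast
    have "b ` {..<card B} = B" using b by (simp add: bij_betw_def lessThan_atLeast0)
    moreover have "B \<subseteq> Sp P x" using B(2) U.span_superset by blast
    ultimately show ?thesis using False B(2) by (intro exI[of _ "card B"] exI[of _ b]) auto
  qed
  then have "ALL x:verts Q. EX (n :: nat) b. (Sp P x = {0} --> n = 0) & (ALL i<n. b i : Sp P x) & Sp P x = U.span (b ` {..<n})"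
    by blast
  from bchoice[OF this] obtain V :: "'o => nat" where
    "ALL x:verts Q. EX b. (Sp P x = {0} --> V x = 0) & (ALL i<V x. b i : Sp P x) & Sp P x = U.span (b ` {..<V x})" ..
  from bchoice[OF this] obtain b where
    Vb: "ALL x:verts Q. (Sp P x = {0} --> V x = 0) & (ALL i<V x. b x i : Sp P x) & Sp P x = U.span (b x ` {..<V x})" ..
  have V: "!!x. x : verts Q ==> Sp P x = {0} ==> V x = 0"
    and b: "!!x i. x : verts Q ==> i < V x ==> b x i : Sp P x"
    and span: "!!x. x : verts Q ==> Sp P x = U.span (b x ` {..<V x})" using Vb by blast+
  have "supp V \<subseteq> {x : verts Q. Sp P x ~= {0}}" unfolding supp_def using V by auto
  then have fin: "finite (supp V)" using amod_finite[OF P is_ind_verts] finite_subset by blast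
  have h: "yoneda V P b : mhom (FT V) P" using yoneda_hom[OF P fin b] .
  have im: "submodule scale A P (%z. yoneda V P b z ` Sp (FT V) z)" using submodule_image[OF FT_amod[OF fin] h] .
  have "Sp P x \<subseteq> yoneda V P b x ` Sp (FT V) x" if x: "x : verts Q" for x
  proof -
    have "b x i : yoneda V P b x ` Sp (FT V) x" if "i < V x" for i
      using yoneda_gen[OF P fin b x that] gen_in[where V=V, OF x that] by force
    then have "b x ` {..<V x} \<subseteq> yoneda V P b x ` Sp (FT V) x" by auto
    then show ?thesis using U.span_minimal[OF _ submodule_subspace[OF im vert_Obj[OF x]]] span[OF x] by simp
  qed
  then have "Sp P z \<subseteq> yoneda V P b z ` Sp (FT V) z" if "z : Obj A" for z
    using submodule_le_verts[OF P submodule_self[OF P] im _ that] by blast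
  then have "yoneda V P b z ` Sp (FT V) z = Sp P z" if "z : Obj A" for z using submodule_in[OF im that] that by blast
  then show ?thesis using that fin h by blast
qed

text \<open>The idempotent \<open>s \<pi>\<close> of a splitting of a cover is lifted modulo the radical: its top is split by
  matrices, and the discrepancy is an idempotent whose conjugate is a radical map, hence zero.\<close>

lemma projective_FT:
  assumes P: "projective scale A P"
  obtains W a b where "finite (supp W)" "a : mhom P (FT W)" "b : mhom (FT W) P"
    "!!x v. x : Obj A ==> v : Sp P x ==> b x (a x v) = v"
    "!!x v. x : Obj A ==> v : Sp (FT W) x ==> a x (b x v) = v"
proof -
  have PM: "amod P" using P unfolding projective_def by simp
  obtain V \<pi> where V: "finite (supp V)" and \<pi>: "\<pi> : mhom (FT V) P"
    and surj: "!!z. z : Obj A ==> \<pi> z ` Sp (FT V) z = Sp P z" using FT_cover[OF PM] by blast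
  note VM = FT_amod[OF V]
  have "EX s:mhom P (FT V). (%x v. \<pi> x (s x v)) = mid P"
    using P VM PM \<pi> surj mhom_mid[OF PM] unfolding projective_def Mod_simps by blast
  then obtain s where s: "s : mhom P (FT V)" and ps: "(%x v. \<pi> x (s x v)) = mid P" by blast
  have pis: "\<pi> x (s x v) = v" if "x : Obj A" "v : Sp P x" for x v using fun_cong[OF fun_cong[OF ps], of x v] that by simp
  define e where "e = (%x v. s x (\<pi> x v))"
  have e: "e : mhom (FT V) (FT V)" unfolding e_def using mhom_comp[OF \<pi> s] .
  have "(%x v. e x (e x v)) = e" by (rule mhom_eqI[OF mhom_comp[OF e e] e]) (auto simp: e_def pis mhom_in[OF \<pi>])
  then have ee: "top V V e z * top V V e z = top V V e z" if "z : verts Q" for z using top_comp[OF e e V that] by simp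
  have "EX r I R. I : carrier_mat (V z) r & R : carrier_mat r (V z) & top V V e z = I * R & R * I = 1\<^sub>m r"
    if "z : verts Q" for z using idempotent_mat_split[OF top_carrier ee[OF that]] by metis
  then obtain W I R where IR: "!!z. z : verts Q ==> I z : carrier_mat (V z) (W z)"
    "!!z. z : verts Q ==> R z : carrier_mat (W z) (V z)" "!!z. z : verts Q ==> top V V e z = I z * R z"
    "!!z. z : verts Q ==> R z * I z = 1\<^sub>m (W z)" by metis
  \<comment> \<open>An empty top admits only an empty splitting, so \<open>W\<close> inherits finite
    support from \<open>V\<close>.\<close>
  have W0: "W z = 0" if "z : verts Q" "V z = 0" for z
  proof (rule ccontr)
    assume "W z ~= 0"
    then have "(R z * I z) $$ (0, 0) = 0" using IR(1,2)[OF that(1)] that(2) by (simp add: scalar_prod_def)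
    moreover have "(R z * I z) $$ (0, 0) = 1" using \<open>W z ~= 0\<close> by (simp add: IR(4)[OF that(1)])
    ultimately show False by simp
  qed
  have "supp W \<subseteq> supp V"
  proof
    show "z : supp V" if "z : supp W" for z using W0[of z] that unfolding supp_def by auto
  qed
  then have W: "finite (supp W)" using V finite_subset by blast
  note WM = FT_amod[OF W]
  obtain i where i: "i : mhom (FT W) (FT V)" "ALL z:verts Q. top W V i z = I z"
    using bexE[OF mhom_exists_top[OF W V IR(1)]] .
  obtain r where r: "r : mhom (FT V) (FT W)" "ALL z:verts Q. top V W r z = R z"
    using bexE[OF mhom_exists_top[OF V W IR(2)]] .
  have d: "dim_row (I z) = V z" "dim_col (I z) = W z" "dim_row (R z) = W z" "dim_col (R z) = V z" if "z : verts Q" for z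
    using IR(1,2)[OF that] by auto
  define a where "a = (%x v. r x (s x v))"
  define b where "b = (%x v. \<pi> x (i x v))"
  have a: "a : mhom P (FT W)" unfolding a_def using mhom_comp[OF s r(1)] .
  have b: "b : mhom (FT W) P" unfolding b_def using mhom_comp[OF i(1) \<pi>] .
  define c where "c = (%x v. a x (b x v))"
  have c: "c : mhom (FT W) (FT W)" unfolding c_def using mhom_comp[OF b a] .
  have ei: "(%x v. e x (i x v)) : mhom (FT W) (FT V)" using mhom_comp[OF i(1) e] .
  have topei: "top W V (%x v. e x (i x v)) z = I z" if "z : verts Q" for z
    unfolding top_comp[OF i(1) e V that] i(2)[rule_format, OF that] IR(3)[OF that]
    using d[OF that] IR(4)[OF that] by (simp add: mat_assoc)
  have c_alt: "c = (%x v. r x (e x (i x v)))" unfolding c_def a_def b_def e_def ..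
  have topc: "top W W c z = 1\<^sub>m (W z)" if "z : verts Q" for z
    unfolding c_alt using top_comp[OF ei r(1) V that] topei[OF that] r(2)[rule_format, OF that] IR(4)[OF that] by simp
  \<comment> \<open>The composite \<open>c = a b\<close> has identity tops, so
    \<open>\<nu> = 1 - c\<close> is radical and squares to zero. Hence \<open>u = 1 + \<nu>\<close>
    is inverse to \<open>c\<close>, and \<open>b u\<close> is an exact right inverse of
    \<open>a\<close>.\<close>
  define \<nu> where "\<nu> = (%x v. mid (FT W) x v - c x v)"
  have \<nu>: "\<nu> : mhom (FT W) (FT W)" unfolding \<nu>_def using mhom_minus[OF WM mhom_mid[OF WM] c] .
  have "top W W \<nu> z = 0\<^sub>m (W z) (W z)" if "z : verts Q" for z
    unfolding \<nu>_def top_diff[OF mhom_mid[OF WM] c that] top_mid[OF that] topc[OF that] by auto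
  then have rnu: "rad_map W W \<nu>" unfolding rad_map_def using \<nu> by blast
  have nunu: "\<nu> x (\<nu> x v) = 0" for x v using rad_map_comp_zero[OF rnu rnu W W W] .
  define u where "u = (%x v. mid (FT W) x v + \<nu> x v)"
  have u: "u : mhom (FT W) (FT W)" unfolding u_def using mhom_plus[OF WM mhom_mid[OF WM] \<nu>] .
  have topu: "top W W u z = 1\<^sub>m (W z)" if "z : verts Q" for z
    unfolding u_def top_add[OF mhom_mid[OF WM] \<nu> that] top_mid[OF that]
    using rnu that unfolding rad_map_def by (auto simp: right_add_zero_mat[of _ "W z" "W z"])
  define b1 where "b1 = (%x v. b x (u x v))"
  have b1: "b1 : mhom (FT W) P" unfolding b1_def using mhom_comp[OF u b] .
  have ab1: "a x (b1 x v) = v" if x: "x : Obj A" and v: "v : Sp (FT W) x" for x v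
  proof -
    have cw: "c x w = w - \<nu> x w" if "w : Sp (FT W) x" for w unfolding \<nu>_def using x that by simp
    have nv: "\<nu> x v : Sp (FT W) x" using mhom_in[OF \<nu> x v] .
    have uv: "u x v = v + \<nu> x v" unfolding u_def using x v by simp
    have "a x (b1 x v) = c x (u x v)" unfolding b1_def c_def ..
    also have "... = v + \<nu> x v - \<nu> x (v + \<nu> x v)" unfolding uv using cw amod_add[OF WM x v nv] by simp
    also have "... = v" by (simp add: mhom_add[OF \<nu> x v nv] nunu)
    finally show ?thesis .
  qed
  \<comment> \<open>It remains to see that the idempotent \<open>q = 1 - b1 a\<close> of
    \<open>P\<close> is zero. Its conjugate \<open>\<psi> = s q \<pi>\<close> on \<open>FT V\<close>
    is again idempotent and turns out to be radical.\<close>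
  define q where "q = (%x v. mid P x v - b1 x (a x v))"
  have q: "q : mhom P P" unfolding q_def using mhom_minus[OF PM mhom_mid[OF PM] mhom_comp[OF a b1]] .
  have qq: "q x (q x v) = q x v" if x: "x : Obj A" and v: "v : Sp P x" for x v
  proof -
    have qv: "q x v = v - b1 x (a x v)" unfolding q_def using x v by simp
    have bv: "b1 x (a x v) : Sp P x" using mhom_in[OF b1 x mhom_in[OF a x v]] .
    have "a x (q x v) = 0" unfolding qv by (simp add: mhom_diff[OF PM a x v bv] ab1[OF x mhom_in[OF a x v]])
    then show ?thesis unfolding q_def using mhom_in[OF q x v] x mhom_0[OF b1] by (simp add: q_def)
  qed
  define \<psi> where "\<psi> = (%x v. s x (q x (\<pi> x v)))"
  have \<psi>: "\<psi> : mhom (FT V) (FT V)" unfolding \<psi>_def using mhom_comp[OF mhom_comp[OF \<pi> q] s] .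
  \<comment> \<open>\<open>g\<close> is \<open>s b1 a \<pi>\<close> written through
    \<open>e = s \<pi>\<close>. Its top is \<open>I R\<close>, which is the top of \<open>e\<close>,
    so \<open>\<psi> = e - g\<close> has top zero.\<close>
  define g where "g = (%x v. e x (i x (u x (r x (e x v)))))"
  note h1 = mhom_comp[OF e r(1)]
  note h2 = mhom_comp[OF h1 u]
  have g: "g : mhom (FT V) (FT V)" unfolding g_def using mhom_comp[OF h2 ei] .
  have topg: "top V V g z = top V V e z" if z: "z : verts Q" for z
    unfolding g_def top_comp[OF h2 ei W z] top_comp[OF h1 u W z] top_comp[OF e r(1) V z]
      topei[OF z] topu[OF z] r(2)[rule_format, OF z] IR(3)[OF z]
    using d[OF z] by (simp add: mat_assoc mat_reduce[OF IR(4)[OF z]] left_mult_one_mat[OF IR(2)[OF z]])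
  have "\<psi> = (%x v. e x v - g x v)"
  proof (rule mhom_eqI[OF \<psi> mhom_minus[OF VM e g]])
    fix x v assume x: "x : Obj A" and v: "v : Sp (FT V) x"
    have pv: "\<pi> x v : Sp P x" using mhom_in[OF \<pi> x v] .
    have bv: "b1 x (a x (\<pi> x v)) : Sp P x" using mhom_in[OF b1 x mhom_in[OF a x pv]] .
    have "\<psi> x v = s x (\<pi> x v) - s x (b1 x (a x (\<pi> x v)))"
      unfolding \<psi>_def q_def using x pv mhom_diff[OF PM s x pv bv] by simp
    also have "s x (b1 x (a x (\<pi> x v))) = g x v" unfolding g_def b1_def b_def a_def e_def ..
    finally show "\<psi> x v = e x v - g x v" unfolding e_def .
  qed
  then have "top V V \<psi> z = 0\<^sub>m (V z) (V z)" if "z : verts Q" for z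
    using top_diff[OF e g that] topg[OF that] by auto
  then have rpsi: "rad_map V V \<psi>" unfolding rad_map_def using \<psi> by blast
  have ba: "b1 x (a x v) = v" if x: "x : Obj A" and v: "v : Sp P x" for x v
  proof -
    have qv: "q x v : Sp P x" using mhom_in[OF q x v] .
    have "\<psi> x (\<psi> x (s x v)) = 0" using rad_map_comp_zero[OF rpsi rpsi V V V] .
    moreover have "\<psi> x (s x v) = s x (q x v)" unfolding \<psi>_def using pis[OF x v] by simp
    moreover have "\<psi> x (s x (q x v)) = s x (q x v)" unfolding \<psi>_def using pis[OF x qv] qq[OF x v] by simp
    ultimately have "s x (q x v) = 0" by simp
    then have "q x v = 0" using pis[OF x qv] mhom_0[OF \<pi>, of x] by simp
    then show ?thesis unfolding q_def using x v by simp
  qed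
  show ?thesis using that[OF W a b1 ba ab1] .
qed

section \<open>The radical of a sum of representables\<close>

definition rad_part :: "('o => nat) => 'o => ('o, 'm) uvec set" where
  "rad_part V z = {v : Sp (FT V) z. ALL x:verts Q. ALL i < V x. v x i : rad A x z}"

lemma rad_part_submodule:
  assumes V: "finite (supp V)"
  shows "submodule scale A (FT V) (rad_part V)" unfolding submodule_def
proof (intro conjI ballI)
  fix x assume x: "x : Obj A"
  show "rad_part V x \<subseteq> Sp (FT V) x" by (auto simp: rad_part_def)
  show "U.subspace (rad_part V x)"
  proof (rule U.subspaceI)
    show "0 : rad_part V x" using amod_0[OF FT_amod[OF V] x] subspace_0[OF rad_subspace] x by (auto simp: rad_part_def)
    show "u + v : rad_part V x" if "u : rad_part V x" "v : rad_part V x" for u v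
      using that amod_add[OF FT_amod[OF V] x] rad_add x by (auto simp: rad_part_def)
    show "uscale scale c u : rad_part V x" if "u : rad_part V x" for c u
      using that amod_scale[OF FT_amod[OF V] x] subspace_scale[OF rad_subspace] x by (auto simp: rad_part_def uscale_apply)
  qed
next
  fix x y f assume "x : Obj A" "y : Obj A" "f : Hom A x y"
  then show "Act (FT V) x y f ` rad_part V x \<subseteq> rad_part V y"
    using Act_in[OF FT_amod[OF V]] rad_Cmp_left by (auto simp: rad_part_def FT_Act)
qed

lemma rad_Act_rad:
  assumes "z : Obj A" "x : Obj A" "f : rad A x z" "v : rad_part V x"
  shows "Act (FT V) x z f v = 0" using assms rad_rad by (auto simp: fun_eq_iff FT_Act rad_part_def)

text \<open>Zero top makes all components of the images of generators radical, and the radical part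
  is a submodule.\<close>

lemma rad_map_rad_part:
  assumes f: "rad_map V W f" and V: "finite (supp V)" and W: "finite (supp W)" and z: "z : Obj A" and v: "v : Sp (FT V) z"
  shows "f z v : rad_part W z"
proof -
  have fh: "f : mhom (FT V) (FT W)" using f unfolding rad_map_def by blast
  have g: "f x (gen x i) : rad_part W x" if x: "x : verts Q" and i: "i < V x" for x i
  proof -
    have m: "f x (gen x i) : Sp (FT W) x" using mhom_in[OF fh _ gen_in[where V=V, OF x i]] x by simp
    have "f x (gen x i) y j : rad A y x" if y: "y : verts Q" and j: "j < W y" for y j
    proof (cases "y = x")
      case True
      have "top V W f x $$ (j, i) = 0" using f x i j True unfolding rad_map_def by simp
      then have "\<tau> x (f x (gen x i) x j) = 0" using i j True by (simp add: top_def tv_def)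
      then show ?thesis using Hom_rad_part(3)[OF x x] FT_Hom[OF m y j] True by simp
    next
      case False
      then show ?thesis using FT_Hom[OF m y j] Hom_rad[OF y x] by simp
    qed
    then show ?thesis using m by (simp add: rad_part_def)
  qed
  have "Act (FT W) x z (v x i) (f x (gen x i)) : rad_part W z" if "x : supp V" "i < V x" for x i
    using submodule_Act[OF rad_part_submodule[OF W] _ z _ g] FT_Hom[OF v] that supp_verts by simp
  then have "(\<Sum>x\<in>supp V. \<Sum>i<V x. Act (FT W) x z (v x i) (f x (gen x i))) : rad_part W z"
    by (intro U.subspace_sum[OF submodule_subspace[OF rad_part_submodule[OF W] z]]) auto
  then show ?thesis using mhom_FT_expand[OF fh V z v] by simp
qed

text \<open>For a maximal submodule \<open>N\<close>, the sum \<open>N'\<close> of \<open>N\<close>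
  and the radical part is \<open>N\<close> or everything. In the second case a generator is
  \<open>n + r\<close> with \<open>n\<close> in \<open>N\<close> and \<open>r\<close> in the radical
  part; a radical morphism kills \<open>r\<close>, so radical multiples of generators lie in
  \<open>N\<close> already. This is Nakayama's lemma in its square zero form.\<close>

lemma rad_part_le_rad_amod:
  assumes V: "finite (supp V)" and z: "z : Obj A" and v: "v : rad_part V z"
  shows "v : rad_amod scale A (FT V) z"
proof -
  note VM = FT_amod[OF V]
  note RS = rad_part_submodule[OF V]
  have "v : N z" if N: "maximal_submodule scale A (FT V) N" for N
  proof -
    have NS: "submodule scale A (FT V) N" using N unfolding maximal_submodule_def by blast
    define N' where "N' x = {u : Sp (FT V) x. EX n:N x. u - n : rad_part V x}" for x
    have "submodule scale A (FT V) N'" unfolding submodule_def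
    proof (intro conjI ballI)
      fix x assume x: "x : Obj A"
      note sN = submodule_subspace[OF NS x] and sR = submodule_subspace[OF RS x]
      show "N' x \<subseteq> Sp (FT V) x" by (auto simp: N'_def)
      show "U.subspace (N' x)"
      proof (rule U.subspaceI)
        have "0 : N x" "0 - 0 : rad_part V x" using U.subspace_0 sN sR by auto
        then show "0 : N' x" unfolding N'_def using amod_0[OF VM x] by blast
        show "u + w : N' x" if u: "u : N' x" and w: "w : N' x" for u w
        proof -
          obtain n m where nm: "n : N x" "u - n : rad_part V x" "m : N x" "w - m : rad_part V x"
            using u w unfolding N'_def by blast
          have "(u + w) - (n + m) = (u - n) + (w - m)" by simp
          then have "n + m : N x" "(u + w) - (n + m) : rad_part V x"
            using nm U.subspace_add[OF sN] U.subspace_add[OF sR] by metis+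
          then show ?thesis using u w amod_add[OF VM x] unfolding N'_def by blast
        qed
        show "uscale scale c u : N' x" if u: "u : N' x" for c u
        proof -
          obtain n where n: "n : N x" "u - n : rad_part V x" using u unfolding N'_def by blast
          then have "uscale scale c n : N x" "uscale scale c u - uscale scale c n : rad_part V x"
            using U.subspace_scale[OF sN] U.subspace_scale[OF sR] by (simp_all add: U.scale_right_diff_distrib[symmetric])
          then show ?thesis using u amod_scale[OF VM x] unfolding N'_def by blast
        qed
      qed
    next
      fix x y f assume x: "x : Obj A" and y: "y : Obj A" and f: "f : Hom A x y"
      show "Act (FT V) x y f ` N' x \<subseteq> N' y"
      proof (rule image_subsetI)
        fix u assume u: "u : N' x"
        then obtain n where n: "n : N x" "u - n : rad_part V x" "u : Sp (FT V) x" unfolding N'_def by blast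
        have "Act (FT V) x y f (u - n) = Act (FT V) x y f u - Act (FT V) x y f n"
          using Act_diff[OF VM x y f n(3) submodule_in[OF NS x n(1)]] .
        moreover have "Act (FT V) x y f n : N y" using submodule_Act[OF NS x y f n(1)] .
        moreover have "Act (FT V) x y f (u - n) : rad_part V y" using submodule_Act[OF RS x y f n(2)] .
        ultimately show "Act (FT V) x y f u : N' y" unfolding N'_def using Act_in[OF VM x y f n(3)] by auto
      qed
    qed
    moreover have "N x \<subseteq> N' x" if x: "x : Obj A" for x
    proof
      fix n assume n: "n : N x"
      have "n - n : rad_part V x" using U.subspace_0[OF submodule_subspace[OF RS x]] by simp
      then show "n : N' x" unfolding N'_def using n submodule_in[OF NS x n] by blast
    qed
    ultimately consider "ALL x:Obj A. N' x = N x" | "ALL x:Obj A. N' x = Sp (FT V) x"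
      using N unfolding maximal_submodule_def by metis
    then show ?thesis
    proof cases
      case 1
      have "0 : N z" using U.subspace_0[OF submodule_subspace[OF NS z]] .
      then have "v : N' z" unfolding N'_def using v by (force simp: rad_part_def)
      then show ?thesis using 1 z by simp
    next
      case 2
      have "Act (FT V) x z (v x i) (gen x i) : N z" if "x : supp V" "i < V x" for x i
      proof -
        have x: "x : verts Q" using that supp_verts by blast
        have vr: "v x i : rad A x z" using v that x by (auto simp: rad_part_def)
        have gx: "gen x i : Sp (FT V) x" using gen_in[where V=V, OF x that(2)] .
        then have "gen x i : N' x" using 2 x by simp
        then obtain n where n: "n : N x" "gen x i - n : rad_part V x" unfolding N'_def by blast
        have "Act (FT V) x z (v x i) (gen x i) - Act (FT V) x z (v x i) n = Act (FT V) x z (v x i) (gen x i - n)"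
          using Act_diff[OF VM _ z _ gx submodule_in[OF NS _ n(1)]] x vr rad_Hom by simp
        also have "... = 0" using rad_Act_rad[OF z _ vr n(2)] x by simp
        finally show ?thesis using submodule_Act[OF NS _ z _ n(1)] x vr rad_Hom by simp
      qed
      then have "(\<Sum>x\<in>supp V. \<Sum>i<V x. Act (FT V) x z (v x i) (gen x i)) : N z"
        by (intro U.subspace_sum[OF submodule_subspace[OF NS z]]) auto
      moreover have vS: "v : Sp (FT V) z" using v by (simp add: rad_part_def)
      ultimately show ?thesis using FT_expand[OF vS V z] by simp
    qed
  qed
  then show ?thesis unfolding rad_amod_def using v by (simp add: rad_part_def)
qed

text \<open>The elements whose component with index \<open>(z, i)\<close> is radical form a maximal
  submodule, the kernel of a map onto a simple module. Lying in all maximal submodules therefore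
  forces every top coordinate to vanish.\<close>

lemma rad_amod_tau_zero:
  assumes X: "amod X" and a: "a : mhom X (FT V)" and b: "b : mhom (FT V) X" and V: "finite (supp V)"
    and ab: "!!x v. x : Obj A ==> v : Sp (FT V) x ==> a x (b x v) = v"
    and v: "v : rad_amod scale A X z" and z: "z : verts Q"
  shows "tv V z (a z v) = 0\<^sub>v (V z)"
proof (rule eq_vecI)
  fix i assume "i < dim_vec (0\<^sub>v (V z) :: 'k vec)"
  then have i: "i < V z" by simp
  note VM = FT_amod[OF V]
  have zO: "z : Obj A" using z by simp
  define N where "N y = {u : Sp X y. a y u z i : rad A z y}" for y
  have NS: "submodule scale A X N" unfolding submodule_def
  proof (intro conjI ballI)
    fix y assume y: "y : Obj A"
    show "N y \<subseteq> Sp X y" by (auto simp: N_def)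
    show "U.subspace (N y)" by (rule U.subspaceI)
        (use y zO amod_0[OF X y] amod_add[OF X y] amod_scale[OF X y] rad_add[OF zO y]
          subspace_0[OF rad_subspace[OF zO y]] subspace_scale[OF rad_subspace[OF zO y]] in
          \<open>auto simp: N_def mhom_0[OF a] mhom_add[OF a] mhom_scale[OF a] uscale_apply\<close>)
  next
    fix x y f assume "x : Obj A" "y : Obj A" "f : Hom A x y"
    then show "Act X x y f ` N x \<subseteq> N y"
      using Act_in[OF X] rad_Cmp_left zO z i by (auto simp: N_def mhom_nat[OF a] FT_Act)
  qed
  have "maximal_submodule scale A X N" unfolding maximal_submodule_def
  proof (intro conjI allI impI)
    show "submodule scale A X N" by (rule NS)
    have g: "gen z i : Sp (FT V) z" using gen_in[where V=V, OF z i] .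
    have "b z (gen z i) ~: N z" unfolding N_def using ab[OF zO g] Idn_notin[OF z] by (simp add: gen_def sg_def)
    moreover have "b z (gen z i) : Sp X z" using mhom_in[OF b zO g] .
    ultimately show "EX x:Obj A. N x ~= Sp X x" using zO by blast
  next
    fix N' assume N': "submodule scale A X N' & (ALL x:Obj A. N x \<subseteq> N' x)"
    then have N'S: "submodule scale A X N'" by blast
    show "(ALL x:Obj A. N' x = N x) \<or> (ALL x:Obj A. N' x = Sp X x)"
    proof (rule disjCI)
      assume "\<not> (ALL x:Obj A. N' x = Sp X x)"
      then have ne: "EX x:Obj A. N' x ~= Sp X x" by blast
      show "ALL x:Obj A. N' x = N x"
      proof (rule ccontr)
        assume "\<not> (ALL x:Obj A. N' x = N x)"
        then obtain y u where y: "y : Obj A" and u: "u : N' y" "u ~: N y" using N' by blast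
        have uX: "u : Sp X y" using submodule_in[OF N'S y u(1)] .
        have "a y u z i ~: rad A z y" using u(2) uX unfolding N_def by blast
        moreover have h: "a y u z i : Hom A z y" using FT_Hom[OF mhom_in[OF a y uX] z i] .
        ultimately obtain g where g: "g : Hom A y z" "Cmp A z y z g (a y u z i) = Idn A z"
          using rad_or_split_mono[OF vert_ind[OF z] y] by blast
        \<comment> \<open>Composing with \<open>g\<close> moves \<open>u\<close> to an element
          \<open>w\<close> of \<open>N'\<close> whose component is the identity. Any
          \<open>t\<close> differs from a multiple of \<open>w\<close> by an element of
          \<open>N\<close>, so \<open>N'\<close> is everything.\<close>
        define w where "w = Act X y z g u"
        have w: "w : N' z" unfolding w_def using submodule_Act[OF N'S y zO g(1) u(1)] .
        have wX: "w : Sp X z" using submodule_in[OF N'S zO w] .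
        have aw: "a z w z i = Idn A z" unfolding w_def mhom_nat[OF a y zO g(1) uX] using z i g(2) by (simp add: FT_Act)
        have "Sp X x \<subseteq> N' x" if x: "x : Obj A" for x
        proof
          fix t assume t: "t : Sp X x"
          have f: "a x t z i : Hom A z x" using FT_Hom[OF mhom_in[OF a x t] z i] .
          have tw: "Act X z x (a x t z i) w : Sp X x" using Act_in[OF X zO x f wX] .
          have "a x (t - Act X z x (a x t z i) w) z i = a x t z i - Cmp A z z x (a x t z i) (Idn A z)"
            unfolding mhom_diff[OF X a x t tw] mhom_nat[OF a zO x f wX] using z i aw by (simp add: FT_Act)
          also have "... = 0" using Cmp_Idn_right[OF zO x f] by simp
          finally have "t - Act X z x (a x t z i) w : N x"
            unfolding N_def using amod_diff[OF X x t tw] subspace_0[OF rad_subspace[OF zO x]] by simp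
          then have "t - Act X z x (a x t z i) w : N' x" using N' x by blast
          moreover have "Act X z x (a x t z i) w : N' x" using submodule_Act[OF N'S zO x f w] .
          ultimately have "(t - Act X z x (a x t z i) w) + Act X z x (a x t z i) w : N' x"
            by (rule U.subspace_add[OF submodule_subspace[OF N'S x]])
          then show "t : N' x" by simp
        qed
        then show False using ne submodule_in[OF N'S] by blast
      qed
    qed
  qed
  then have "v : N z" using v unfolding rad_amod_def by blast
  then have "a z v z i : rad A z z" unfolding N_def by blast
  then show "tv V z (a z v) $ i = 0\<^sub>v (V z) $ i" using i tau_rad[OF z] by (simp add: tv_def)
qed simp

section \<open>The functor \<open>F\<close> in coordinates\<close>

definition dims :: "('o, 'a, 'k) brep => int => 'o => nat" where
  "dims M n = (%x. Dim M (x, n))"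

lemma F_term_FT: "F_term A Q M n = FT (dims M n)" by (simp add: F_term_def FT_def dims_def)

text \<open>Representations of the box quiver that have finite total dimension in each degree but
  may be nonzero in infinitely many degrees, in contrast to \<open>is_qrep\<close>.\<close>

definition loc_rep :: "('o, 'a, 'k) brep => bool" where
  "loc_rep M \<longleftrightarrow> (ALL n. finite (supp (dims M n))) &
     (ALL q:arcs Q. ALL n. Mat M (q, n) : carrier_mat (Dim M (tail Q q, n - 1)) (Dim M (head Q q, n)))"

lemma loc_rep_fin: "loc_rep M ==> finite (supp (dims M n))" by (simp add: loc_rep_def)

lemma loc_rep_Mat: "loc_rep M ==> q : arcs Q ==>
    Mat M (q, n) : carrier_mat (Dim M (tail Q q, n - 1)) (Dim M (head Q q, n))" by (simp add: loc_rep_def)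

text \<open>A map \<open>f\<close> with zero top and the matrices of \<open>M\<close> along the
  arrows exists by \<open>mhom_exists\<close>. Expanding \<open>f\<close> in the basis of identities
  and arrows and regrouping yields the defining formula of \<open>F_diff\<close>, so the two agree
  and the coordinates can be read off.\<close>

lemma F_diff_coord:
  assumes M: "loc_rep M"
  shows "F_diff scale A Q \<rho> M n : mhom (FT (dims M n)) (FT (dims M (n - 1)))"
    and "rad_map (dims M n) (dims M (n - 1)) (F_diff scale A Q \<rho> M n)"
    and "!!q. q : arcs Q ==> arm (dims M n) (dims M (n - 1)) (F_diff scale A Q \<rho> M n) q = Mat M (q, n)"
proof -
  let ?V = "dims M n" and ?W = "dims M (n - 1)"
  note V = loc_rep_fin[OF M, of n] and W = loc_rep_fin[OF M, of "n - 1"]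
  obtain f where f: "f : mhom (FT ?V) (FT ?W)" and tf: "!!z. z : verts Q ==> top ?V ?W f z = 0\<^sub>m (?W z) (?V z)"
    and af: "!!q. q : arcs Q ==> arm ?V ?W f q = Mat M (q, n)"
    using mhom_exists[OF V W zero_carrier_mat, of "%q. Mat M (q, n)"] loc_rep_Mat[OF M, of _ n] unfolding dims_def by blast
  have fg: "f y (gen y i) x j = (\<Sum>q\<in>arr x y. scale (Mat M (q, n) $$ (j, i)) (\<rho> q))"
    if x: "x : verts Q" and y: "y : verts Q" and i: "i < ?V y" and j: "j < ?W x" for x y i j
  proof -
    have "f y (gen y i) x j : Hom A x y" using FT_gen_Hom[OF f V y i x j] .
    note ex = Hom_expand[OF x y this]
    have t: "\<tau> x (f y (gen y i) x j) = 0" if "x = y"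
    proof -
      have "top ?V ?W f y $$ (j, i) = 0" using tf[OF y] i j that by simp
      then show ?thesis using i j that by (simp add: top_def tv_def)
    qed
    have k: "\<kappa> q (f y (gen y i) x j) = Mat M (q, n) $$ (j, i)" if "q : arr x y" for q
    proof -
      have "arm ?V ?W f q $$ (j, i) = Mat M (q, n) $$ (j, i)" using af arr_D[OF that] by simp
      then show ?thesis using arr_D[OF that] i j by (auto simp: arm_def av_def)
    qed
    show ?thesis by (subst ex) (use t k in auto)
  qed
  have "F_diff scale A Q \<rho> M n = f"
  proof (rule ext, rule ext)
    fix z v
    show "F_diff scale A Q \<rho> M n z v = f z v"
    proof (cases "z : Obj A & v : Sp (FT ?V) z")
      case True
      then have z: "z : Obj A" and v: "v : Sp (FT ?V) z" by auto
      have fin: "f z v : Sp (FT ?W) z" using mhom_in[OF f z v] .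
      show ?thesis
      proof (rule ext, rule ext)
        fix x j
        show "F_diff scale A Q \<rho> M n z v x j = f z v x j"
        proof (cases "x : verts Q & j < ?W x")
          case True
          then have x: "x : verts Q" and j: "j < ?W x" by auto
          let ?T = "{q : arcs Q. tail Q q = x}"
          have finT: "finite ?T" using finite_star[OF x] by blast
          define t where "t q y = (\<Sum>i<?V y. scale (Mat M (q, n) $$ (j, i)) (Cmp A x y z (v y i) (\<rho> q)))" for q y
          have "f z v x j = (\<Sum>y\<in>supp ?V. \<Sum>i<?V y. Cmp A x y z (v y i) (f y (gen y i) x j))"
            unfolding mhom_FT_expand[OF f V z v] sum_fun2 using x j by (simp add: FT_Act)
          also have "... = (\<Sum>y\<in>supp ?V. \<Sum>i<?V y. \<Sum>q\<in>arr x y. scale (Mat M (q, n) $$ (j, i)) (Cmp A x y z (v y i) (\<rho> q)))"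
          proof (intro sum.cong refl)
            fix y i assume y: "y : supp ?V" and i: "i : {..<?V y}"
            have yv: "y : verts Q" using y supp_verts by blast
            have vi: "v y i : Hom A y z" using FT_Hom[OF v yv] i by simp
            have r: "\<rho> q : Hom A x y" if "q : arr x y" for q using rho_Hom[of q] arr_D[OF that] by auto
            have "Cmp A x y z (v y i) (f y (gen y i) x j) =
              (\<Sum>q\<in>arr x y. Cmp A x y z (v y i) (scale (Mat M (q, n) $$ (j, i)) (\<rho> q)))"
              unfolding fg[OF x yv _ j, of i, OF i[unfolded lessThan_iff]]
              using r x yv z vi by (intro Cmp_sum_right) (auto intro: Hom_scale)
            also have "... = (\<Sum>q\<in>arr x y. scale (Mat M (q, n) $$ (j, i)) (Cmp A x y z (v y i) (\<rho> q)))"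
              using r x yv z vi by (intro sum.cong refl Cmp_scale_right) auto
            finally show "Cmp A x y z (v y i) (f y (gen y i) x j) =
              (\<Sum>q\<in>arr x y. scale (Mat M (q, n) $$ (j, i)) (Cmp A x y z (v y i) (\<rho> q)))" .
          qed
          also have "... = (\<Sum>y\<in>supp ?V. \<Sum>q\<in>arr x y. t q y)"
            unfolding t_def by (intro sum.cong refl sum.swap)
          \<comment> \<open>The finitely many arrows leaving \<open>x\<close> are sorted by their
            heads, which gives both sums fixed ranges and lets them be exchanged.\<close>
          also have "... = (\<Sum>y\<in>supp ?V. \<Sum>q\<in>?T. if head Q q = y then t q y else 0)"
          proof (rule sum.cong[OF refl])
            fix y assume "y : supp ?V"
            have "arr x y = {q : ?T. head Q q = y}" by (auto simp: arr_def)
            then show "(\<Sum>q\<in>arr x y. t q y) = (\<Sum>q\<in>?T. if head Q q = y then t q y else 0)"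
              using sum.inter_filter[OF finT, of "%q. t q y" "%q. head Q q = y"] by simp
          qed
          also have "... = (\<Sum>q\<in>?T. \<Sum>y\<in>supp ?V. if head Q q = y then t q y else 0)" by (rule sum.swap)
          also have "... = (\<Sum>q\<in>?T. t q (head Q q))"
          proof (rule sum.cong[OF refl])
            fix q assume "q : ?T"
            \<comment> \<open>A head outside the support contributes an empty sum.\<close>
            then have "head Q q ~: supp ?V ==> ?V (head Q q) = 0" by (simp add: supp_def)
            then show "(\<Sum>y\<in>supp ?V. if head Q q = y then t q y else 0) = t q (head Q q)"
              using V by (auto simp: sum.delta' t_def)
          qed
          also have "... = F_diff scale A Q \<rho> M n z v x j"
            using z v x j by (simp add: F_diff_def F_term_FT t_def dims_def Let_def)
          finally show ?thesis by simp
        next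
          case False
          then show ?thesis using FT_out[OF fin] z v by (auto simp: F_diff_def F_term_FT dims_def)
        qed
      qed
    next
      case False
      then show ?thesis using mhom_out[OF f] by (auto simp: F_diff_def F_term_FT)
    qed
  qed
  then show "F_diff scale A Q \<rho> M n : mhom (FT ?V) (FT ?W)" "rad_map ?V ?W (F_diff scale A Q \<rho> M n)"
    "!!q. q : arcs Q ==> arm ?V ?W (F_diff scale A Q \<rho> M n) q = Mat M (q, n)"
    using f tf af unfolding rad_map_def by auto
qed

end

section \<open>Complexes and homotopy\<close>

context k_category
begin

abbreviation "chain \<equiv> chain_maps scale A"
abbreviation "cpx \<equiv> is_complex scale A"
abbreviation "ccat \<equiv> complexes scale A"
abbreviation "hcat \<equiv> homotopy_category scale A"
abbreviation "htp \<equiv> homotopic scale A"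
abbreviation "hcl \<equiv> homotopy_class scale A"

definition cid :: "('o, 'm) cplx => ('o, 'm) cmap" where
  "cid X = (%n. mid (Tm X n))"

definition ccomp :: "('o, 'm) cmap => ('o, 'm) cmap => ('o, 'm) cmap" where
  "ccomp g f = (%n x v. g n x (f n x v))"

definition csum :: "('o, 'm) cmap => ('o, 'm) cmap => ('o, 'm) cmap" where
  "csum f g = (%n x v. f n x v + g n x v)"

definition czero :: "('o, 'm) cmap" where
  "czero = (%n x v. 0)"

lemma complexes_simps [simp]:
  "Obj (ccat S) = S" "Hom (ccat S) = chain" "Idn (ccat S) = cid"
  "Cmp (ccat S) X Y Z g f = ccomp g f" "precat.Sum (ccat S) X Y f g = csum f g"
  "Zer (ccat S) X Y = czero" unfolding complexes_def cid_def ccomp_def csum_def czero_def by (simp_all add: fun_eq_iff)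

lemma homotopy_category_simps [simp]:
  "Obj (hcat S) = S"
  "Hom (hcat S) X Y = hcl X Y ` chain X Y"
  "Idn (hcat S) X = hcl X X (cid X)"
  "Cmp (hcat S) X Y Z G F = (\<Union>f\<in>F. \<Union>g\<in>G. hcl X Z (ccomp g f))"
  "precat.Sum (hcat S) X Y F G = (\<Union>f\<in>F. \<Union>g\<in>G. hcl X Y (csum f g))"
  "Zer (hcat S) X Y = hcl X Y czero" unfolding homotopy_category_def Let_def complexes_simps by simp_all

lemma complex_amod: "cpx X ==> amod (Tm X n)" unfolding is_complex_def by simp

lemma complex_Df: "cpx X ==> Df X n : mhom (Tm X n) (Tm X (n - 1))" unfolding is_complex_def by simp

lemma complex_Df': "cpx X ==> Df X (n + 1) : mhom (Tm X (n + 1)) (Tm X n)" using complex_Df[of X "n + 1"] by simp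

lemma complex_DD: "cpx X ==> Df X n x (Df X (n + 1) x v) = 0" unfolding is_complex_def Mod_simps by meson

lemma complexI:
  assumes T: "!!n. amod (Tm X n)" and d: "!!n. Df X n : mhom (Tm X n) (Tm X (n - 1))"
    and dd: "!!n x v. x : Obj A ==> v : Sp (Tm X (n + 1)) x ==> Df X n x (Df X (n + 1) x v) = 0"
  shows "cpx X"
proof -
  have d': "Df X (n + 1) : mhom (Tm X (n + 1)) (Tm X n)" for n using d[of "n + 1"] by simp
  have "(%x v. Df X n x (Df X (n + 1) x v)) = (%x v. 0)" for n
    by (rule mhom_eqI[OF mhom_comp[OF d' d] mhom_zero_map[OF T]]) (rule dd)
  then show ?thesis unfolding is_complex_def using T d by simp
qed

lemma chain_hom: "f : chain X Y ==> f n : mhom (Tm X n) (Tm Y n)" unfolding chain_maps_def by simp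

lemma chain_comm: "f : chain X Y ==> Df Y n x (f n x v) = f (n - 1) x (Df X n x v)"
  unfolding chain_maps_def Mod_simps by (metis (mono_tags, lifting) mem_Collect_eq)

lemma chainI:
  assumes X: "cpx X" and Y: "cpx Y"
    and f: "!!n. f n : mhom (Tm X n) (Tm Y n)"
    and c: "!!n x v. x : Obj A ==> v : Sp (Tm X n) x ==> Df Y n x (f n x v) = f (n - 1) x (Df X n x v)"
  shows "f : chain X Y"
proof -
  have "(%x v. Df Y n x (f n x v)) = (%x v. f (n - 1) x (Df X n x v))" for n
    by (rule mhom_eqI[OF mhom_comp[OF f complex_Df[OF Y]] mhom_comp[OF complex_Df[OF X] f]]) (rule c)
  then show ?thesis unfolding chain_maps_def using f by simp
qed

lemma chain_cid: "cpx X ==> cid X : chain X X" by (intro chainI)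
    (auto simp: cid_def complex_amod intro: mhom_mid dest: mhom_in[OF complex_Df])

lemma chain_ccomp:
  assumes "cpx X" "cpx Z" and f: "f : chain X Y" and g: "g : chain Y Z"
  shows "ccomp g f : chain X Z"
proof (rule chainI[OF assms(1,2)])
  show "ccomp g f n : mhom (Tm X n) (Tm Z n)" for n unfolding ccomp_def using mhom_comp[OF chain_hom[OF f] chain_hom[OF g]] .
  show "Df Z n x (ccomp g f n x v) = ccomp g f (n - 1) x (Df X n x v)" for n x v
    unfolding ccomp_def by (simp add: chain_comm[OF f] chain_comm[OF g])
qed

lemma chain_csum:
  assumes X: "cpx X" and Y: "cpx Y" and f: "f : chain X Y" and g: "g : chain X Y"
  shows "csum f g : chain X Y"
proof (rule chainI[OF X Y])
  show "csum f g n : mhom (Tm X n) (Tm Y n)" for n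
    unfolding csum_def using mhom_plus[OF complex_amod[OF Y] chain_hom[OF f] chain_hom[OF g]] .
  show "Df Y n x (csum f g n x v) = csum f g (n - 1) x (Df X n x v)" if "x : Obj A" "v : Sp (Tm X n) x" for n x v
    unfolding csum_def using mhom_add[OF complex_Df[OF Y], of x "f n x v" n "g n x v"] that
      mhom_in[OF chain_hom[OF f]] mhom_in[OF chain_hom[OF g]] by (simp add: chain_comm[OF f] chain_comm[OF g])
qed

lemma chain_czero: "cpx X ==> cpx Y ==> czero : chain X Y"
  by (intro chainI) (auto simp: czero_def mhom_zero_map[OF complex_amod] mhom_0[OF complex_Df])

text \<open>\<open>homotopic\<close> demands its identity for all \<open>x\<close> and
  \<open>v\<close>; outside the modules both sides vanish, since maps are extended by zero.\<close>

lemma htpI: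
  assumes Y: "cpx Y" and X: "cpx X" and f: "f : chain X Y" and g: "g : chain X Y"
    and h: "!!n. h n : mhom (Tm X n) (Tm Y (n + 1))"
    and e: "!!n x v. x : Obj A ==> v : Sp (Tm X n) x ==>
      f n x v - g n x v = Df Y (n + 1) x (h n x v) + h (n - 1) x (Df X n x v)"
  shows "htp X Y f g" unfolding homotopic_def
proof (intro exI[of _ h] conjI allI)
  show "h n : Hom (Mod scale A) (Tm X n) (Tm Y (n + 1))" for n using h by simp
  show "f n x v - g n x v = Df Y (n + 1) x (h n x v) + h (n - 1) x (Df X n x v)" for n x v
  proof (cases "x : Obj A & v : Sp (Tm X n) x")
    case False
    then show ?thesis using mhom_out[OF chain_hom[OF f]] mhom_out[OF chain_hom[OF g]] mhom_out[OF h]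
        mhom_out[OF complex_Df[OF X]] mhom_0[OF complex_Df[OF Y]] mhom_0[OF h] by simp
  qed (use e in blast)
qed

lemma htpE:
  assumes "htp X Y f g"
  obtains h where "!!n. h n : mhom (Tm X n) (Tm Y (n + 1))"
    "!!n x v. f n x v - g n x v = Df Y (n + 1) x (h n x v) + h (n - 1) x (Df X n x v)"
  using assms unfolding homotopic_def Mod_simps by blast

lemma htp_refl: "cpx X ==> cpx Y ==> f : chain X Y ==> htp X Y f f"
  by (rule htpI[where h = "%n x v. 0"]) (auto simp: mhom_zero_map[OF complex_amod] mhom_0[OF complex_Df])

lemma htp_sym:
  assumes X: "cpx X" and Y: "cpx Y" and f: "f : chain X Y" and g: "g : chain X Y" and "htp X Y f g"
  shows "htp X Y g f"
proof -
  obtain h where h: "!!n. h n : mhom (Tm X n) (Tm Y (n + 1))"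
    and e: "!!n x v. f n x v - g n x v = Df Y (n + 1) x (h n x v) + h (n - 1) x (Df X n x v)"
    using htpE[OF assms(5)] by blast
  show ?thesis
  proof (rule htpI[where h = "%n x v. 0 - h n x v", OF Y X g f])
    show "(%x v. 0 - h n x v) : mhom (Tm X n) (Tm Y (n + 1))" for n
      using mhom_minus[OF complex_amod[OF Y] mhom_zero_map[OF complex_amod[OF Y]] h] .
    fix n x v assume x: "x : Obj A" and v: "v : Sp (Tm X n) x"
    have "Df Y (n + 1) x (0 - h n x v) = 0 - Df Y (n + 1) x (h n x v)"
      using mhom_diff[OF complex_amod[OF Y] complex_Df[OF Y] x amod_0[OF complex_amod[OF Y] x] mhom_in[OF h x v]]
        mhom_0[OF complex_Df[OF Y]] by simp
    then show "g n x v - f n x v = Df Y (n + 1) x (0 - h n x v) + (0 - h (n - 1) x (Df X n x v))"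
      using e[of n x v] by (simp add: algebra_simps)
  qed
qed

lemma htp_csum:
  assumes X: "cpx X" and Y: "cpx Y" and c: "f : chain X Y" "f' : chain X Y" "g : chain X Y" "g' : chain X Y"
    and 1: "htp X Y f f'" and 2: "htp X Y g g'"
  shows "htp X Y (csum f g) (csum f' g')"
proof -
  obtain h where h: "!!n. h n : mhom (Tm X n) (Tm Y (n + 1))"
    and e: "!!n x v. f n x v - f' n x v = Df Y (n + 1) x (h n x v) + h (n - 1) x (Df X n x v)" using htpE[OF 1] by blast
  obtain k where k: "!!n. k n : mhom (Tm X n) (Tm Y (n + 1))"
    and e': "!!n x v. g n x v - g' n x v = Df Y (n + 1) x (k n x v) + k (n - 1) x (Df X n x v)" using htpE[OF 2] by blast
  show ?thesis
  proof (rule htpI[where h = "%n x v. h n x v + k n x v", OF Y X chain_csum[OF X Y] chain_csum[OF X Y]])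
    show "(%x v. h n x v + k n x v) : mhom (Tm X n) (Tm Y (n + 1))" for n using mhom_plus[OF complex_amod[OF Y] h k] .
    fix n x v assume x: "x : Obj A" and v: "v : Sp (Tm X n) x"
    have "csum f g n x v - csum f' g' n x v = (f n x v - f' n x v) + (g n x v - g' n x v)" by (simp add: csum_def)
    then show "csum f g n x v - csum f' g' n x v = Df Y (n + 1) x (h n x v + k n x v) + (h (n - 1) x (Df X n x v) + k (n - 1) x (Df X n x v))"
      unfolding e e' using mhom_add[OF complex_Df[OF Y] x mhom_in[OF h x v] mhom_in[OF k x v]] by (simp add: algebra_simps)
  qed (use c in auto)
qed

lemma htp_trans:
  assumes X: "cpx X" and Y: "cpx Y" and c: "f : chain X Y" "g : chain X Y" "k : chain X Y"
    and 1: "htp X Y f g" and 2: "htp X Y g k"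
  shows "htp X Y f k"
proof -
  obtain h where h: "!!n. h n : mhom (Tm X n) (Tm Y (n + 1))"
    and e: "!!n x v. f n x v - g n x v = Df Y (n + 1) x (h n x v) + h (n - 1) x (Df X n x v)" using htpE[OF 1] by blast
  obtain h' where h': "!!n. h' n : mhom (Tm X n) (Tm Y (n + 1))"
    and e': "!!n x v. g n x v - k n x v = Df Y (n + 1) x (h' n x v) + h' (n - 1) x (Df X n x v)" using htpE[OF 2] by blast
  show ?thesis
  proof (rule htpI[where h = "%n x v. h n x v + h' n x v", OF Y X c(1,3)])
    show "(%x v. h n x v + h' n x v) : mhom (Tm X n) (Tm Y (n + 1))" for n using mhom_plus[OF complex_amod[OF Y] h h'] .
    fix n x v assume x: "x : Obj A" and v: "v : Sp (Tm X n) x"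
    have "f n x v - k n x v = (f n x v - g n x v) + (g n x v - k n x v)" by simp
    then show "f n x v - k n x v = Df Y (n + 1) x (h n x v + h' n x v) + (h (n - 1) x (Df X n x v) + h' (n - 1) x (Df X n x v))"
      unfolding e e' using mhom_add[OF complex_Df[OF Y] x mhom_in[OF h x v] mhom_in[OF h' x v]] by (simp add: algebra_simps)
  qed
qed

lemma htp_ccomp:
  assumes X: "cpx X" and Y: "cpx Y" and Z: "cpx Z"
    and c: "f : chain X Y" "f' : chain X Y" "g : chain Y Z" "g' : chain Y Z"
    and 1: "htp X Y f f'" and 2: "htp Y Z g g'"
  shows "htp X Z (ccomp g f) (ccomp g' f')"
proof -
  obtain h where h: "!!n. h n : mhom (Tm X n) (Tm Y (n + 1))"
    and e: "!!n x v. f n x v - f' n x v = Df Y (n + 1) x (h n x v) + h (n - 1) x (Df X n x v)" using htpE[OF 1] by blast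
  obtain k where k: "!!n. k n : mhom (Tm Y n) (Tm Z (n + 1))"
    and e': "!!n x v. g n x v - g' n x v = Df Z (n + 1) x (k n x v) + k (n - 1) x (Df Y n x v)" using htpE[OF 2] by blast
  show ?thesis
  \<comment> \<open>From \<open>g f - g' f' = g (f - f') + (g - g') f'\<close>: the first term has
    homotopy \<open>g h\<close>, the second \<open>k f'\<close>.\<close>
  proof (rule htpI[where h = "%n x v. g (n + 1) x (h n x v) + k n x (f' n x v)", OF Z X chain_ccomp[OF X Z] chain_ccomp[OF X Z]])
    show "(%x v. g (n + 1) x (h n x v) + k n x (f' n x v)) : mhom (Tm X n) (Tm Z (n + 1))" for n
      using mhom_plus[OF complex_amod[OF Z] mhom_comp[OF h chain_hom[OF c(3)]] mhom_comp[OF chain_hom[OF c(2)] k]] .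
    fix n x v assume x: "x : Obj A" and v: "v : Sp (Tm X n) x"
    have fv: "f n x v : Sp (Tm Y n) x" "f' n x v : Sp (Tm Y n) x" using mhom_in[OF chain_hom x v] c by blast+
    have hv: "h n x v : Sp (Tm Y (n + 1)) x" using mhom_in[OF h x v] .
    have Dh: "Df Y (n + 1) x (h n x v) : Sp (Tm Y n) x" using mhom_in[OF complex_Df'[OF Y] x hv] .
    have hD: "h (n - 1) x (Df X n x v) : Sp (Tm Y n) x" using mhom_in[OF h x mhom_in[OF complex_Df[OF X] x v]] by simp
    have "ccomp g f n x v - ccomp g' f' n x v = g n x (f n x v - f' n x v) + (g n x (f' n x v) - g' n x (f' n x v))"
      unfolding ccomp_def using mhom_diff[OF complex_amod[OF Y] chain_hom[OF c(3)] x fv] by simp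
    also have "g n x (f n x v - f' n x v) = g n x (Df Y (n + 1) x (h n x v)) + g n x (h (n - 1) x (Df X n x v))"
      unfolding e using mhom_add[OF chain_hom[OF c(3)] x Dh hD] .
    also have "g n x (Df Y (n + 1) x (h n x v)) = Df Z (n + 1) x (g (n + 1) x (h n x v))"
      using chain_comm[OF c(3), of "n + 1"] by simp
    also have "g n x (f' n x v) - g' n x (f' n x v) = Df Z (n + 1) x (k n x (f' n x v)) + k (n - 1) x (f' (n - 1) x (Df X n x v))"
      unfolding e' chain_comm[OF c(2)] ..
    also have "Df Z (n + 1) x (g (n + 1) x (h n x v)) + g n x (h (n - 1) x (Df X n x v)) +
       (Df Z (n + 1) x (k n x (f' n x v)) + k (n - 1) x (f' (n - 1) x (Df X n x v))) =
       Df Z (n + 1) x (g (n + 1) x (h n x v) + k n x (f' n x v)) +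
       (g (n - 1 + 1) x (h (n - 1) x (Df X n x v)) + k (n - 1) x (f' (n - 1) x (Df X n x v)))"
      using mhom_add[OF complex_Df[OF Z] x mhom_in[OF chain_hom[OF c(3)] x hv] mhom_in[OF k x fv(2)]]
      by (simp add: algebra_simps)
    finally show "ccomp g f n x v - ccomp g' f' n x v = Df Z (n + 1) x (g (n + 1) x (h n x v) + k n x (f' n x v)) +
       (g (n - 1 + 1) x (h (n - 1) x (Df X n x v)) + k (n - 1) x (f' (n - 1) x (Df X n x v)))" .
  qed (use c in auto)
qed

context
  fixes X Y assumes X: "cpx X" and Y: "cpx Y"
begin

lemma hcl_self: "f : chain X Y ==> f : hcl X Y f" unfolding homotopy_class_def using htp_refl[OF X Y] by blast

lemma hcl_eq_iff:
  assumes f: "f : chain X Y" and g: "g : chain X Y"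
  shows "hcl X Y f = hcl X Y g \<longleftrightarrow> htp X Y f g"
proof
  assume "hcl X Y f = hcl X Y g"
  then have "g : hcl X Y f" using hcl_self[OF g] by blast
  then show "htp X Y f g" unfolding homotopy_class_def by blast
next
  assume *: "htp X Y f g"
  show "hcl X Y f = hcl X Y g" using htp_trans[OF X Y f g _ *] htp_trans[OF X Y g f _ htp_sym[OF X Y f g *]]
    unfolding homotopy_class_def by blast
qed

lemma hcl_D: "g : hcl X Y f ==> g : chain X Y & htp X Y f g" unfolding homotopy_class_def by blast

end

text \<open>Composition of classes is a union over all representatives; by \<open>htp_ccomp\<close>
  every member of that union is the same class.\<close>

lemma hcl_ccomp:
  assumes X: "cpx X" and Y: "cpx Y" and Z: "cpx Z"
    and f: "f : chain X Y" and g: "g : chain Y Z"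
  shows "(\<Union>f'\<in>hcl X Y f. \<Union>g'\<in>hcl Y Z g. hcl X Z (ccomp g' f')) = hcl X Z (ccomp g f)"
proof -
  have "hcl X Z (ccomp g' f') = hcl X Z (ccomp g f)" if "f' : hcl X Y f" "g' : hcl Y Z g" for f' g'
  proof -
    note f' = hcl_D[OF X Y that(1)] and g' = hcl_D[OF Y Z that(2)]
    have "htp X Z (ccomp g f) (ccomp g' f')" using htp_ccomp[OF X Y Z f _ g] f' g' by blast
    then show ?thesis using hcl_eq_iff[OF X Z chain_ccomp[OF X Z f g] chain_ccomp[OF X Z, of f' Y g']] f' g' by blast
  qed
  then show ?thesis using hcl_self[OF X Y f] hcl_self[OF Y Z g] by blast
qed

lemma hcl_csum:
  assumes X: "cpx X" and Y: "cpx Y"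
    and f: "f : chain X Y" and g: "g : chain X Y"
  shows "(\<Union>f'\<in>hcl X Y f. \<Union>g'\<in>hcl X Y g. hcl X Y (csum f' g')) = hcl X Y (csum f g)"
proof -
  have "hcl X Y (csum f' g') = hcl X Y (csum f g)" if "f' : hcl X Y f" "g' : hcl X Y g" for f' g'
  proof -
    note f' = hcl_D[OF X Y that(1)] and g' = hcl_D[OF X Y that(2)]
    have "htp X Y (csum f g) (csum f' g')" using htp_csum[OF X Y f _ g] f' g' by blast
    then show ?thesis using hcl_eq_iff[OF X Y chain_csum[OF X Y f g] chain_csum[OF X Y, of f' g']] f' g' by blast
  qed
  then show ?thesis using hcl_self[OF X Y f] hcl_self[OF X Y g] by blast
qed

lemma ccomp_cid_right: "f : chain X Y ==> ccomp f (cid X) = f"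
proof -
  assume f: "f : chain X Y"
  have "f n x (mid (Tm X n) x v) = f n x v" for n x v
    using mhom_out[OF chain_hom[OF f], of x v n] mhom_0[OF chain_hom[OF f], of n x] by (simp add: mid_def)
  then show ?thesis unfolding ccomp_def cid_def by simp
qed

lemma ccomp_cid_left: "f : chain X Y ==> ccomp (cid Y) f = f"
proof -
  assume f: "f : chain X Y"
  have "mid (Tm Y n) x (f n x v) = f n x v" for n x v
    using mhom_out[OF chain_hom[OF f], of x v n] mhom_in[OF chain_hom[OF f], of x v n] by (auto simp: mid_def)
  then show ?thesis unfolding ccomp_def cid_def by simp
qed

lemma ccomp_assoc: "ccomp (ccomp h g) f = ccomp h (ccomp g f)" by (simp add: ccomp_def)

lemma ccomp_csum_left: "ccomp (csum g g') f = csum (ccomp g f) (ccomp g' f)" unfolding ccomp_def csum_def by (rule refl)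

lemma ccomp_csum_right:
  assumes f: "f : chain X Y" "f' : chain X Y" and g: "g : chain Y Z"
  shows "ccomp g (csum f f') = csum (ccomp g f) (ccomp g f')"
proof -
  have "g n x (f n x v + f' n x v) = g n x (f n x v) + g n x (f' n x v)" for n x v
  proof (cases "x : Obj A & v : Sp (Tm X n) x")
    case True
    then show ?thesis using mhom_add[OF chain_hom[OF g]] mhom_in[OF chain_hom[OF f(1)]] mhom_in[OF chain_hom[OF f(2)]] by simp
  next
    case False
    then show ?thesis using mhom_out[OF chain_hom[OF f(1)]] mhom_out[OF chain_hom[OF f(2)]] mhom_0[OF chain_hom[OF g]] by simp
  qed
  then show ?thesis unfolding ccomp_def csum_def by simp
qed

lemma ccomp_czero: "ccomp czero f = czero" "g : chain Y Z ==> ccomp g czero = czero"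
  unfolding ccomp_def czero_def using mhom_0[OF chain_hom] by fastforce+

lemma preadditive_complexes:
  assumes S: "!!X. X : S ==> cpx X"
  shows "preadditive (ccat S)" by unfold_locales
    (use S in \<open>simp_all add: chain_cid chain_ccomp chain_csum ccomp_cid_right ccomp_cid_left ccomp_assoc
      ccomp_czero ccomp_csum_left ccomp_csum_right\<close>)

lemma preadditive_homotopy_category:
  assumes S: "!!X. X : S ==> cpx X"
  shows "preadditive (hcat S)" by (unfold_locales; unfold homotopy_category_simps; clarify?)
    (use S in \<open>simp_all add: hcl_ccomp hcl_csum chain_cid chain_ccomp chain_csum chain_czero ccomp_cid_right
      ccomp_cid_left ccomp_assoc ccomp_czero ccomp_csum_left ccomp_csum_right\<close>)

lemma isomorphic_homotopyI:
  assumes S: "!!X. X : S ==> cpx X" and X: "X : S" and Y: "Y : S"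
    and f: "f : chain X Y" and g: "g : chain Y X"
    and 1: "htp X X (ccomp g f) (cid X)" and 2: "htp Y Y (ccomp f g) (cid Y)"
  shows "isomorphic (hcat S) X Y"
proof -
  note c = S[OF X] S[OF Y]
  have e1: "(\<Union>f'\<in>hcl X Y f. \<Union>g'\<in>hcl Y X g. hcl X X (ccomp g' f')) = hcl X X (cid X)"
    using hcl_ccomp[OF c(1) c(2) c(1) f g] 1
      hcl_eq_iff[OF c(1) c(1) chain_ccomp[OF c(1) c(1) f g] chain_cid[OF c(1)]] by simp
  have e2: "(\<Union>g'\<in>hcl Y X g. \<Union>f'\<in>hcl X Y f. hcl Y Y (ccomp f' g')) = hcl Y Y (cid Y)"
    using hcl_ccomp[OF c(2) c(1) c(2) g f] 2
      hcl_eq_iff[OF c(2) c(2) chain_ccomp[OF c(2) c(2) g f] chain_cid[OF c(2)]] by simp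
  show ?thesis unfolding isomorphic_def homotopy_category_simps
    using X Y e1 e2 imageI[OF f, of "hcl X Y"] imageI[OF g, of "hcl Y X"] by meson
qed

lemma isomorphic_complexes_homotopy:
  assumes S: "!!X. X : S ==> cpx X" and i: "isomorphic (ccat S') X Y"
    and X: "X : S" and Y: "Y : S"
  shows "isomorphic (hcat S) X Y"
proof -
  obtain f g where fg: "f : chain X Y" "g : chain Y X" "ccomp g f = cid X" "ccomp f g = cid Y"
    using i unfolding isomorphic_def by auto
  show ?thesis using isomorphic_homotopyI[OF S X Y fg(1,2)] fg(3,4) htp_refl chain_cid S X Y by simp
qed

definition exact_at :: "('o, 'm) cplx => int => bool" where
  "exact_at X n \<longleftrightarrow> (ALL x:Obj A. cycles X n x = boundaries X n x)"

lemma boundaries_cycles: "cpx X ==> x : Obj A ==> boundaries X n x \<subseteq> cycles X n x"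
  unfolding boundaries_def cycles_def using mhom_in[OF complex_Df'] complex_DD by auto

text \<open>For a cycle \<open>v\<close> of \<open>X\<close> the homotopy gives
  \<open>v = g f v - d h v\<close>, and \<open>f v\<close> is a boundary by exactness of
  \<open>Y\<close>.\<close>

lemma exact_at_retract:
  assumes X: "cpx X" and Y: "cpx Y"
    and f: "f : chain X Y" and g: "g : chain Y X" and 1: "htp X X (ccomp g f) (cid X)" and ex: "exact_at Y n"
  shows "exact_at X n"
proof -
  obtain h where h: "!!n. h n : mhom (Tm X n) (Tm X (n + 1))"
    and e: "!!n x v. ccomp g f n x v - cid X n x v = Df X (n + 1) x (h n x v) + h (n - 1) x (Df X n x v)"
    using htpE[OF 1] by blast
  have "v : boundaries X n x" if x: "x : Obj A" and v: "v : cycles X n x" for x v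
  proof -
    have vX: "v : Sp (Tm X n) x" and dv: "Df X n x v = 0" using v by (auto simp: cycles_def)
    have "f n x v : cycles Y n x"
      unfolding cycles_def using mhom_in[OF chain_hom[OF f] x vX] chain_comm[OF f] dv mhom_0[OF chain_hom[OF f]] by simp
    then obtain w where w: "w : Sp (Tm Y (n + 1)) x" "f n x v = Df Y (n + 1) x w"
      using ex x unfolding exact_at_def boundaries_def by blast
    have gw: "g (n + 1) x w : Sp (Tm X (n + 1)) x" using mhom_in[OF chain_hom[OF g] x w(1)] .
    have hv: "h n x v : Sp (Tm X (n + 1)) x" using mhom_in[OF h x vX] .
    have "g n x (f n x v) = Df X (n + 1) x (g (n + 1) x w)" unfolding w(2) using chain_comm[OF g, of "n + 1"] by simp
    then have "v = Df X (n + 1) x (g (n + 1) x w) - Df X (n + 1) x (h n x v)"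
      using e[of n x v] x vX dv mhom_0[OF h] by (simp add: ccomp_def cid_def algebra_simps)
    also have "... = Df X (n + 1) x (g (n + 1) x w - h n x v)"
      using mhom_diff[OF complex_amod[OF X] complex_Df[OF X] x gw hv] by simp
    finally show ?thesis unfolding boundaries_def using amod_diff[OF complex_amod[OF X] x gw hv] by blast
  qed
  then show ?thesis unfolding exact_at_def using boundaries_cycles[OF X] by blast
qed

end

section \<open>The complexes \<open>F(M)\<close>\<close>

context radical_square_zero_category
begin

abbreviation "FC \<equiv> F_complex scale A Q \<rho>"
abbreviation "QB \<equiv> box_quiver Q"

lemma FC_Tm: "Tm (FC M) n = FT (dims M n)" by (simp add: F_complex_def F_term_FT)

lemma FC_Df: "Df (FC M) n = F_diff scale A Q \<rho> M n" by (simp add: F_complex_def)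

lemma zero_FT: "is_zero_amod A (FT V) \<longleftrightarrow> supp V = {}" unfolding is_zero_amod_def by (rule FT_zero_iff)

context
  fixes M assumes M: "loc_rep M"
begin

lemma FC_rad: "rad_map (dims M n) (dims M (n - 1)) (Df (FC M) n)" unfolding FC_Df using F_diff_coord(2)[OF M] .

lemma FC_Df_hom: "Df (FC M) n : mhom (FT (dims M n)) (FT (dims M (n - 1)))" unfolding FC_Df using F_diff_coord(1)[OF M] .

lemma FC_Df_top: "z : verts Q ==> top (dims M n) (dims M (n - 1)) (Df (FC M) n) z = 0\<^sub>m (dims M (n - 1) z) (dims M n z)"
  using FC_rad unfolding rad_map_def by blast

lemma FC_Df_arm: "q : arcs Q ==> arm (dims M n) (dims M (n - 1)) (Df (FC M) n) q = Mat M (q, n)"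
  unfolding FC_Df using F_diff_coord(3)[OF M] .

lemma FC_complex: "cpx (FC M)"
proof (rule complexI)
  show "amod (Tm (FC M) n)" for n unfolding FC_Tm using FT_amod loc_rep_fin[OF M] by blast
  show "Df (FC M) n : mhom (Tm (FC M) n) (Tm (FC M) (n - 1))" for n unfolding FC_Tm using FC_Df_hom .
  show "Df (FC M) n x (Df (FC M) (n + 1) x v) = 0" for n x v
    using rad_map_comp_zero[where f = "Df (FC M) (n + 1)" and g = "Df (FC M) n" and U = "dims M (n + 1)"
      and V = "dims M n" and W = "dims M (n - 1)", OF _ FC_rad loc_rep_fin[OF M] loc_rep_fin[OF M] loc_rep_fin[OF M]]
      FC_rad[of "n + 1"] by simp
qed

lemma FC_fgp: "is_fgp_complex scale A (FC M)" unfolding is_fgp_complex_def FC_Tm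
  using FC_complex FT_projective FT_finitely_generated loc_rep_fin[OF M] by blast

lemma FC_minimal: "minimal_complex scale A (FC M)" unfolding minimal_complex_def FC_Tm
proof (intro allI ballI image_subsetI)
  fix n x v assume x: "x : Obj A" and v: "v : Sp (FT (dims M n)) x"
  show "Df (FC M) n x v : rad_amod scale A (FT (dims M (n - 1))) x" using rad_part_le_rad_amod[OF loc_rep_fin[OF M] x]
      rad_map_rad_part[OF FC_rad loc_rep_fin[OF M] loc_rep_fin[OF M] x v] by blast
qed

end

lemma loc_rep_dims: "loc_rep M ==> q : arcs Q ==>
    Mat M (q, n) : carrier_mat (dims M (n - 1) (tail Q q)) (dims M n (head Q q))" unfolding dims_def by (rule loc_rep_Mat)

section \<open>Lifting matrix families to maps and morphisms of representations to chain
  maps\<close>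

definition carr :: "('o => nat) => ('o => nat) => ('o => 'k mat) => bool" where
  "carr V W F \<longleftrightarrow> (ALL z:verts Q. F z : carrier_mat (W z) (V z))"

lemma carrD: "carr V W F ==> z : verts Q ==> F z : carrier_mat (W z) (V z)" by (simp add: carr_def)

text \<open>The lift of a family of tops whose radical component is zero. It is unique by
  \<open>phi_eqI\<close>, and this choice of the radical component is compatible with composites and
  sums, so that taking tops has a functorial section.\<close>

definition phi :: "('o => nat) => ('o => nat) => ('o => 'k mat) => ('o, 'm) amap" where
  "phi V W F = (SOME f. f : mhom (FT V) (FT W) & (ALL z:verts Q. top V W f z = F z) &
     (ALL q:arcs Q. arm V W f q = 0\<^sub>m (W (tail Q q)) (V (head Q q))))"

lemma phi:
  assumes "finite (supp V)" "finite (supp W)" "carr V W F"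
  shows "phi V W F : mhom (FT V) (FT W)" "!!z. z : verts Q ==> top V W (phi V W F) z = F z"
    "!!q. q : arcs Q ==> arm V W (phi V W F) q = 0\<^sub>m (W (tail Q q)) (V (head Q q))"
proof -
  have "EX f. f : mhom (FT V) (FT W) & (ALL z:verts Q. top V W f z = F z) &
     (ALL q:arcs Q. arm V W f q = 0\<^sub>m (W (tail Q q)) (V (head Q q)))"
  proof (rule mhom_exists[OF assms(1,2) carrD[OF assms(3)] zero_carrier_mat])
    fix f assume "f : mhom (FT V) (FT W)" "!!z. z : verts Q ==> top V W f z = F z"
      "!!q. q : arcs Q ==> arm V W f q = 0\<^sub>m (W (tail Q q)) (V (head Q q))"
    then show ?thesis by (intro exI[of _ f] conjI ballI)
  qed
  from someI_ex[OF this, folded phi_def]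
  show "phi V W F : mhom (FT V) (FT W)" "!!z. z : verts Q ==> top V W (phi V W F) z = F z"
    "!!q. q : arcs Q ==> arm V W (phi V W F) q = 0\<^sub>m (W (tail Q q)) (V (head Q q))" by blast+
qed

lemma phi_eqI:
  assumes V: "finite (supp V)" and W: "finite (supp W)" and F: "carr V W F"
    and f: "f : mhom (FT V) (FT W)" "!!z. z : verts Q ==> top V W f z = F z"
      "!!q. q : arcs Q ==> arm V W f q = 0\<^sub>m (W (tail Q q)) (V (head Q q))"
  shows "phi V W F = f" by (rule mhom_coord_eqI[OF phi(1)[OF V W F] f(1) V]) (use f(2,3) phi(2,3)[OF V W F] in auto)

lemma phi_comp:
  assumes fin: "finite (supp U)" "finite (supp V)" "finite (supp W)"
    and F: "carr U V F" and G: "carr V W G"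
  shows "phi U W (%z. G z * F z) = (%x v. phi V W G x (phi U V F x v))"
proof (rule phi_eqI[OF fin(1,3)])
  note f = phi[OF fin(1,2) F] and g = phi[OF fin(2,3) G]
  show "(%x v. phi V W G x (phi U V F x v)) : mhom (FT U) (FT W)" using mhom_comp[OF f(1) g(1)] .
  show "carr U W (%z. G z * F z)" using F G unfolding carr_def by (meson mult_carrier_mat)
  show "top U W (%x v. phi V W G x (phi U V F x v)) z = G z * F z" if "z : verts Q" for z
    using top_comp[OF f(1) g(1) fin(2) that] f(2)[OF that] g(2)[OF that] by simp
  show "arm U W (%x v. phi V W G x (phi U V F x v)) q = 0\<^sub>m (W (tail Q q)) (U (head Q q))" if "q : arcs Q" for q
    unfolding arm_comp[OF f(1) g(1) fin(2) that] f(3)[OF that] g(3)[OF that]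
    by (simp add: right_mult_zero_mat[OF top_carrier] left_mult_zero_mat[OF top_carrier])
qed

lemma phi_id: "finite (supp V) ==> phi V V (%z. 1\<^sub>m (V z)) = mid (FT V)"
  by (rule phi_eqI) (auto simp: carr_def top_mid arm_mid mhom_mid FT_amod)

lemma phi_zero: "finite (supp V) ==> finite (supp W) ==> phi V W (%z. 0\<^sub>m (W z) (V z)) = (%x v. 0)"
  by (rule phi_eqI) (auto simp: carr_def top_zero arm_zero mhom_zero_map FT_amod)

lemma phi_add:
  assumes V: "finite (supp V)" and W: "finite (supp W)"
    and F: "carr V W F" and G: "carr V W G"
  shows "phi V W (%z. F z + G z) = (%x v. phi V W F x v + phi V W G x v)"
proof (rule phi_eqI[OF V W])
  note f = phi[OF V W F] and g = phi[OF V W G]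
  show "(%x v. phi V W F x v + phi V W G x v) : mhom (FT V) (FT W)" using mhom_plus[OF FT_amod[OF W] f(1) g(1)] .
  show "carr V W (%z. F z + G z)" using F G unfolding carr_def by (meson add_carrier_mat)
  show "top V W (%x v. phi V W F x v + phi V W G x v) z = F z + G z" if "z : verts Q" for z
    using top_add[OF f(1) g(1) that] f(2)[OF that] g(2)[OF that] by simp
  show "arm V W (%x v. phi V W F x v + phi V W G x v) q = 0\<^sub>m (W (tail Q q)) (V (head Q q))" if "q : arcs Q" for q
    unfolding arm_add[OF f(1) g(1) that] f(3)[OF that] g(3)[OF that] by (simp add: left_add_zero_mat[OF zero_carrier_mat])
qed

lemma QB_simps: "verts QB = verts Q \<times> UNIV" "arcs QB = arcs Q \<times> UNIV"
    "tail QB (q, n) = (head Q q, n)" "head QB (q, n) = (tail Q q, n - 1)" by (simp_all add: box_quiver_def)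

lemma qrep_hom_iff: "\<phi> : qrep_hom QB M N \<longleftrightarrow>
    (ALL x:verts Q. ALL n. \<phi> (x, n) : carrier_mat (dims N n x) (dims M n x)) &
    (ALL x n. x ~: verts Q --> \<phi> (x, n) = 0\<^sub>m 0 0) &
    (ALL q:arcs Q. ALL n. \<phi> (tail Q q, n - 1) * Mat M (q, n) = Mat N (q, n) * \<phi> (head Q q, n))"
  unfolding qrep_hom_def QB_simps dims_def by (auto simp: QB_simps)

lemma Rep_simps [simp]:
  "Obj (Rep QB) = {M. is_qrep QB M}" "Hom (Rep QB) = qrep_hom QB"
  "Idn (Rep QB) M = (%v. if v : verts QB then 1\<^sub>m (Dim M v) else 0\<^sub>m 0 0)"
  "Cmp (Rep QB) L M N \<psi> \<phi> = (%v. \<psi> v * \<phi> v)" "precat.Sum (Rep QB) M N \<phi> \<psi> = (%v. \<phi> v + \<psi> v)"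
  "Zer (Rep QB) M N = (%v. if v : verts QB then 0\<^sub>m (Dim N v) (Dim M v) else 0\<^sub>m 0 0)"
  unfolding Rep_def by simp_all

text \<open>The value off the vertices is the default that \<open>qrep_hom\<close> prescribes, so
  that equality of morphisms is equality of functions.\<close>

definition ctop :: "('o, 'a, 'k) brep => ('o, 'a, 'k) brep => ('o, 'm) cmap => 'o \<times> int => 'k mat" where
  "ctop M N f = (%(x, n). if x : verts Q then top (dims M n) (dims N n) (f n) x else 0\<^sub>m 0 0)"

definition cphi :: "('o, 'a, 'k) brep => ('o, 'a, 'k) brep => ('o \<times> int => 'k mat) => ('o, 'm) cmap" where
  "cphi M N \<phi> = (%n. phi (dims M n) (dims N n) (%x. \<phi> (x, n)))"

lemma FC_chain_hom: "f : chain (FC M) (FC N) ==> f n : mhom (FT (dims M n)) (FT (dims N n))"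
  using chain_hom[of f "FC M" "FC N" n] by (simp add: FC_Tm)

text \<open>Compares the arrow components of the two composites: the differentials have zero top, so
  only the tops of \<open>f\<close> enter. The hypotheses concern a single square, which also covers
  families that commute with the differentials in some degrees only.\<close>

lemma top_commute:
  assumes M: "loc_rep M" and N: "loc_rep N" and f: "f n : mhom (FT (dims M n)) (FT (dims N n))"
    and f': "f (n - 1) : mhom (FT (dims M (n - 1))) (FT (dims N (n - 1)))"
    and c: "!!x v. Df (FC N) n x (f n x v) = f (n - 1) x (Df (FC M) n x v)" and a: "q : arcs Q"
  shows "top (dims M (n - 1)) (dims N (n - 1)) (f (n - 1)) (tail Q q) * Mat M (q, n) =
    Mat N (q, n) * top (dims M n) (dims N n) (f n) (head Q q)"
proof -
  have "arm (dims M n) (dims N (n - 1)) (%x v. Df (FC N) n x (f n x v)) q =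
    Mat N (q, n) * top (dims M n) (dims N n) (f n) (head Q q)"
    unfolding arm_comp[OF f FC_Df_hom[OF N] loc_rep_fin[OF N] a] FC_Df_arm[OF N a] using a FC_Df_top[OF N, of "tail Q q" n]
    by (simp add: left_mult_zero_mat[OF arm_carrier] left_add_zero_mat[OF mult_carrier_mat[OF loc_rep_dims[OF N a, of n] top_carrier[of "dims M n" "dims N n"]]])
  moreover have "arm (dims M n) (dims N (n - 1)) (%x v. f (n - 1) x (Df (FC M) n x v)) q =
    top (dims M (n - 1)) (dims N (n - 1)) (f (n - 1)) (tail Q q) * Mat M (q, n)"
    unfolding arm_comp[OF FC_Df_hom[OF M] f' loc_rep_fin[OF M] a] FC_Df_arm[OF M a] using a FC_Df_top[OF M, of "head Q q" n]
    by (simp add: right_mult_zero_mat[OF arm_carrier] right_add_zero_mat[OF mult_carrier_mat[OF top_carrier[of "dims M (n - 1)" "dims N (n - 1)"] loc_rep_dims[OF M a, of n]]])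
  ultimately show ?thesis using c by simp
qed

lemma ctop_hom:
  assumes M: "loc_rep M" and N: "loc_rep N" and f: "f : chain (FC M) (FC N)"
  shows "ctop M N f : qrep_hom QB M N" unfolding qrep_hom_iff
proof (intro conjI ballI allI impI)
  fix q n assume a: "q : arcs Q"
  show "ctop M N f (tail Q q, n - 1) * Mat M (q, n) = Mat N (q, n) * ctop M N f (head Q q, n)"
    using top_commute[OF M N FC_chain_hom[OF f] FC_chain_hom[OF f] chain_comm[OF f] a] a by (simp add: ctop_def)
qed (auto simp: ctop_def)

lemma ctop_cid:
  assumes M: "loc_rep M"
  shows "ctop M M (cid (FC M)) = Idn (Rep QB) M" by (auto simp: fun_eq_iff ctop_def cid_def FC_Tm top_mid QB_simps dims_def)

lemma ctop_czero: "ctop M N czero = Zer (Rep QB) M N"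
  by (auto simp: fun_eq_iff ctop_def czero_def top_zero QB_simps dims_def)

lemma ctop_ccomp:
  assumes M: "loc_rep M" and f: "f : chain (FC L) (FC M)" and g: "g : chain (FC M) (FC N)"
  shows "ctop L N (ccomp g f) = Cmp (Rep QB) L M N (ctop M N g) (ctop L M f)"
  using top_comp[OF FC_chain_hom[OF f] FC_chain_hom[OF g] loc_rep_fin[OF M]] by (auto simp: fun_eq_iff ctop_def ccomp_def)

lemma ctop_csum:
  assumes f: "f : chain (FC M) (FC N)" and g: "g : chain (FC M) (FC N)"
  shows "ctop M N (csum f g) = precat.Sum (Rep QB) M N (ctop M N f) (ctop M N g)"
  using top_add[OF FC_chain_hom[OF f] FC_chain_hom[OF g]] by (auto simp: fun_eq_iff ctop_def csum_def)

text \<open>A null-homotopic map is \<open>d h + h d\<close>, and both terms are radical because the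
  differentials are.\<close>

lemma ctop_htp:
  assumes M: "loc_rep M" and N: "loc_rep N" and f: "f : chain (FC M) (FC N)" and g: "g : chain (FC M) (FC N)"
    and *: "htp (FC M) (FC N) f g"
  shows "ctop M N f = ctop M N g"
proof -
  obtain h where h: "!!n. h n : mhom (FT (dims M n)) (FT (dims N (n + 1)))"
    and e: "!!n x v. f n x v - g n x v = Df (FC N) (n + 1) x (h n x v) + h (n - 1) x (Df (FC M) n x v)"
    using htpE[OF *] unfolding FC_Tm by blast
  have "top (dims M n) (dims N n) (f n) x = top (dims M n) (dims N n) (g n) x" if x: "x : verts Q" for n x
  proof -
    have D: "rad_map (dims N (n + 1)) (dims N n) (Df (FC N) (n + 1))" using FC_rad[OF N, of "n + 1"] by simp
    have h1: "h (n - 1) : mhom (FT (dims M (n - 1))) (FT (dims N n))" using h[of "n - 1"] by simp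
    have r1: "rad_map (dims M n) (dims N n) (%x v. Df (FC N) (n + 1) x (h n x v))"
      using rad_map_left[OF h D loc_rep_fin[OF N]] .
    have r2: "rad_map (dims M n) (dims N n) (%x v. h (n - 1) x (Df (FC M) n x v))"
      using rad_map_right[OF FC_rad[OF M] h1 loc_rep_fin[OF M]] .
    have "top (dims M n) (dims N n) (f n) x - top (dims M n) (dims N n) (g n) x = top (dims M n) (dims N n) (%x v. f n x v - g n x v) x"
      using top_diff[OF FC_chain_hom[OF f] FC_chain_hom[OF g] x] by simp
    also have "... = 0\<^sub>m (dims N n x) (dims M n x)"
      unfolding e using top_add[OF _ _ x] r1 r2 x unfolding rad_map_def by simp
    finally have "top (dims M n) (dims N n) (f n) x - top (dims M n) (dims N n) (g n) x = 0\<^sub>m (dims N n x) (dims M n x)" .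
    then have "(top (dims M n) (dims N n) (f n) x - top (dims M n) (dims N n) (g n) x) $$ (i, j) = 0"
      if "i < dims N n x" "j < dims M n x" for i j using that by simp
    then show ?thesis by (intro eq_matI) auto
  qed
  then show ?thesis by (auto simp: fun_eq_iff ctop_def)
qed

context
  fixes M N \<phi>
  assumes M: "loc_rep M" and N: "loc_rep N" and \<phi>: "\<phi> : qrep_hom QB M N"
begin

lemma cphi_carr: "carr (dims M n) (dims N n) (%z. \<phi> (z, n))" using \<phi> unfolding qrep_hom_iff carr_def by blast

lemmas cphi_carrier = carrD[OF cphi_carr]

lemmas cphi_phi = phi[OF loc_rep_fin[OF M] loc_rep_fin[OF N] cphi_carr]

lemma cphi_chain: "cphi M N \<phi> : chain (FC M) (FC N)"
proof (rule chainI[OF FC_complex[OF M] FC_complex[OF N]])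
  show h: "cphi M N \<phi> n : mhom (Tm (FC M) n) (Tm (FC N) n)" for n unfolding FC_Tm cphi_def using cphi_phi(1) .
  fix n x v
  note hn = h[of n, unfolded FC_Tm] and hn' = h[of "n - 1", unfolded FC_Tm]
  have "(%x v. Df (FC N) n x (cphi M N \<phi> n x v)) = (%x v. cphi M N \<phi> (n - 1) x (Df (FC M) n x v))"
  proof (rule mhom_coord_eqI[OF mhom_comp[OF hn FC_Df_hom[OF N]] mhom_comp[OF FC_Df_hom[OF M] hn'] loc_rep_fin[OF M]])
    fix z assume z: "z : verts Q"
    show "top (dims M n) (dims N (n - 1)) (%x v. Df (FC N) n x (cphi M N \<phi> n x v)) z =
      top (dims M n) (dims N (n - 1)) (%x v. cphi M N \<phi> (n - 1) x (Df (FC M) n x v)) z"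
      using rad_map_left[OF hn FC_rad[OF N] loc_rep_fin[OF N]] rad_map_right[OF FC_rad[OF M] hn' loc_rep_fin[OF M]] z
      unfolding rad_map_def by simp
  next
    fix q assume a: "q : arcs Q"
    have c: "Mat N (q, n) * \<phi> (head Q q, n) : carrier_mat (dims N (n - 1) (tail Q q)) (dims M n (head Q q))"
      using mult_carrier_mat[OF loc_rep_dims[OF N a] cphi_carrier] a by simp
    have "arm (dims M n) (dims N (n - 1)) (%x v. Df (FC N) n x (cphi M N \<phi> n x v)) q = Mat N (q, n) * \<phi> (head Q q, n)"
      unfolding arm_comp[OF hn FC_Df_hom[OF N] loc_rep_fin[OF N] a] FC_Df_arm[OF N a]
      using a FC_Df_top[OF N, of "tail Q q" n] cphi_phi(2)[of "head Q q" n] c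
      by (simp add: cphi_def left_mult_zero_mat[OF arm_carrier] left_add_zero_mat)
    moreover have "arm (dims M n) (dims N (n - 1)) (%x v. cphi M N \<phi> (n - 1) x (Df (FC M) n x v)) q = \<phi> (tail Q q, n - 1) * Mat M (q, n)"
    proof -
      have c': "\<phi> (tail Q q, n - 1) * Mat M (q, n) : carrier_mat (dims N (n - 1) (tail Q q)) (dims M n (head Q q))"
        using c \<phi> a unfolding qrep_hom_iff by simp
      show ?thesis unfolding arm_comp[OF FC_Df_hom[OF M] hn' loc_rep_fin[OF M] a] FC_Df_arm[OF M a]
        using a FC_Df_top[OF M, of "head Q q" n] cphi_phi(2)[of "tail Q q" "n - 1"] c'
        by (simp add: cphi_def right_mult_zero_mat[OF arm_carrier] right_add_zero_mat)
    qed
    ultimately show "arm (dims M n) (dims N (n - 1)) (%x v. Df (FC N) n x (cphi M N \<phi> n x v)) q =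
      arm (dims M n) (dims N (n - 1)) (%x v. cphi M N \<phi> (n - 1) x (Df (FC M) n x v)) q"
      using \<phi> a unfolding qrep_hom_iff by simp
  qed
  then show "Df (FC N) n x (cphi M N \<phi> n x v) = cphi M N \<phi> (n - 1) x (Df (FC M) n x v)" by meson
qed

end

lemma phi_cong: "(!!z. z : verts Q ==> F z = G z) ==> phi V W F = phi V W G"
  unfolding phi_def by (metis (mono_tags, lifting))

lemma cphi_Idn:
  assumes M: "loc_rep M"
  shows "cphi M M (Idn (Rep QB) M) = cid (FC M)"
proof
  fix n
  have "phi (dims M n) (dims M n) (%x. Idn (Rep QB) M (x, n)) = phi (dims M n) (dims M n) (%z. 1\<^sub>m (dims M n z))"
    by (rule phi_cong) (simp add: QB_simps dims_def)
  then show "cphi M M (Idn (Rep QB) M) n = cid (FC M) n"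
    unfolding cphi_def cid_def FC_Tm using phi_id[OF loc_rep_fin[OF M]] by simp
qed

lemma cphi_Zer:
  assumes M: "loc_rep M" and N: "loc_rep N"
  shows "cphi M N (Zer (Rep QB) M N) = czero"
proof
  fix n
  have "phi (dims M n) (dims N n) (%x. Zer (Rep QB) M N (x, n)) = phi (dims M n) (dims N n) (%z. 0\<^sub>m (dims N n z) (dims M n z))"
    by (rule phi_cong) (simp add: QB_simps dims_def)
  then show "cphi M N (Zer (Rep QB) M N) n = czero n"
    unfolding cphi_def czero_def using phi_zero[OF loc_rep_fin[OF M] loc_rep_fin[OF N]] by simp
qed

lemma cphi_Cmp:
  assumes L: "loc_rep L" and M: "loc_rep M" and N: "loc_rep N" and \<phi>: "\<phi> : qrep_hom QB L M" and \<psi>: "\<psi> : qrep_hom QB M N"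
  shows "cphi L N (Cmp (Rep QB) L M N \<psi> \<phi>) = ccomp (cphi M N \<psi>) (cphi L M \<phi>)"
proof
  fix n
  show "cphi L N (Cmp (Rep QB) L M N \<psi> \<phi>) n = ccomp (cphi M N \<psi>) (cphi L M \<phi>) n"
    unfolding cphi_def ccomp_def Rep_simps
    by (rule phi_comp[OF loc_rep_fin[OF L] loc_rep_fin[OF M] loc_rep_fin[OF N] cphi_carr[OF L M \<phi>] cphi_carr[OF M N \<psi>]])
qed

lemma cphi_Sum:
  assumes M: "loc_rep M" and N: "loc_rep N" and \<phi>: "\<phi> : qrep_hom QB M N" and \<psi>: "\<psi> : qrep_hom QB M N"
  shows "cphi M N (precat.Sum (Rep QB) M N \<phi> \<psi>) = csum (cphi M N \<phi>) (cphi M N \<psi>)"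
proof
  fix n
  show "cphi M N (precat.Sum (Rep QB) M N \<phi> \<psi>) n = csum (cphi M N \<phi>) (cphi M N \<psi>) n"
    unfolding cphi_def csum_def Rep_simps
    by (rule phi_add[OF loc_rep_fin[OF M] loc_rep_fin[OF N] cphi_carr[OF M N \<phi>] cphi_carr[OF M N \<psi>]])
qed

lemma qrep_hom_Cmp:
  assumes L: "loc_rep L" and M: "loc_rep M" and N: "loc_rep N" and \<phi>: "\<phi> : qrep_hom QB L M" and \<psi>: "\<psi> : qrep_hom QB M N"
  shows "(%v. \<psi> v * \<phi> v) : qrep_hom QB L N" unfolding qrep_hom_iff
proof (intro conjI ballI allI impI)
  fix x n assume "x : verts Q"
  then show "\<psi> (x, n) * \<phi> (x, n) : carrier_mat (dims N n x) (dims L n x)"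
    using cphi_carrier[OF L M \<phi>] cphi_carrier[OF M N \<psi>] mult_carrier_mat by blast
next
  fix x n assume "x ~: verts Q"
  then show "\<psi> (x, n) * \<phi> (x, n) = 0\<^sub>m 0 0" using \<phi> \<psi> unfolding qrep_hom_iff by simp
next
  fix q n assume a: "q : arcs Q"
  note d = loc_rep_dims[OF L a, of n] loc_rep_dims[OF M a, of n] loc_rep_dims[OF N a, of n]
    cphi_carrier[OF L M \<phi>, of "head Q q" n] cphi_carrier[OF L M \<phi>, of "tail Q q" "n - 1"]
    cphi_carrier[OF M N \<psi>, of "head Q q" n] cphi_carrier[OF M N \<psi>, of "tail Q q" "n - 1"]
  have dd: "dim_col (\<psi> (tail Q q, n - 1)) = dim_row (\<phi> (tail Q q, n - 1))"
    "dim_col (\<phi> (tail Q q, n - 1)) = dim_row (Mat L (q, n))"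
    "dim_col (\<psi> (tail Q q, n - 1)) = dim_row (Mat M (q, n))" "dim_col (Mat M (q, n)) = dim_row (\<phi> (head Q q, n))"
    "dim_col (Mat N (q, n)) = dim_row (\<psi> (head Q q, n))" "dim_col (\<psi> (head Q q, n)) = dim_row (\<phi> (head Q q, n))"
    using d a by auto
  have e: "\<phi> (tail Q q, n - 1) * Mat L (q, n) = Mat M (q, n) * \<phi> (head Q q, n)"
    "\<psi> (tail Q q, n - 1) * Mat M (q, n) = Mat N (q, n) * \<psi> (head Q q, n)"
    using \<phi> \<psi> a unfolding qrep_hom_iff by blast+
  have "\<psi> (tail Q q, n - 1) * \<phi> (tail Q q, n - 1) * Mat L (q, n) = \<psi> (tail Q q, n - 1) * (Mat M (q, n) * \<phi> (head Q q, n))"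
    unfolding mat_assoc[OF dd(1,2)] e ..
  also have "... = Mat N (q, n) * (\<psi> (head Q q, n) * \<phi> (head Q q, n))"
    unfolding mat_assoc[OF dd(3,4), symmetric] e(2) mat_assoc[OF dd(5,6)] ..
  finally show "\<psi> (tail Q q, n - 1) * \<phi> (tail Q q, n - 1) * Mat L (q, n) = Mat N (q, n) * (\<psi> (head Q q, n) * \<phi> (head Q q, n))" .
qed

end

section \<open>Perturbation of a contraction\<close>

definition additive_on :: "'v::ab_group_add set => 'v set => ('v => 'v) => bool" where
  "additive_on X Y f \<longleftrightarrow> (ALL u:X. f u : Y) &
     (ALL u:X. ALL v:X. f (u + v) = f u + f v & f (u - v) = f u - f v)"

text \<open>The differential is \<open>d0 + d1\<close>, where \<open>d0\<close> is split by \<open>h\<close>, \<open>i\<close>, \<open>p\<close>. Composites with two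
  factors \<open>d1\<close> vanish, so the usual perturbation series stop after the first correction term.\<close>

locale perturbation =
  fixes S W :: "int => 'v::ab_group_add set"
    and d0 d1 h i p :: "int => 'v => 'v"
  assumes S: "!!n u v. u : S n ==> v : S n ==> u + v : S n" "!!n u v. u : S n ==> v : S n ==> u - v : S n"
    and d0: "!!n. additive_on (S n) (S (n - 1)) (d0 n)"
    and d1: "!!n. additive_on (S n) (S (n - 1)) (d1 n)"
    and h: "!!n. additive_on (S n) (S (n + 1)) (h n)"
    and i: "!!n. additive_on (W n) (S n) (i n)"
    and p: "!!n. additive_on (S n) (W n) (p n)"
    and di: "!!n w. w : W n ==> d0 n (i n w) = 0"
    and pd: "!!n u. u : S n ==> p (n - 1) (d0 n u) = 0"
    and hi: "!!n w. w : W n ==> h n (i n w) = 0"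
    and ph: "!!n u. u : S n ==> p (n + 1) (h n u) = 0"
    and pi: "!!n w. w : W n ==> p n (i n w) = w"
    and ip: "!!n u. u : S n ==> i n (p n u) = u - d0 (n + 1) (h n u) - h (n - 1) (d0 n u)"
    and anti: "!!n u. u : S n ==> d0 (n - 1) (d1 n u) + d1 (n - 1) (d0 n u) = 0"
    and dd: "!!n u. u : S n ==> d1 (n - 1) (d1 n u) = 0"
    and dhd: "!!n u. u : S n ==> d1 n (h (n - 1) (d1 n u)) = 0"
    and dipd: "!!n u. u : S n ==> d1 (n - 1) (i (n - 1) (p (n - 1) (d1 n u))) = 0"
    and dhhd: "!!n u. u : S n ==> d1 (n + 1) (h n (h (n - 1) (d1 n u))) = 0"
begin

lemma mem: "u : S n ==> d0 n u : S (n - 1)" "u : S (n + 1) ==> d0 (n + 1) u : S n"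
  "u : S n ==> d1 n u : S (n - 1)" "u : S (n + 1) ==> d1 (n + 1) u : S n"
  "u : S n ==> h n u : S (n + 1)" "u : S (n - 1) ==> h (n - 1) u : S n"
  "w : W n ==> i n w : S n" "u : S n ==> p n u : W n"
  using d0[of n] d0[of "n + 1"] d1[of n] d1[of "n + 1"] h[of n] h[of "n - 1"] i[of n] p[of n]
  by (simp_all add: additive_on_def)

lemma lin: "u : S n ==> v : S n ==> d0 n (u + v) = d0 n u + d0 n v" "u : S n ==> v : S n ==> d0 n (u - v) = d0 n u - d0 n v"
  "u : S n ==> v : S n ==> d1 n (u + v) = d1 n u + d1 n v" "u : S n ==> v : S n ==> d1 n (u - v) = d1 n u - d1 n v"
  "u : S n ==> v : S n ==> h n (u + v) = h n u + h n v" "u : S n ==> v : S n ==> h n (u - v) = h n u - h n v"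
  "w : W n ==> w' : W n ==> i n (w - w') = i n w - i n w'"
  "u : S n ==> v : S n ==> p n (u + v) = p n u + p n v" "u : S n ==> v : S n ==> p n (u - v) = p n u - p n v"
  using d0[of n] d1[of n] h[of n] i[of n] p[of n] by (simp_all add: additive_on_def)

lemma nul: "u : S n ==> d0 n 0 = 0" "u : S n ==> d1 n 0 = 0" "u : S n ==> h n 0 = 0" "u : S n ==> p n 0 = 0"
  "w : W n ==> i n 0 = 0" using lin(2)[of u n u] lin(4)[of u n u] lin(6)[of u n u] lin(9)[of u n u] lin(7)[of w n w] by auto

text \<open>First terms of the series of the homological perturbation lemma, for instance of
  \<open>i - h d1 i + h d1 h d1 i - ...\<close> for \<open>I'\<close>; the omitted terms contain
  \<open>d1 h d1\<close> and vanish by \<open>dhd\<close>.\<close>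

definition \<delta> where "\<delta> n w = p (n - 1) (d1 n (i n w))"
definition I' where "I' n w = i n w - h (n - 1) (d1 n (i n w))"
definition P' where "P' n u = p n u - p n (d1 (n + 1) (h n u))"
definition H' where "H' n u = h n u - h n (d1 (n + 1) (h n u))"

lemma anti': "u : S n ==> d0 (n - 1) (d1 n u) = - d1 (n - 1) (d0 n u)" using anti[of u n] by (simp add: add_eq_0_iff2)

text \<open>With \<open>a = d1 (i w)\<close>, anticommutation and \<open>d0 i = 0\<close> make
  \<open>a\<close> a cycle for \<open>d0\<close>, so \<open>i p a = a - d0 (h a)\<close>. Both sides
  of the claim equal this element.\<close>

lemma I'_chain:
  assumes w: "w : W n" shows "d0 n (I' n w) + d1 n (I' n w) = I' (n - 1) (\<delta> n w)"
proof -
  define u a b where "u = i n w" and "a = d1 n u" and "b = h (n - 1) a"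
  have m: "u : S n" "a : S (n - 1)" "b : S n" unfolding u_def a_def b_def using w by (simp_all add: mem)
  have "d0 n u = 0" unfolding u_def using di w by blast
  moreover have "d1 n b = 0" unfolding b_def a_def using dhd m by blast
  ultimately have l: "d0 n (I' n w) + d1 n (I' n w) = a - d0 n b"
    unfolding I'_def u_def[symmetric] a_def[symmetric] b_def[symmetric] using m by (simp add: lin a_def)
  have "d0 (n - 1) a = - d1 (n - 1) 0" unfolding a_def using anti'[OF m(1)] \<open>d0 n u = 0\<close> by simp
  then have "d0 (n - 1) a = 0" using nul(2)[OF m(2)] by simp
  moreover have "h (n - 1 - 1) 0 = 0" using nul(3)[OF mem(1)[OF m(2)]] .
  ultimately have "i (n - 1) (p (n - 1) a) = a - d0 n b" using ip[OF m(2)] by (simp add: b_def)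
  moreover have "d1 (n - 1) (i (n - 1) (p (n - 1) a)) = 0" unfolding a_def using dipd m by blast
  ultimately have "I' (n - 1) (\<delta> n w) = a - d0 n b"
    unfolding I'_def \<delta>_def u_def[symmetric] a_def[symmetric] using \<open>h (n - 1 - 1) 0 = 0\<close> by simp
  then show ?thesis using l by simp
qed

lemma P'_chain:
  assumes u: "u : S n" shows "\<delta> n (P' n u) = P' (n - 1) (d0 n u + d1 n u)"
proof -
  define a s e where "a = h n u" and "s = d1 (n + 1) a" and "e = h (n - 1) (d0 n u)"
  have m: "a : S (n + 1)" "s : S n" "e : S n" "d0 (n + 1) a : S n" "d0 n u : S (n - 1)" "d1 n u : S (n - 1)"
    unfolding a_def s_def e_def using u by (simp_all add: mem)
  have ipm: "i n (p n u) : S n" "i n (p n s) : S n" using u m by (simp_all add: mem)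
  have "d1 n (i n (p n s)) = 0" using dipd[OF m(1)] by (simp add: s_def)
  then have "\<delta> n (P' n u) = p (n - 1) (d1 n (i n (p n u)))"
    unfolding \<delta>_def P'_def a_def[symmetric] s_def[symmetric] using u m ipm by (simp add: lin mem)
  also have "d1 n (i n (p n u)) = d1 n u - d1 n (d0 (n + 1) a) - d1 n e"
    unfolding ip[OF u] a_def[symmetric] e_def[symmetric] using u m by (simp add: lin S)
  also have "p (n - 1) (d1 n u - d1 n (d0 (n + 1) a) - d1 n e) =
      p (n - 1) (d1 n u) - p (n - 1) (d1 n (d0 (n + 1) a)) - p (n - 1) (d1 n e)" using u m by (simp add: lin S mem)
  also have "p (n - 1) (d1 n (d0 (n + 1) a)) = 0"
  proof -
    have "d0 n s + d1 n (d0 (n + 1) a) = 0" using anti[OF m(1)] by (simp add: s_def)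
    moreover have "p (n - 1) (d0 n s + d1 n (d0 (n + 1) a)) = p (n - 1) (d0 n s) + p (n - 1) (d1 n (d0 (n + 1) a))"
      using m by (intro lin) (simp_all add: mem)
    ultimately show ?thesis using pd[OF m(2)] nul(4)[OF m(5)] by simp
  qed
  finally have l: "\<delta> n (P' n u) = p (n - 1) (d1 n u) - p (n - 1) (d1 n e)" by simp
  have "d1 n (h (n - 1) (d1 n u)) = 0" using dhd[OF u] .
  then have "P' (n - 1) (d0 n u + d1 n u) = p (n - 1) (d1 n u) - p (n - 1) (d1 n e)"
    unfolding P'_def using u m pd[OF u] mem(6)[OF m(6)] by (simp add: lin S e_def[symmetric])
  then show ?thesis using l by simp
qed

text \<open>In the expanded product every correction term contains \<open>p h\<close>,
  \<open>h i\<close> or two factors \<open>d1\<close>, so the retraction is strict and not only up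
  to homotopy.\<close>

lemma P'_I':
  assumes w: "w : W n" shows "P' n (I' n w) = w"
proof -
  define u b where "u = i n w" and "b = h (n - 1) (d1 n u)"
  have m: "u : S n" "d1 n u : S (n - 1)" "b : S n" unfolding u_def b_def using w by (simp_all add: mem)
  have "p n b = 0" unfolding b_def using ph[OF m(2)] by simp
  moreover have "d1 (n + 1) (h n b) = 0" unfolding b_def using dhhd[OF m(1)] .
  moreover have "h n u = 0" unfolding u_def using hi[OF w] .
  moreover have "d1 (n + 1) 0 = 0" using nul(2)[OF mem(5)[OF m(1)]] .
  moreover have "h n (u - b) = h n u - h n b" "p n (u - b) = p n u - p n b" using lin(6)[OF m(1,3)] lin(9)[OF m(1,3)] .
  moreover have "d1 (n + 1) (0 - h n b) = d1 (n + 1) 0 - d1 (n + 1) (h n b)"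
  proof (rule lin(4))
    show "0 : S (n + 1)" using S(2)[OF mem(5)[OF m(1)] mem(5)[OF m(1)]] by simp
    show "h n b : S (n + 1)" using mem(5)[OF m(3)] .
  qed
  ultimately have "P' n (u - b) = p n u" unfolding P'_def using nul(4)[OF m(1)] by simp
  then show ?thesis unfolding I'_def u_def[symmetric] b_def[symmetric] using pi[OF w] by (simp add: u_def)
qed

lemma I'_P':
  assumes u: "u : S n"
  shows "u - I' n (P' n u) = (d0 (n + 1) (H' n u) + d1 (n + 1) (H' n u)) + H' (n - 1) (d0 n u + d1 n u)"
proof -
  define a s e where "a = h n u" and "s = d1 (n + 1) a" and "e = h (n - 1) (d0 n u)"
  have m: "a : S (n + 1)" "s : S n" "e : S n" "d0 (n + 1) a : S n" "d0 n u : S (n - 1)" "d1 n u : S (n - 1)"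
    "p n u : W n" "p n s : W n" "i n (p n u) : S n" "i n (p n s) : S n" "d1 n s : S (n - 1)" "d0 n s : S (n - 1)"
    "h n s : S (n + 1)" "d1 n (d0 (n + 1) a) : S (n - 1)" "d1 n e : S (n - 1)" "h (n - 1) (d1 n u) : S n"
    "h (n - 1) (d1 n e) : S n" "h (n - 1) (d1 n (d0 (n + 1) a)) : S n" "h (n - 1) (d0 n s) : S n"
    unfolding a_def s_def e_def using u by (simp_all add: mem)
  have z0: "d1 n (i n (p n s)) = 0" using dipd[OF m(1)] by (simp add: s_def)
  have z1: "d1 (n + 1) (h n s) = 0" using dhd[OF m(1)] by (simp add: s_def)
  have z2: "d1 n (h (n - 1) (d1 n u)) = 0" using dhd[OF u] .
  \<comment> \<open>Anticommutation at \<open>a = h u\<close>, followed by \<open>h\<close>: these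
    two terms appear on one side of the comparison only and have to cancel.\<close>
  have z3: "h (n - 1) (d0 n s) + h (n - 1) (d1 n (d0 (n + 1) a)) = 0"
    using anti[OF m(1)] lin(5)[OF m(12,14)] nul(3)[OF m(6)] by (simp add: s_def)
  have "I' n (P' n u) = (i n (p n u) - i n (p n s)) - h (n - 1) (d1 n (i n (p n u)))"
    unfolding I'_def P'_def a_def[symmetric] s_def[symmetric] using m z0 by (simp add: lin)
  also have "i n (p n u) = u - d0 (n + 1) a - e" unfolding ip[OF u] a_def e_def ..
  also have "i n (p n s) = s - d0 (n + 1) (h n s) - h (n - 1) (d0 n s)" using ip[OF m(2)] .
  also have "h (n - 1) (d1 n (u - d0 (n + 1) a - e)) =
      h (n - 1) (d1 n u) - h (n - 1) (d1 n (d0 (n + 1) a)) - h (n - 1) (d1 n e)" using u m by (simp add: lin S)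
  finally have L: "u - I' n (P' n u) = d0 (n + 1) a + e + s - d0 (n + 1) (h n s) + h (n - 1) (d1 n u) - h (n - 1) (d1 n e)
     - (h (n - 1) (d0 n s) + h (n - 1) (d1 n (d0 (n + 1) a)))" by (simp add: algebra_simps)
  have "d0 (n + 1) (H' n u) + d1 (n + 1) (H' n u) = d0 (n + 1) a - d0 (n + 1) (h n s) + s"
    unfolding H'_def a_def[symmetric] s_def[symmetric] using m z1 by (simp add: lin s_def)
  moreover have "H' (n - 1) (d0 n u + d1 n u) = e + h (n - 1) (d1 n u) - h (n - 1) (d1 n e)"
  proof -
    have "h (n - 1) (d0 n u + d1 n u) = e + h (n - 1) (d1 n u)" using m by (simp add: lin e_def)
    moreover have "d1 n (e + h (n - 1) (d1 n u)) = d1 n e" using m z2 by (simp add: lin)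
    ultimately show ?thesis unfolding H'_def by simp
  qed
  ultimately show ?thesis unfolding L z3 by (simp add: algebra_simps)
qed

end

section \<open>Every complex is homotopy equivalent to some \<open>F(M)\<close>\<close>

text \<open>Every entry of \<open>P * I\<close> is an empty sum. This keeps the support of a retract
  inside the support of the whole.\<close>

lemma right_inverse_dim_zero:
  fixes P :: "'k::field mat"
  assumes "I : carrier_mat 0 r" "P : carrier_mat r 0" "P * I = 1\<^sub>m r"
  shows "r = 0"
proof (rule ccontr)
  assume "r ~= 0"
  then have "(P * I) $$ (0, 0) = 0" using assms(1,2) by (simp add: scalar_prod_def)
  then show False using \<open>r ~= 0\<close> assms(3) by simp
qed

context k_category
begin

lemma isomorphic_homotopyD:
  assumes S: "!!X. X : S ==> cpx X" and i: "isomorphic (hcat S) X Y"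
  obtains f g where "f : chain X Y" "g : chain Y X" "htp X X (ccomp g f) (cid X)" "htp Y Y (ccomp f g) (cid Y)"
proof -
  have XY: "X : S" "Y : S" using i by (simp_all add: isomorphic_def)
  have "EX F:hcl X Y ` chain X Y. EX G:hcl Y X ` chain Y X.
      (\<Union>f'\<in>F. \<Union>g'\<in>G. hcl X X (ccomp g' f')) = hcl X X (cid X) &
      (\<Union>g'\<in>G. \<Union>f'\<in>F. hcl Y Y (ccomp f' g')) = hcl Y Y (cid Y)"
    using i unfolding isomorphic_def homotopy_category_simps by (elim conjE)
  then obtain F G where F: "F : hcl X Y ` chain X Y" and G: "G : hcl Y X ` chain Y X"
    and e: "(\<Union>f'\<in>F. \<Union>g'\<in>G. hcl X X (ccomp g' f')) = hcl X X (cid X)"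
      "(\<Union>g'\<in>G. \<Union>f'\<in>F. hcl Y Y (ccomp f' g')) = hcl Y Y (cid Y)" by (elim bexE conjE) (rule that)
  obtain f where f: "F = hcl X Y f" "f : chain X Y" using F by (rule imageE)
  obtain g where g: "G = hcl Y X g" "g : chain Y X" using G by (rule imageE)
  note fg = XY f(2) g(2) e[unfolded f(1) g(1)]
  note c = S[OF fg(1)] S[OF fg(2)]
  have "htp X X (ccomp g f) (cid X)" using fg(5) hcl_ccomp[OF c(1) c(2) c(1) fg(3,4)]
      hcl_eq_iff[OF c(1) c(1) chain_ccomp[OF c(1) c(1) fg(3,4)] chain_cid[OF c(1)]] by simp
  moreover have "htp Y Y (ccomp f g) (cid Y)" using fg(6) hcl_ccomp[OF c(2) c(1) c(2) fg(4,3)]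
      hcl_eq_iff[OF c(2) c(2) chain_ccomp[OF c(2) c(2) fg(4,3)] chain_cid[OF c(2)]] by simp
  ultimately show ?thesis using that fg(3,4) by blast
qed

lemma isomorphic_homotopy_exact:
  assumes S: "!!X. X : S ==> cpx X" and i: "isomorphic (hcat S) X Y"
  shows "exact_at X n \<longleftrightarrow> exact_at Y n"
proof -
  have c: "cpx X" "cpx Y" using i S unfolding isomorphic_def by auto
  obtain f g where "f : chain X Y" "g : chain Y X" "htp X X (ccomp g f) (cid X)" "htp Y Y (ccomp f g) (cid Y)"
    using isomorphic_homotopyD[OF S i] by blast
  then show ?thesis using exact_at_retract[OF c(1,2)] exact_at_retract[OF c(2,1)] by blast
qed

lemma isomorphic_complexesD:
  assumes "isomorphic (ccat S) X Y"
  obtains f g where "f : chain X Y" "g : chain Y X"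
    "!!n x v. x : Obj A ==> v : Sp (Tm X n) x ==> g n x (f n x v) = v"
    "!!n x v. x : Obj A ==> v : Sp (Tm Y n) x ==> f n x (g n x v) = v"
proof -
  obtain f g where fg: "f : chain X Y" "g : chain Y X" "ccomp g f = cid X" "ccomp f g = cid Y"
    using assms unfolding isomorphic_def by auto
  have "g n x (f n x v) = cid X n x v" "f n x (g n x v) = cid Y n x v" for n x v using fg(3,4) by (metis ccomp_def)+
  then show ?thesis using that[OF fg(1,2)] by (simp add: cid_def)
qed

lemma isomorphic_complexesI:
  assumes X: "cpx X" and Y: "cpx Y" and S: "X : S" "Y : S"
    and fg: "f : chain X Y" "g : chain Y X"
    and gf: "!!n x v. x : Obj A ==> v : Sp (Tm X n) x ==> g n x (f n x v) = v"
    and fg': "!!n x v. x : Obj A ==> v : Sp (Tm Y n) x ==> f n x (g n x v) = v"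
  shows "isomorphic (ccat S) X Y"
proof -
  have "ccomp g f = cid X"
  proof
    fix n
    show "ccomp g f n = cid X n" by (rule mhom_eqI[OF chain_hom[OF chain_ccomp[OF X X fg]] chain_hom[OF chain_cid[OF X]]])
        (simp add: ccomp_def cid_def gf)
  qed
  moreover have "ccomp f g = cid Y"
  proof
    fix n
    show "ccomp f g n = cid Y n"
      by (rule mhom_eqI[OF chain_hom[OF chain_ccomp[OF Y Y fg(2,1)]] chain_hom[OF chain_cid[OF Y]]])
        (simp add: ccomp_def cid_def fg')
  qed
  ultimately show ?thesis unfolding isomorphic_def using S fg by auto
qed

lemma isomorphic_complexes_zero:
  assumes S: "!!X. X : S ==> cpx X" and i: "isomorphic (ccat S) X Y" and z: "is_zero_amod A (Tm Y n)"
  shows "is_zero_amod A (Tm X n)"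
proof -
  have c: "cpx X" using i S unfolding isomorphic_def by auto
  obtain f g where fg: "f : chain X Y" "g : chain Y X"
    "!!n x v. x : Obj A ==> v : Sp (Tm X n) x ==> g n x (f n x v) = v" using isomorphic_complexesD[OF i] by metis
  have "v = 0" if x: "x : Obj A" and v: "v : Sp (Tm X n) x" for x v
    using mhom_in[OF chain_hom[OF fg(1)] x v] z x fg(3)[OF x v] mhom_0[OF chain_hom[OF fg(2)], of n x]
    unfolding is_zero_amod_def by auto
  then show ?thesis unfolding is_zero_amod_def using amod_0[OF complex_amod[OF c]] by blast
qed

end

context radical_square_zero_category
begin

abbreviation "fgp_complexes \<equiv> {X. is_fgp_complex scale A X}"

lemma fgp_complex: "X : fgp_complexes ==> cpx X" by (simp add: is_fgp_complex_def)

text \<open>Each term is replaced by an isomorphic sum of representables through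
  \<open>projective_FT\<close>, and the differential is conjugated by the chosen
  isomorphisms.\<close>

lemma FT_model:
  assumes X: "is_fgp_complex scale A X"
  obtains V Y a b where "!!n. finite (supp (V n))" "is_fgp_complex scale A Y" "!!n. Tm Y n = FT (V n)"
    "a : chain X Y" "b : chain Y X"
    "!!n x v. x : Obj A ==> v : Sp (Tm X n) x ==> b n x (a n x v) = v"
    "!!n x v. x : Obj A ==> v : Sp (Tm Y n) x ==> a n x (b n x v) = v"
    "!!n x v. Df Y n x v = a (n - 1) x (Df X n x (b n x v))"
proof -
  have Xc: "cpx X" and Xp: "projective scale A (Tm X n)" for n using X unfolding is_fgp_complex_def by blast+
  have "EX W a b. finite (supp W) & a : mhom (Tm X n) (FT W) & b : mhom (FT W) (Tm X n) &
    (ALL x v. x : Obj A --> v : Sp (Tm X n) x --> b x (a x v) = v) &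
    (ALL x v. x : Obj A --> v : Sp (FT W) x --> a x (b x v) = v)" for n
  proof (rule projective_FT[OF Xp[of n]])
    fix W a b
    assume "finite (supp W)" "a : mhom (Tm X n) (FT W)" "b : mhom (FT W) (Tm X n)"
      "!!x v. x : Obj A ==> v : Sp (Tm X n) x ==> b x (a x v) = v"
      "!!x v. x : Obj A ==> v : Sp (FT W) x ==> a x (b x v) = v"
    then show ?thesis by (intro exI[of _ W] exI[of _ a] exI[of _ b]) simp
  qed
  then obtain V a b where V: "!!n. finite (supp (V n))" and a: "!!n. a n : mhom (Tm X n) (FT (V n))"
    and b: "!!n. b n : mhom (FT (V n)) (Tm X n)"
    and ba: "!!n x v. x : Obj A ==> v : Sp (Tm X n) x ==> b n x (a n x v) = v"
    and ab: "!!n x v. x : Obj A ==> v : Sp (FT (V n)) x ==> a n x (b n x v) = v" by metis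
  define Y where "Y = \<lparr>Tm = (%n. FT (V n)), Df = (%n x v. a (n - 1) x (Df X n x (b n x v)))\<rparr>"
  have Yc: "cpx Y"
  proof (rule complexI)
    show "amod (Tm Y n)" for n unfolding Y_def using FT_amod[OF V] by simp
    show "Df Y n : mhom (Tm Y n) (Tm Y (n - 1))" for n
      unfolding Y_def using mhom_comp[OF mhom_comp[OF b complex_Df[OF Xc]] a] by simp
    fix n x v assume x: "x : Obj A" and v: "v : Sp (Tm Y (n + 1)) x"
    have "Df X (n + 1) x (b (n + 1) x v) : Sp (Tm X n) x"
      using mhom_in[OF complex_Df'[OF Xc] x mhom_in[OF b x]] v by (simp add: Y_def)
    then show "Df Y n x (Df Y (n + 1) x v) = 0" unfolding Y_def using ba[OF x] complex_DD[OF Xc] mhom_0[OF a] by simp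
  qed
  have aY: "a : chain X Y" by (rule chainI[OF Xc Yc]) (use a ba in \<open>simp_all add: Y_def\<close>)
  have bY: "b : chain Y X"
  proof (rule chainI[OF Yc Xc])
    show "b n : mhom (Tm Y n) (Tm X n)" for n using b by (simp add: Y_def)
    fix n x v assume x: "x : Obj A" and v: "v : Sp (Tm Y n) x"
    have "Df X n x (b n x v) : Sp (Tm X (n - 1)) x"
      using mhom_in[OF complex_Df[OF Xc] x mhom_in[OF b x]] v by (simp add: Y_def)
    then show "Df X n x (b n x v) = b (n - 1) x (Df Y n x v)" using ba[OF x] by (simp add: Y_def)
  qed
  have "is_fgp_complex scale A Y"
    unfolding is_fgp_complex_def using Yc FT_projective[OF V] FT_finitely_generated[OF V] by (simp add: Y_def)
  then show ?thesis by (rule that[OF V _ _ aY bY ba]) (use ab in \<open>simp_all add: Y_def\<close>)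
qed

text \<open>A radical differential is given by its arrow matrices alone, and \<open>d d = 0\<close>
  imposes no condition on them, since composites of radical maps vanish. This is why the box quiver
  carries no relations.\<close>

lemma rad_complex_FC:
  assumes Y: "cpx Y" and V: "!!n. finite (supp (V n))" and T: "!!n. Tm Y n = FT (V n)"
    and r: "!!n. rad_map (V n) (V (n - 1)) (Df Y n)"
  obtains M where "loc_rep M" "FC M = Y" "ALL n. dims M n = V n"
proof -
  define M :: "('o, 'a, 'k) brep" where
    "M = \<lparr>Dim = (%(x, n). V n x), Mat = (%(q, n). arm (V n) (V (n - 1)) (Df Y n) q)\<rparr>"
  have d: "dims M n = V n" for n by (simp add: M_def dims_def)
  have M: "loc_rep M" unfolding loc_rep_def d using V by (simp add: M_def)
  have "Df (FC M) n = Df Y n" for n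
  proof (rule mhom_coord_eqI[OF FC_Df_hom[OF M]])
    show "Df Y n : mhom (FT (dims M n)) (FT (dims M (n - 1)))" unfolding d using r unfolding rad_map_def by blast
    show "finite (supp (dims M n))" unfolding d using V .
    show "top (dims M n) (dims M (n - 1)) (Df (FC M) n) z = top (dims M n) (dims M (n - 1)) (Df Y n) z" if "z : verts Q" for z
      using FC_Df_top[OF M that, of n] r[of n] that unfolding rad_map_def d by simp
    show "arm (dims M n) (dims M (n - 1)) (Df (FC M) n) q = arm (dims M n) (dims M (n - 1)) (Df Y n) q" if "q : arcs Q" for q
    proof -
      have "Mat M (q, n) = arm (V n) (V (n - 1)) (Df Y n) q" by (simp add: M_def)
      then show ?thesis using FC_Df_arm[OF M that, of n] by (simp add: d)
    qed
  qed
  then have "FC M = Y" by (intro cplx.equality) (auto simp: fun_eq_iff FC_Tm d T)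
  then show ?thesis using that[OF M] d by simp
qed

text \<open>Minimality puts the images of the differentials into the radical, where top coordinates
  vanish by \<open>rad_amod_tau_zero\<close>. The transported complex therefore has radical
  differentials and is equal to some \<open>FC M\<close>.\<close>

lemma minimal_dense:
  assumes X: "is_fgp_complex scale A X" and min: "minimal_complex scale A X"
  obtains M where "loc_rep M" "isomorphic (ccat fgp_complexes) X (FC M)"
proof (rule FT_model[OF X])
  fix V Y a b
  assume V: "!!n. finite (supp (V n))" and Y: "is_fgp_complex scale A Y" and T: "!!n. Tm Y n = FT (V n)"
    and a: "a : chain X Y" and b: "b : chain Y X"
    and ba: "!!n x v. x : Obj A ==> v : Sp (Tm X n) x ==> b n x (a n x v) = v"
    and ab: "!!n x v. x : Obj A ==> v : Sp (Tm Y n) x ==> a n x (b n x v) = v"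
    and d: "!!n x v. Df Y n x v = a (n - 1) x (Df X n x (b n x v))"
  have Xc: "cpx X" and Yc: "cpx Y" using X Y unfolding is_fgp_complex_def by blast+
  note ah = chain_hom[OF a, unfolded T] and bh = chain_hom[OF b, unfolded T]
  have r: "rad_map (V n) (V (n - 1)) (Df Y n)" for n unfolding rad_map_def
  proof (intro conjI ballI)
    show "Df Y n : mhom (FT (V n)) (FT (V (n - 1)))" using complex_Df[OF Yc, of n] by (simp add: T)
    fix z assume z: "z : verts Q"
    have "tv (V (n - 1)) z (Df Y n z (gen z i)) = 0\<^sub>v (V (n - 1) z)" if i: "i < V n z" for i unfolding d
    proof (rule rad_amod_tau_zero[OF complex_amod[OF Xc] ah bh V _ _ z])
      show "a (n - 1) x (b (n - 1) x v) = v" if "x : Obj A" "v : Sp (FT (V (n - 1))) x" for x v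
        using ab[of x v "n - 1"] that by (simp add: T)
      have "b n z (gen z i) : Sp (Tm X n) z" using mhom_in[OF bh vert_Obj[OF z] gen_in[where V = "V n", OF z i]] .
      then show "Df X n z (b n z (gen z i)) : rad_amod scale A (Tm X (n - 1)) z"
        by (rule subsetD[OF min[unfolded minimal_complex_def, rule_format, OF vert_Obj[OF z]] imageI])
    qed
    then show "top (V n) (V (n - 1)) (Df Y n) z = 0\<^sub>m (V (n - 1) z) (V n z)" by (intro eq_matI) (auto simp: top_def)
  qed
  obtain M where M: "loc_rep M" "FC M = Y" by (rule rad_complex_FC[OF Yc V T r])
  have "isomorphic (ccat fgp_complexes) X Y" by (rule isomorphic_complexesI[OF Xc Yc _ _ a b ba ab]) (use X Y in auto)
  then show ?thesis using that M by blast
qed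

lemma mhom_additive_on:
  assumes M: "amod M" and f: "f : mhom M N" and x: "x : Obj A"
  shows "additive_on (Sp M x) (Sp N x) (f x)"
  unfolding additive_on_def using mhom_in[OF f x] mhom_add[OF f x] mhom_diff[OF M f x] by blast

lemma phi_diff:
  assumes V: "finite (supp V)" and W: "finite (supp W)" and F: "carr V W F" and G: "carr V W G"
  shows "phi V W (%z. F z - G z) = (%x v. phi V W F x v - phi V W G x v)"
proof -
  have FG: "carr V W (%z. F z - G z)" using F G unfolding carr_def by (meson minus_carrier_mat)
  have "F z - G z + G z = F z" if "z : verts Q" for z using carrD[OF F that] carrD[OF G that] by (intro eq_matI) auto
  then have "phi V W F = phi V W (%z. (F z - G z) + G z)" by (intro phi_cong) simp
  also have "... = (%x v. phi V W (%z. F z - G z) x v + phi V W G x v)" by (rule phi_add[OF V W FG G])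
  finally show ?thesis by (simp add: fun_eq_iff)
qed

lemma phi_comp_eq:
  assumes "finite (supp U)" "finite (supp V)" "finite (supp W)" "carr U V F" "carr V W G"
    and "!!z. z : verts Q ==> G z * F z = K z"
  shows "phi V W G x (phi U V F x v) = phi U W K x v"
proof -
  have "phi U W K = phi U W (%z. G z * F z)" by (rule phi_cong) (use assms(6) in simp)
  then show ?thesis using phi_comp[OF assms(1-5)] by simp
qed

lemma phi_comp_zero:
  assumes "finite (supp U)" "finite (supp V)" "finite (supp W)" "carr U V F" "carr V W G"
    and "!!z. z : verts Q ==> G z * F z = 0\<^sub>m (W z) (U z)"
  shows "phi V W G x (phi U V F x v) = 0" using phi_comp_eq[OF assms] phi_zero[OF assms(1,3)] by simp

text \<open>The differential is split as \<open>d0 + d1\<close>: \<open>d0\<close> lifts its tops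
  with zero radical component, \<open>d1\<close> is the radical rest. The tops form a complex of
  vector spaces at every vertex, whose contraction lifts through \<open>phi\<close>, and
  perturbation transfers \<open>d1\<close> to the homology of the tops. The statement on zero terms
  preserves boundedness.\<close>

lemma homotopy_dense:
  assumes X: "is_fgp_complex scale A X"
  obtains M where "loc_rep M" "isomorphic (hcat fgp_complexes) X (FC M)"
    "!!n. is_zero_amod A (Tm X n) ==> supp (dims M n) = {}"
proof (rule FT_model[OF X])
  fix V Y a b
  assume V: "!!n. finite (supp (V n))" and Y: "is_fgp_complex scale A Y" and T: "!!n. Tm Y n = FT (V n)"
    and a: "a : chain X Y" and b: "b : chain Y X"
    and ba: "!!n x v. x : Obj A ==> v : Sp (Tm X n) x ==> b n x (a n x v) = v"
    and ab: "!!n x v. x : Obj A ==> v : Sp (Tm Y n) x ==> a n x (b n x v) = v"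
  have Xc: "cpx X" and Yc: "cpx Y" using X Y unfolding is_fgp_complex_def by blast+
  have dY: "Df Y n : mhom (FT (V n)) (FT (V (n - 1)))" for n using complex_Df[OF Yc, of n] by (simp add: T)
  have dY': "Df Y (n + 1) : mhom (FT (V (n + 1))) (FT (V n))" for n using dY[of "n + 1"] by simp
  note VM = FT_amod[OF V]
  define D where "D n z = top (V n) (V (n - 1)) (Df Y n) z" for n z
  have DD: "D n z * D (n + 1) z = 0\<^sub>m (V (n - 1) z) (V (n + 1) z)" if z: "z : verts Q" for n z
  proof -
    have "D n z * D (n + 1) z = top (V (n + 1)) (V (n - 1)) (%x v. Df Y n x (Df Y (n + 1) x v)) z"
      unfolding D_def using top_comp[OF dY' dY V z] by simp
    then show ?thesis using complex_DD[OF Yc] top_zero[OF z] by simp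
  qed
  define sdr where "sdr z r H I P \<longleftrightarrow> (ALL n. H n : carrier_mat (V (n + 1) z) (V n z) & I n : carrier_mat (V n z) (r n) &
    P n : carrier_mat (r n) (V n z) & P n * I n = 1\<^sub>m (r n) &
    I n * P n = 1\<^sub>m (V n z) - D (n + 1) z * H n - H (n - 1) * D n z &
    D n z * I n = 0\<^sub>m (V (n - 1) z) (r n) & P n * D (n + 1) z = 0\<^sub>m (r n) (V (n + 1) z) &
    H n * I n = 0\<^sub>m (V (n + 1) z) (r n) & P (n + 1) * H n = 0\<^sub>m (r (n + 1)) (V n z))"
    for z and r :: "int => nat" and H I P :: "int => 'k mat"
  have "EX r H I P. sdr z r H I P" if z: "z : verts Q" for z unfolding sdr_def
  proof (rule mat_complex_contraction[of "%n. D n z" "%n. V n z"])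
    show "D n z : carrier_mat (V (n - 1) z) (V n z)" for n by (simp add: D_def)
    show "D n z * D (n + 1) z = 0\<^sub>m (V (n - 1) z) (V (n + 1) z)" for n using DD[OF z] .
  qed
  then have "ALL z:verts Q. EX r H I P. sdr z r H I P" by blast
  from bchoice[OF this] obtain r :: "'o => int => nat" where "ALL z:verts Q. EX H I P. sdr z (r z) H I P" ..
  from bchoice[OF this] obtain H :: "'o => int => 'k mat" where "ALL z:verts Q. EX I P. sdr z (r z) (H z) I P" ..
  from bchoice[OF this] obtain I :: "'o => int => 'k mat" where "ALL z:verts Q. EX P. sdr z (r z) (H z) (I z) P" ..
  from bchoice[OF this] obtain P :: "'o => int => 'k mat" where sdr: "ALL z:verts Q. sdr z (r z) (H z) (I z) (P z)" ..
  define W where "W n z = r z n" for n z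
  note sd = sdr[unfolded sdr_def, rule_format]
  \<comment> \<open>Where the space is zero so is its homology; hence the new terms vanish wherever
    the old ones do.\<close>
  have W0: "supp (W n) \<subseteq> supp (V n)" for n
  proof
    fix z assume z: "z : supp (W n)"
    then have zv: "z : verts Q" using supp_verts by blast
    have "V n z ~= 0"
    proof
      assume "V n z = 0"
      then have "r z n = 0" using sd[OF zv, of n] by (intro right_inverse_dim_zero[of "I z n" _ "P z n"]) simp_all
      then show False using z by (simp add: supp_def W_def)
    qed
    then show "z : supp (V n)" using zv by (simp add: supp_def)
  qed
  have W: "finite (supp (W n))" for n using W0 V finite_subset by blast
  note WM = FT_amod[OF W]
  have cD: "carr (V n) (V (n - 1)) (D n)" for n by (simp add: carr_def D_def)
  have cD': "carr (V (n + 1)) (V n) (D (n + 1))" for n using cD[of "n + 1"] by simp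
  have cH: "carr (V n) (V (n + 1)) (%z. H z n)" for n using sd unfolding carr_def by blast
  have cH': "carr (V (n - 1)) (V n) (%z. H z (n - 1))" for n using cH[of "n - 1"] by simp
  have cI: "carr (W n) (V n) (%z. I z n)" for n using sd unfolding carr_def W_def by blast
  have cP: "carr (V n) (W n) (%z. P z n)" for n using sd unfolding carr_def W_def by blast
  define d0 where "d0 n = phi (V n) (V (n - 1)) (D n)" for n
  define h where "h n = phi (V n) (V (n + 1)) (%z. H z n)" for n
  define i where "i n = phi (W n) (V n) (%z. I z n)" for n
  define p where "p n = phi (V n) (W n) (%z. P z n)" for n
  define d1 where "d1 n = (%x v. Df Y n x v - d0 n x v)" for n
  have d0': "d0 (n + 1) = phi (V (n + 1)) (V n) (D (n + 1))" and h': "h (n - 1) = phi (V (n - 1)) (V n) (%z. H z (n - 1))" for n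
    by (simp_all add: d0_def h_def)
  have hd0: "d0 n : mhom (FT (V n)) (FT (V (n - 1)))" for n unfolding d0_def using phi(1)[OF V V cD] .
  have hh: "h n : mhom (FT (V n)) (FT (V (n + 1)))" for n unfolding h_def using phi(1)[OF V V cH] .
  have hh': "h (n - 1) : mhom (FT (V (n - 1))) (FT (V n))" for n using hh[of "n - 1"] by simp
  have hi: "i n : mhom (FT (W n)) (FT (V n))" for n unfolding i_def using phi(1)[OF W V cI] .
  have hp: "p n : mhom (FT (V n)) (FT (W n))" for n unfolding p_def using phi(1)[OF V W cP] .
  have hd1: "d1 n : mhom (FT (V n)) (FT (V (n - 1)))" for n unfolding d1_def using mhom_minus[OF VM dY hd0] .
  have r1: "rad_map (V n) (V (n - 1)) (d1 n)" for n unfolding rad_map_def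
  proof (intro conjI ballI)
    show "d1 n : mhom (FT (V n)) (FT (V (n - 1)))" by (rule hd1)
    fix z assume z: "z : verts Q"
    have "top (V n) (V (n - 1)) (d0 n) z = D n z" unfolding d0_def using phi(2)[OF V V cD z] .
    then show "top (V n) (V (n - 1)) (d1 n) z = 0\<^sub>m (V (n - 1) z) (V n z)"
      unfolding d1_def top_diff[OF dY hd0 z] by (simp add: D_def)
  qed
  have r1': "rad_map (V (n + 1)) (V n) (d1 (n + 1))" for n using r1[of "n + 1"] by simp
  have d1d1: "d1 (n - 1) x (d1 n x v) = 0" for n x v by (rule rad_map_comp_zero[OF r1 r1 V V V])
  \<comment> \<open>Radical maps form an ideal with square zero, so whatever stands between two
    factors \<open>d1\<close>, the composite vanishes.\<close>
  have d1hd1: "d1 n x (h (n - 1) x (d1 n x v)) = 0" for n x v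
    by (rule rad_map_comp_zero[OF rad_map_right[OF r1 hh' V] r1 V V V])
  have d1ipd1: "d1 (n - 1) x (i (n - 1) x (p (n - 1) x (d1 n x v))) = 0" for n x v
    by (rule rad_map_comp_zero[OF rad_map_right[OF r1 mhom_comp[OF hp hi] V] r1 V V V])
  have d1hhd1: "d1 (n + 1) x (h n x (h (n - 1) x (d1 n x v))) = 0" for n x v
    by (rule rad_map_comp_zero[OF rad_map_right[OF r1 mhom_comp[OF hh' hh] V] r1' V V V])
  have d0d0: "d0 (n - 1) x (d0 n x v) = 0" for n x v
    unfolding d0_def by (rule phi_comp_zero[OF V V V cD cD]) (use DD[of _ "n - 1"] in simp)
  \<comment> \<open>The locale is instantiated at each object separately; compatibility between
    objects is supplied by the maps being morphisms of modules.\<close>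
  have pert: "perturbation (%n. Sp (FT (V n)) x) (%n. Sp (FT (W n)) x) (%n. d0 n x) (%n. d1 n x)
     (%n. h n x) (%n. i n x) (%n. p n x)" if x: "x : Obj A" for x
  proof
    fix n
    show "u + v : Sp (FT (V n)) x" "u - v : Sp (FT (V n)) x" if "u : Sp (FT (V n)) x" "v : Sp (FT (V n)) x" for u v
      using amod_add[OF VM x] amod_diff[OF VM x] that by blast+
    show "additive_on (Sp (FT (V n)) x) (Sp (FT (V (n - 1))) x) (d0 n x)" using mhom_additive_on[OF VM hd0 x] .
    show "additive_on (Sp (FT (V n)) x) (Sp (FT (V (n - 1))) x) (d1 n x)" using mhom_additive_on[OF VM hd1 x] .
    show "additive_on (Sp (FT (V n)) x) (Sp (FT (V (n + 1))) x) (h n x)" using mhom_additive_on[OF VM hh x] .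
    show "additive_on (Sp (FT (W n)) x) (Sp (FT (V n)) x) (i n x)" using mhom_additive_on[OF WM hi x] .
    show "additive_on (Sp (FT (V n)) x) (Sp (FT (W n)) x) (p n x)" using mhom_additive_on[OF VM hp x] .
    show "d0 n x (i n x w) = 0" for w
      unfolding d0_def i_def by (rule phi_comp_zero[OF W V V cI cD]) (use sd in \<open>simp add: W_def\<close>)
    show "p (n - 1) x (d0 n x u) = 0" for u
      unfolding d0_def p_def by (rule phi_comp_zero[OF V V W cD cP]) (use sd[of _ "n - 1"] in \<open>simp add: W_def\<close>)
    show "h n x (i n x w) = 0" for w
      unfolding h_def i_def by (rule phi_comp_zero[OF W V V cI cH]) (use sd in \<open>simp add: W_def\<close>)
    show "p (n + 1) x (h n x u) = 0" for u
      unfolding h_def p_def by (rule phi_comp_zero[OF V V W cH cP]) (use sd in \<open>simp add: W_def\<close>)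
    show "p n x (i n x w) = w" if "w : Sp (FT (W n)) x" for w
    proof -
      have "p n x (i n x w) = phi (W n) (W n) (%z. 1\<^sub>m (W n z)) x w"
        unfolding i_def p_def by (rule phi_comp_eq[OF W V W cI cP]) (use sd in \<open>simp add: W_def\<close>)
      then show ?thesis using phi_id[OF W] x that by simp
    qed
    show "i n x (p n x u) = u - d0 (n + 1) x (h n x u) - h (n - 1) x (d0 n x u)" if u: "u : Sp (FT (V n)) x" for u
    proof -
      let ?A = "%z. D (n + 1) z * H z n" and ?B = "%z. H z (n - 1) * D n z"
      have cA: "carr (V n) (V n) ?A" using cD' cH unfolding carr_def by (meson mult_carrier_mat)
      have cB: "carr (V n) (V n) ?B" using cD cH' unfolding carr_def by (meson mult_carrier_mat)
      have c1: "carr (V n) (V n) (%z. 1\<^sub>m (V n z))" by (simp add: carr_def)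
      have c1A: "carr (V n) (V n) (%z. 1\<^sub>m (V n z) - ?A z)" using c1 cA unfolding carr_def by (meson minus_carrier_mat)
      have "i n x (p n x u) = phi (V n) (V n) (%z. 1\<^sub>m (V n z) - ?A z - ?B z) x u"
        unfolding i_def p_def by (rule phi_comp_eq[OF V W V cP cI]) (use sd in simp)
      also have "... = phi (V n) (V n) (%z. 1\<^sub>m (V n z)) x u - phi (V n) (V n) ?A x u - phi (V n) (V n) ?B x u"
        using phi_diff[OF V V c1A cB] phi_diff[OF V V c1 cA] by simp
      also have "phi (V n) (V n) (%z. 1\<^sub>m (V n z)) x u = u" using phi_id[OF V] x u by simp
      also have "phi (V n) (V n) ?A x u = d0 (n + 1) x (h n x u)"
        unfolding d0' h_def using phi_comp_eq[OF V V V cH[of n] cD'[of n], where K = ?A] by simp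
      also have "phi (V n) (V n) ?B x u = h (n - 1) x (d0 n x u)"
        unfolding h' d0_def using phi_comp_eq[OF V V V cD[of n] cH'[of n], where K = ?B] by simp
      finally show ?thesis .
    qed
    show "d0 (n - 1) x (d1 n x u) + d1 (n - 1) x (d0 n x u) = 0" if u: "u : Sp (FT (V n)) x" for u
    proof -
      have m: "d0 n x u : Sp (FT (V (n - 1))) x" "d1 n x u : Sp (FT (V (n - 1))) x"
        using mhom_in[OF hd0 x u] mhom_in[OF hd1 x u] .
      \<comment> \<open>In the expanded square of \<open>d0 + d1\<close> the parts
        \<open>d0 d0\<close> and \<open>d1 d1\<close> vanish separately, and the mixed part is the
        claim.\<close>
      have "Df Y n x u = d0 n x u + d1 n x u" by (simp add: d1_def)
      then have "0 = Df Y (n - 1) x (d0 n x u + d1 n x u)" using complex_DD[OF Yc, of "n - 1" x u] by simp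
      also have "... = Df Y (n - 1) x (d0 n x u) + Df Y (n - 1) x (d1 n x u)" using mhom_add[OF dY x m] .
      also have "Df Y (n - 1) x (d0 n x u) = d1 (n - 1) x (d0 n x u)" using d0d0 by (simp add: d1_def)
      also have "Df Y (n - 1) x (d1 n x u) = d0 (n - 1) x (d1 n x u)" using d1d1[of n x u] by (simp add: d1_def[of "n - 1"])
      finally have "d1 (n - 1) x (d0 n x u) + d0 (n - 1) x (d1 n x u) = 0" by (rule sym)
      then show ?thesis by (subst add.commute)
    qed
  qed (use d1d1 d1hd1 d1ipd1 d1hhd1 in auto)
  \<comment> \<open>The homology of the tops with the transferred differential
    \<open>p d1 i\<close>, which is radical.\<close>
  define Z where "Z = \<lparr>Tm = (%n. FT (W n)), Df = (%n x v. p (n - 1) x (d1 n x (i n x v)))\<rparr>"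
  have TZ: "Tm Z n = FT (W n)" and DZ: "Df Z n = (%x v. p (n - 1) x (d1 n x (i n x v)))" for n by (simp_all add: Z_def)
  have rZ: "rad_map (W n) (W (n - 1)) (Df Z n)" for n unfolding DZ using rad_map_right[OF rad_map_left[OF hi r1 V] hp V] .
  have Zc: "cpx Z"
  proof (rule complexI)
    show "amod (Tm Z n)" for n unfolding TZ using WM .
    show "Df Z n : mhom (Tm Z n) (Tm Z (n - 1))" for n unfolding TZ using rZ unfolding rad_map_def by blast
    have rZ': "rad_map (W (n + 1)) (W n) (Df Z (n + 1))" for n using rZ[of "n + 1"] by simp
    show "Df Z n x (Df Z (n + 1) x v) = 0" for n x v by (rule rad_map_comp_zero[OF rZ' rZ W W W])
  qed
  obtain M where M: "loc_rep M" "FC M = Z" "ALL n. dims M n = W n" using rad_complex_FC[OF Zc W TZ rZ] .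
  define i' where "i' n = (%x v. i n x v - h (n - 1) x (d1 n x (i n x v)))" for n
  define p' where "p' n = (%x v. p n x v - p n x (d1 (n + 1) x (h n x v)))" for n
  define h'' where "h'' n = (%x v. h n x v - h n x (d1 (n + 1) x (h n x v)))" for n
  have hd1': "d1 (n + 1) : mhom (FT (V (n + 1))) (FT (V n))" for n using hd1[of "n + 1"] by simp
  have hi': "i' n : mhom (FT (W n)) (FT (V n))" for n
    unfolding i'_def using mhom_minus[OF VM hi mhom_comp[OF mhom_comp[OF hi hd1] hh']] .
  have hp': "p' n : mhom (FT (V n)) (FT (W n))" for n
    unfolding p'_def using mhom_minus[OF WM hp mhom_comp[OF mhom_comp[OF hh hd1'] hp]] .
  have hh'': "h'' n : mhom (FT (V n)) (FT (V (n + 1)))" for n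
    unfolding h''_def using mhom_minus[OF VM hh mhom_comp[OF mhom_comp[OF hh hd1'] hh]] .
  have split: "Df Y n x v = d0 n x v + d1 n x v" for n x v by (simp add: d1_def)
  have ic: "i' : chain Z Y"
  proof (rule chainI[OF Zc Yc])
    show "i' n : mhom (Tm Z n) (Tm Y n)" for n unfolding TZ T using hi' .
    fix n x v assume x: "x : Obj A" and v: "v : Sp (Tm Z n) x"
    note pt = pert[OF x]
    show "Df Y n x (i' n x v) = i' (n - 1) x (Df Z n x v)" using perturbation.I'_chain[OF pt, of v n] v
      unfolding split TZ DZ i'_def perturbation.I'_def[OF pt] perturbation.\<delta>_def[OF pt] by simp
  qed
  have pc: "p' : chain Y Z"
  proof (rule chainI[OF Yc Zc])
    show "p' n : mhom (Tm Y n) (Tm Z n)" for n unfolding TZ T using hp' .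
    fix n x v assume x: "x : Obj A" and v: "v : Sp (Tm Y n) x"
    note pt = pert[OF x]
    show "Df Z n x (p' n x v) = p' (n - 1) x (Df Y n x v)" using perturbation.P'_chain[OF pt, of v n] v
      unfolding split T DZ p'_def perturbation.P'_def[OF pt] perturbation.\<delta>_def[OF pt] by simp
  qed
  have 1: "htp Z Z (ccomp p' i') (cid Z)"
  proof (rule htpI[OF Zc Zc chain_ccomp[OF Zc Zc ic pc] chain_cid[OF Zc], where h = "%n x v. 0"])
    show "(%x v. 0) : mhom (Tm Z n) (Tm Z (n + 1))" for n unfolding TZ using mhom_zero_map[OF WM] .
    fix n x v assume x: "x : Obj A" and v: "v : Sp (Tm Z n) x"
    note pt = pert[OF x]
    have "p' n x (i' n x v) = v" using perturbation.P'_I'[OF pt, of v n] v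
      unfolding TZ i'_def p'_def perturbation.P'_def[OF pt] perturbation.I'_def[OF pt] by simp
    then show "ccomp p' i' n x v - cid Z n x v = Df Z (n + 1) x 0 + 0"
      using x v mhom_0[OF complex_Df[OF Zc]] by (simp add: ccomp_def cid_def)
  qed
  have 2: "htp Y Y (cid Y) (ccomp i' p')"
  proof (rule htpI[OF Yc Yc chain_cid[OF Yc] chain_ccomp[OF Yc Yc pc ic], where h = h''])
    show "h'' n : mhom (Tm Y n) (Tm Y (n + 1))" for n unfolding T using hh'' .
    fix n x v assume x: "x : Obj A" and v: "v : Sp (Tm Y n) x"
    note pt = pert[OF x]
    have "v - i' n x (p' n x v) = Df Y (n + 1) x (h'' n x v) + h'' (n - 1) x (Df Y n x v)"
      using perturbation.I'_P'[OF pt, of v n] v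
      unfolding T split i'_def p'_def h''_def perturbation.P'_def[OF pt] perturbation.I'_def[OF pt] perturbation.H'_def[OF pt]
      by simp
    then show "cid Y n x v - ccomp i' p' n x v = Df Y (n + 1) x (h'' n x v) + h'' (n - 1) x (Df Y n x v)"
      using x v by (simp add: ccomp_def cid_def)
  qed
  have Zf: "Z : fgp_complexes" using FC_fgp[OF M(1)] M(2) by simp
  have Yf: "Y : fgp_complexes" and Xf: "X : fgp_complexes" using X Y by simp_all
  have YZ: "isomorphic (hcat fgp_complexes) Y Z"
    by (rule isomorphic_homotopyI[OF fgp_complex Yf Zf pc ic htp_sym[OF Yc Yc chain_cid[OF Yc] chain_ccomp[OF Yc Yc pc ic] 2] 1])
  have XYc: "isomorphic (ccat fgp_complexes) X Y" by (rule isomorphic_complexesI[OF Xc Yc Xf Yf a b ba ab])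
  have XY: "isomorphic (hcat fgp_complexes) X Y" by (rule isomorphic_complexes_homotopy[OF fgp_complex XYc Xf Yf])
  interpret hc: preadditive "hcat fgp_complexes" by (rule preadditive_homotopy_category[OF fgp_complex])
  interpret cc: preadditive "ccat fgp_complexes" by (rule preadditive_complexes[OF fgp_complex])
  have "supp (dims M n) = {}" if "is_zero_amod A (Tm X n)" for n
    using isomorphic_complexes_zero[OF fgp_complex cc.isomorphic_sym[OF XYc] that] W0[of n] by (simp add: T zero_FT M(3))
  then show ?thesis using that[OF M(1)] hc.isomorphic_trans[OF XY YZ] M(2) by simp
qed

section \<open>The comparison functors\<close>

text \<open>The representations whose complex lies in the category \<open>K_minus_b\<close>, see
  \<open>FC_KS\<close>.\<close>

definition lrep :: "('o, 'a, 'k) brep => bool" where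
  "lrep M \<longleftrightarrow> loc_rep M & (EX b. ALL n<b. supp (dims M n) = {}) & finite {n. \<not> exact_at (FC M) n}"

definition LRep :: "(('o, 'a, 'k) brep, 'o \<times> int => 'k mat) precat" where
  "LRep = (Rep QB)\<lparr>Obj := {M. lrep M}\<rparr>"

lemma LRep_simps [simp]:
  "Obj LRep = {M. lrep M}" "Hom LRep = qrep_hom QB"
  "Idn LRep = Idn (Rep QB)" "Cmp LRep = Cmp (Rep QB)" "precat.Sum LRep = precat.Sum (Rep QB)" "Zer LRep = Zer (Rep QB)"
  unfolding LRep_def Rep_def by simp_all

abbreviation "KS \<equiv> {X. is_fgp_complex scale A X & right_bounded A X & bounded_homology A X}"
abbreviation "PS \<equiv> {X. is_fgp_complex scale A X & bounded_complex A X & minimal_complex scale A X}"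

lemma KS_complex: "X : KS ==> cpx X"
  and PS_complex: "X : PS ==> cpx X" by (simp_all add: is_fgp_complex_def)

lemma bounded_homology_iff: "bounded_homology A X \<longleftrightarrow> finite {n. \<not> exact_at X n}"
  unfolding bounded_homology_def exact_at_def by (simp add: Bex_def)

lemma FC_KS: "loc_rep M ==> FC M : KS \<longleftrightarrow> lrep M"
  using FC_fgp by (auto simp: lrep_def right_bounded_def FC_Tm zero_FT bounded_homology_iff)

lemma lrep_loc: "lrep M ==> loc_rep M" by (simp add: lrep_def)

text \<open>Puts finite total support into the form that compares with \<open>lrep\<close> and with
  boundedness of complexes.\<close>

lemma is_qrep_iff: "is_qrep QB M \<longleftrightarrow> loc_rep M & (EX b. ALL n<b. supp (dims M n) = {}) & (EX t. ALL n>t. supp (dims M n) = {})"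
proof
  assume q: "is_qrep QB M"
  let ?S = "{v : verts Q \<times> UNIV. Dim M v ~= 0}"
  have fin: "finite ?S" using q unfolding is_qrep_def QB_simps by blast
  have f1: "finite (supp (dims M n))" for n
  proof (rule finite_subset)
    show "supp (dims M n) \<subseteq> fst ` ?S"
    proof
      fix x assume "x : supp (dims M n)"
      then have "(x, n) : ?S" by (simp add: supp_def dims_def)
      then show "x : fst ` ?S" by (rule rev_image_eqI) simp
    qed
    show "finite (fst ` ?S)" using fin by (rule finite_imageI)
  qed
  have m: "Mat M (q, n) : carrier_mat (Dim M (tail Q q, n - 1)) (Dim M (head Q q, n))" if "q : arcs Q" for q n
  proof -
    have "ALL a:arcs QB. Mat M a : carrier_mat (Dim M (head QB a)) (Dim M (tail QB a))"
      using q unfolding is_qrep_def by blast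
    from bspec[OF this, of "(q, n)"] show ?thesis using that by (simp add: QB_simps)
  qed
  have s: "n : snd ` ?S" if ne: "supp (dims M n) ~= {}" for n
  proof -
    obtain x where "x : supp (dims M n)" using ne by blast
    then have "(x, n) : ?S" by (simp add: supp_def dims_def)
    then show ?thesis by (rule rev_image_eqI) simp
  qed
  have fs: "finite (snd ` ?S)" using fin by (rule finite_imageI)
  obtain b where b: "!!n. n : snd ` ?S ==> b <= n" using bdd_below_finite[OF fs] unfolding bdd_below_def by blast
  obtain t where t: "!!n. n : snd ` ?S ==> n <= t" using bdd_above_finite[OF fs] unfolding bdd_above_def by blast
  have "loc_rep M" unfolding loc_rep_def using f1 m by blast
  moreover have "ALL n<b. supp (dims M n) = {}" "ALL n>t. supp (dims M n) = {}" using b[OF s] t[OF s] by force+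
  ultimately show "loc_rep M & (EX b. ALL n<b. supp (dims M n) = {}) & (EX t. ALL n>t. supp (dims M n) = {})" by blast
next
  assume *: "loc_rep M & (EX b. ALL n<b. supp (dims M n) = {}) & (EX t. ALL n>t. supp (dims M n) = {})"
  then obtain b t where b: "!!n. n < b ==> supp (dims M n) = {}" and t: "!!n. n > t ==> supp (dims M n) = {}" by blast
  have "{v : verts Q \<times> UNIV. Dim M v ~= 0} \<subseteq> (\<Union>n\<in>{b..t}. (%x. (x, n)) ` supp (dims M n))"
  proof
    fix v assume "v : {v : verts Q \<times> UNIV. Dim M v ~= 0}"
    then obtain x n where v: "v = (x, n)" "x : supp (dims M n)" by (cases v) (auto simp: supp_def dims_def)
    then have "b <= n" "n <= t" using b[of n] t[of n] by force+
    then show "v : (\<Union>n\<in>{b..t}. (%x. (x, n)) ` supp (dims M n))" using v by auto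
  qed
  moreover have "finite (\<Union>n\<in>{b..t}. (%x. (x, n)) ` supp (dims M n))" using * loc_rep_fin by auto
  ultimately have "finite {v : verts QB. Dim M v ~= 0}" unfolding QB_simps by (rule finite_subset)
  then show "is_qrep QB M" unfolding is_qrep_def using * loc_rep_Mat by (auto simp: QB_simps)
qed

lemma FC_PS: "M : Obj (Rep QB) ==> FC M : PS"
  using FC_fgp[of M] FC_minimal[of M] by (auto simp: is_qrep_iff bounded_complex_def FC_Tm zero_FT)

lemma isomorphic_complexes_mono:
  "isomorphic (ccat S) X Y ==> X : S' ==> Y : S' ==> isomorphic (ccat S') X Y" unfolding isomorphic_def by simp

lemma isomorphic_homotopy_mono:
  assumes S: "!!X. X : S ==> cpx X" and S': "!!X. X : S' ==> cpx X"
    and i: "isomorphic (hcat S) X Y" and X: "X : S'" and Y: "Y : S'"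
  shows "isomorphic (hcat S') X Y"
proof (rule isomorphic_homotopyD[OF S i])
  fix f g
  assume "f : chain X Y" "g : chain Y X" "htp X X (ccomp g f) (cid X)" "htp Y Y (ccomp f g) (cid Y)"
  with S' X Y show ?thesis using isomorphic_homotopyI[of S' X Y f g] by blast
qed

lemma PS_dense:
  assumes X: "X : PS"
  shows "EX M:Obj (Rep QB). isomorphic (ccat PS) X (FC M)"
proof -
  have fX: "is_fgp_complex scale A X" and mX: "minimal_complex scale A X" and bX: "bounded_complex A X" using X by simp_all
  obtain M where M: "loc_rep M" and i: "isomorphic (ccat fgp_complexes) X (FC M)" using minimal_dense[OF fX mX] by blast
  interpret cc: preadditive "ccat fgp_complexes" by (rule preadditive_complexes[OF fgp_complex])
  have "supp (dims M n) = {}" if "is_zero_amod A (Tm X n)" for n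
    using isomorphic_complexes_zero[OF fgp_complex cc.isomorphic_sym[OF i] that] by (simp add: FC_Tm zero_FT)
  then have q: "M : Obj (Rep QB)" using M bX unfolding bounded_complex_def Rep_simps mem_Collect_eq is_qrep_iff by blast
  have "isomorphic (ccat PS) X (FC M)" using isomorphic_complexes_mono[OF i _ FC_PS[OF q]] X by simp
  then show "EX M:Obj (Rep QB). isomorphic (ccat PS) X (FC M)" using q by blast
qed

lemma functor_pair_P: "functor_pair (ccat PS) (Rep QB) FC cphi ctop"
proof (rule functor_pair.intro[OF preadditive_complexes[OF PS_complex] functor_pair_axioms.intro], goal_cases)
  case (11 L M N f g)
  then show ?case unfolding complexes_simps by (intro ctop_ccomp) (simp_all add: is_qrep_iff)
next
  case (12 M N f g)
  then show ?case unfolding complexes_simps by (intro ctop_csum) simp_all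
next
  case (13 L M N)
  then show ?case unfolding Rep_simps by (intro qrep_hom_Cmp[of L M N]) (simp_all add: is_qrep_iff)
next
  case (14 X)
  then show ?case using PS_dense by simp
next
  case 2
  then show ?case using FC_PS by simp
qed (simp_all add: is_qrep_iff cphi_chain cphi_Idn cphi_Zer cphi_Cmp cphi_Sum ctop_hom ctop_cid ctop_czero del: Rep_simps(3-6))

text \<open>\<open>Umap\<close> picks an arbitrary representative of a homotopy class; by
  \<open>ctop_htp\<close> the top does not depend on the choice.\<close>

lemma ctop_some_hcl:
  assumes M: "loc_rep M" and N: "loc_rep N" and f: "f : chain (FC M) (FC N)"
  shows "ctop M N (SOME g. g : hcl (FC M) (FC N) f) = ctop M N f"
proof -
  note c = FC_complex[OF M] FC_complex[OF N]
  define g where "g = (SOME g. g : hcl (FC M) (FC N) f)"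
  have "g : hcl (FC M) (FC N) f" unfolding g_def using someI[of "%g. g : hcl (FC M) (FC N) f", OF hcl_self[OF c f]] .
  from hcl_D[OF c this] have "g : chain (FC M) (FC N)" "htp (FC M) (FC N) f g" by blast+
  then show ?thesis unfolding g_def[symmetric] using ctop_htp[OF M N f] by simp
qed

abbreviation "Gmap M N \<phi> \<equiv> hcl (FC M) (FC N) (cphi M N \<phi>)"
abbreviation "Umap M N F \<equiv> ctop M N (SOME f. f : F)"

lemma functor_pair_K: "functor_pair (hcat KS) LRep FC Gmap Umap"
proof (rule functor_pair.intro[OF preadditive_homotopy_category[OF KS_complex] functor_pair_axioms.intro], goal_cases)
  case (2 M)
  then show ?case using FC_KS[of M] lrep_loc[of M] by simp
next
  case (6 L M N \<phi> \<psi>)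
  then have l: "loc_rep L" "loc_rep M" "loc_rep N" and h: "\<phi> : qrep_hom QB L M" "\<psi> : qrep_hom QB M N" using lrep_loc by simp_all
  show ?case unfolding homotopy_category_simps LRep_simps cphi_Cmp[OF l h]
    using hcl_ccomp[OF l[THEN FC_complex] cphi_chain[OF l(1,2) h(1)] cphi_chain[OF l(2,3) h(2)]] by simp
next
  case (7 M N \<phi> \<psi>)
  then have l: "loc_rep M" "loc_rep N" and h: "\<phi> : qrep_hom QB M N" "\<psi> : qrep_hom QB M N" using lrep_loc by simp_all
  show ?case unfolding homotopy_category_simps LRep_simps cphi_Sum[OF l h]
    using hcl_csum[OF l[THEN FC_complex] cphi_chain[OF l h(1)] cphi_chain[OF l h(2)]] by simp
next
  case (8 M N F)
  then have l: "loc_rep M" "loc_rep N" using lrep_loc by simp_all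
  obtain f where f: "f : chain (FC M) (FC N)" "F = hcl (FC M) (FC N) f" using 8(3) unfolding homotopy_category_simps by blast
  show ?case unfolding f(2) ctop_some_hcl[OF l f(1)] LRep_simps by (rule ctop_hom[OF l f(1)])
next
  case (9 M)
  then have l: "loc_rep M" using lrep_loc by simp
  show ?case unfolding homotopy_category_simps ctop_some_hcl[OF l l chain_cid[OF FC_complex[OF l]]] LRep_simps by (rule ctop_cid[OF l])
next
  case (10 M N)
  then have l: "loc_rep M" "loc_rep N" using lrep_loc by simp_all
  show ?case
    unfolding homotopy_category_simps ctop_some_hcl[OF l chain_czero[OF l[THEN FC_complex]]] LRep_simps by (rule ctop_czero)
next
  case (11 L M N F G)
  then have l: "loc_rep L" "loc_rep M" "loc_rep N" using lrep_loc by simp_all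
  note c = l[THEN FC_complex]
  obtain f where f: "f : chain (FC L) (FC M)" "F = hcl (FC L) (FC M) f" using 11(4) unfolding homotopy_category_simps by blast
  obtain g where g: "g : chain (FC M) (FC N)" "G = hcl (FC M) (FC N) g" using 11(5) unfolding homotopy_category_simps by blast
  show ?case unfolding homotopy_category_simps f(2) g(2) hcl_ccomp[OF c f(1) g(1)]
      ctop_some_hcl[OF l(1,2) f(1)] ctop_some_hcl[OF l(2,3) g(1)] ctop_some_hcl[OF l(1,3) chain_ccomp[OF c(1,3) f(1) g(1)]]
      ctop_ccomp[OF l(2) f(1) g(1)] LRep_simps ..
next
  case (12 M N F G)
  then have l: "loc_rep M" "loc_rep N" using lrep_loc by simp_all
  note c = l[THEN FC_complex]
  obtain f where f: "f : chain (FC M) (FC N)" "F = hcl (FC M) (FC N) f" using 12(3) unfolding homotopy_category_simps by blast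
  obtain g where g: "g : chain (FC M) (FC N)" "G = hcl (FC M) (FC N) g" using 12(4) unfolding homotopy_category_simps by blast
  show ?case unfolding homotopy_category_simps f(2) g(2) hcl_csum[OF c f(1) g(1)]
      ctop_some_hcl[OF l f(1)] ctop_some_hcl[OF l g(1)] ctop_some_hcl[OF l chain_csum[OF c f(1) g(1)]]
      ctop_csum[OF f(1) g(1)] LRep_simps ..
next
  case (13 L M N)
  then show ?case unfolding LRep_simps Rep_simps by (intro qrep_hom_Cmp[of L M N]) (simp_all add: lrep_loc)
next
  \<comment> \<open>Density: right boundedness and bounded homology pass from \<open>X\<close> to
    its model \<open>FC M\<close>, which makes \<open>M\<close> an \<open>lrep\<close>.\<close>
  case (14 X)
  let ?K = "hcat KS"
  from 14 have fX: "is_fgp_complex scale A X" and rX: "right_bounded A X" and hX: "bounded_homology A X" by simp_all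
  obtain M where M: "loc_rep M" and i: "isomorphic (hcat fgp_complexes) X (FC M)"
    and z: "!!n. is_zero_amod A (Tm X n) ==> supp (dims M n) = {}" using homotopy_dense[OF fX] by blast
  have "{n. \<not> exact_at (FC M) n} = {n. \<not> exact_at X n}" using isomorphic_homotopy_exact[OF fgp_complex i] by simp
  then have "finite {n. \<not> exact_at (FC M) n}" using hX unfolding bounded_homology_iff by simp
  then have lM: "lrep M" using M rX z unfolding lrep_def right_bounded_def by blast
  have FK: "FC M : KS" using FC_KS[OF M] lM by blast
  have XK: "X : KS" using fX rX hX by blast
  have "isomorphic ?K X (FC M)" by (rule isomorphic_homotopy_mono[OF fgp_complex KS_complex i XK FK])
  then show ?case using lM by auto
qed (simp_all add: lrep_loc cphi_chain cphi_Idn cphi_Zer del: Rep_simps(3-6))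

section \<open>Exactness and coinduced representations\<close>

lemma FT_exists_vec:
  assumes z: "z : verts Q" and c: "c : carrier_vec (V z)"
    and w: "ALL q:arcs Q. head Q q = z --> w q : carrier_vec (V (tail Q q))"
  shows "EX v:Sp (FT V) z. tv V z v = c & (ALL q:arcs Q. head Q q = z --> av V q v = w q)"
proof (rule FT_exists[OF z, where V = V and c = "%i. c $ i" and w = "%q i. w q $ i"])
  fix v assume v: "v : Sp (FT V) z" and t: "!!i. i < V z ==> tv V z v $ i = c $ i"
    and a: "!!q i. q : arcs Q ==> head Q q = z ==> i < V (tail Q q) ==> av V q v $ i = w q $ i"
  have "tv V z v = c" using t c by (intro eq_vecI) auto
  moreover have "av V q v = w q" if q: "q : arcs Q" "head Q q = z" for q
  proof (rule eq_vecI)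
    have wc: "w q : carrier_vec (V (tail Q q))" using w q by blast
    show "dim_vec (av V q v) = dim_vec (w q)" using wc by simp
    fix i assume "i < dim_vec (w q)"
    then show "av V q v $ i = w q $ i" using a[OF q] wc by simp
  qed
  ultimately show ?thesis using v by blast
qed

lemma FT_exists_tv:
  assumes z: "z : verts Q" and c: "c : carrier_vec (V z)"
  shows "EX v:Sp (FT V) z. tv V z v = c"
  using FT_exists_vec[where V = V and w = "%q. 0\<^sub>v (V (tail Q q))", OF z c] by auto

text \<open>Injectivity of the joint map from the space at \<open>(z, n)\<close> into the sum, over
  the arrows \<open>q\<close> ending at \<open>z\<close>, of the spaces at
  \<open>(tail Q q, n - 1)\<close>; \<open>jsurj\<close> is surjectivity of the same map. Elements
  of the sum are written as families indexed by arrows.\<close>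

definition jinj :: "('o, 'a, 'k) brep => int => bool" where
  "jinj M n \<longleftrightarrow> (ALL z:verts Q. ALL c:carrier_vec (dims M n z).
     (ALL q:arcs Q. head Q q = z --> Mat M (q, n) *\<^sub>v c = 0\<^sub>v (dims M (n - 1) (tail Q q))) --> c = 0\<^sub>v (dims M n z))"

definition jsurj :: "('o, 'a, 'k) brep => int => bool" where
  "jsurj M n \<longleftrightarrow> (ALL z:verts Q. ALL w.
     (ALL q:arcs Q. head Q q = z --> w q : carrier_vec (dims M (n - 1) (tail Q q))) -->
     (EX c:carrier_vec (dims M n z). ALL q:arcs Q. head Q q = z --> Mat M (q, n) *\<^sub>v c = w q))"

lemma FC_tv:
  assumes M: "loc_rep M" and z: "z : verts Q" and v: "v : Sp (FT (dims M n)) z"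
  shows "tv (dims M (n - 1)) z (Df (FC M) n z v) = 0\<^sub>v (dims M (n - 1) z)"
  using tv_mhom[OF FC_Df_hom[OF M] loc_rep_fin[OF M] z v] FC_Df_top[OF M z, of n] by auto

lemma FC_av:
  assumes M: "loc_rep M" and a: "q : arcs Q" and v: "v : Sp (FT (dims M n)) (head Q q)"
  shows "av (dims M (n - 1)) q (Df (FC M) n (head Q q) v) = Mat M (q, n) *\<^sub>v tv (dims M n) (head Q q) v"
proof -
  have t: "tail Q q : verts Q" using a by simp
  have z: "0\<^sub>m (dims M (n - 1) (tail Q q)) (dims M n (tail Q q)) *\<^sub>v av (dims M n) q v = 0\<^sub>v (dims M (n - 1) (tail Q q))"
    by auto
  show ?thesis unfolding av_mhom[OF FC_Df_hom[OF M] loc_rep_fin[OF M] a v] FC_Df_top[OF M t, of n] FC_Df_arm[OF M a] z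
    using loc_rep_dims[OF M a, of n] by (intro left_zero_vec mult_mat_vec_carrier) auto
qed

lemma FC_mem: "loc_rep M ==> x : Obj A ==> v : Sp (FT (dims M n)) x ==> Df (FC M) n x v : Sp (FT (dims M (n - 1))) x"
  using mhom_in[OF FC_Df_hom] by blast

text \<open>The differential is radical and kills the radical part, so only the top coordinates of
  \<open>v\<close> count, and only arrow coordinates of the image can be nonzero.\<close>

lemma FC_cycle_iff:
  assumes M: "loc_rep M" and z: "z : verts Q"
  shows "v : cycles (FC M) n z \<longleftrightarrow> v : Sp (FT (dims M n)) z &
    (ALL q:arcs Q. head Q q = z --> Mat M (q, n) *\<^sub>v tv (dims M n) z v = 0\<^sub>v (dims M (n - 1) (tail Q q)))"
proof -
  have 0: "0 : Sp (FT (dims M (n - 1))) z" using amod_0[OF FT_amod[OF loc_rep_fin[OF M]]] z by simp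
  have "Df (FC M) n z v = 0 \<longleftrightarrow> (ALL q:arcs Q. head Q q = z -->
      Mat M (q, n) *\<^sub>v tv (dims M n) z v = 0\<^sub>v (dims M (n - 1) (tail Q q)))" if v: "v : Sp (FT (dims M n)) z"
  proof
    assume d: "Df (FC M) n z v = 0"
    show "ALL q:arcs Q. head Q q = z --> Mat M (q, n) *\<^sub>v tv (dims M n) z v = 0\<^sub>v (dims M (n - 1) (tail Q q))"
      using FC_av[OF M, of _ v n] v d by (metis av_0)
  next
    assume *: "ALL q:arcs Q. head Q q = z --> Mat M (q, n) *\<^sub>v tv (dims M n) z v = 0\<^sub>v (dims M (n - 1) (tail Q q))"
    show "Df (FC M) n z v = 0"
    proof (rule FT_eqI[OF z FC_mem[OF M vert_Obj[OF z] v] 0])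
      show "tv (dims M (n - 1)) z (Df (FC M) n z v) = tv (dims M (n - 1)) z 0" using FC_tv[OF M z v] tv_0[OF z] by simp
      show "av (dims M (n - 1)) q (Df (FC M) n z v) = av (dims M (n - 1)) q 0" if "q : arcs Q" "head Q q = z" for q
        using FC_av[OF M that(1), of v n] v that * av_0[OF that(1)] by simp
    qed
  qed
  then show ?thesis unfolding cycles_def FC_Tm by blast
qed

lemma FC_boundary_iff:
  assumes M: "loc_rep M" and z: "z : verts Q"
  shows "v : boundaries (FC M) n z \<longleftrightarrow> v : Sp (FT (dims M n)) z & tv (dims M n) z v = 0\<^sub>v (dims M n z) &
    (EX c:carrier_vec (dims M (n + 1) z). ALL q:arcs Q. head Q q = z --> av (dims M n) q v = Mat M (q, n + 1) *\<^sub>v c)"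
proof
  assume "v : boundaries (FC M) n z"
  then obtain u where u: "u : Sp (FT (dims M (n + 1))) z" "v = Df (FC M) (n + 1) z u" unfolding boundaries_def FC_Tm by blast
  have "v : Sp (FT (dims M n)) z" using FC_mem[OF M vert_Obj[OF z] u(1)] u(2) by simp
  moreover have "tv (dims M n) z v = 0\<^sub>v (dims M n z)" using FC_tv[OF M z u(1)] u(2) by simp
  moreover have "ALL q:arcs Q. head Q q = z --> av (dims M n) q v = Mat M (q, n + 1) *\<^sub>v tv (dims M (n + 1)) z u"
    using FC_av[OF M, of _ u "n + 1"] u by auto
  ultimately show "v : Sp (FT (dims M n)) z & tv (dims M n) z v = 0\<^sub>v (dims M n z) &
    (EX c:carrier_vec (dims M (n + 1) z). ALL q:arcs Q. head Q q = z --> av (dims M n) q v = Mat M (q, n + 1) *\<^sub>v c)"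
    using tv_carrier by blast
next
  assume *: "v : Sp (FT (dims M n)) z & tv (dims M n) z v = 0\<^sub>v (dims M n z) &
    (EX c:carrier_vec (dims M (n + 1) z). ALL q:arcs Q. head Q q = z --> av (dims M n) q v = Mat M (q, n + 1) *\<^sub>v c)"
  then obtain c where c: "c : carrier_vec (dims M (n + 1) z)"
    "!!q. q : arcs Q ==> head Q q = z ==> av (dims M n) q v = Mat M (q, n + 1) *\<^sub>v c" by blast
  obtain u where u: "u : Sp (FT (dims M (n + 1))) z" and tu: "tv (dims M (n + 1)) z u = c"
    using FT_exists_tv[where V = "dims M (n + 1)", OF z c(1)] by blast
  have "Df (FC M) (n + 1) z u = v"
  proof (rule FT_eqI[OF z])
    show "Df (FC M) (n + 1) z u : Sp (FT (dims M n)) z" using FC_mem[OF M vert_Obj[OF z] u(1)] by simp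
    show "v : Sp (FT (dims M n)) z" using * by blast
    show "tv (dims M n) z (Df (FC M) (n + 1) z u) = tv (dims M n) z v" using FC_tv[OF M z u(1)] * by simp
    show "av (dims M n) q (Df (FC M) (n + 1) z u) = av (dims M n) q v" if "q : arcs Q" "head Q q = z" for q
      using FC_av[OF M that(1), of u "n + 1"] u(1) that c(2)[OF that] tu by simp
  qed
  then show "v : boundaries (FC M) n z" unfolding boundaries_def FC_Tm using u(1) by blast
qed

text \<open>At a vertex the cycles of degree \<open>n\<close> consist of the whole radical part
  together with tops in the kernel of the joint map of degree \<open>n\<close>, while the boundaries
  are the image of the joint map of degree \<open>n + 1\<close> inside the radical part. Equality
  splits into injectivity of the one and surjectivity of the other.\<close>

lemma exact_FC_iff:
  assumes M: "loc_rep M"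
  shows "exact_at (FC M) n \<longleftrightarrow> jinj M n & jsurj M (n + 1)"
proof
  assume ex: "exact_at (FC M) n"
  then have cb: "cycles (FC M) n z = boundaries (FC M) n z" if "z : verts Q" for z using that unfolding exact_at_def by simp
  have "jinj M n" unfolding jinj_def
  proof (intro ballI impI)
    fix z c assume z: "z : verts Q" and c: "c : carrier_vec (dims M n z)"
      and k: "ALL q:arcs Q. head Q q = z --> Mat M (q, n) *\<^sub>v c = 0\<^sub>v (dims M (n - 1) (tail Q q))"
    obtain v where v: "v : Sp (FT (dims M n)) z" and tv: "tv (dims M n) z v = c"
      using FT_exists_tv[where V = "dims M n", OF z c] by blast
    have "v : cycles (FC M) n z" unfolding FC_cycle_iff[OF M z] tv using v k by blast
    then have "v : boundaries (FC M) n z" using cb[OF z] by blast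
    then show "c = 0\<^sub>v (dims M n z)" unfolding FC_boundary_iff[OF M z] tv by blast
  qed
  moreover have "jsurj M (n + 1)" unfolding jsurj_def
  proof (intro ballI allI impI)
    fix z and w :: "'a => 'k vec" assume z: "z : verts Q" and w: "ALL q:arcs Q. head Q q = z --> w q : carrier_vec (dims M (n + 1 - 1) (tail Q q))"
    have w': "ALL q:arcs Q. head Q q = z --> w q : carrier_vec (dims M n (tail Q q))" using w by simp
    obtain v where v: "v : Sp (FT (dims M n)) z" and tv: "tv (dims M n) z v = 0\<^sub>v (dims M n z)"
      and av: "ALL q:arcs Q. head Q q = z --> av (dims M n) q v = w q"
      using FT_exists_vec[where V = "dims M n" and w = w, OF z zero_carrier_vec w'] by blast
    have "Mat M (q, n) *\<^sub>v 0\<^sub>v (dims M n z) = 0\<^sub>v (dims M (n - 1) (tail Q q))" if "q : arcs Q" "head Q q = z" for q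
      using loc_rep_dims[OF M that(1), of n] that(2) by auto
    then have "v : cycles (FC M) n z" unfolding FC_cycle_iff[OF M z] tv using v by blast
    then have "v : boundaries (FC M) n z" using cb[OF z] by blast
    then obtain c where c: "c : carrier_vec (dims M (n + 1) z)"
      "ALL q:arcs Q. head Q q = z --> av (dims M n) q v = Mat M (q, n + 1) *\<^sub>v c"
      unfolding FC_boundary_iff[OF M z] by blast
    show "EX c:carrier_vec (dims M (n + 1) z). ALL q:arcs Q. head Q q = z --> Mat M (q, n + 1) *\<^sub>v c = w q"
    proof (rule bexI[OF _ c(1)], intro ballI impI)
      fix q assume a: "q : arcs Q" "head Q q = z"
      then show "Mat M (q, n + 1) *\<^sub>v c = w q" using c(2) av by simp
    qed
  qed
  ultimately show "jinj M n & jsurj M (n + 1)" by blast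
next
  assume j: "jinj M n & jsurj M (n + 1)"
  have *: "cycles (FC M) n z \<subseteq> boundaries (FC M) n z" if z: "z : verts Q" for z
  proof
    fix v assume "v : cycles (FC M) n z"
    then have v: "v : Sp (FT (dims M n)) z"
      and k: "ALL q:arcs Q. head Q q = z --> Mat M (q, n) *\<^sub>v tv (dims M n) z v = 0\<^sub>v (dims M (n - 1) (tail Q q))"
      unfolding FC_cycle_iff[OF M z] by blast+
    have t: "tv (dims M n) z v = 0\<^sub>v (dims M n z)" using j z k tv_carrier unfolding jinj_def by blast
    have "ALL q:arcs Q. head Q q = z --> av (dims M n) q v : carrier_vec (dims M (n + 1 - 1) (tail Q q))" by simp
    then obtain c where c: "c : carrier_vec (dims M (n + 1) z)"
      "ALL q:arcs Q. head Q q = z --> Mat M (q, n + 1) *\<^sub>v c = av (dims M n) q v"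
      using conjunct2[OF j, unfolded jsurj_def, rule_format, OF z, of "%q. av (dims M n) q v"] by auto
    then show "v : boundaries (FC M) n z" unfolding FC_boundary_iff[OF M z] using v t by (intro conjI bexI[OF _ c(1)]) (simp_all add: c(2))
  qed
  note c = FC_complex[OF M]
  \<comment> \<open>Cycles and boundaries are submodules, so agreement at the vertices extends to
    all objects.\<close>
  have S1: "submodule scale A (Tm (FC M) n) (cycles (FC M) n)"
    using submodule_kernel[OF complex_amod[OF c] complex_Df[OF c] complex_amod[OF c]] unfolding cycles_def .
  have S2: "submodule scale A (Tm (FC M) n) (boundaries (FC M) n)"
    using submodule_image[OF complex_amod[OF c] complex_Df'[OF c]] unfolding boundaries_def .
  show "exact_at (FC M) n"
    unfolding exact_at_def using submodule_le_verts[OF complex_amod[OF c] S1 S2 *] boundaries_cycles[OF c] by blast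
qed

definition hom_upto :: "int => ('o, 'a, 'k) brep => ('o, 'a, 'k) brep => ('o \<times> int => 'k mat) => bool" where
  "hom_upto t M N \<phi> \<longleftrightarrow> (ALL x:verts Q. ALL n<=t. \<phi> (x, n) : carrier_mat (dims N n x) (dims M n x)) &
    (ALL q:arcs Q. ALL n<=t. \<phi> (tail Q q, n - 1) * Mat M (q, n) = Mat N (q, n) * \<phi> (head Q q, n))"

definition agree_upto :: "int => ('o, 'a, 'k) brep => ('o, 'a, 'k) brep => bool" where
  "agree_upto t M N \<longleftrightarrow> (ALL n<=t. dims M n = dims N n) & (ALL q:arcs Q. ALL n<=t. Mat M (q, n) = Mat N (q, n))"

text \<open>With bijective joint maps above \<open>t\<close>, the part of \<open>M\<close> above
  \<open>t\<close> is determined by the part up to \<open>t\<close>, and morphisms into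
  \<open>M\<close> given up to \<open>t\<close> extend uniquely.\<close>

definition coinduced :: "int => ('o, 'a, 'k) brep => bool" where
  "coinduced t M \<longleftrightarrow> (ALL n>t. jinj M n & jsurj M n)"

text \<open>Surjectivity of the joint map of \<open>N\<close> solves the commutation conditions for
  all arrows ending at a vertex with one and the same matrix, column by column.\<close>

lemma extend_step:
  assumes M: "loc_rep M" and N: "loc_rep N" and s: "jsurj N (n + 1)"
    and \<psi>: "ALL x:verts Q. \<psi> x : carrier_mat (dims N n x) (dims M n x)"
  shows "EX \<psi>'. (ALL x:verts Q. \<psi>' x : carrier_mat (dims N (n + 1) x) (dims M (n + 1) x)) &
    (ALL q:arcs Q. \<psi> (tail Q q) * Mat M (q, n + 1) = Mat N (q, n + 1) * \<psi>' (head Q q))"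
proof -
  have dM: "Mat M (q, n + 1) : carrier_mat (dims M n (tail Q q)) (dims M (n + 1) (head Q q))"
    and dN: "Mat N (q, n + 1) : carrier_mat (dims N n (tail Q q)) (dims N (n + 1) (head Q q))" if "q : arcs Q" for q
    using loc_rep_dims[OF M that, of "n + 1"] loc_rep_dims[OF N that, of "n + 1"] by simp_all
  have "EX X. X : carrier_mat (dims N (n + 1) z) (dims M (n + 1) z) &
      (ALL q:{q : arcs Q. head Q q = z}. Mat N (q, n + 1) * X = \<psi> (tail Q q) * Mat M (q, n + 1))" if z: "z : verts Q" for z
  proof (rule mat_solve_cols[where S = "{q : arcs Q. head Q q = z}" and M = "%q. Mat N (q, n + 1)" and p = "%q. dims N n (tail Q q)"
        and d = "dims N (n + 1) z" and W = "%q. \<psi> (tail Q q) * Mat M (q, n + 1)" and n = "dims M (n + 1) z"])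
    show "Mat N (a, n + 1) : carrier_mat (dims N n (tail Q a)) (dims N (n + 1) z)" if "a : {q : arcs Q. head Q q = z}" for a
      using dN that by auto
    show Wc: "\<psi> (tail Q a) * Mat M (a, n + 1) : carrier_mat (dims N n (tail Q a)) (dims M (n + 1) z)"
      if "a : {q : arcs Q. head Q q = z}" for a
      using that mult_carrier_mat[OF bspec[OF \<psi>, of "tail Q a"] dM[of a]] by auto
    show "EX c:carrier_vec (dims N (n + 1) z). ALL a:{q : arcs Q. head Q q = z}. Mat N (a, n + 1) *\<^sub>v c = col (\<psi> (tail Q a) * Mat M (a, n + 1)) i"
      if "i < dims M (n + 1) z" for i
    proof -
      have "ALL a:arcs Q. head Q a = z --> col (\<psi> (tail Q a) * Mat M (a, n + 1)) i : carrier_vec (dims N (n + 1 - 1) (tail Q a))"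
      proof (intro ballI impI)
        fix a assume "a : arcs Q" "head Q a = z"
        then show "col (\<psi> (tail Q a) * Mat M (a, n + 1)) i : carrier_vec (dims N (n + 1 - 1) (tail Q a))"
          using col_carrier_vec[OF that Wc[of a]] by simp
      qed
      from s[unfolded jsurj_def, rule_format, OF z, OF this[rule_format]] show ?thesis by auto
    qed
  qed blast
  then have "ALL z:verts Q. EX X. X : carrier_mat (dims N (n + 1) z) (dims M (n + 1) z) &
      (ALL q:{q : arcs Q. head Q q = z}. Mat N (q, n + 1) * X = \<psi> (tail Q q) * Mat M (q, n + 1))" by blast
  from bchoice[OF this] obtain \<psi>' where p: "ALL z:verts Q. \<psi>' z : carrier_mat (dims N (n + 1) z) (dims M (n + 1) z) &
      (ALL q:{q : arcs Q. head Q q = z}. Mat N (q, n + 1) * \<psi>' z = \<psi> (tail Q q) * Mat M (q, n + 1))" ..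
  have "\<psi> (tail Q q) * Mat M (q, n + 1) = Mat N (q, n + 1) * \<psi>' (head Q q)" if "q : arcs Q" for q
    using bspec[OF p, of "head Q q"] that by simp
  then show ?thesis using p by blast
qed

lemma extend_hom:
  assumes M: "loc_rep M" and N: "loc_rep N" and co: "coinduced t N" and \<phi>: "hom_upto t M N \<phi>"
  obtains \<Phi> where "\<Phi> : qrep_hom QB M N" "ALL x:verts Q. ALL n<=t. \<Phi> (x, n) = \<phi> (x, n)"
proof -
  \<comment> \<open>The clause for \<open>k = 0\<close> pins the start of the sequence to the given
    matrices in degree \<open>t\<close>.\<close>
  define P where "P k \<psi> \<longleftrightarrow> (ALL x:verts Q. \<psi> x : carrier_mat (dims N (t + int k) x) (dims M (t + int k) x)) &
    (k = 0 --> \<psi> = (%x. \<phi> (x, t)))" for k and \<psi> :: "'o => 'k mat"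
  define R where "R k \<psi> \<psi>' \<longleftrightarrow> (ALL q:arcs Q. \<psi> (tail Q q) * Mat M (q, t + int k + 1) = Mat N (q, t + int k + 1) * \<psi>' (head Q q))"
    for k and \<psi> \<psi>' :: "'o => 'k mat"
  have "P 0 (%x. \<phi> (x, t))" using \<phi> unfolding P_def hom_upto_def by simp
  then have base: "EX \<psi>. P 0 \<psi>" by blast
  have step: "EX \<psi>'. P (Suc k) \<psi>' & R k \<psi> \<psi>'" if "P k \<psi>" for k \<psi>
  proof -
    have "jsurj N (t + int k + 1)" using co unfolding coinduced_def by simp
    moreover have "ALL x:verts Q. \<psi> x : carrier_mat (dims N (t + int k) x) (dims M (t + int k) x)" using that unfolding P_def ..
    ultimately have "EX \<psi>'. (ALL x:verts Q. \<psi>' x : carrier_mat (dims N (t + int k + 1) x) (dims M (t + int k + 1) x)) & R k \<psi> \<psi>'"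
      unfolding R_def by (rule extend_step[OF M N])
    then obtain \<psi>' where \<psi>': "ALL x:verts Q. \<psi>' x : carrier_mat (dims N (t + int k + 1) x) (dims M (t + int k + 1) x)" "R k \<psi> \<psi>'"
      by (elim exE conjE)
    have e: "t + int (Suc k) = t + int k + 1" by simp
    have "P (Suc k) \<psi>'" unfolding P_def e using \<psi>'(1) by simp
    with \<psi>'(2) show ?thesis by (intro exI[of _ \<psi>'] conjI)
  qed
  have "EX f. ALL k. P k (f k) & R k (f k) (f (Suc k))" by (rule dependent_nat_choice[of P R, OF base step])
  then obtain f where "ALL k. P k (f k) & R k (f k) (f (Suc k))" ..
  then have f: "P k (f k)" "R k (f k) (f (Suc k))" for k by simp_all
  define \<Phi> where "\<Phi> = (%(x, n). if x ~: verts Q then 0\<^sub>m 0 0 else if n <= t then \<phi> (x, n) else f (nat (n - t)) x)"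
  have f0: "f 0 = (%x. \<phi> (x, t))" using f(1)[of 0] unfolding P_def by blast
  have \<Phi>t: "\<Phi> (x, t + int k) = f k x" if "x : verts Q" for x k
    using that f0 by (cases "k = 0") (auto simp: \<Phi>_def)
  have "\<Phi> : qrep_hom QB M N" unfolding qrep_hom_iff
  proof (intro conjI ballI allI impI)
    fix x n assume x: "x : verts Q"
    show "\<Phi> (x, n) : carrier_mat (dims N n x) (dims M n x)"
    proof (cases "n <= t")
      case True
      then show ?thesis using \<phi> x unfolding \<Phi>_def hom_upto_def by simp
    next
      case False
      then obtain k where "n = t + int k" using zle_iff_zadd[of t n] by auto
      then show ?thesis using \<Phi>t[OF x, of k] f(1)[of k] x unfolding P_def by simp
    qed
  next
    fix q n assume a: "q : arcs Q"
    show "\<Phi> (tail Q q, n - 1) * Mat M (q, n) = Mat N (q, n) * \<Phi> (head Q q, n)"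
    proof (cases "n <= t")
      case True
      then show ?thesis using \<phi> a unfolding \<Phi>_def hom_upto_def by simp
    next
      case False
      then obtain k where k: "n = t + int k + 1" using zle_iff_zadd[of "t + 1" n] by auto
      have e: "\<Phi> (tail Q q, n - 1) = f k (tail Q q)" using \<Phi>t[of "tail Q q" k] a k by simp
      have "n = t + int (Suc k)" using k by simp
      then have e': "\<Phi> (head Q q, n) = f (Suc k) (head Q q)" using \<Phi>t[of "head Q q" "Suc k"] a by (simp only: arc_verts)
      show ?thesis unfolding e e' using f(2)[of k] a k unfolding R_def by simp
    qed
  qed (simp add: \<Phi>_def)
  then show ?thesis using that[of \<Phi>] by (simp add: \<Phi>_def)
qed

lemma jinj_cancel:
  assumes N: "loc_rep N" and j: "jinj N n" and z: "z : verts Q"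
    and X: "X : carrier_mat (dims N n z) k" and Y: "Y : carrier_mat (dims N n z) k"
    and e: "!!q. q : arcs Q ==> head Q q = z ==> Mat N (q, n) * X = Mat N (q, n) * Y"
  shows "X = Y"
proof (rule mat_col_eqI)
  fix i assume "i < dim_col Y"
  then have i: "i < k" using Y by simp
  let ?c = "col X i - col Y i"
  have cX: "col X i : carrier_vec (dims N n z)" and cY: "col Y i : carrier_vec (dims N n z)"
    using col_carrier_vec[OF i X] col_carrier_vec[OF i Y] .
  have "Mat N (q, n) *\<^sub>v ?c = 0\<^sub>v (dims N (n - 1) (tail Q q))" if a: "q : arcs Q" "head Q q = z" for q
  proof -
    have m: "Mat N (q, n) : carrier_mat (dims N (n - 1) (tail Q q)) (dims N n z)" using loc_rep_dims[OF N a(1), of n] a(2) by simp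
    have "Mat N (q, n) *\<^sub>v ?c = Mat N (q, n) *\<^sub>v col X i - Mat N (q, n) *\<^sub>v col Y i"
      by (rule mult_minus_distrib_mat_vec[OF m cX cY])
    also have "... = col (Mat N (q, n) * X) i - col (Mat N (q, n) * Y) i"
      using col_mult2[OF m X i] col_mult2[OF m Y i] by simp
    finally show ?thesis using e[OF a] m by auto
  qed
  moreover have "?c : carrier_vec (dims N n z)" using cX cY by simp
  ultimately have c0: "?c = 0\<^sub>v (dims N n z)" using j z unfolding jinj_def by blast
  have "col X i $ l = col Y i $ l" if l: "l < dims N n z" for l
  proof -
    have "l < dim_vec (col Y i)" using l carrier_vecD[OF cY] by (simp only:)
    then have "?c $ l = col X i $ l - col Y i $ l" by (rule index_minus_vec(1))
    moreover have "?c $ l = 0" unfolding c0 using l by simp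
    ultimately show ?thesis by (simp del: index_col)
  qed
  then show "col X i = col Y i" using carrier_vecD[OF cX] carrier_vecD[OF cY] by (intro eq_vecI) (simp_all only:)
qed (use X Y in auto)

text \<open>By injectivity of the joint maps of the target, the values in degree
  \<open>n - 1\<close> determine those in degree \<open>n\<close>. Identities between morphisms into
  a coinduced representation therefore can be checked up to \<open>t\<close>.\<close>

lemma hom_unique:
  assumes M: "loc_rep M" and N: "loc_rep N" and co: "coinduced t N"
    and \<Phi>: "\<Phi> : qrep_hom QB M N" and \<Psi>: "\<Psi> : qrep_hom QB M N"
    and e: "ALL x:verts Q. ALL n<=t. \<Phi> (x, n) = \<Psi> (x, n)"
  shows "\<Phi> = \<Psi>"
proof -
  have *: "ALL x:verts Q. \<Phi> (x, t + int k) = \<Psi> (x, t + int k)" for k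
  proof (induction k)
    case (Suc k)
    show ?case
    proof
      fix z assume z: "z : verts Q"
      have k: "t + int (Suc k) - 1 = t + int k" by simp
      show "\<Phi> (z, t + int (Suc k)) = \<Psi> (z, t + int (Suc k))"
      proof (rule jinj_cancel[OF N _ z cphi_carrier[OF M N \<Phi> z] cphi_carrier[OF M N \<Psi> z]])
        show "jinj N (t + int (Suc k))" using co unfolding coinduced_def by simp
        fix q assume a: "q : arcs Q" "head Q q = z"
        have "\<Phi> (tail Q q, t + int k) = \<Psi> (tail Q q, t + int k)" using Suc a by simp
        moreover have "\<Phi> (tail Q q, t + int (Suc k) - 1) * Mat M (q, t + int (Suc k)) = Mat N (q, t + int (Suc k)) * \<Phi> (head Q q, t + int (Suc k))"
          "\<Psi> (tail Q q, t + int (Suc k) - 1) * Mat M (q, t + int (Suc k)) = Mat N (q, t + int (Suc k)) * \<Psi> (head Q q, t + int (Suc k))"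
          using \<Phi> \<Psi> a unfolding qrep_hom_iff by blast+
        ultimately show "Mat N (q, t + int (Suc k)) * \<Phi> (z, t + int (Suc k)) = Mat N (q, t + int (Suc k)) * \<Psi> (z, t + int (Suc k))"
          unfolding k a(2) by simp
      qed
    qed
  qed (use e in simp)
  show ?thesis
  proof (rule ext)
    fix v :: "'o \<times> int"
    obtain x n where v: "v = (x, n)" by (cases v)
    show "\<Phi> v = \<Psi> v"
    proof (cases "x : verts Q")
      case True
      show ?thesis
      proof (cases "n <= t")
        case False
        then obtain k where "n = t + int k" using zle_iff_zadd[of t n] by auto
        then show ?thesis using *[of k] True v by simp
      qed (use e True v in simp)
    next
      case False
      then show ?thesis using \<Phi> \<Psi> v unfolding qrep_hom_iff by simp
    qed
  qed
qed

lemma hom_upto_of_hom: "\<phi> : qrep_hom QB M N ==> agree_upto t M' M ==> agree_upto t N' N ==> hom_upto t M' N' \<phi>"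
  unfolding qrep_hom_iff agree_upto_def hom_upto_def by simp

lemma qrep_hom_Idn: "loc_rep M ==> Idn (Rep QB) M : qrep_hom QB M M"
  using ctop_hom[of M M "cid (FC M)"] chain_cid[OF FC_complex] ctop_cid by metis

lemma qrep_hom_Zer: "loc_rep M ==> loc_rep N ==> Zer (Rep QB) M N : qrep_hom QB M N"
  using ctop_hom[of M N czero] chain_czero[OF FC_complex FC_complex] ctop_czero by metis

text \<open>Closure under sums is imported from chain maps, since \<open>ctop\<close> undoes
  \<open>cphi\<close>.\<close>

lemma qrep_hom_Sum:
  assumes M: "loc_rep M" and N: "loc_rep N" and \<phi>: "\<phi> : qrep_hom QB M N" and \<psi>: "\<psi> : qrep_hom QB M N"
  shows "(%v. \<phi> v + \<psi> v) : qrep_hom QB M N"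
proof -
  have t: "ctop M N (cphi M N \<theta>) = \<theta>" if "\<theta> : qrep_hom QB M N" for \<theta>
  proof (rule ext)
    fix v :: "'o \<times> int"
    obtain x n where v: "v = (x, n)" by (cases v)
    show "ctop M N (cphi M N \<theta>) v = \<theta> v"
      using cphi_phi(2)[OF M N that, of x n] that unfolding v ctop_def cphi_def qrep_hom_iff by simp
  qed
  have "ctop M N (csum (cphi M N \<phi>) (cphi M N \<psi>)) = (%v. \<phi> v + \<psi> v)"
    using ctop_csum[OF cphi_chain[OF M N \<phi>] cphi_chain[OF M N \<psi>]] t[OF \<phi>] t[OF \<psi>] by simp
  then show ?thesis
    using ctop_hom[OF M N chain_csum[OF FC_complex[OF M] FC_complex[OF N] cphi_chain[OF M N \<phi>] cphi_chain[OF M N \<psi>]]] by simp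
qed

text \<open>Both composites of the extended morphisms agree with the identity up to
  \<open>t\<close>, so uniqueness makes them identities.\<close>

lemma isomorphic_of_upto:
  assumes M: "lrep M" and N: "lrep N" and cM: "coinduced t M" and cN: "coinduced t N"
    and \<phi>: "hom_upto t M N \<phi>" and \<psi>: "hom_upto t N M \<psi>"
    and 1: "ALL x:verts Q. ALL n<=t. \<psi> (x, n) * \<phi> (x, n) = 1\<^sub>m (dims M n x)"
    and 2: "ALL x:verts Q. ALL n<=t. \<phi> (x, n) * \<psi> (x, n) = 1\<^sub>m (dims N n x)"
  shows "isomorphic LRep M N"
proof -
  note lM = lrep_loc[OF M] and lN = lrep_loc[OF N]
  obtain \<Phi> where \<Phi>: "\<Phi> : qrep_hom QB M N" "ALL x:verts Q. ALL n<=t. \<Phi> (x, n) = \<phi> (x, n)"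
    using extend_hom[OF lM lN cN \<phi>] .
  obtain \<Psi> where \<Psi>: "\<Psi> : qrep_hom QB N M" "ALL x:verts Q. ALL n<=t. \<Psi> (x, n) = \<psi> (x, n)"
    using extend_hom[OF lN lM cM \<psi>] .
  have "(%v. \<Psi> v * \<Phi> v) = Idn (Rep QB) M"
    by (rule hom_unique[OF lM lM cM qrep_hom_Cmp[OF lM lN lM \<Phi>(1) \<Psi>(1)] qrep_hom_Idn[OF lM]])
      (use \<Phi>(2) \<Psi>(2) 1 in \<open>simp add: QB_simps dims_def\<close>)
  moreover have "(%v. \<Phi> v * \<Psi> v) = Idn (Rep QB) N"
    by (rule hom_unique[OF lN lN cN qrep_hom_Cmp[OF lN lM lN \<Psi>(1) \<Phi>(1)] qrep_hom_Idn[OF lN]])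
      (use \<Phi>(2) \<Psi>(2) 2 in \<open>simp add: QB_simps dims_def\<close>)
  ultimately show ?thesis unfolding isomorphic_def LRep_simps Rep_simps(4) using M N \<Phi>(1) \<Psi>(1) by auto
qed

text \<open>In degree \<open>t + k + 1\<close> the coinduced representation is the direct sum, over the arrows ending at
  a vertex, of the spaces in degree \<open>t + k\<close> at their tails.\<close>

primrec codim :: "('o => nat) => nat => 'o => nat" where
  "codim V 0 = V"
| "codim V (Suc k) = (%y. \<Sum>q \<in> {q : arcs Q. head Q q = y}. codim V k (tail Q q))"

lemma codim_finite:
  assumes "finite (supp V)" shows "finite (supp (codim V k))"
proof (induction k)
  case (Suc k)
  \<comment> \<open>A vertex in the next support is the head of an arrow that starts in the present
    one, and only finitely many arrows start at a vertex.\<close>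
  have "supp (codim V (Suc k)) \<subseteq> head Q ` (\<Union>x\<in>supp (codim V k). {q : arcs Q. tail Q q = x})"
  proof
    fix y assume y: "y : supp (codim V (Suc k))"
    then obtain q where "q : arcs Q" "head Q q = y" "codim V k (tail Q q) ~= 0"
      using sum.not_neutral_contains_not_neutral[of "%q. codim V k (tail Q q)" "{q : arcs Q. head Q q = y}"] by (auto simp: supp_def)
    then show "y : head Q ` (\<Union>x\<in>supp (codim V k). {q : arcs Q. tail Q q = x})" by (force simp: supp_def)
  qed
  moreover have "finite (head Q ` (\<Union>x\<in>supp (codim V k). {q : arcs Q. tail Q q = x}))"
    using Suc finite_star(1) supp_verts by auto
  ultimately show ?case by (rule finite_subset)
qed (use assms in simp)

text \<open>The spaces above \<open>t\<close> are the targets of the joint maps, with coordinate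
  projections as matrices, so each joint map is the identity up to a numbering of basis
  vectors.\<close>

lemma coinduced_exists:
  assumes N: "loc_rep N"
  obtains M where "loc_rep M" "coinduced t M" "agree_upto t M N"
proof -
  let ?c = "codim (dims N t)"
  let ?In = "%y. {q : arcs Q. head Q q = y}"
  \<comment> \<open>\<open>B k y\<close> indexes the standard basis of the sum: an arrow ending at
    \<open>y\<close> together with a basis index at its tail. The bijection \<open>e\<close> numbers
    it, since spaces occur only as coordinate spaces.\<close>
  define B where "B k y = Sigma (?In y) (%q. {0..<?c k (tail Q q)})" for k y
  have "EX e. bij_betw e {0..<?c (Suc k) y} (B k y)" if "y : verts Q" for k y
  proof -
    have "finite (B k y)" unfolding B_def using finite_star(2)[OF that] by auto
    moreover have "card (B k y) = ?c (Suc k) y" unfolding B_def using finite_star(2)[OF that] by (simp add: card_SigmaI)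
    ultimately show ?thesis using ex_bij_betw_nat_finite by metis
  qed
  note ex = this
  define e where "e k y = (SOME e. bij_betw e {0..<?c (Suc k) y} (B k y))" for k y
  have e: "bij_betw (e k y) {0..<?c (Suc k) y} (B k y)" if "y : verts Q" for k y
    unfolding e_def using ex[OF that, of k] by (rule someI_ex)
  define M :: "('o, 'a, 'k) brep" where
    "M = \<lparr>Dim = (%(x, n). if n <= t then Dim N (x, n) else ?c (nat (n - t)) x),
      Mat = (%(q, n). if n <= t then Mat N (q, n) else let k = nat (n - t - 1) in
        mat (?c k (tail Q q)) (?c (Suc k) (head Q q)) (%(j, i). if e k (head Q q) i = (q, j) then 1 else 0))\<rparr>"
  have d1: "dims M n = dims N n" if "n <= t" for n using that by (simp add: M_def dims_def fun_eq_iff)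
  have d2: "dims M (t + int k) = ?c k" for k by (cases "k = 0") (auto simp: M_def dims_def fun_eq_iff)
  have m1: "Mat M (q, n) = Mat N (q, n)" if "n <= t" for q n using that by (simp add: M_def)
  have m2: "Mat M (q, t + int k + 1) = mat (?c k (tail Q q)) (?c (Suc k) (head Q q)) (%(j, i). if e k (head Q q) i = (q, j) then 1 else 0)" for q k
    unfolding M_def by (simp add: Let_def del: codim.simps)
  have d3: "dims M (t + int k + 1) = ?c (Suc k)" for k using d2[of "Suc k"] by (simp add: ac_simps del: codim.simps)
  have M: "loc_rep M" unfolding loc_rep_def
  proof (intro conjI allI ballI)
    show "finite (supp (dims M n))" for n
    proof (cases "n <= t")
      case False
      then obtain k where "n = t + int k" using zle_iff_zadd[of t n] by auto
      then show ?thesis using d2[of k] codim_finite[OF loc_rep_fin[OF N]] by simp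
    qed (use d1 loc_rep_fin[OF N] in simp)
    fix q n assume a: "q : arcs Q"
    have "Mat M (q, n) : carrier_mat (dims M (n - 1) (tail Q q)) (dims M n (head Q q))"
    proof (cases "n <= t")
      case True
      then show ?thesis using d1[of n] d1[of "n - 1"] m1 loc_rep_dims[OF N a, of n] by simp
    next
      case False
      then obtain k where k: "n = t + int k + 1" using zle_iff_zadd[of "t + 1" n] by auto
      then have "n - 1 = t + int k" by simp
      then show ?thesis using k m2[of q k] d2[of k] d3[of k] by simp
    qed
    then show "Mat M (q, n) : carrier_mat (Dim M (tail Q q, n - 1)) (Dim M (head Q q, n))" by (simp add: dims_def)
  qed
  \<comment> \<open>The matrix of \<open>q\<close> reads off the coordinates belonging to
    \<open>q\<close>; injectivity and surjectivity both follow from this.\<close>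
  have key: "(Mat M (q, t + int k + 1) *\<^sub>v c) $ j = c $ i"
    if y: "y : verts Q" and c: "c : carrier_vec (?c (Suc k) y)" and i: "i < ?c (Suc k) y" and ei: "e k y i = (q, j)" for k y c i q j
  proof -
    have "(q, j) : B k y" using e[OF y, of k] i ei unfolding bij_betw_def by force
    then have a: "head Q q = y" "j < ?c k (tail Q q)" by (auto simp: B_def)
    have inj: "e k y i' = (q, j) \<longleftrightarrow> i' = i" if "i' < ?c (Suc k) y" for i'
      using e[OF y, of k] that i ei unfolding bij_betw_def inj_on_def by force
    have "(Mat M (q, t + int k + 1) *\<^sub>v c) $ j = (\<Sum>i'=0..<?c (Suc k) y. (if e k y i' = (q, j) then 1 else 0) * c $ i')"
      unfolding m2 using a c by (simp add: scalar_prod_def del: codim.simps)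
    also have "... = (\<Sum>i'=0..<?c (Suc k) y. if i' = i then c $ i else 0)"
      using inj by (intro sum.cong refl) (auto simp del: codim.simps)
    also have "... = c $ i" using i by (subst sum.delta) (auto simp del: codim.simps)
    finally show ?thesis .
  qed
  have "jinj M (t + int k + 1) & jsurj M (t + int k + 1)" for k
  proof
    have k1: "t + int k + 1 - 1 = t + int k" by simp
    show "jinj M (t + int k + 1)" unfolding jinj_def d3 k1 d2
    proof (intro ballI impI)
      fix y c assume y: "y : verts Q" and c: "c : carrier_vec (?c (Suc k) y)"
        and z: "ALL q:arcs Q. head Q q = y --> Mat M (q, t + int k + 1) *\<^sub>v c = 0\<^sub>v (?c k (tail Q q))"
      show "c = 0\<^sub>v (?c (Suc k) y)"
      proof (rule eq_vecI)
        fix i assume "i < dim_vec (0\<^sub>v (?c (Suc k) y) :: 'k vec)"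
        then have i: "i < ?c (Suc k) y" by simp
        obtain q j where ei: "e k y i = (q, j)" by (cases "e k y i")
        then have "(q, j) : B k y" using e[OF y, of k] i unfolding bij_betw_def by force
        then have "q : arcs Q" "head Q q = y" "j < ?c k (tail Q q)" by (auto simp: B_def)
        then have "(Mat M (q, t + int k + 1) *\<^sub>v c) $ j = 0" using z by simp
        then show "c $ i = 0\<^sub>v (?c (Suc k) y) $ i" using key[OF y c i ei] i by simp
      qed (use c in simp)
    qed
    show "jsurj M (t + int k + 1)" unfolding jsurj_def d3 k1 d2
    proof (intro ballI allI impI)
      fix y and w :: "'a => 'k vec"
      assume y: "y : verts Q" and w: "ALL q:arcs Q. head Q q = y --> w q : carrier_vec (?c k (tail Q q))"
      define c where "c = vec (?c (Suc k) y) (%i. w (fst (e k y i)) $ snd (e k y i))"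
      have c: "c : carrier_vec (?c (Suc k) y)" by (simp add: c_def)
      have "Mat M (q, t + int k + 1) *\<^sub>v c = w q" if a: "q : arcs Q" "head Q q = y" for q
      proof (rule eq_vecI)
        have wc: "w q : carrier_vec (?c k (tail Q q))" using w a by blast
        show "dim_vec (Mat M (q, t + int k + 1) *\<^sub>v c) = dim_vec (w q)" using wc unfolding m2 by simp
        fix j assume "j < dim_vec (w q)"
        then have "(q, j) : B k y" using wc a by (simp add: B_def)
        then have "(q, j) : e k y ` {0..<?c (Suc k) y}" using e[OF y, of k] unfolding bij_betw_def by blast
        then obtain i where i: "e k y i = (q, j)" "i < ?c (Suc k) y" by auto
        show "(Mat M (q, t + int k + 1) *\<^sub>v c) $ j = w q $ j"
          unfolding key[OF y c i(2) i(1)] using i by (simp add: c_def)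
      qed
      then show "EX c:carrier_vec (?c (Suc k) y). ALL q:arcs Q. head Q q = y --> Mat M (q, t + int k + 1) *\<^sub>v c = w q"
        using c by blast
    qed
  qed
  then have "jinj M n & jsurj M n" if "n > t" for n
  proof -
    obtain k where "n = t + int k + 1" using \<open>n > t\<close> zle_iff_zadd[of "t + 1" n] by auto
    then show ?thesis using \<open>!!k. jinj M (t + int k + 1) & jsurj M (t + int k + 1)\<close> by blast
  qed
  then have "coinduced t M" unfolding coinduced_def by blast
  moreover have "agree_upto t M N" unfolding agree_upto_def using d1 m1 by blast
  ultimately show ?thesis using that M by blast
qed

end

section \<open>Decompositions of representations\<close>

text \<open>For idempotents \<open>I P\<close> and \<open>I' P'\<close> that intertwine with
  \<open>X\<close>, the matrix \<open>P X I'\<close> is the map induced between their images. This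
  lemma and the next make the inclusions and the projections morphisms of representations.\<close>

lemma mat_retract_left:
  fixes X :: "'f::field mat"
  assumes c: "I : carrier_mat a r" "P : carrier_mat r a" "X : carrier_mat a b" "I' : carrier_mat b s" "P' : carrier_mat s b"
    and h: "I * P * X = X * (I' * P')" and 1: "P' * I' = 1\<^sub>m s"
  shows "I * (P * X * I') = X * I'"
proof -
  note d = c[THEN carrier_matD(1)] c[THEN carrier_matD(2)]
  have "I * (P * X * I') = I * P * X * I'" using d by (simp add: mat_assoc)
  also have "... = X * (I' * (P' * I'))" unfolding h using d by (simp add: mat_assoc)
  finally show ?thesis unfolding 1 using c(4) by simp
qed

lemma mat_retract_right:
  fixes X :: "'f::field mat"
  assumes c: "I : carrier_mat a r" "P : carrier_mat r a" "X : carrier_mat a b" "I' : carrier_mat b s" "P' : carrier_mat s b"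
    and h: "I * P * X = X * (I' * P')" and 1: "P * I = 1\<^sub>m r"
  shows "P * X * I' * P' = P * X"
proof -
  note d = c[THEN carrier_matD(1)] c[THEN carrier_matD(2)]
  have "P * X * I' * P' = P * (X * (I' * P'))" using d by (simp add: mat_assoc)
  also have "... = P * I * (P * X)" unfolding h[symmetric] using d by (simp add: mat_assoc)
  finally show ?thesis unfolding 1 using left_mult_one_mat[OF mult_carrier_mat[OF c(2,3)]] by simp
qed

lemma mat_no_col_eq: "A : carrier_mat r 0 ==> B : carrier_mat r 0 ==> A = B" by (intro eq_matI) auto

text \<open>Surjectivity gives a right inverse \<open>B\<close>; in \<open>A (B A) = A\<close>
  injectivity cancels \<open>A\<close>. That \<open>m\<close> and \<open>n\<close> coincide is a
  consequence here and not a premise.\<close>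

lemma mat_bij_inverse:
  fixes A :: "'k::field mat"
  assumes A: "A : carrier_mat m n" and inj: "ALL c:carrier_vec n. A *\<^sub>v c = 0\<^sub>v m --> c = 0\<^sub>v n"
    and surj: "ALL w:carrier_vec m. EX c:carrier_vec n. A *\<^sub>v c = w"
  shows "EX B. B : carrier_mat n m & A * B = 1\<^sub>m m & B * A = 1\<^sub>m n"
proof (rule mat_solve_cols[where S = "{()}" and M = "%_. A" and W = "%_. 1\<^sub>m m" and p = "%_. m" and d = n and n = m])
  show "EX c:carrier_vec n. ALL a:{()}. A *\<^sub>v c = col (1\<^sub>m m) i" if "i < m" for i
    using surj col_carrier_vec[OF that one_carrier_mat] by blast
  fix B assume B: "B : carrier_mat n m" and AB': "!!a. a : {()} ==> A * B = 1\<^sub>m m"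
  have AB: "A * B = 1\<^sub>m m" using AB' by blast
  have BA: "B * A : carrier_mat n n" using mult_carrier_mat[OF B A] .
  have ABA: "A * (B * A) = A * 1\<^sub>m n"
  proof -
    have "A * (B * A) = A * B * A" using A B by (simp add: mat_assoc)
    then show ?thesis unfolding AB using A by simp
  qed
  have "B * A = 1\<^sub>m n"
  proof (rule mat_col_eqI)
    fix i assume "i < dim_col (1\<^sub>m n :: 'k mat)"
    then have i: "i < n" by simp
    note c1 = col_carrier_vec[OF i BA] and c2 = col_carrier_vec[OF i one_carrier_mat[of n]]
    have "A *\<^sub>v (col (B * A) i - col (1\<^sub>m n) i) = col (A * (B * A)) i - col (A * 1\<^sub>m n) i"
      unfolding mult_minus_distrib_mat_vec[OF A c1 c2] col_mult2[OF A BA i] col_mult2[OF A one_carrier_mat i] ..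
    then have "A *\<^sub>v (col (B * A) i - col (1\<^sub>m n) i) = 0\<^sub>v m"
      unfolding ABA using minus_cancel_vec[OF col_carrier_vec[OF i mult_carrier_mat[OF A one_carrier_mat]]] by simp
    moreover have "col (B * A) i - col (1\<^sub>m n) i : carrier_vec n" using minus_carrier_vec[OF c1 c2] .
    ultimately have c0: "col (B * A) i - col (1\<^sub>m n) i = 0\<^sub>v n" using inj by blast
    show "col (B * A) i = col (1\<^sub>m n) i"
    proof (rule eq_vecI)
      fix l assume "l < dim_vec (col (1\<^sub>m n :: 'k mat) i)"
      then have l: "l < n" by simp
      have "(col (B * A) i - col (1\<^sub>m n) i) $ l = col (B * A) i $ l - col (1\<^sub>m n) i $ l"
        by (rule index_minus_vec(1)) (use l in simp)
      then show "col (B * A) i $ l = col (1\<^sub>m n) i $ l" unfolding c0 using l by simp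
    qed (use B in simp)
  qed (use A B in auto)
  then show ?thesis using AB B by blast
qed (use A in simp_all)

context radical_square_zero_category
begin

text \<open>The data of a direct sum without reference to a class of objects, shared by
  \<open>Rep\<close> and \<open>LRep\<close>, which differ only in their objects.\<close>

definition rsum :: "('o, 'a, 'k) brep => ('o, 'a, 'k) brep => ('o, 'a, 'k) brep =>
    ('o \<times> int => 'k mat) => ('o \<times> int => 'k mat) => ('o \<times> int => 'k mat) => ('o \<times> int => 'k mat) => bool" where
  "rsum M M1 M2 i1 i2 p1 p2 \<longleftrightarrow> i1 : qrep_hom QB M1 M & i2 : qrep_hom QB M2 M & p1 : qrep_hom QB M M1 & p2 : qrep_hom QB M M2 &
    (%v. p1 v * i1 v) = Idn (Rep QB) M1 & (%v. p2 v * i2 v) = Idn (Rep QB) M2 &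
    (%v. p1 v * i2 v) = Zer (Rep QB) M2 M1 & (%v. p2 v * i1 v) = Zer (Rep QB) M1 M2 &
    (%v. i1 v * p1 v + i2 v * p2 v) = Idn (Rep QB) M"

definition vanish :: "('o, 'a, 'k) brep => bool" where
  "vanish M \<longleftrightarrow> (ALL n. supp (dims M n) = {})"

lemma eq_on_verts:
  assumes "ALL x n. x ~: verts Q --> f (x, n) = 0\<^sub>m 0 0"
  shows "f = (%v. if v : verts QB then g v else 0\<^sub>m 0 0) \<longleftrightarrow> (ALL x:verts Q. ALL n. f (x, n) = g (x, n))"
  using assms by (auto simp: fun_eq_iff QB_simps)

context
  fixes \<phi> and M N :: "('o, 'a, 'k) brep"
  assumes \<phi>: "\<phi> : qrep_hom QB M N"
begin

lemma qrep_hom_out: "x ~: verts Q ==> \<phi> (x, n) = 0\<^sub>m 0 0"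
  and qrep_hom_carrier: "x : verts Q ==> \<phi> (x, n) : carrier_mat (dims N n x) (dims M n x)"
  and qrep_hom_comm: "q : arcs Q ==> \<phi> (tail Q q, n - 1) * Mat M (q, n) = Mat N (q, n) * \<phi> (head Q q, n)"
  using \<phi> unfolding qrep_hom_iff by blast+

end

lemma Idn_eq_iff:
  assumes "ALL x n. x ~: verts Q --> f (x, n) = 0\<^sub>m 0 0"
  shows "f = Idn (Rep QB) M \<longleftrightarrow> (ALL x:verts Q. ALL n. f (x, n) = 1\<^sub>m (dims M n x))"
  unfolding Rep_simps eq_on_verts[OF assms] by (simp add: dims_def)

lemma Zer_eq_iff:
  assumes "ALL x n. x ~: verts Q --> f (x, n) = 0\<^sub>m 0 0"
  shows "f = Zer (Rep QB) M N \<longleftrightarrow> (ALL x:verts Q. ALL n. f (x, n) = 0\<^sub>m (dims N n x) (dims M n x))"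
  unfolding Rep_simps eq_on_verts[OF assms] by (simp add: dims_def)

lemma rsum_iff:
  "rsum M M1 M2 i1 i2 p1 p2 \<longleftrightarrow> i1 : qrep_hom QB M1 M & i2 : qrep_hom QB M2 M & p1 : qrep_hom QB M M1 & p2 : qrep_hom QB M M2 &
    (ALL x:verts Q. ALL n. p1 (x, n) * i1 (x, n) = 1\<^sub>m (dims M1 n x)) & (ALL x:verts Q. ALL n. p2 (x, n) * i2 (x, n) = 1\<^sub>m (dims M2 n x)) &
    (ALL x:verts Q. ALL n. p1 (x, n) * i2 (x, n) = 0\<^sub>m (dims M1 n x) (dims M2 n x)) &
    (ALL x:verts Q. ALL n. p2 (x, n) * i1 (x, n) = 0\<^sub>m (dims M2 n x) (dims M1 n x)) &
    (ALL x:verts Q. ALL n. i1 (x, n) * p1 (x, n) + i2 (x, n) * p2 (x, n) = 1\<^sub>m (dims M n x))"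
proof (cases "i1 : qrep_hom QB M1 M & i2 : qrep_hom QB M2 M & p1 : qrep_hom QB M M1 & p2 : qrep_hom QB M M2")
  case True
  then have o: "i1 (x, n) = 0\<^sub>m 0 0" "i2 (x, n) = 0\<^sub>m 0 0" "p1 (x, n) = 0\<^sub>m 0 0" "p2 (x, n) = 0\<^sub>m 0 0" if "x ~: verts Q" for x n
    using qrep_hom_out that by blast+
  have e1: "(%v. p1 v * i1 v) = Idn (Rep QB) M1 \<longleftrightarrow> (ALL x:verts Q. ALL n. p1 (x, n) * i1 (x, n) = 1\<^sub>m (dims M1 n x))"
    by (rule Idn_eq_iff) (simp add: o)
  have e2: "(%v. p2 v * i2 v) = Idn (Rep QB) M2 \<longleftrightarrow> (ALL x:verts Q. ALL n. p2 (x, n) * i2 (x, n) = 1\<^sub>m (dims M2 n x))"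
    by (rule Idn_eq_iff) (simp add: o)
  have e3: "(%v. p1 v * i2 v) = Zer (Rep QB) M2 M1 \<longleftrightarrow> (ALL x:verts Q. ALL n. p1 (x, n) * i2 (x, n) = 0\<^sub>m (dims M1 n x) (dims M2 n x))"
    by (rule Zer_eq_iff) (simp add: o)
  have e4: "(%v. p2 v * i1 v) = Zer (Rep QB) M1 M2 \<longleftrightarrow> (ALL x:verts Q. ALL n. p2 (x, n) * i1 (x, n) = 0\<^sub>m (dims M2 n x) (dims M1 n x))"
    by (rule Zer_eq_iff) (simp add: o)
  have e5: "(%v. i1 v * p1 v + i2 v * p2 v) = Idn (Rep QB) M \<longleftrightarrow>
      (ALL x:verts Q. ALL n. i1 (x, n) * p1 (x, n) + i2 (x, n) * p2 (x, n) = 1\<^sub>m (dims M n x))"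
    by (rule Idn_eq_iff) (simp add: o)
  show ?thesis unfolding rsum_def e1 e2 e3 e4 e5 ..
qed (auto simp: rsum_def)

lemma Idn_Zer_iff: "Idn (Rep QB) M = Zer (Rep QB) M M \<longleftrightarrow> vanish M"
proof -
  have "Idn (Rep QB) M = Zer (Rep QB) M M \<longleftrightarrow> (ALL x:verts Q. ALL n. Idn (Rep QB) M (x, n) = 0\<^sub>m (dims M n x) (dims M n x))"
    by (rule Zer_eq_iff) (simp add: QB_simps)
  also have "... \<longleftrightarrow> (ALL x:verts Q. ALL n. (1\<^sub>m (dims M n x) :: 'k mat) = 0\<^sub>m (dims M n x) (dims M n x))"
    by (simp add: QB_simps dims_def)
  also have "... \<longleftrightarrow> (ALL x:verts Q. ALL n. dims M n x = 0)"
  proof -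
    have "k = 0" if "(1\<^sub>m k :: 'k mat) = 0\<^sub>m k k" for k
    proof (rule ccontr)
      assume "k ~= 0"
      then have "(1\<^sub>m k :: 'k mat) $$ (0, 0) = 1" "(0\<^sub>m k k :: 'k mat) $$ (0, 0) = 0" by simp_all
      then show False using that by simp
    qed
    moreover have "(1\<^sub>m 0 :: 'k mat) = 0\<^sub>m 0 0" by (intro eq_matI) auto
    ultimately show ?thesis by metis
  qed
  finally show ?thesis unfolding vanish_def supp_def by auto
qed

lemma indecomposable_rsum_iff:
  assumes C: "Hom C = qrep_hom QB" "Idn C = Idn (Rep QB)" "Cmp C = Cmp (Rep QB)" "precat.Sum C = precat.Sum (Rep QB)" "Zer C = Zer (Rep QB)"
  shows "indecomposable C M \<longleftrightarrow> M : Obj C & \<not> vanish M &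
    (ALL M1 M2 i1 i2 p1 p2. M1 : Obj C & M2 : Obj C & rsum M M1 M2 i1 i2 p1 p2 --> vanish M1 \<or> vanish M2)"
proof -
  have ds: "is_direct_sum C M M1 M2 \<longleftrightarrow> M : Obj C & M1 : Obj C & M2 : Obj C & (EX i1 i2 p1 p2. rsum M M1 M2 i1 i2 p1 p2)" for M1 M2
    unfolding is_direct_sum_def rsum_def C Rep_simps(4,5)
  proof (rule iffI, goal_cases)
    case 1
    then show ?case by (elim conjE bexE, intro conjI exI) assumption+
  next
    case 2
    then obtain i1 i2 p1 p2 where *: "M : Obj C" "M1 : Obj C" "M2 : Obj C" "i1 : qrep_hom QB M1 M" "i2 : qrep_hom QB M2 M"
      "p1 : qrep_hom QB M M1" "p2 : qrep_hom QB M M2"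
      "(%v. p1 v * i1 v) = Idn (Rep QB) M1" "(%v. p2 v * i2 v) = Idn (Rep QB) M2"
      "(%v. p1 v * i2 v) = Zer (Rep QB) M2 M1" "(%v. p2 v * i1 v) = Zer (Rep QB) M1 M2"
      "(%v. i1 v * p1 v + i2 v * p2 v) = Idn (Rep QB) M" by (elim conjE exE)
    show ?case
      by (intro conjI *(1-3), rule bexI[OF _ *(4)], rule bexI[OF _ *(5)], rule bexI[OF _ *(6)], rule bexI[OF _ *(7)], intro conjI *(8-12))
  qed
  have z: "zero_object C N \<longleftrightarrow> N : Obj C & vanish N" for N unfolding zero_object_def C Idn_Zer_iff ..
  show ?thesis unfolding indecomposable_def ds z by blast
qed

lemma indecomposable_Rep_iff: "indecomposable (Rep QB) M \<longleftrightarrow> is_qrep QB M & \<not> vanish M &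
    (ALL M1 M2 i1 i2 p1 p2. is_qrep QB M1 & is_qrep QB M2 & rsum M M1 M2 i1 i2 p1 p2 --> vanish M1 \<or> vanish M2)"
  using indecomposable_rsum_iff[of "Rep QB" M] unfolding Rep_simps(1,2) mem_Collect_eq by (simp only: refl simp_thms)

lemma indecomposable_LRep_iff: "indecomposable LRep M \<longleftrightarrow> lrep M & \<not> vanish M &
    (ALL M1 M2 i1 i2 p1 p2. lrep M1 & lrep M2 & rsum M M1 M2 i1 i2 p1 p2 --> vanish M1 \<or> vanish M2)"
  using indecomposable_rsum_iff[of LRep M] unfolding LRep_simps mem_Collect_eq by (simp only: refl simp_thms)

text \<open>An identity matrix that factors through a space of dimension 0 has size 0.\<close>

lemma retract_supp:
  assumes i: "i : qrep_hom QB M1 M" and p: "p : qrep_hom QB M M1" and 1: "ALL x:verts Q. ALL n. p (x, n) * i (x, n) = 1\<^sub>m (dims M1 n x)"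
    and z: "supp (dims M n) = {}"
  shows "supp (dims M1 n) = {}"
proof -
  have "dims M1 n x = 0" if x: "x : verts Q" for x
  proof -
    have "dims M n x = 0" using z x by (auto simp: supp_def)
    then show ?thesis
      using right_inverse_dim_zero[of "i (x, n)" "dims M1 n x" "p (x, n)"] qrep_hom_carrier[OF i x, of n] qrep_hom_carrier[OF p x, of n] 1 x by simp
  qed
  then show ?thesis by (simp add: supp_def)
qed

lemma rsum_supp:
  assumes "rsum M M1 M2 i1 i2 p1 p2" "supp (dims M n) = {}"
  shows "supp (dims M1 n) = {}" "supp (dims M2 n) = {}"
  using assms retract_supp[of i1 M1 M p1 n] retract_supp[of i2 M2 M p2 n] unfolding rsum_iff by blast+

lemma isomorphic_LRep_supp:
  assumes "isomorphic LRep M N" "supp (dims M n) = {}"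
  shows "supp (dims N n) = {}"
proof -
  obtain f g where fg: "f : qrep_hom QB M N" "g : qrep_hom QB N M" "(%v. f v * g v) = Idn (Rep QB) N"
    using assms(1) unfolding isomorphic_def LRep_simps Rep_simps(4) by blast
  have "ALL x:verts Q. ALL n. f (x, n) * g (x, n) = 1\<^sub>m (dims N n x)"
    using Idn_eq_iff[of "%v. f v * g v" N] fg(3) by (simp add: qrep_hom_out[OF fg(1)] qrep_hom_out[OF fg(2)] del: Rep_simps)
  from retract_supp[OF fg(2,1) this assms(2)] show ?thesis .
qed

lemma dims_supp_zero: "supp (dims M n) = {} ==> x : verts Q ==> dims M n x = 0" by (auto simp: supp_def)

lemma vec_dim_0: "c : carrier_vec 0 ==> d : carrier_vec 0 ==> c = d" by (intro eq_vecI) auto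

lemma jinj_zero:
  assumes "supp (dims M n) = {}" shows "jinj M n" unfolding jinj_def
proof (intro ballI impI)
  fix z and c :: "'k vec" assume z: "z : verts Q" and c: "c : carrier_vec (dims M n z)"
  show "c = 0\<^sub>v (dims M n z)" using vec_dim_0[of c "0\<^sub>v 0"] c unfolding dims_supp_zero[OF assms z] by simp
qed

lemma jsurj_zero:
  assumes M: "loc_rep M" and z: "supp (dims M n) = {}" shows "jsurj M (n + 1)" unfolding jsurj_def
proof (intro ballI allI impI)
  fix y and w :: "'a => 'k vec"
  assume w: "ALL q:arcs Q. head Q q = y --> w q : carrier_vec (dims M (n + 1 - 1) (tail Q q))"
  have "Mat M (q, n + 1) *\<^sub>v 0\<^sub>v (dims M (n + 1) y) = w q" if a: "q : arcs Q" "head Q q = y" for q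
  proof (rule vec_dim_0)
    have d: "dims M n (tail Q q) = 0" using dims_supp_zero[OF z] a by simp
    show "w q : carrier_vec 0" using w a d by auto
    show "Mat M (q, n + 1) *\<^sub>v 0\<^sub>v (dims M (n + 1) y) : carrier_vec 0"
      using mult_mat_vec_carrier[OF loc_rep_dims[OF M a(1), of "n + 1"], of "0\<^sub>v (dims M (n + 1) y)"] a d by simp
  qed
  then show "EX c:carrier_vec (dims M (n + 1) y). ALL q:arcs Q. head Q q = y --> Mat M (q, n + 1) *\<^sub>v c = w q"
    by (intro bexI[of _ "0\<^sub>v (dims M (n + 1) y)"]) auto
qed

text \<open>Below the support all joint maps involved have zero source and zero target, so the
  complex is exact there and the hypothesis on large degrees bounds the homology on the other
  side.\<close>

lemma lrepI:
  assumes M: "loc_rep M" and b: "EX b. ALL n<b. supp (dims M n) = {}" and t: "ALL n>t. exact_at (FC M) n"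
  shows "lrep M"
proof -
  obtain b where b: "!!n. n < b ==> supp (dims M n) = {}" using b by blast
  have "exact_at (FC M) n" if "n < b" for n
    unfolding exact_FC_iff[OF M] using jinj_zero[OF b[OF that]] jsurj_zero[OF M b[OF that]] by blast
  then have "{n. \<not> exact_at (FC M) n} \<subseteq> {b..t}" using t by (auto simp: not_less[symmetric])
  then have "finite {n. \<not> exact_at (FC M) n}" by (rule finite_subset) simp
  then show ?thesis unfolding lrep_def using M b by blast
qed

lemma qrep_lrep:
  assumes "is_qrep QB M" shows "lrep M"
proof -
  obtain t where t: "!!n. n > t ==> supp (dims M n) = {}" and M: "loc_rep M" and b: "EX b. ALL n<b. supp (dims M n) = {}"
    using assms unfolding is_qrep_iff by blast
  have "ALL n>t. exact_at (FC M) n" unfolding exact_FC_iff[OF M] using jinj_zero[OF t] jsurj_zero[OF M t] by blast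
  then show ?thesis by (rule lrepI[OF M b])
qed

lemma coinduced_exact: "loc_rep M ==> coinduced t M ==> n > t ==> exact_at (FC M) n"
  unfolding exact_FC_iff coinduced_def by simp

text \<open>Exactness in degree \<open>n - 1\<close> gives surjectivity of the joint map of degree
  \<open>n\<close>, exactness in degree \<open>n\<close> its injectivity; this is why exactness is
  asked for from \<open>t\<close> on.\<close>

lemma exact_coinduced: "loc_rep M ==> ALL n>=t. exact_at (FC M) n ==> coinduced t M"
  unfolding coinduced_def using exact_FC_iff[of M] by (metis add.commute diff_add_cancel less_imp_le zle_diff1_eq zless_imp_add1_zle le_diff_eq)

lemma coinduced_lrep:
  assumes M: "loc_rep M" and co: "coinduced t M" and ag: "agree_upto t M N" and N: "EX b. ALL n<b. supp (dims N n) = {}"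
  shows "lrep M"
proof (rule lrepI[OF M])
  obtain b where b: "!!n. n < b ==> supp (dims N n) = {}" using N by blast
  have "supp (dims M n) = {}" if "n < min b t" for n using ag b[of n] that unfolding agree_upto_def by simp
  then show "EX b. ALL n<b. supp (dims M n) = {}" by blast
  show "ALL n>t. exact_at (FC M) n" using coinduced_exact[OF M co] by blast
qed

text \<open>A space embedded into a sum of zero spaces is zero, so vanishing spreads upwards from
  degree \<open>t\<close>.\<close>

lemma coinduced_supp:
  assumes M: "loc_rep M" and co: "ALL n>t. jinj M n" and z: "supp (dims M t) = {}" and n: "n >= t"
  shows "supp (dims M n) = {}" using n
proof (induction n rule: int_ge_induct)
  case (step n)
  have "dims M (n + 1) x = 0" if x: "x : verts Q" for x
  proof (rule ccontr)
    assume d: "dims M (n + 1) x ~= 0"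
    let ?c = "unit_vec (dims M (n + 1) x) 0 :: 'k vec"
    have "Mat M (q, n + 1) *\<^sub>v ?c = 0\<^sub>v (dims M (n + 1 - 1) (tail Q q))" if a: "q : arcs Q" "head Q q = x" for q
    proof -
      have d0: "dims M (n + 1 - 1) (tail Q q) = 0" using dims_supp_zero[OF step(2)] a by simp
      show ?thesis
        using vec_dim_0[of "Mat M (q, n + 1) *\<^sub>v ?c" "0\<^sub>v 0"] mult_mat_vec_carrier[OF loc_rep_dims[OF M a(1), of "n + 1"], of ?c] a d0 by simp
    qed
    moreover have "jinj M (n + 1)" using co step(1) by simp
    moreover have "?c : carrier_vec (dims M (n + 1) x)" by simp
    ultimately have "?c = 0\<^sub>v (dims M (n + 1) x)" using x unfolding jinj_def by blast
    then have "?c $ 0 = 0" using d by simp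
    then show False using d by simp
  qed
  then show ?case by (simp add: supp_def)
qed (rule z)

text \<open>Direct summands vanish where the whole does, so allowing unbounded summands yields no
  further decompositions of a bounded representation.\<close>

lemma indecomposable_bounded:
  assumes q: "is_qrep QB M"
  shows "indecomposable LRep M \<longleftrightarrow> indecomposable (Rep QB) M"
proof -
  have "is_qrep QB M1 & is_qrep QB M2" if l: "lrep M1" "lrep M2" and s: "rsum M M1 M2 i1 i2 p1 p2" for M1 M2 i1 i2 p1 p2
  proof -
    obtain b t where "!!n. n < b ==> supp (dims M n) = {}" "!!n. n > t ==> supp (dims M n) = {}"
      using q unfolding is_qrep_iff by blast
    then have "ALL n<b. supp (dims M1 n) = {} & supp (dims M2 n) = {}" "ALL n>t. supp (dims M1 n) = {} & supp (dims M2 n) = {}"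
      using rsum_supp[OF s] by blast+
    then show ?thesis using l unfolding is_qrep_iff lrep_def by blast
  qed
  then show ?thesis unfolding indecomposable_LRep_iff indecomposable_Rep_iff using q qrep_lrep by blast
qed

text \<open>Above \<open>t\<close> the matrices must still have the format that
  \<open>is_qrep\<close> prescribes: no columns, and in degree \<open>t + 1\<close> as many rows as
  the dimension of the untouched space of degree \<open>t\<close>.\<close>

definition trunc :: "int => ('o, 'a, 'k) brep => ('o, 'a, 'k) brep" where
  "trunc t M = \<lparr>Dim = (%(x, n). if n <= t then Dim M (x, n) else 0),
     Mat = (%(q, n). if n <= t then Mat M (q, n) else 0\<^sub>m (if n - 1 <= t then Dim M (tail Q q, n - 1) else 0) 0)\<rparr>"

lemma trunc_agree: "agree_upto t M (trunc t M)" "agree_upto t (trunc t M) M"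
  by (auto simp: agree_upto_def trunc_def dims_def fun_eq_iff)

lemma trunc_supp: "n > t ==> supp (dims (trunc t M) n) = {}" by (simp add: trunc_def dims_def supp_def)

lemma trunc_dims: "n <= t ==> dims (trunc t M) n = dims M n" by (simp add: trunc_def dims_def fun_eq_iff)

lemma trunc_qrep:
  assumes "lrep M" shows "is_qrep QB (trunc t M)" unfolding is_qrep_iff
proof (intro conjI)
  note M = lrep_loc[OF assms]
  show "loc_rep (trunc t M)" unfolding loc_rep_def
  proof (intro conjI allI ballI)
    show "finite (supp (dims (trunc t M) n))" for n
      using trunc_supp[of t n M] trunc_dims[of n t M] loc_rep_fin[OF M, of n] by (cases "n <= t") auto
    show "Mat (trunc t M) (q, n) : carrier_mat (Dim (trunc t M) (tail Q q, n - 1)) (Dim (trunc t M) (head Q q, n))" if "q : arcs Q" for q n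
      using loc_rep_Mat[OF M that, of n] by (auto simp: trunc_def)
  qed
  obtain b where b: "!!n. n < b ==> supp (dims M n) = {}" using assms unfolding lrep_def by blast
  have "supp (dims (trunc t M) n) = {}" if "n < b" for n
    using trunc_supp[of t n M] trunc_dims[of n t M] b[OF that] by (cases "n <= t") auto
  then show "EX b. ALL n<b. supp (dims (trunc t M) n) = {}" by blast
  show "EX t'. ALL n>t'. supp (dims (trunc t M) n) = {}" using trunc_supp by blast
qed

definition trh :: "int => ('o \<times> int => 'k mat) => 'o \<times> int => 'k mat" where
  "trh t \<phi> = (%(x, n). if n <= t then \<phi> (x, n) else 0\<^sub>m 0 0)"

lemma trh_hom:
  assumes M': "loc_rep M'" and N': "loc_rep N'" and \<phi>: "\<phi> : qrep_hom QB M N" and aM: "agree_upto t M M'" and aN: "agree_upto t N N'"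
    and zM: "ALL n>t. supp (dims M' n) = {}" and zN: "ALL n>t. supp (dims N' n) = {}"
  shows "trh t \<phi> : qrep_hom QB M' N'" unfolding qrep_hom_iff
proof (intro conjI ballI allI impI)
  show c: "trh t \<phi> (x, n) : carrier_mat (dims N' n x) (dims M' n x)" if x: "x : verts Q" for x n
  proof (cases "n <= t")
    case True
    then show ?thesis using qrep_hom_carrier[OF \<phi> x, of n] aM aN by (simp add: trh_def agree_upto_def)
  next
    case False
    then have "dims N' n x = 0" "dims M' n x = 0" using zM zN dims_supp_zero x by auto
    then show ?thesis using False by (simp add: trh_def)
  qed
  show "trh t \<phi> (x, n) = 0\<^sub>m 0 0" if "x ~: verts Q" for x n using qrep_hom_out[OF \<phi> that] by (simp add: trh_def)
  fix q n assume a: "q : arcs Q"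
  show "trh t \<phi> (tail Q q, n - 1) * Mat M' (q, n) = Mat N' (q, n) * trh t \<phi> (head Q q, n)"
  proof (cases "n <= t")
    case True
    then show ?thesis using qrep_hom_comm[OF \<phi> a, of n] aM aN a by (simp add: trh_def agree_upto_def)
  next
    case False
    then have z: "dims M' n (head Q q) = 0" using zM dims_supp_zero a by simp
    have v: "tail Q q : verts Q" "head Q q : verts Q" using a by simp_all
    show ?thesis using mult_carrier_mat[OF c[OF v(1), of "n - 1"] loc_rep_dims[OF M' a, of n]]
        mult_carrier_mat[OF loc_rep_dims[OF N' a, of n] c[OF v(2), of n]] mat_no_col_eq unfolding z by blast
  qed
qed

text \<open>A decomposition of \<open>M\<close> restricts to one of \<open>N\<close>, so one summand
  vanishes up to \<open>t\<close>. A summand is a retract of \<open>M\<close> and inherits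
  injectivity of the joint maps above \<open>t\<close>; hence it vanishes altogether.\<close>

lemma indecomposable_coinduced:
  assumes M: "lrep M" and co: "coinduced t M" and ag: "agree_upto t M N" and z: "ALL n>t. supp (dims N n) = {}"
    and N: "indecomposable (Rep QB) N"
  shows "indecomposable LRep M" unfolding indecomposable_LRep_iff
proof (intro conjI allI impI)
  note lM = lrep_loc[OF M]
  have qN: "is_qrep QB N" and nz: "\<not> vanish N" using N unfolding indecomposable_Rep_iff by blast+
  have lN: "loc_rep N" using qN unfolding is_qrep_iff by blast
  show "lrep M" by (rule M)
  show "\<not> vanish M"
  proof
    assume v: "vanish M"
    have "supp (dims N n) = {}" for n
    proof (cases "n <= t")
      case True
      then have "dims N n = dims M n" using ag unfolding agree_upto_def by simp
      then show ?thesis using v unfolding vanish_def by simp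
    qed (use z in simp)
    then show False using nz unfolding vanish_def by blast
  qed
  fix M1 M2 i1 i2 p1 p2 assume "lrep M1 & lrep M2 & rsum M M1 M2 i1 i2 p1 p2"
  then have M1: "lrep M1" and M2: "lrep M2" and s: "rsum M M1 M2 i1 i2 p1 p2" by blast+
  note q = trunc_qrep[OF M1, of t] trunc_qrep[OF M2, of t]
  then have l: "loc_rep (trunc t M1)" "loc_rep (trunc t M2)" unfolding is_qrep_iff by blast+
  have z1: "ALL n>t. supp (dims (trunc t M1) n) = {}" and z2: "ALL n>t. supp (dims (trunc t M2) n) = {}" using trunc_supp by blast+
  note s' = s[unfolded rsum_iff]
  have "rsum N (trunc t M1) (trunc t M2) (trh t i1) (trh t i2) (trh t p1) (trh t p2)" unfolding rsum_iff
  proof (intro conjI ballI allI)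
    show "trh t i1 : qrep_hom QB (trunc t M1) N" by (rule trh_hom[OF l(1) lN _ trunc_agree(1) ag z1 z]) (use s' in blast)
    show "trh t i2 : qrep_hom QB (trunc t M2) N" by (rule trh_hom[OF l(2) lN _ trunc_agree(1) ag z2 z]) (use s' in blast)
    show "trh t p1 : qrep_hom QB N (trunc t M1)" by (rule trh_hom[OF lN l(1) _ ag trunc_agree(1) z z1]) (use s' in blast)
    show "trh t p2 : qrep_hom QB N (trunc t M2)" by (rule trh_hom[OF lN l(2) _ ag trunc_agree(1) z z2]) (use s' in blast)
    fix x n assume x: "x : verts Q"
    have "trh t p1 (x, n) * trh t i1 (x, n) = 1\<^sub>m (dims (trunc t M1) n x) &
      trh t p2 (x, n) * trh t i2 (x, n) = 1\<^sub>m (dims (trunc t M2) n x) &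
      trh t p1 (x, n) * trh t i2 (x, n) = 0\<^sub>m (dims (trunc t M1) n x) (dims (trunc t M2) n x) &
      trh t p2 (x, n) * trh t i1 (x, n) = 0\<^sub>m (dims (trunc t M2) n x) (dims (trunc t M1) n x) &
      trh t i1 (x, n) * trh t p1 (x, n) + trh t i2 (x, n) * trh t p2 (x, n) = 1\<^sub>m (dims N n x)"
    proof (cases "n <= t")
      case True
      moreover have "dims N n = dims M n" using ag True unfolding agree_upto_def by simp
      ultimately show ?thesis using s' x by (simp add: trh_def trunc_dims)
    next
      case False
      then have "dims N n x = 0" "dims (trunc t M1) n x = 0" "dims (trunc t M2) n x = 0"
        using dims_supp_zero[OF _ x] z z1 z2 by auto
      moreover have "0\<^sub>m 0 0 * 0\<^sub>m 0 0 = (1\<^sub>m 0 :: 'k mat)" "0\<^sub>m 0 0 * 0\<^sub>m 0 0 + 0\<^sub>m 0 0 * 0\<^sub>m 0 0 = (1\<^sub>m 0 :: 'k mat)"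
        by (intro eq_matI; simp)+
      ultimately show ?thesis using False by (simp add: trh_def)
    qed
    then show "trh t p1 (x, n) * trh t i1 (x, n) = 1\<^sub>m (dims (trunc t M1) n x)"
      "trh t p2 (x, n) * trh t i2 (x, n) = 1\<^sub>m (dims (trunc t M2) n x)"
      "trh t p1 (x, n) * trh t i2 (x, n) = 0\<^sub>m (dims (trunc t M1) n x) (dims (trunc t M2) n x)"
      "trh t p2 (x, n) * trh t i1 (x, n) = 0\<^sub>m (dims (trunc t M2) n x) (dims (trunc t M1) n x)"
      "trh t i1 (x, n) * trh t p1 (x, n) + trh t i2 (x, n) * trh t p2 (x, n) = 1\<^sub>m (dims N n x)" by blast+
  qed
  then have "vanish (trunc t M1) \<or> vanish (trunc t M2)" using N q unfolding indecomposable_Rep_iff by blast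
  moreover have "vanish M'" if M': "lrep M'" and i: "i : qrep_hom QB M' M" and p: "p : qrep_hom QB M M'"
    and 1: "ALL x:verts Q. ALL n. p (x, n) * i (x, n) = 1\<^sub>m (dims M' n x)" and v: "vanish (trunc t M')" for M' i p
  proof -
    note lM' = lrep_loc[OF M']
    \<comment> \<open>A kernel vector \<open>c\<close> goes to a kernel vector \<open>i c\<close> of
      \<open>M\<close>, which is zero, and \<open>c = p (i c)\<close>.\<close>
    have j: "jinj M' n" if n: "n > t" for n unfolding jinj_def
    proof (intro ballI impI)
      fix y c assume y: "y : verts Q" and c: "c : carrier_vec (dims M' n y)"
        and k: "ALL q:arcs Q. head Q q = y --> Mat M' (q, n) *\<^sub>v c = 0\<^sub>v (dims M' (n - 1) (tail Q q))"
      note ci = qrep_hom_carrier[OF i] and cp = qrep_hom_carrier[OF p]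
      have "Mat M (q, n) *\<^sub>v (i (y, n) *\<^sub>v c) = 0\<^sub>v (dims M (n - 1) (tail Q q))" if a: "q : arcs Q" "head Q q = y" for q
      proof -
        have v: "tail Q q : verts Q" using a by simp
        note m = loc_rep_dims[OF lM a(1), of n, unfolded a(2)] and m' = loc_rep_dims[OF lM' a(1), of n, unfolded a(2)]
        have "Mat M (q, n) *\<^sub>v (i (y, n) *\<^sub>v c) = Mat M (q, n) * i (y, n) *\<^sub>v c"
          using assoc_mult_mat_vec[OF m ci[OF y] c] by simp
        also have "Mat M (q, n) * i (y, n) = i (tail Q q, n - 1) * Mat M' (q, n)" using qrep_hom_comm[OF i a(1), of n] a(2) by simp
        also have "... *\<^sub>v c = i (tail Q q, n - 1) *\<^sub>v (Mat M' (q, n) *\<^sub>v c)"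
          using assoc_mult_mat_vec[OF ci[OF v, of "n - 1"] m' c] by simp
        also have "Mat M' (q, n) *\<^sub>v c = 0\<^sub>v (dims M' (n - 1) (tail Q q))" using k a by blast
        finally show ?thesis using ci[OF v, of "n - 1"] by auto
      qed
      moreover have "jinj M n" using co n unfolding coinduced_def by blast
      moreover have "i (y, n) *\<^sub>v c : carrier_vec (dims M n y)" using mult_mat_vec_carrier[OF ci[OF y] c] .
      ultimately have "i (y, n) *\<^sub>v c = 0\<^sub>v (dims M n y)" using y unfolding jinj_def by blast
      then have "p (y, n) *\<^sub>v (i (y, n) *\<^sub>v c) = 0\<^sub>v (dims M' n y)" using cp[OF y, of n] by auto
      then show "c = 0\<^sub>v (dims M' n y)" using assoc_mult_mat_vec[OF cp[OF y] ci[OF y] c] 1 y c by simp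
    qed
    have e: "supp (dims M' n) = {}" if "n <= t" for n using v trunc_dims[OF that, of M'] unfolding vanish_def by metis
    have "supp (dims M' n) = {}" for n
      using e[of n] coinduced_supp[OF lM' _ e[OF order_refl], of n] j by (cases "n <= t") auto
    then show ?thesis unfolding vanish_def by blast
  qed
  ultimately show "vanish M1 \<or> vanish M2" using M1 M2 s' by blast
qed

text \<open>A decomposition of the truncation extends to \<open>M\<close>: the summands are
  coinduced, the structure maps are extended, and the identities between them are checked up to
  \<open>t\<close>. Nonvanishing in degree \<open>t\<close> makes the truncation nonzero.\<close>

lemma trunc_indecomposable:
  assumes M: "lrep M" and co: "coinduced t M" and i: "indecomposable LRep M" and nz: "supp (dims M t) ~= {}"
  shows "indecomposable (Rep QB) (trunc t M)" unfolding indecomposable_Rep_iff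
proof (intro conjI allI impI)
  note lM = lrep_loc[OF M]
  show "is_qrep QB (trunc t M)" by (rule trunc_qrep[OF M])
  show "\<not> vanish (trunc t M)" using nz trunc_dims[OF order_refl, of t M] unfolding vanish_def by metis
  fix N1 N2 i1 i2 p1 p2 assume "is_qrep QB N1 & is_qrep QB N2 & rsum (trunc t M) N1 N2 i1 i2 p1 p2"
  then have N1: "is_qrep QB N1" and N2: "is_qrep QB N2" and s: "rsum (trunc t M) N1 N2 i1 i2 p1 p2" by blast+
  note s' = s[unfolded rsum_iff]
  have l: "loc_rep N1" "loc_rep N2" and b: "EX b. ALL n<b. supp (dims N1 n) = {}" "EX b. ALL n<b. supp (dims N2 n) = {}"
    using N1 N2 unfolding is_qrep_iff by blast+
  obtain M1 where M1: "loc_rep M1" "coinduced t M1" "agree_upto t M1 N1" using coinduced_exists[OF l(1)] .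
  obtain M2 where M2: "loc_rep M2" "coinduced t M2" "agree_upto t M2 N2" using coinduced_exists[OF l(2)] .
  have L1: "lrep M1" and L2: "lrep M2" using coinduced_lrep[OF M1 b(1)] coinduced_lrep[OF M2 b(2)] .
  have h: "hom_upto t M1 M i1" "hom_upto t M2 M i2" "hom_upto t M M1 p1" "hom_upto t M M2 p2"
    using s' hom_upto_of_hom[OF _ M1(3) trunc_agree(1)] hom_upto_of_hom[OF _ M2(3) trunc_agree(1)]
      hom_upto_of_hom[OF _ trunc_agree(1) M1(3)] hom_upto_of_hom[OF _ trunc_agree(1) M2(3)] by blast+
  obtain I1 where I1: "I1 : qrep_hom QB M1 M" "ALL x:verts Q. ALL n<=t. I1 (x, n) = i1 (x, n)" using extend_hom[OF M1(1) lM co h(1)] .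
  obtain I2 where I2: "I2 : qrep_hom QB M2 M" "ALL x:verts Q. ALL n<=t. I2 (x, n) = i2 (x, n)" using extend_hom[OF M2(1) lM co h(2)] .
  obtain P1 where P1: "P1 : qrep_hom QB M M1" "ALL x:verts Q. ALL n<=t. P1 (x, n) = p1 (x, n)" using extend_hom[OF lM M1(1,2) h(3)] .
  obtain P2 where P2: "P2 : qrep_hom QB M M2" "ALL x:verts Q. ALL n<=t. P2 (x, n) = p2 (x, n)" using extend_hom[OF lM M2(1,2) h(4)] .
  have d: "Dim M1 (x, n) = dims N1 n x" "Dim M2 (x, n) = dims N2 n x" "Dim M (x, n) = dims (trunc t M) n x" if "n <= t" for x n
    using M1(3) M2(3) trunc_agree(1)[of t M] that unfolding agree_upto_def by (metis dims_def)+
  note ag = I1(2) I2(2) P1(2) P2(2) d s'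
  have "rsum M M1 M2 I1 I2 P1 P2" unfolding rsum_def
  proof (intro conjI)
    show "(%v. P1 v * I1 v) = Idn (Rep QB) M1"
      by (rule hom_unique[OF M1(1) M1(1,2) qrep_hom_Cmp[OF M1(1) lM M1(1) I1(1) P1(1)] qrep_hom_Idn[OF M1(1)]])
        (use ag in \<open>simp add: QB_simps\<close>)
    show "(%v. P2 v * I2 v) = Idn (Rep QB) M2"
      by (rule hom_unique[OF M2(1) M2(1,2) qrep_hom_Cmp[OF M2(1) lM M2(1) I2(1) P2(1)] qrep_hom_Idn[OF M2(1)]])
        (use ag in \<open>simp add: QB_simps\<close>)
    show "(%v. P1 v * I2 v) = Zer (Rep QB) M2 M1"
      by (rule hom_unique[OF M2(1) M1(1,2) qrep_hom_Cmp[OF M2(1) lM M1(1) I2(1) P1(1)] qrep_hom_Zer[OF M2(1) M1(1)]])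
        (use ag in \<open>simp add: QB_simps\<close>)
    show "(%v. P2 v * I1 v) = Zer (Rep QB) M1 M2"
      by (rule hom_unique[OF M1(1) M2(1,2) qrep_hom_Cmp[OF M1(1) lM M2(1) I1(1) P2(1)] qrep_hom_Zer[OF M1(1) M2(1)]])
        (use ag in \<open>simp add: QB_simps\<close>)
    show "(%v. I1 v * P1 v + I2 v * P2 v) = Idn (Rep QB) M"
      by (rule hom_unique[OF lM lM co qrep_hom_Sum[OF lM lM qrep_hom_Cmp[OF lM M1(1) lM P1(1) I1(1)] qrep_hom_Cmp[OF lM M2(1) lM P2(1) I2(1)]] qrep_hom_Idn[OF lM]])
        (use ag in \<open>simp add: QB_simps\<close>)
  qed (rule I1(1) I2(1) P1(1) P2(1))+
  then have "vanish M1 \<or> vanish M2" using i L1 L2 unfolding indecomposable_LRep_iff by blast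
  moreover have "vanish N'" if v: "vanish M'" and ag: "agree_upto t M' N'" and z: "!!n. supp (dims (trunc t M) n) = {} ==> supp (dims N' n) = {}"
    for M' N' :: "('o, 'a, 'k) brep" unfolding vanish_def
  proof
    fix n
    show "supp (dims N' n) = {}"
    proof (cases "n <= t")
      case True
      then show ?thesis using v ag unfolding vanish_def agree_upto_def by metis
    qed (use z trunc_supp in simp)
  qed
  ultimately show "vanish N1 \<or> vanish N2" using M1(3) M2(3) rsum_supp[OF s] by blast
qed

section \<open>Idempotent endomorphisms of representations\<close>

lemma idempotent_splits:
  assumes N: "is_qrep QB N" and e: "e : qrep_hom QB N N" and ee: "ALL x:verts Q. ALL n. e (x, n) * e (x, n) = e (x, n)"
  obtains M i p where "is_qrep QB M" "i : qrep_hom QB M N" "p : qrep_hom QB N M"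
    "ALL x:verts Q. ALL n. p (x, n) * i (x, n) = 1\<^sub>m (dims M n x)" "ALL x:verts Q. ALL n. i (x, n) * p (x, n) = e (x, n)"
proof -
  have lN: "loc_rep N" using N unfolding is_qrep_iff by blast
  have "EX r I P. I : carrier_mat (Dim N v) r & P : carrier_mat r (Dim N v) & e v = I * P & P * I = 1\<^sub>m r" if v: "v : verts QB" for v
  proof -
    obtain x n where xn: "v = (x, n)" "x : verts Q" using v by (auto simp: QB_simps)
    have "e v : carrier_mat (Dim N v) (Dim N v)" using qrep_hom_carrier[OF e xn(2), of n] xn(1) by (simp add: dims_def)
    from idempotent_mat_split[OF this] ee xn show ?thesis by metis
  qed
  then have "ALL v:verts QB. EX r I P. I : carrier_mat (Dim N v) r & P : carrier_mat r (Dim N v) & e v = I * P & P * I = 1\<^sub>m r" by (rule ballI)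
  from bchoice[OF this] obtain r where "ALL v:verts QB. EX I P. I : carrier_mat (Dim N v) (r v) & P : carrier_mat (r v) (Dim N v) & e v = I * P & P * I = 1\<^sub>m (r v)" ..
  from bchoice[OF this] obtain I where "ALL v:verts QB. EX P. I v : carrier_mat (Dim N v) (r v) & P : carrier_mat (r v) (Dim N v) & e v = I v * P & P * I v = 1\<^sub>m (r v)" ..
  from bchoice[OF this] obtain P where "ALL v:verts QB. I v : carrier_mat (Dim N v) (r v) & P v : carrier_mat (r v) (Dim N v) & e v = I v * P v & P v * I v = 1\<^sub>m (r v)" ..
  then have IP: "I (x, n) : carrier_mat (dims N n x) (r (x, n))" "P (x, n) : carrier_mat (r (x, n)) (dims N n x)"
    "e (x, n) = I (x, n) * P (x, n)" "P (x, n) * I (x, n) = 1\<^sub>m (r (x, n))" if "x : verts Q" for x n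
    using that by (simp_all add: QB_simps dims_def)
  define M :: "('o, 'a, 'k) brep" where
    "M = \<lparr>Dim = r, Mat = (%(q, n). P (tail Q q, n - 1) * Mat N (q, n) * I (head Q q, n))\<rparr>"
  have dM: "dims M n x = r (x, n)" for n x by (simp add: M_def dims_def)
  have mM: "Mat M (q, n) = P (tail Q q, n - 1) * Mat N (q, n) * I (head Q q, n)" for q n by (simp add: M_def)
  define i where "i = (%(x, n). if x : verts Q then I (x, n) else 0\<^sub>m 0 0)"
  define p where "p = (%(x, n). if x : verts Q then P (x, n) else 0\<^sub>m 0 0)"
  have ix: "i (x, n) = I (x, n)" and px: "p (x, n) = P (x, n)" if "x : verts Q" for x n using that by (simp_all add: i_def p_def)
  have supp0: "supp (dims M n) \<subseteq> supp (dims N n)" for n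
  proof
    fix x assume x: "x : supp (dims M n)"
    then have xv: "x : verts Q" using supp_verts by blast
    have "dims N n x ~= 0"
    proof
      assume "dims N n x = 0"
      then have "r (x, n) = 0" using right_inverse_dim_zero[of "I (x, n)" "r (x, n)" "P (x, n)"] IP[OF xv, of n] by simp
      then show False using x dM by (simp add: supp_def)
    qed
    then show "x : supp (dims N n)" using xv by (simp add: supp_def)
  qed
  have "loc_rep M" unfolding loc_rep_def
  proof (intro conjI allI ballI)
    show "finite (supp (dims M n))" for n using supp0 loc_rep_fin[OF lN] by (rule finite_subset)
    show "Mat M (q, n) : carrier_mat (Dim M (tail Q q, n - 1)) (Dim M (head Q q, n))" if a: "q : arcs Q" for q n
    proof -
      have v: "tail Q q : verts Q" "head Q q : verts Q" using a by simp_all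
      show ?thesis unfolding mM
        using mult_carrier_mat[OF mult_carrier_mat[OF IP(2)[OF v(1), of "n - 1"] loc_rep_dims[OF lN a, of n]] IP(1)[OF v(2), of n]] by (simp add: M_def)
    qed
  qed
  then have "is_qrep QB M" using N supp0 unfolding is_qrep_iff by (metis subset_empty)
  moreover have "i : qrep_hom QB M N & p : qrep_hom QB N M"
  proof -
    have *: "I (tail Q q, n - 1) * P (tail Q q, n - 1) * Mat N (q, n) = Mat N (q, n) * (I (head Q q, n) * P (head Q q, n))"
      if a: "q : arcs Q" for q n using qrep_hom_comm[OF e a, of n] IP(3) a by simp
    have v: "tail Q q : verts Q" "head Q q : verts Q" if "q : arcs Q" for q using that by simp_all
    have "i (tail Q q, n - 1) * Mat M (q, n) = Mat N (q, n) * i (head Q q, n)" if a: "q : arcs Q" for q n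
      unfolding ix[OF v(1)[OF a]] ix[OF v(2)[OF a]] mM
      by (rule mat_retract_left[OF IP(1,2)[OF v(1)[OF a]] loc_rep_dims[OF lN a] IP(1,2)[OF v(2)[OF a]] *[OF a] IP(4)[OF v(2)[OF a]]])
    moreover have "p (tail Q q, n - 1) * Mat N (q, n) = Mat M (q, n) * p (head Q q, n)" if a: "q : arcs Q" for q n
      unfolding px[OF v(1)[OF a]] px[OF v(2)[OF a]] mM
      by (rule mat_retract_right[OF IP(1,2)[OF v(1)[OF a]] loc_rep_dims[OF lN a] IP(1,2)[OF v(2)[OF a]] *[OF a] IP(4)[OF v(1)[OF a]], symmetric])
    ultimately show ?thesis unfolding qrep_hom_iff using IP(1,2) ix px by (auto simp: dM i_def p_def)
  qed
  ultimately show ?thesis using that[of M i p] IP(3,4) ix px dM by simp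
qed

text \<open>The images of \<open>e\<close> and \<open>f = 1 - e\<close> are complementary summands;
  vanishing of one of them makes \<open>e\<close> zero or the identity.\<close>

lemma idempotent_indecomposable:
  assumes N: "indecomposable (Rep QB) N" and e: "e : qrep_hom QB N N" and ee: "ALL x:verts Q. ALL n. e (x, n) * e (x, n) = e (x, n)"
  shows "(ALL x:verts Q. ALL n. e (x, n) = 0\<^sub>m (dims N n x) (dims N n x)) \<or> (ALL x:verts Q. ALL n. e (x, n) = 1\<^sub>m (dims N n x))"
proof -
  have q: "is_qrep QB N" using N unfolding indecomposable_Rep_iff by blast
  then have lN: "loc_rep N" unfolding is_qrep_iff by blast
  note ec = qrep_hom_carrier[OF e]
  define f where "f = (%(x, n). if x : verts Q then 1\<^sub>m (dims N n x) - e (x, n) else 0\<^sub>m 0 0)"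
  have fx: "f (x, n) = 1\<^sub>m (dims N n x) - e (x, n)" if "x : verts Q" for x n using that by (simp add: f_def)
  have fc: "f (x, n) : carrier_mat (dims N n x) (dims N n x)" if "x : verts Q" for x n
    unfolding fx[OF that] using minus_carrier_mat[OF ec[OF that]] .
  have dd: "dim_row (e (x, n)) = dims N n x" "dim_col (e (x, n)) = dims N n x" if "x : verts Q" for x n using ec[OF that, of n] by auto
  have f: "f : qrep_hom QB N N" unfolding qrep_hom_iff
  proof (intro conjI ballI allI impI)
    fix q n assume a: "q : arcs Q"
    note m = loc_rep_dims[OF lN a, of n]
    have v: "tail Q q : verts Q" "head Q q : verts Q" using a by simp_all
    have "f (tail Q q, n - 1) * Mat N (q, n) = Mat N (q, n) - e (tail Q q, n - 1) * Mat N (q, n)"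
      unfolding fx[OF v(1)] using mat_minus_mult[of "1\<^sub>m (dims N (n - 1) (tail Q q))" "Mat N (q, n)" "e (tail Q q, n - 1)"] m dd[OF v(1)]
      by simp
    moreover have "Mat N (q, n) * f (head Q q, n) = Mat N (q, n) - Mat N (q, n) * e (head Q q, n)"
      unfolding fx[OF v(2)] using mat_mult_minus[of "Mat N (q, n)" "1\<^sub>m (dims N n (head Q q))" "e (head Q q, n)"] m dd[OF v(2)]
      by simp
    ultimately show "f (tail Q q, n - 1) * Mat N (q, n) = Mat N (q, n) * f (head Q q, n)" using qrep_hom_comm[OF e a, of n] by simp
  qed (use fc in \<open>auto simp: f_def\<close>)
  have ef: "e (x, n) * f (x, n) = 0\<^sub>m (dims N n x) (dims N n x)" and fe: "f (x, n) * e (x, n) = 0\<^sub>m (dims N n x) (dims N n x)"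
    if x: "x : verts Q" for x n
  proof -
    have "e (x, n) * f (x, n) = e (x, n) - e (x, n)"
      unfolding fx[OF x] using mat_mult_minus[of "e (x, n)" "1\<^sub>m (dims N n x)" "e (x, n)"] dd[OF x, of n] ee x ec[OF x, of n] by simp
    then show "e (x, n) * f (x, n) = 0\<^sub>m (dims N n x) (dims N n x)" using minus_r_inv_mat[OF ec[OF x, of n]] by simp
    have "f (x, n) * e (x, n) = e (x, n) - e (x, n)"
      unfolding fx[OF x] using mat_minus_mult[of "1\<^sub>m (dims N n x)" "e (x, n)" "e (x, n)"] dd[OF x, of n] ee x ec[OF x, of n] by simp
    then show "f (x, n) * e (x, n) = 0\<^sub>m (dims N n x) (dims N n x)" using minus_r_inv_mat[OF ec[OF x, of n]] by simp
  qed
  have ff: "ALL x:verts Q. ALL n. f (x, n) * f (x, n) = f (x, n)"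
  proof (intro ballI allI)
    fix x n assume x: "x : verts Q"
    have "f (x, n) * f (x, n) = f (x, n) - e (x, n) * f (x, n)"
      by (subst (1) fx[OF x]) (use mat_minus_mult[of "1\<^sub>m (dims N n x)" "f (x, n)" "e (x, n)"] dd[OF x, of n] fc[OF x, of n] in simp)
    then show "f (x, n) * f (x, n) = f (x, n)" unfolding ef[OF x] using fc[OF x, of n] by (intro eq_matI) auto
  qed
  obtain M1 i1 p1 where 1: "is_qrep QB M1" "i1 : qrep_hom QB M1 N" "p1 : qrep_hom QB N M1"
    "ALL x:verts Q. ALL n. p1 (x, n) * i1 (x, n) = 1\<^sub>m (dims M1 n x)" "ALL x:verts Q. ALL n. i1 (x, n) * p1 (x, n) = e (x, n)"
    using idempotent_splits[OF q e ee] .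
  obtain M2 i2 p2 where 2: "is_qrep QB M2" "i2 : qrep_hom QB M2 N" "p2 : qrep_hom QB N M2"
    "ALL x:verts Q. ALL n. p2 (x, n) * i2 (x, n) = 1\<^sub>m (dims M2 n x)" "ALL x:verts Q. ALL n. i2 (x, n) * p2 (x, n) = f (x, n)"
    using idempotent_splits[OF q f ff] .
  \<comment> \<open>\<open>p j = (p i) (p j) (q j)\<close>, as the outer factors are identities, and
    regrouping exhibits the product of the two orthogonal idempotents in the middle.\<close>
  have orth: "p (x, n) * j (x, n) = 0\<^sub>m (dims L n x) (dims K n x)"
    if x: "x : verts Q" and p: "p : qrep_hom QB N L" and i: "i : qrep_hom QB L N" and j: "j : qrep_hom QB K N" and q: "q : qrep_hom QB N K"
      and e: "p (x, n) * i (x, n) = 1\<^sub>m (dims L n x)" "q (x, n) * j (x, n) = 1\<^sub>m (dims K n x)"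
        "(i (x, n) * p (x, n)) * (j (x, n) * q (x, n)) = 0\<^sub>m (dims N n x) (dims N n x)" for p i j q L K x n
  proof -
    note c = qrep_hom_carrier[OF p x, of n] qrep_hom_carrier[OF i x, of n] qrep_hom_carrier[OF j x, of n] qrep_hom_carrier[OF q x, of n]
    note d = c[THEN carrier_matD(1)] c[THEN carrier_matD(2)]
    have "p (x, n) * j (x, n) = (p (x, n) * i (x, n)) * (p (x, n) * j (x, n)) * (q (x, n) * j (x, n))"
      unfolding e(1,2) using d left_mult_one_mat[OF mult_carrier_mat[OF c(1,3)]] right_mult_one_mat[OF mult_carrier_mat[OF c(1,3)]] by simp
    also have "... = p (x, n) * ((i (x, n) * p (x, n)) * (j (x, n) * q (x, n))) * j (x, n)" using d by (simp add: mat_assoc)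
    finally show ?thesis unfolding e(3) using c by simp
  qed
  have "rsum N M1 M2 i1 i2 p1 p2" unfolding rsum_iff
  proof (intro conjI)
    show "ALL x:verts Q. ALL n. p1 (x, n) * i2 (x, n) = 0\<^sub>m (dims M1 n x) (dims M2 n x)"
      using orth[OF _ 1(3,2) 2(2,3)] 1(4,5) 2(4,5) ef by simp
    show "ALL x:verts Q. ALL n. p2 (x, n) * i1 (x, n) = 0\<^sub>m (dims M2 n x) (dims M1 n x)"
      using orth[OF _ 2(3,2) 1(2,3)] 1(4,5) 2(4,5) fe by simp
    show "ALL x:verts Q. ALL n. i1 (x, n) * p1 (x, n) + i2 (x, n) * p2 (x, n) = 1\<^sub>m (dims N n x)"
    proof (intro ballI allI)
      fix x n assume x: "x : verts Q"
      show "i1 (x, n) * p1 (x, n) + i2 (x, n) * p2 (x, n) = 1\<^sub>m (dims N n x)"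
        using 1(5) 2(5) x fx[OF x, of n] ec[OF x, of n] by (intro eq_matI) auto
    qed
  qed (use 1 2 in blast)+
  then have "vanish M1 \<or> vanish M2" using N 1(1) 2(1) unfolding indecomposable_Rep_iff by blast
  then show ?thesis
  proof
    assume v: "vanish M1"
    have "e (x, n) = 0\<^sub>m (dims N n x) (dims N n x)" if x: "x : verts Q" for x n
    proof -
      have "dims M1 n x = 0" using v dims_supp_zero[OF _ x] unfolding vanish_def by blast
      then have "i1 (x, n) : carrier_mat (dims N n x) 0" "p1 (x, n) : carrier_mat 0 (dims N n x)"
        using qrep_hom_carrier[OF 1(2) x, of n] qrep_hom_carrier[OF 1(3) x, of n] by simp_all
      then have "i1 (x, n) * p1 (x, n) = 0\<^sub>m (dims N n x) (dims N n x)" by (intro eq_matI) (auto simp: scalar_prod_def)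
      then show ?thesis using 1(5) x by simp
    qed
    then show ?thesis by blast
  next
    assume v: "vanish M2"
    have "e (x, n) = 1\<^sub>m (dims N n x)" if x: "x : verts Q" for x n
    proof -
      have "dims M2 n x = 0" using v dims_supp_zero[OF _ x] unfolding vanish_def by blast
      then have "i2 (x, n) : carrier_mat (dims N n x) 0" "p2 (x, n) : carrier_mat 0 (dims N n x)"
        using qrep_hom_carrier[OF 2(2) x, of n] qrep_hom_carrier[OF 2(3) x, of n] by simp_all
      then have "i2 (x, n) * p2 (x, n) = 0\<^sub>m (dims N n x) (dims N n x)" by (intro eq_matI) (auto simp: scalar_prod_def)
      then have f0: "f (x, n) = 0\<^sub>m (dims N n x) (dims N n x)" using 2(5) x by simp
      show ?thesis
      proof (rule eq_matI)
        fix i j assume ij: "i < dim_row (1\<^sub>m (dims N n x) :: 'k mat)" "j < dim_col (1\<^sub>m (dims N n x) :: 'k mat)"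
        have "(1\<^sub>m (dims N n x) - e (x, n)) $$ (i, j) = 0" unfolding fx[OF x, symmetric] f0 using ij by simp
        then show "e (x, n) $$ (i, j) = 1\<^sub>m (dims N n x) $$ (i, j)" using ij dd[OF x, of n] by simp
      qed (use dd[OF x, of n] in auto)
    qed
    then show ?thesis by blast
  qed
qed

text \<open>A vector \<open>c\<close> at \<open>(y, t)\<close> killed by all outgoing maps spans a
  subrepresentation. Since nothing lives above degree \<open>t\<close>, only zero maps arrive there,
  so any projection onto the line of \<open>c\<close> is an endomorphism. Being a nonzero idempotent
  it is the identity, and \<open>N\<close> is concentrated in degree \<open>t\<close>.\<close>

lemma not_jinj_concentrated:
  assumes N: "indecomposable (Rep QB) N" and z: "ALL n>t. supp (dims N n) = {}" and j: "\<not> jinj N t" and n: "n ~= t"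
  shows "supp (dims N n) = {}"
proof -
  have q: "is_qrep QB N" using N unfolding indecomposable_Rep_iff by blast
  then have lN: "loc_rep N" unfolding is_qrep_iff by blast
  obtain y c where y: "y : verts Q" and c: "c : carrier_vec (dims N t y)" and c0: "c ~= 0\<^sub>v (dims N t y)"
    and k: "ALL q:arcs Q. head Q q = y --> Mat N (q, t) *\<^sub>v c = 0\<^sub>v (dims N (t - 1) (tail Q q))"
    using j unfolding jinj_def by blast
  obtain l where l: "l < dims N t y" "c $ l ~= 0"
  proof -
    have "EX l < dims N t y. c $ l ~= 0"
    proof (rule ccontr)
      assume "\<not> (EX l < dims N t y. c $ l ~= 0)"
      then have "c = 0\<^sub>v (dims N t y)" using c by (intro eq_vecI) auto
      then show False using c0 by blast
    qed
    then show ?thesis using that by blast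
  qed
  let ?d = "dims N t y"
  \<comment> \<open>Rank-one projection onto the line of \<open>c\<close>, normalised by the nonzero
    entry \<open>c $ l\<close>.\<close>
  define E where "E = mat ?d ?d (%(i, j). if j = l then c $ i / c $ l else 0)"
  have E: "E : carrier_mat ?d ?d" by (simp add: E_def)
  have EE: "E * E = E"
  proof (rule eq_matI)
    fix i j assume ij: "i < dim_row E" "j < dim_col E"
    have "(E * E) $$ (i, j) = (\<Sum>m=0..<?d. E $$ (i, m) * E $$ (m, j))" using ij E by (simp add: scalar_prod_def)
    also have "... = (\<Sum>m=0..<?d. if m = l then E $$ (i, l) * E $$ (l, j) else 0)" using ij by (intro sum.cong refl) (auto simp: E_def)
    also have "... = E $$ (i, l) * E $$ (l, j)" using l by (subst sum.delta) auto
    also have "... = E $$ (i, j)" using ij l by (auto simp: E_def)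
    finally show "(E * E) $$ (i, j) = E $$ (i, j)" .
  qed (use E in auto)
  have ME: "Mat N (q, t) * E = 0\<^sub>m (dims N (t - 1) (tail Q q)) ?d" if a: "q : arcs Q" "head Q q = y" for q
  proof (rule eq_matI)
    note m = loc_rep_dims[OF lN a(1), of t, unfolded a(2)]
    fix i j assume "i < dim_row (0\<^sub>m (dims N (t - 1) (tail Q q)) ?d :: 'k mat)" "j < dim_col (0\<^sub>m (dims N (t - 1) (tail Q q)) ?d :: 'k mat)"
    then have ij: "i < dims N (t - 1) (tail Q q)" "j < ?d" by simp_all
    have "(Mat N (q, t) *\<^sub>v c) $ i = 0" using k a ij by simp
    then have s: "(\<Sum>m=0..<?d. Mat N (q, t) $$ (i, m) * c $ m) = 0" using ij m c by (simp add: scalar_prod_def)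
    have "(Mat N (q, t) * E) $$ (i, j) = (\<Sum>m=0..<?d. Mat N (q, t) $$ (i, m) * E $$ (m, j))" using ij m E by (simp add: scalar_prod_def)
    also have "... = (\<Sum>m=0..<?d. Mat N (q, t) $$ (i, m) * c $ m) * (if j = l then 1 / c $ l else 0)"
      unfolding sum_distrib_right using ij by (intro sum.cong refl) (auto simp: E_def)
    finally show "(Mat N (q, t) * E) $$ (i, j) = 0\<^sub>m (dims N (t - 1) (tail Q q)) ?d $$ (i, j)" unfolding s using ij by simp
  qed (use loc_rep_dims[OF lN a(1), of t] E in auto)
  define e where "e = (%(x, n). if (x, n) = (y, t) then E else if x : verts Q then 0\<^sub>m (dims N n x) (dims N n x) else 0\<^sub>m 0 0)"
  have e: "e : qrep_hom QB N N" unfolding qrep_hom_iff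
  proof (intro conjI ballI allI impI)
    show ec: "e (x, n) : carrier_mat (dims N n x) (dims N n x)" if "x : verts Q" for x n using that E by (auto simp: e_def)
    show "e (x, n) = 0\<^sub>m 0 0" if "x ~: verts Q" for x n using that y by (auto simp: e_def)
    fix q n assume a: "q : arcs Q"
    note m = loc_rep_dims[OF lN a, of n]
    have v: "tail Q q : verts Q" "head Q q : verts Q" using a by simp_all
    show "e (tail Q q, n - 1) * Mat N (q, n) = Mat N (q, n) * e (head Q q, n)"
    proof (cases "n > t")
      case True
      then have z: "dims N n (head Q q) = 0" using z dims_supp_zero[OF _ v(2)] by blast
      show ?thesis
        using mult_carrier_mat[OF ec[OF v(1), of "n - 1"] m] mult_carrier_mat[OF m ec[OF v(2), of n]] mat_no_col_eq unfolding z by blast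
    next
      case False
      then have "e (tail Q q, n - 1) = 0\<^sub>m (dims N (n - 1) (tail Q q)) (dims N (n - 1) (tail Q q))" using v by (auto simp: e_def)
      then have "e (tail Q q, n - 1) * Mat N (q, n) = 0\<^sub>m (dims N (n - 1) (tail Q q)) (dims N n (head Q q))"
        using left_mult_zero_mat[OF m] by simp
      moreover have "Mat N (q, n) * e (head Q q, n) = 0\<^sub>m (dims N (n - 1) (tail Q q)) (dims N n (head Q q))"
      proof (cases "(head Q q, n) = (y, t)")
        case True
        then show ?thesis using ME[OF a] by (auto simp: e_def)
      next
        case False
        then have "e (head Q q, n) = 0\<^sub>m (dims N n (head Q q)) (dims N n (head Q q))" using v by (auto simp: e_def)
        then show ?thesis using right_mult_zero_mat[OF m] by simp
      qed
      ultimately show ?thesis by simp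
    qed
  qed
  have ee: "ALL x:verts Q. ALL n. e (x, n) * e (x, n) = e (x, n)" using EE by (auto simp: e_def)
  have nz: "\<not> (ALL x:verts Q. ALL n. e (x, n) = 0\<^sub>m (dims N n x) (dims N n x))"
  proof
    assume "ALL x:verts Q. ALL n. e (x, n) = 0\<^sub>m (dims N n x) (dims N n x)"
    then have "e (y, t) = 0\<^sub>m ?d ?d" using y by blast
    then have "E = 0\<^sub>m ?d ?d" by (simp add: e_def)
    moreover have "E $$ (l, l) = 1" using l by (simp add: E_def)
    ultimately show False using l by simp
  qed
  have 1: "ALL x:verts Q. ALL n. e (x, n) = 1\<^sub>m (dims N n x)" using idempotent_indecomposable[OF N e ee] nz by blast
  have "dims N n x = 0" if x: "x : verts Q" for x
  proof (rule ccontr)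
    assume d: "dims N n x ~= 0"
    have "e (x, n) = 0\<^sub>m (dims N n x) (dims N n x)" using n x by (simp add: e_def)
    moreover have "e (x, n) = 1\<^sub>m (dims N n x)" using 1 x by blast
    ultimately have "(1\<^sub>m (dims N n x) :: 'k mat) $$ (0, 0) = 0" using d by simp
    then show False using d by simp
  qed
  then show ?thesis by (simp add: supp_def)
qed

section \<open>Resolutions of truncations\<close>

lemma K_minus_b_eq: "K_minus_b scale A = hcat KS" by (simp add: K_minus_b_def)

lemma P_b_min_eq: "P_b_min scale A = ccat PS" by (simp add: P_b_min_def)

text \<open>Serves for maps into \<open>\<beta> A N\<close>: unlike \<open>chainI\<close> it does
  not ask for the target to be a complex of modules, and in return the squares must commute for all
  \<open>x\<close> and \<open>v\<close>.\<close>

lemma chain_raw: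
  assumes f: "!!n. f n : mhom (Tm X n) (Tm Y n)" and c: "!!n x v. Df Y n x (f n x v) = f (n - 1) x (Df X n x v)"
  shows "f : chain X Y"
proof -
  have "(%x v. Df Y n x (f n x v)) = (%x v. f (n - 1) x (Df X n x v))" for n by (rule ext, rule ext) (rule c)
  then show ?thesis unfolding chain_maps_def using f by simp
qed

lemma boundaries_0:
  assumes X: "cpx X" and x: "x : Obj A" shows "0 : boundaries X n x"
proof -
  have "Df X (n + 1) x 0 = 0" by (rule mhom_0[OF complex_Df[OF X]])
  then show ?thesis unfolding boundaries_def using amod_0[OF complex_amod[OF X] x, of "n + 1"] by (metis imageI)
qed

lemma cycles_0:
  assumes N: "cpx N" shows "x : Obj A ==> 0 : cycles N n x"
  using amod_0[OF complex_amod[OF N]] mhom_0[OF complex_Df[OF N]] unfolding cycles_def by simp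

lemma quasi_iso_exact:
  assumes X: "cpx X" and f: "f : chain X Y" and qi: "quasi_iso A X Y f"
    and e: "ALL x:Obj A. cycles Y n x = boundaries Y n x"
  shows "exact_at X n" unfolding exact_at_def
proof (intro ballI equalityI subsetI)
  fix x v assume x: "x : Obj A" and v: "v : cycles X n x"
  have "Df Y n x (f n x v) = f (n - 1) x 0" using chain_comm[OF f, of n x v] v unfolding cycles_def by simp
  also have "... = 0" by (rule mhom_0[OF chain_hom[OF f]])
  finally have "f n x v : cycles Y n x" using mhom_in[OF chain_hom[OF f] x] v unfolding cycles_def by simp
  then have "f n x v : boundaries Y n x" using e x by blast
  then show "v : boundaries X n x" using qi x v unfolding quasi_iso_def by blast
next
  fix x v assume "x : Obj A" "v : boundaries X n x"
  then show "v : cycles X n x" using boundaries_cycles[OF X] by blast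
qed

section \<open>Cycles and boundaries of the truncation \<open>\<beta>\<close>\<close>

context
  fixes N t assumes N: "cpx N" and t: "top_degree A N = t"
begin

lemma beta_Tm: "n <= t ==> Tm (\<beta> A N) n = Tm N n"
  and beta_Df: "n <= t ==> Df (\<beta> A N) n = Df N n"
  and beta_Sp_top: "Sp (Tm (\<beta> A N) (t + 1)) x = cycles N t x"
  and beta_Act_top: "Act (Tm (\<beta> A N) (t + 1)) = Act (Tm N t)"
  and beta_Df_top: "Df (\<beta> A N) (t + 1) x v = (if x : Obj A & v : cycles N t x then v else 0)"
  and beta_above: "n > t + 1 ==> Tm (\<beta> A N) n = zero_amod" "n > t + 1 ==> Df (\<beta> A N) n = (%x v. 0)"
  by (auto simp: \<beta>_def t Let_def ker_amod_def cycles_def)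

lemma beta_cycles: "n <= t ==> cycles (\<beta> A N) n x = cycles N n x" by (simp add: cycles_def beta_Tm beta_Df)

lemma beta_boundaries: "n < t ==> boundaries (\<beta> A N) n x = boundaries N n x"
  by (simp add: boundaries_def beta_Tm beta_Df)

text \<open>The added term consists of the cycles of degree \<open>t\<close>, so these become
  boundaries, and the added differential is an inclusion, hence injective.\<close>

lemma beta_exact:
  assumes n: "n >= t" and x: "x : Obj A"
  shows "cycles (\<beta> A N) n x = boundaries (\<beta> A N) n x"
proof -
  consider "n = t" | "n = t + 1" | "n > t + 1" using n by linarith
  then show ?thesis
  proof cases
    case 1
    have "boundaries (\<beta> A N) t x = (%v. v) ` cycles N t x"
      unfolding boundaries_def beta_Sp_top using x by (intro image_cong refl) (simp add: beta_Df_top)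
    then show ?thesis unfolding 1 beta_cycles[OF order_refl] by simp
  next
    case 2
    have "cycles (\<beta> A N) n x = {0}"
      unfolding 2 cycles_def[of "\<beta> A N"] beta_Sp_top using cycles_0[OF N x] x by (auto simp: beta_Df_top)
    moreover have "boundaries (\<beta> A N) n x = {0}" unfolding 2 boundaries_def by (simp add: beta_above zero_amod_def)
    ultimately show ?thesis by simp
  next
    case 3
    then show ?thesis by (simp add: cycles_def boundaries_def beta_above zero_amod_def)
  qed
qed

lemma beta_Df_0: "Df (\<beta> A N) n x 0 = 0"
proof -
  consider "n <= t" | "n = t + 1" | "n > t + 1" by linarith
  then show ?thesis by cases (simp_all add: beta_Df beta_Df_top beta_above mhom_0[OF complex_Df[OF N]])
qed

lemma beta_top_hom:
  assumes f: "f : mhom P (Tm N t)" and z: "!!x v. x : Obj A ==> v : Sp P x ==> Df N t x (f x v) = 0"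
  shows "f : mhom P (Tm (\<beta> A N) (t + 1))"
  using f z unfolding amap_hom_def linear_map_def beta_Sp_top beta_Act_top cycles_def by blast

lemma beta_zero_hom:
  assumes n: "n > t + 1" shows "(%x v. 0) : mhom P (Tm (\<beta> A N) n)"
  unfolding amap_hom_def linear_map_def beta_above(1)[OF n] by (auto simp: zero_amod_def)

end

text \<open>Below \<open>t\<close> the terms are zero, and from \<open>t\<close> on exactness is
  built into the truncation. This is the degenerate case of a complex concentrated in its top
  degree.\<close>

lemma beta_exact_everywhere:
  assumes N: "cpx N" and t: "top_degree A N = t" and z: "!!n. n < t ==> is_zero_amod A (Tm N n)" and x: "x : Obj A"
  shows "cycles (\<beta> A N) n x = boundaries (\<beta> A N) n x"
proof (cases "n >= t")
  case False
  then have n: "n < t" by simp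
  have "cycles N n x \<subseteq> {0}" using z[OF n] x unfolding is_zero_amod_def cycles_def by auto
  then have "cycles N n x = boundaries N n x" using boundaries_cycles[OF N x, of n] boundaries_0[OF N x, of n] by blast
  then show ?thesis using n by (simp add: beta_cycles[OF N t] beta_boundaries[OF N t])
qed (rule beta_exact[OF N t _ x])

lemma FC_Df_agree:
  assumes M: "loc_rep M" and N: "loc_rep N" and ag: "agree_upto t M N" and n: "n <= t"
  shows "Df (FC M) n = Df (FC N) n"
proof -
  have d: "dims M n = dims N n" "dims M (n - 1) = dims N (n - 1)" and m: "!!q. q : arcs Q ==> Mat M (q, n) = Mat N (q, n)"
    using ag n unfolding agree_upto_def by simp_all
  have hN: "Df (FC N) n : mhom (FT (dims M n)) (FT (dims M (n - 1)))" using FC_Df_hom[OF N, of n] d by simp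
  show ?thesis
  proof (rule mhom_coord_eqI[OF FC_Df_hom[OF M] hN loc_rep_fin[OF M]])
    show "top (dims M n) (dims M (n - 1)) (Df (FC M) n) z = top (dims M n) (dims M (n - 1)) (Df (FC N) n) z" if "z : verts Q" for z
      using FC_Df_top[OF M that, of n] FC_Df_top[OF N that, of n] d by simp
    show "arm (dims M n) (dims M (n - 1)) (Df (FC M) n) q = arm (dims M n) (dims M (n - 1)) (Df (FC N) n) q" if "q : arcs Q" for q
      using FC_Df_arm[OF M that, of n] FC_Df_arm[OF N that, of n] d m[OF that] by simp
  qed
qed

lemma jinj_agree: "agree_upto t M N ==> n <= t ==> jinj N n ==> jinj M n" unfolding jinj_def agree_upto_def by simp

section \<open>The coinduced representation resolves the truncation\<close>

context
  fixes N N0 a b t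
  assumes N: "cpx N" and q: "is_qrep QB N0" and a: "a : chain N (FC N0)" and b: "b : chain (FC N0) N"
    and ba: "ALL n. ALL x:Obj A. ALL v:Sp (Tm N n) x. b n x (a n x v) = v"
    and ab: "ALL n. ALL x:Obj A. ALL v:Sp (Tm (FC N0) n) x. a n x (b n x v) = v"
    and nz: "supp (dims N0 t) ~= {}" and zt: "ALL n>t. supp (dims N0 n) = {}"
begin

lemma lN0: "loc_rep N0" using q unfolding is_qrep_iff by blast

lemma zero_N_iff: "is_zero_amod A (Tm N n) \<longleftrightarrow> supp (dims N0 n) = {}"
proof -
  have "is_zero_amod A (Tm N n) \<longleftrightarrow> is_zero_amod A (Tm (FC N0) n)" unfolding is_zero_amod_def
  proof (rule iffI; intro ballI)
    fix x assume x: "x : Obj A"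
    note c = FC_complex[OF lN0]
    show "Sp (Tm (FC N0) n) x = {0}" if z: "ALL x:Obj A. Sp (Tm N n) x = {0}"
    proof -
      have "v = 0" if v: "v : Sp (Tm (FC N0) n) x" for v
        using ab[rule_format, OF x v] mhom_in[OF chain_hom[OF b] x v] z x mhom_0[OF chain_hom[OF a], of n x] by auto
      then show ?thesis using amod_0[OF complex_amod[OF c] x, of n] by blast
    qed
    show "Sp (Tm N n) x = {0}" if z: "ALL x:Obj A. Sp (Tm (FC N0) n) x = {0}"
    proof -
      have "v = 0" if v: "v : Sp (Tm N n) x" for v
        using ba[rule_format, OF x v] mhom_in[OF chain_hom[OF a] x v] z x mhom_0[OF chain_hom[OF b], of n x] by auto
      then show ?thesis using amod_0[OF complex_amod[OF N] x, of n] by blast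
    qed
  qed
  then show ?thesis by (simp add: FC_Tm zero_FT)
qed

lemma top_N: "top_degree A N = t" unfolding top_degree_def
proof (rule Least_equality)
  show "ALL n>t. is_zero_amod A (Tm N n)" using zt zero_N_iff by blast
  show "t <= y" if "ALL n>y. is_zero_amod A (Tm N n)" for y using that nz zero_N_iff[of t] by (meson not_le_imp_less)
qed

text \<open>\<open>FC M\<close> agrees with \<open>FC N0\<close> up to \<open>t\<close> and is exact
  from \<open>t\<close> on, just as \<open>\<beta> A N\<close> is, so homology has to be compared
  only below \<open>t\<close>, where the map is the isomorphism \<open>b\<close>. Exactness in
  degree \<open>t\<close> itself is where \<open>jinj N0 t\<close> enters.\<close>

lemma beta_resolution:
  assumes j: "jinj N0 t" and M: "lrep M" and co: "coinduced t M" and ag: "agree_upto t M N0"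
  shows "is_min_proj_resolution scale A (\<beta> A N) (FC M)"
proof -
  note lM = lrep_loc[OF M]
  note cM = FC_complex[OF lM]
  have Tm_eq: "Tm (FC M) n = Tm (FC N0) n" if "n <= t" for n using ag that unfolding agree_upto_def FC_Tm by simp
  have Df_eq: "Df (FC M) n = Df (FC N0) n" if "n <= t" for n by (rule FC_Df_agree[OF lM lN0 ag that])
  \<comment> \<open>In degree \<open>t + 1\<close> the map is forced: the differential of the
    truncation is an inclusion there, so the square determines it as \<open>b d\<close>.\<close>
  define c where "c n = (if n <= t then b n else if n = t + 1 then (%x v. b t x (Df (FC M) (t + 1) x v)) else (%x v. 0))" for n
  have ct: "c n = b n" if "n <= t" for n using that by (simp add: c_def)
  have ct1: "c (t + 1) = (%x v. b t x (Df (FC M) (t + 1) x v))" by (simp add: c_def)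
  have ct2: "c n = (%x v. 0)" if "n > t + 1" for n using that by (simp add: c_def)
  have z1: "Df N t x (b t x (Df (FC M) (t + 1) x v)) = 0" for x v
  proof -
    have "Df N t x (b t x (Df (FC M) (t + 1) x v)) = b (t - 1) x (Df (FC M) t x (Df (FC M) (t + 1) x v))"
      using chain_comm[OF b] Df_eq[OF order_refl] by simp
    then show ?thesis using complex_DD[OF cM] mhom_0[OF chain_hom[OF b]] by simp
  qed
  have h1: "(%x v. b t x (Df (FC M) (t + 1) x v)) : mhom (Tm (FC M) (t + 1)) (Tm N t)"
    by (rule mhom_comp[OF complex_Df'[OF cM]]) (use chain_hom[OF b, of t] Tm_eq[OF order_refl] in simp)
  have c: "c : chain (FC M) (\<beta> A N)"
  proof (rule chain_raw)
    fix n
    consider "n <= t" | "n = t + 1" | "n > t + 1" by linarith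
    then show "c n : mhom (Tm (FC M) n) (Tm (\<beta> A N) n)"
    proof cases
      case 1
      then show ?thesis unfolding ct[OF 1] beta_Tm[OF N top_N 1] Tm_eq[OF 1] by (intro chain_hom[OF b])
    next
      case 2
      show ?thesis unfolding 2 ct1 by (rule beta_top_hom[OF N top_N h1 z1])
    next
      case 3
      show ?thesis unfolding ct2[OF 3] by (rule beta_zero_hom[OF N top_N 3])
    qed
  next
    fix n x v
    consider "n <= t" | "n = t + 1" | "n = t + 2" | "n > t + 2" by linarith
    then show "Df (\<beta> A N) n x (c n x v) = c (n - 1) x (Df (FC M) n x v)"
    proof cases
      case 1
      then have le: "n - 1 <= t" by simp
      show ?thesis unfolding ct[OF 1] ct[OF le] beta_Df[OF N top_N 1] Df_eq[OF 1] by (rule chain_comm[OF b])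
    next
      case 2
      have e: "n - 1 = t" using 2 by simp
      have "Df (\<beta> A N) (t + 1) x (c (t + 1) x v) = c (t + 1) x v"
      proof (cases "x : Obj A & v : Sp (Tm (FC M) (t + 1)) x")
        case True
        then have "c (t + 1) x v : cycles N t x" unfolding ct1 cycles_def using mhom_in[OF h1] z1 by simp
        then show ?thesis using True by (simp add: beta_Df_top[OF N top_N])
      next
        case False
        then have "c (t + 1) x v = 0" unfolding ct1 using mhom_out[OF h1, of x v] by blast
        then show ?thesis by (simp add: beta_Df_0[OF N top_N])
      qed
      then show ?thesis unfolding e unfolding 2 ct[OF order_refl] unfolding ct1 .
    next
      case 3
      have e: "n - 1 = t + 1" and e': "n = t + 1 + 1" using 3 by simp_all
      have g: "n > t + 1" using 3 by simp
      have "c (t + 1) x (Df (FC M) (t + 1 + 1) x v) = 0" unfolding ct1 complex_DD[OF cM] by (rule mhom_0[OF chain_hom[OF b]])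
      then show ?thesis unfolding e beta_above(2)[OF N top_N g] unfolding e' by simp
    next
      case 4
      then have g: "n > t + 1" "n - 1 > t + 1" by simp_all
      show ?thesis unfolding beta_above(2)[OF N top_N g(1)] ct2[OF g(2)] by (rule refl)
    qed
  qed
  have jM: "jinj M t" using jinj_agree[OF ag order_refl j] .
  have exM: "exact_at (FC M) n" if "n >= t" for n
    using that co jM unfolding exact_FC_iff[OF lM] coinduced_def by (cases "n = t") auto
  have "quasi_iso A (FC M) (\<beta> A N) c" unfolding quasi_iso_def
  proof (intro allI ballI conjI impI)
    fix n x v assume x: "x : Obj A" and v: "v : cycles (FC M) n x" and B: "c n x v : boundaries (\<beta> A N) n x"
    show "v : boundaries (FC M) n x"
    proof (cases "n >= t")
      case True
      then show ?thesis using exM[OF True] x v unfolding exact_at_def by blast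
    next
      case False
      then have n: "n < t" "n <= t" "n + 1 <= t" by simp_all
      have vS: "v : Sp (Tm (FC N0) n) x" using v Tm_eq[OF n(2)] unfolding cycles_def by simp
      have "b n x v : boundaries N n x" using B unfolding ct[OF n(2)] beta_boundaries[OF N top_N n(1)] .
      then obtain w where w: "w : Sp (Tm N (n + 1)) x" "b n x v = Df N (n + 1) x w" unfolding boundaries_def by blast
      have "v = a n x (Df N (n + 1) x w)" using ab[rule_format, OF x vS] w(2) by simp
      also have "... = Df (FC N0) (n + 1) x (a (n + 1) x w)" using chain_comm[OF a, of "n + 1" x w] by simp
      finally have "v = Df (FC M) (n + 1) x (a (n + 1) x w)" using Df_eq[OF n(3)] by simp
      moreover have "a (n + 1) x w : Sp (Tm (FC M) (n + 1)) x" using mhom_in[OF chain_hom[OF a] x w(1)] Tm_eq[OF n(3)] by simp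
      ultimately show ?thesis unfolding boundaries_def by blast
    qed
  next
    fix n x w assume x: "x : Obj A" and w: "w : cycles (\<beta> A N) n x"
    show "EX v:cycles (FC M) n x. w - c n x v : boundaries (\<beta> A N) n x"
    proof (cases "n >= t")
      case True
      have "c n x 0 = 0" by (rule mhom_0[OF chain_hom[OF c]])
      moreover have "w : boundaries (\<beta> A N) n x" using w beta_exact[OF N top_N True x] by simp
      ultimately show ?thesis using cycles_0[OF cM x, of n] by (intro bexI[of _ 0]) simp_all
    next
      case False
      then have n: "n < t" "n <= t" by simp_all
      have w': "w : Sp (Tm N n) x" "Df N n x w = 0" using w unfolding beta_cycles[OF N top_N n(2)] unfolding cycles_def by blast+
      have "Df (FC M) n x (a n x w) = 0" unfolding Df_eq[OF n(2)] chain_comm[OF a] w'(2) by (rule mhom_0[OF chain_hom[OF a]])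
      then have "a n x w : cycles (FC M) n x" unfolding cycles_def using mhom_in[OF chain_hom[OF a] x w'(1)] Tm_eq[OF n(2)] by simp
      moreover have "w - c n x (a n x w) = 0" unfolding ct[OF n(2)] using ba[rule_format, OF x w'(1)] by simp
      ultimately show ?thesis using boundaries_0[OF N x, of n] unfolding beta_boundaries[OF N top_N n(1)] by (metis (no_types))
    qed
  qed
  moreover have "FC M : Obj (K_minus_b scale A)" unfolding K_minus_b_eq homotopy_category_simps using FC_KS[OF lM] M by blast
  ultimately show ?thesis unfolding is_min_proj_resolution_def using c FC_minimal[OF lM] by blast
qed

end

definition top_bij :: "('o => nat) => ('o => nat) => ('o, 'm) amap => bool" where
  "top_bij V W f \<longleftrightarrow> (ALL z:verts Q. (ALL c:carrier_vec (V z). top V W f z *\<^sub>v c = 0\<^sub>v (W z) --> c = 0\<^sub>v (V z)) &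
    (ALL w:carrier_vec (W z). EX c:carrier_vec (V z). top V W f z *\<^sub>v c = w))"

text \<open>A quasi-isomorphism with top components \<open>\<phi>\<close> induces isomorphisms of the kernels and cokernels of
  the maps from degree \<open>n\<close> to degree \<open>n - 1\<close>, so bijectivity of \<open>\<phi>\<close> propagates upwards as in the five lemma.\<close>

context
  fixes M N t and g :: "('o, 'm) cmap"
  assumes M: "loc_rep M" and N: "loc_rep N"
    and g: "!!n. n <= t ==> g n : mhom (FT (dims M n)) (FT (dims N n))"
    and comm: "!!n x v. n <= t ==> Df (FC N) n x (g n x v) = g (n - 1) x (Df (FC M) n x v)"
    and inj: "!!n z v. n < t ==> z : verts Q ==> v : cycles (FC M) n z ==> g n z v : boundaries (FC N) n z ==> v : boundaries (FC M) n z"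
    and surj: "!!n z w. n < t ==> z : verts Q ==> w : cycles (FC N) n z ==> EX v:cycles (FC M) n z. w - g n z v : boundaries (FC N) n z"
    and jM: "jinj M t" and jN: "jinj N t"
begin

abbreviation "tp n z \<equiv> top (dims M n) (dims N n) (g n) z"

abbreviation "tp_bij n \<equiv> top_bij (dims M n) (dims N n) (g n)"

lemma tp_comm: "n <= t ==> q : arcs Q ==> tp (n - 1) (tail Q q) * Mat M (q, n) = Mat N (q, n) * tp n (head Q q)"
  by (rule top_commute[OF M N]) (use g comm in auto)

lemma tp_carrier: "tp n z : carrier_mat (dims N n z) (dims M n z)" by (rule top_carrier)

lemma tp_vec: "tp n z *\<^sub>v c : carrier_vec (dims N n z)" if "c : carrier_vec (dims M n z)"
  by (rule mult_mat_vec_carrier[OF tp_carrier that])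

lemma tp_zero: "tp n z *\<^sub>v 0\<^sub>v (dims M n z) = 0\<^sub>v (dims N n z)" using tp_carrier[of n z] by auto

lemma tp_comm_vec:
  assumes n: "n <= t" and a: "q : arcs Q" and c: "c : carrier_vec (dims M n (head Q q))"
  shows "tp (n - 1) (tail Q q) *\<^sub>v (Mat M (q, n) *\<^sub>v c) = Mat N (q, n) *\<^sub>v (tp n (head Q q) *\<^sub>v c)"
proof -
  have "tp (n - 1) (tail Q q) *\<^sub>v (Mat M (q, n) *\<^sub>v c) = tp (n - 1) (tail Q q) * Mat M (q, n) *\<^sub>v c"
    by (rule assoc_mult_mat_vec[OF tp_carrier loc_rep_dims[OF M a] c, symmetric])
  also have "... = Mat N (q, n) *\<^sub>v (tp n (head Q q) *\<^sub>v c)"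
    unfolding tp_comm[OF n a] by (rule assoc_mult_mat_vec[OF loc_rep_dims[OF N a] tp_carrier c])
  finally show ?thesis .
qed

lemma tp_tv: "n <= t ==> z : verts Q ==> v : Sp (FT (dims M n)) z ==> tv (dims N n) z (g n z v) = tp n z *\<^sub>v tv (dims M n) z v"
  by (rule tv_mhom[OF g loc_rep_fin[OF M]])

lemma tp_av: "n <= t ==> q : arcs Q ==> v : Sp (FT (dims M n)) (head Q q) ==>
    av (dims N n) q (g n (head Q q) v) = tp n (tail Q q) *\<^sub>v av (dims M n) q v + arm (dims M n) (dims N n) (g n) q *\<^sub>v tv (dims M n) (head Q q) v"
  by (rule av_mhom[OF g loc_rep_fin[OF M]])

text \<open>Below \<open>t\<close> a kernel vector is the top of a cycle, which up to a boundary is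
  the image of a cycle of \<open>FC M\<close>, and boundaries have zero top. In degree
  \<open>t\<close> the kernel is zero.\<close>

lemma kernel_onto:
  assumes n: "n <= t" and z: "z : verts Q" and w: "w : carrier_vec (dims N n z)"
    and k: "ALL q:arcs Q. head Q q = z --> Mat N (q, n) *\<^sub>v w = 0\<^sub>v (dims N (n - 1) (tail Q q))"
  shows "EX c:carrier_vec (dims M n z). tp n z *\<^sub>v c = w"
proof (cases "n = t")
  case True
  then have "w = 0\<^sub>v (dims N n z)" using jN z w k unfolding jinj_def by blast
  then show ?thesis using tp_zero[of n z] zero_carrier_vec by blast
next
  case False
  then have n': "n < t" using n by simp
  obtain u where u: "u : Sp (FT (dims N n)) z" "tv (dims N n) z u = w" using FT_exists_tv[where V = "dims N n", OF z w] by blast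
  have "u : cycles (FC N) n z" unfolding FC_cycle_iff[OF N z] using u k by blast
  then obtain v where v: "v : cycles (FC M) n z" "u - g n z v : boundaries (FC N) n z" using surj[OF n' z] by blast
  have vS: "v : Sp (FT (dims M n)) z" using v(1) unfolding cycles_def FC_Tm by blast
  have gv: "g n z v : Sp (FT (dims N n)) z" using mhom_in[OF g[OF n] vert_Obj[OF z] vS] .
  have "tv (dims N n) z (u - g n z v) = 0\<^sub>v (dims N n z)" using v(2) unfolding FC_boundary_iff[OF N z] by blast
  then have 0: "w - tp n z *\<^sub>v tv (dims M n) z v = 0\<^sub>v (dims N n z)" unfolding tv_diff[OF z u(1) gv] tp_tv[OF n z vS] u(2) .
  have "tp n z *\<^sub>v tv (dims M n) z v = w"
  proof (rule eq_vecI)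
    fix i assume "i < dim_vec w"
    then have i: "i < dims N n z" using w by simp
    have "(w - tp n z *\<^sub>v tv (dims M n) z v) $ i = w $ i - (tp n z *\<^sub>v tv (dims M n) z v) $ i"
      by (rule index_minus_vec(1)) (use i in simp)
    then show "(tp n z *\<^sub>v tv (dims M n) z v) $ i = w $ i" unfolding 0 using i by simp
  qed (use w in simp)
  then show ?thesis using tv_carrier by blast
qed

text \<open>The family \<open>y\<close> is the arrow part of an element with zero top, which is a
  cycle of degree \<open>n - 1\<close>. Its image is a boundary by the hypothesis on
  \<open>w\<close>, so it is a boundary itself by injectivity on homology, and a preimage has the
  top \<open>c\<close> sought for.\<close>

lemma cokernel_inj:
  assumes n: "n <= t" and z: "z : verts Q" and w: "w : carrier_vec (dims N n z)"
    and y: "ALL q:arcs Q. head Q q = z --> y q : carrier_vec (dims M (n - 1) (tail Q q)) & tp (n - 1) (tail Q q) *\<^sub>v y q = Mat N (q, n) *\<^sub>v w"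
  shows "EX c:carrier_vec (dims M n z). ALL q:arcs Q. head Q q = z --> Mat M (q, n) *\<^sub>v c = y q"
proof -
  have n': "n - 1 < t" "n - 1 <= t" and e: "n - 1 + 1 = n" using n by simp_all
  have yc: "ALL q:arcs Q. head Q q = z --> y q : carrier_vec (dims M (n - 1) (tail Q q))" using y by blast
  obtain v where v: "v : Sp (FT (dims M (n - 1))) z" "tv (dims M (n - 1)) z v = 0\<^sub>v (dims M (n - 1) z)"
    "ALL q:arcs Q. head Q q = z --> av (dims M (n - 1)) q v = y q"
    using FT_exists_vec[where V = "dims M (n - 1)" and w = y, OF z zero_carrier_vec yc] by blast
  have "Mat M (q, n - 1) *\<^sub>v 0\<^sub>v (dims M (n - 1) z) = 0\<^sub>v (dims M (n - 1 - 1) (tail Q q))" if a: "q : arcs Q" "head Q q = z" for q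
    using loc_rep_dims[OF M a(1), of "n - 1"] a(2) by auto
  then have vc: "v : cycles (FC M) (n - 1) z" unfolding FC_cycle_iff[OF M z] v(2) using v(1) by blast
  have "g (n - 1) z v : boundaries (FC N) (n - 1) z" unfolding FC_boundary_iff[OF N z] e
  proof (intro conjI bexI[OF _ w] ballI impI)
    show "g (n - 1) z v : Sp (FT (dims N (n - 1))) z" using mhom_in[OF g[OF n'(2)] vert_Obj[OF z] v(1)] .
    show "tv (dims N (n - 1)) z (g (n - 1) z v) = 0\<^sub>v (dims N (n - 1) z)"
      unfolding tp_tv[OF n'(2) z v(1)] v(2) by (rule tp_zero)
    fix q assume a: "q : arcs Q" "head Q q = z"
    have vS: "v : Sp (FT (dims M (n - 1))) (head Q q)" using v(1) a(2) by simp
    have "arm (dims M (n - 1)) (dims N (n - 1)) (g (n - 1)) q *\<^sub>v 0\<^sub>v (dims M (n - 1) z) = 0\<^sub>v (dims N (n - 1) (tail Q q))"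
      using arm_carrier[of "dims M (n - 1)" "dims N (n - 1)" "g (n - 1)" q] a(2) by auto
    moreover have "tp (n - 1) (tail Q q) *\<^sub>v y q : carrier_vec (dims N (n - 1) (tail Q q))" using tp_vec yc a by blast
    moreover have "av (dims M (n - 1)) q v = y q" "tp (n - 1) (tail Q q) *\<^sub>v y q = Mat N (q, n) *\<^sub>v w" using v(3) y a by blast+
    ultimately show "av (dims N (n - 1)) q (g (n - 1) z v) = Mat N (q, n) *\<^sub>v w"
      using tp_av[OF n'(2) a(1) vS] unfolding a(2) v(2) by simp
  qed
  from inj[OF n'(1) z vc this] obtain c where c: "c : carrier_vec (dims M n z)"
    "ALL q:arcs Q. head Q q = z --> av (dims M (n - 1)) q v = Mat M (q, n) *\<^sub>v c"
    unfolding FC_boundary_iff[OF M z] e by blast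
  show ?thesis by (rule bexI[OF _ c(1)]) (use c(2) v(3) in auto)
qed

text \<open>A preimage is first found up to the kernel of the joint map, by
  \<open>cokernel_inj\<close>, and then corrected by \<open>kernel_onto\<close>. Injectivity relies
  on the surjectivity just shown, in the same degree.\<close>

lemma tp_bij_step:
  assumes n: "n <= t" and B: "tp_bij (n - 1)" shows "tp_bij n"
proof -
  have onto: "EX c:carrier_vec (dims M n z). tp n z *\<^sub>v c = w" if z: "z : verts Q" and w: "w : carrier_vec (dims N n z)" for z w
  proof -
    have "EX y:carrier_vec (dims M (n - 1) (tail Q q)). tp (n - 1) (tail Q q) *\<^sub>v y = Mat N (q, n) *\<^sub>v w"
      if a: "q : arcs Q" "head Q q = z" for q
    proof -
      have "Mat N (q, n) *\<^sub>v w : carrier_vec (dims N (n - 1) (tail Q q))"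
        using mult_mat_vec_carrier[OF loc_rep_dims[OF N a(1), of n]] w a(2) by simp
      moreover have "tail Q q : verts Q" using a by simp
      ultimately show ?thesis using B unfolding top_bij_def by blast
    qed
    then have "ALL q:{q : arcs Q. head Q q = z}. EX y. y : carrier_vec (dims M (n - 1) (tail Q q)) & tp (n - 1) (tail Q q) *\<^sub>v y = Mat N (q, n) *\<^sub>v w"
      by blast
    from bchoice[OF this] obtain y where y: "ALL q:{q : arcs Q. head Q q = z}. y q : carrier_vec (dims M (n - 1) (tail Q q)) &
      tp (n - 1) (tail Q q) *\<^sub>v y q = Mat N (q, n) *\<^sub>v w" ..
    have "EX c:carrier_vec (dims M n z). ALL q:arcs Q. head Q q = z --> Mat M (q, n) *\<^sub>v c = y q"
      by (rule cokernel_inj[OF n z w]) (use y in simp)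
    then obtain c where c: "c : carrier_vec (dims M n z)" "ALL q:arcs Q. head Q q = z --> Mat M (q, n) *\<^sub>v c = y q" by blast
    note pc = tp_vec[OF c(1)]
    have "Mat N (q, n) *\<^sub>v (w - tp n z *\<^sub>v c) = 0\<^sub>v (dims N (n - 1) (tail Q q))" if a: "q : arcs Q" "head Q q = z" for q
    proof -
      note m = loc_rep_dims[OF N a(1), of n, unfolded a(2)]
      have "Mat N (q, n) *\<^sub>v (w - tp n z *\<^sub>v c) = Mat N (q, n) *\<^sub>v w - Mat N (q, n) *\<^sub>v (tp n z *\<^sub>v c)"
        by (rule mult_minus_distrib_mat_vec[OF m w pc])
      also have "Mat N (q, n) *\<^sub>v (tp n z *\<^sub>v c) = tp (n - 1) (tail Q q) *\<^sub>v (Mat M (q, n) *\<^sub>v c)"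
        using tp_comm_vec[OF n a(1)] c(1) a(2) by simp
      also have "... = Mat N (q, n) *\<^sub>v w" using c(2) y a by simp
      finally show ?thesis using minus_cancel_vec[OF mult_mat_vec_carrier[OF m w]] by simp
    qed
    then have "EX e:carrier_vec (dims M n z). tp n z *\<^sub>v e = w - tp n z *\<^sub>v c"
      by (intro kernel_onto[OF n z minus_carrier_vec[OF w pc]]) blast
    then obtain e where e: "e : carrier_vec (dims M n z)" "tp n z *\<^sub>v e = w - tp n z *\<^sub>v c" by blast
    have "tp n z *\<^sub>v (c + e) = tp n z *\<^sub>v c + (w - tp n z *\<^sub>v c)"
      using mult_add_distrib_mat_vec[OF tp_carrier c(1) e(1)] e(2) by simp
    also have "... = w"
    proof (rule eq_vecI)
      fix i assume "i < dim_vec w"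
      then have i: "i < dims N n z" using w by simp
      have "(tp n z *\<^sub>v c + (w - tp n z *\<^sub>v c)) $ i = (tp n z *\<^sub>v c) $ i + (w - tp n z *\<^sub>v c) $ i" by (rule index_add_vec(1)) (use i in simp)
      also have "(w - tp n z *\<^sub>v c) $ i = w $ i - (tp n z *\<^sub>v c) $ i" by (rule index_minus_vec(1)) (use i in simp)
      finally show "(tp n z *\<^sub>v c + (w - tp n z *\<^sub>v c)) $ i = w $ i" by simp
    qed (use w in simp)
    finally show ?thesis using add_carrier_vec[OF c(1) e(1)] by blast
  qed
  have inj0: "c = 0\<^sub>v (dims M n z)" if z: "z : verts Q" and c: "c : carrier_vec (dims M n z)" and 0: "tp n z *\<^sub>v c = 0\<^sub>v (dims N n z)" for z c
  proof -
    have k: "ALL q:arcs Q. head Q q = z --> Mat M (q, n) *\<^sub>v c = 0\<^sub>v (dims M (n - 1) (tail Q q))"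
    proof (intro ballI impI)
      fix q assume a: "q : arcs Q" "head Q q = z"
      have "tp (n - 1) (tail Q q) *\<^sub>v (Mat M (q, n) *\<^sub>v c) = Mat N (q, n) *\<^sub>v 0\<^sub>v (dims N n z)"
        using tp_comm_vec[OF n a(1)] c 0 a(2) by simp
      also have "... = 0\<^sub>v (dims N (n - 1) (tail Q q))" using loc_rep_dims[OF N a(1), of n] a(2) by auto
      finally have e: "tp (n - 1) (tail Q q) *\<^sub>v (Mat M (q, n) *\<^sub>v c) = 0\<^sub>v (dims N (n - 1) (tail Q q))" .
      have "Mat M (q, n) *\<^sub>v c : carrier_vec (dims M (n - 1) (tail Q q))"
        using mult_mat_vec_carrier[OF loc_rep_dims[OF M a(1), of n]] c a(2) by simp
      moreover have "tail Q q : verts Q" using a by simp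
      ultimately show "Mat M (q, n) *\<^sub>v c = 0\<^sub>v (dims M (n - 1) (tail Q q))" using B e unfolding top_bij_def by blast
    qed
    show ?thesis
    proof (cases "n = t")
      case True
      then show ?thesis using jM z c k unfolding jinj_def by blast
    next
      case False
      then have n': "n < t" using n by simp
      \<comment> \<open>A cycle with top \<open>c\<close> is completed by arrow coordinates
        \<open>y\<close> chosen, by surjectivity in degree \<open>n\<close>, to cancel the radical
        component of \<open>g\<close> at \<open>c\<close>. Then \<open>g\<close> maps it to 0, so it
        is a boundary and its top \<open>c\<close> is zero.\<close>
      let ?r = "%q. arm (dims M n) (dims N n) (g n) q *\<^sub>v c"
      have rc: "?r q : carrier_vec (dims N n (tail Q q))" if a: "q : arcs Q" "head Q q = z" for q
        using mult_mat_vec_carrier[OF arm_carrier[of "dims M n" "dims N n" "g n" q]] c a(2) by simp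
      have "EX y. y : carrier_vec (dims M n (tail Q q)) & tp n (tail Q q) *\<^sub>v y = - ?r q" if a: "q : arcs Q" "head Q q = z" for q
      proof -
        have "- ?r q : carrier_vec (dims N n (tail Q q))" using rc[OF a] by simp
        then show ?thesis using onto[of "tail Q q" "- ?r q"] a by auto
      qed
      then have "ALL q:{q : arcs Q. head Q q = z}. EX y. y : carrier_vec (dims M n (tail Q q)) & tp n (tail Q q) *\<^sub>v y = - ?r q" by blast
      from bchoice[OF this] obtain y where y: "ALL q:{q : arcs Q. head Q q = z}. y q : carrier_vec (dims M n (tail Q q)) & tp n (tail Q q) *\<^sub>v y q = - ?r q" ..
      have yc: "ALL q:arcs Q. head Q q = z --> y q : carrier_vec (dims M n (tail Q q))" using y by simp
      obtain v where v: "v : Sp (FT (dims M n)) z" "tv (dims M n) z v = c" "ALL q:arcs Q. head Q q = z --> av (dims M n) q v = y q"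
        using FT_exists_vec[where V = "dims M n" and w = y, OF z c yc] by blast
      have vc: "v : cycles (FC M) n z" unfolding FC_cycle_iff[OF M z] v(2) using v(1) k by blast
      have "g n z v = 0"
      proof (rule FT_eqI[OF z mhom_in[OF g[OF n] vert_Obj[OF z] v(1)] amod_0[OF FT_amod[OF loc_rep_fin[OF N]] vert_Obj[OF z]]])
        show "tv (dims N n) z (g n z v) = tv (dims N n) z 0" unfolding tp_tv[OF n z v(1)] v(2) 0 using z by simp
        fix q assume a: "q : arcs Q" "head Q q = z"
        have vS: "v : Sp (FT (dims M n)) (head Q q)" using v(1) a(2) by simp
        have e: "av (dims M n) q v = y q" "tp n (tail Q q) *\<^sub>v y q = - ?r q" using v(3) y a by blast+
        have "av (dims N n) q (g n z v) = - ?r q + ?r q" using tp_av[OF n a(1) vS] unfolding a(2) v(2) e .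
        also have "... = 0\<^sub>v (dims N n (tail Q q))" using rc[OF a] by simp
        finally show "av (dims N n) q (g n z v) = av (dims N n) q 0" using av_0[OF a(1)] by simp
      qed
      then have "g n z v : boundaries (FC N) n z" using boundaries_0[OF FC_complex[OF N] vert_Obj[OF z]] by simp
      from inj[OF n' z vc this] show ?thesis unfolding FC_boundary_iff[OF M z] v(2) by blast
    qed
  qed
  show ?thesis unfolding top_bij_def using onto inj0 by blast
qed

lemma tp_bij:
  assumes bM: "EX b. ALL n<b. supp (dims M n) = {}" and bN: "EX b. ALL n<b. supp (dims N n) = {}" and n: "n <= t"
  shows "tp_bij n"
proof -
  obtain b1 b2 where b1: "!!n. n < b1 ==> supp (dims M n) = {}" and b2: "!!n. n < b2 ==> supp (dims N n) = {}" using bM bN by blast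
  \<comment> \<open>Below both bounds all spaces vanish and bijectivity is trivial; the shift by 1
    turns the strict bounds into \<open>n <= b\<close>.\<close>
  define b where "b = min (min b1 b2 - 1) t"
  have z: "tp_bij n" if "n <= b" for n unfolding top_bij_def
  proof (intro ballI conjI impI)
    fix z and c :: "'k vec" assume z: "z : verts Q" and c: "c : carrier_vec (dims M n z)"
    have "dims M n z = 0" using dims_supp_zero[OF b1 z] that by (simp add: b_def)
    then show "c = 0\<^sub>v (dims M n z)" using vec_dim_0[of c "0\<^sub>v 0"] c by simp
  next
    fix z and w :: "'k vec" assume z: "z : verts Q" and w: "w : carrier_vec (dims N n z)"
    have d: "dims N n z = 0" using dims_supp_zero[OF b2 z] that by (simp add: b_def)
    have "tp n z *\<^sub>v 0\<^sub>v (dims M n z) : carrier_vec (dims N n z)" by (rule tp_vec[OF zero_carrier_vec])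
    then have "tp n z *\<^sub>v 0\<^sub>v (dims M n z) = w" using vec_dim_0 w unfolding d by blast
    then show "EX c:carrier_vec (dims M n z). tp n z *\<^sub>v c = w" using zero_carrier_vec by blast
  qed
  show ?thesis
  proof (cases "n <= b")
    case False
    then have "b <= n" by simp
    then show ?thesis using n
    proof (induction n rule: int_ge_induct)
      case base
      show ?case by (rule z) simp
    next
      case (step i)
      then show ?case using tp_bij_step[of "i + 1"] by simp
    qed
  qed (rule z)
qed

end

end

text \<open>Conjugating a commutation rule by inverses on both sides; it makes the pointwise inverse
  of a morphism a morphism.\<close>

lemma mat_inverse_comm:
  fixes X :: "'f::field mat"
  assumes c: "P : carrier_mat a a'" "I : carrier_mat a' a" "X : carrier_mat a' b'" "Y : carrier_mat a b"
      "P' : carrier_mat b b'" "I' : carrier_mat b' b"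
    and e: "I * P = 1\<^sub>m a'" "P' * I' = 1\<^sub>m b" "P * X = Y * P'"
  shows "I * Y = X * I'"
proof -
  note d = c[THEN carrier_matD(1)] c[THEN carrier_matD(2)]
  have "I * Y = I * Y * (P' * I')" unfolding e(2) using right_mult_one_mat[OF mult_carrier_mat[OF c(2,4)]] by simp
  also have "... = I * (Y * P') * I'" using d by (simp add: mat_assoc)
  also have "... = I * P * (X * I')" unfolding e(3)[symmetric] using d by (simp add: mat_assoc)
  finally show ?thesis unfolding e(1) using left_mult_one_mat[OF mult_carrier_mat[OF c(3,6)]] by simp
qed

context radical_square_zero_category
begin

context
  fixes N N0 a b t
  assumes N: "cpx N" and q: "is_qrep QB N0" and a: "a : chain N (FC N0)" and b: "b : chain (FC N0) N"
    and ba: "ALL n. ALL x:Obj A. ALL v:Sp (Tm N n) x. b n x (a n x v) = v"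
    and ab: "ALL n. ALL x:Obj A. ALL v:Sp (Tm (FC N0) n) x. a n x (b n x v) = v"
    and top: "top_degree A N = t"
begin

text \<open>Takes the place of the uniqueness of minimal resolutions. The truncation is exact from
  \<open>t\<close> on, so \<open>M'\<close> is coinduced above \<open>t\<close>; up to
  \<open>t\<close> the quasi-isomorphism has bijective tops by \<open>tp_bij\<close>. The resulting
  isomorphism with \<open>N0\<close>, hence with \<open>M\<close>, up to \<open>t\<close> extends by
  \<open>isomorphic_of_upto\<close>.\<close>

lemma resolution_isomorphic:
  assumes j: "jinj N0 t" and M: "lrep M" and co: "coinduced t M" and ag: "agree_upto t M N0"
    and M': "lrep M'" and f: "f : chain (FC M') (\<beta> A N)" and qi: "quasi_iso A (FC M') (\<beta> A N) f"
  shows "isomorphic LRep M' M"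
proof -
  note lM = lrep_loc[OF M] and lM' = lrep_loc[OF M']
  have lN0: "loc_rep N0" and bN: "EX b. ALL n<b. supp (dims N0 n) = {}" using q unfolding is_qrep_iff by blast+
  have bM: "EX b. ALL n<b. supp (dims M' n) = {}" using M' unfolding lrep_def by blast
  note cM' = FC_complex[OF lM']
  have exM': "exact_at (FC M') n" if "n >= t" for n
    by (rule quasi_iso_exact[OF cM' f qi]) (use beta_exact[OF N top that] in blast)
  have jM': "jinj M' t" using exM'[OF order_refl] unfolding exact_FC_iff[OF lM'] by blast
  have coM': "coinduced t M'" by (rule exact_coinduced[OF lM']) (use exM' in blast)
  define g where "g n = (%x v. a n x (f n x v))" for n
  have fh: "f n : mhom (FT (dims M' n)) (Tm N n)" if "n <= t" for n
    using chain_hom[OF f, of n] unfolding beta_Tm[OF N top that] FC_Tm .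
  have gh: "g n : mhom (FT (dims M' n)) (FT (dims N0 n))" if "n <= t" for n
    unfolding g_def using mhom_comp[OF fh[OF that] chain_hom[OF a, of n]] unfolding FC_Tm .
  have comm: "Df (FC N0) n x (g n x v) = g (n - 1) x (Df (FC M') n x v)" if "n <= t" for n x v
    using chain_comm[OF a, of n x "f n x v"] chain_comm[OF f, of n x v] unfolding beta_Df[OF N top that] g_def by simp
  have inj: "v : boundaries (FC M') n z"
    if n: "n < t" and z: "z : verts Q" and v: "v : cycles (FC M') n z" and B: "g n z v : boundaries (FC N0) n z" for n z v
  proof -
    note x = vert_Obj[OF z]
    obtain u where u: "u : Sp (Tm (FC N0) (n + 1)) z" "g n z v = Df (FC N0) (n + 1) z u" using B unfolding boundaries_def by blast
    have vS: "v : Sp (FT (dims M' n)) z" using v unfolding cycles_def FC_Tm by blast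
    have fS: "f n z v : Sp (Tm N n) z" using mhom_in[OF fh x vS] n by simp
    have "f n z v = b n z (g n z v)" unfolding g_def using ba[rule_format, OF x fS] by simp
    also have "... = Df N (n + 1) z (b (n + 1) z u)" unfolding u(2) using chain_comm[OF b, of "n + 1" z u] by simp
    finally have "f n z v : boundaries N n z" unfolding boundaries_def using mhom_in[OF chain_hom[OF b] x u(1)] by blast
    then have "f n z v : boundaries (\<beta> A N) n z" unfolding beta_boundaries[OF N top n] .
    then show ?thesis using qi x v unfolding quasi_iso_def by blast
  qed
  have surj: "EX v:cycles (FC M') n z. w - g n z v : boundaries (FC N0) n z"
    if n: "n < t" and z: "z : verts Q" and w: "w : cycles (FC N0) n z" for n z w
  proof -
    note x = vert_Obj[OF z]
    have wS: "w : Sp (Tm (FC N0) n) z" and w0: "Df (FC N0) n z w = 0" using w unfolding cycles_def by blast+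
    have bS: "b n z w : Sp (Tm N n) z" by (rule mhom_in[OF chain_hom[OF b] x wS])
    have "Df N n z (b n z w) = 0" unfolding chain_comm[OF b] w0 by (rule mhom_0[OF chain_hom[OF b]])
    then have "b n z w : cycles N n z" using bS unfolding cycles_def by blast
    then have "b n z w : cycles (\<beta> A N) n z" using beta_cycles[OF N top, of n z] n by simp
    then obtain v where v: "v : cycles (FC M') n z" "b n z w - f n z v : boundaries (\<beta> A N) n z"
      using qi x unfolding quasi_iso_def by blast
    then obtain u where u: "u : Sp (Tm N (n + 1)) z" "b n z w - f n z v = Df N (n + 1) z u"
      unfolding beta_boundaries[OF N top n] unfolding boundaries_def by blast
    have vS: "v : Sp (FT (dims M' n)) z" using v(1) unfolding cycles_def FC_Tm by blast
    have fS: "f n z v : Sp (Tm N n) z" using mhom_in[OF fh x vS] n by simp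
    have "w - g n z v = a n z (b n z w) - a n z (f n z v)" unfolding g_def using ab[rule_format, OF x wS] by simp
    also have "... = a n z (Df N (n + 1) z u)"
      unfolding u(2)[symmetric] using mhom_diff[OF complex_amod[OF N] chain_hom[OF a] x bS fS] by simp
    also have "... = Df (FC N0) (n + 1) z (a (n + 1) z u)" using chain_comm[OF a, of "n + 1" z u] by simp
    finally have "w - g n z v : boundaries (FC N0) n z" unfolding boundaries_def using mhom_in[OF chain_hom[OF a] x u(1)] by blast
    then show ?thesis using v(1) by blast
  qed
  have B: "top_bij (dims M' n) (dims N0 n) (g n)" if "n <= t" for n
    by (rule tp_bij[OF lM' lN0 gh comm inj surj jM' j bM bN that])
  define \<phi> where "\<phi> = (%(x, n). top (dims M' n) (dims N0 n) (g n) x)"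
  have \<phi>x: "\<phi> (x, n) = top (dims M' n) (dims N0 n) (g n) x" for x n by (simp add: \<phi>_def)
  have \<phi>c: "\<phi> (x, n) : carrier_mat (dims N0 n x) (dims M' n x)" for x n unfolding \<phi>x by (rule top_carrier)
  have \<phi>m: "\<phi> (tail Q q, n - 1) * Mat M' (q, n) = Mat N0 (q, n) * \<phi> (head Q q, n)" if n: "n <= t" and q: "q : arcs Q" for q n
    unfolding \<phi>x by (rule top_commute[OF lM' lN0]) (use gh comm n q in auto)
  have "EX B. B : carrier_mat (dims M' n x) (dims N0 n x) & \<phi> (x, n) * B = 1\<^sub>m (dims N0 n x) & B * \<phi> (x, n) = 1\<^sub>m (dims M' n x)"
    if x: "x : verts Q" and n: "n <= t" for x n
    by (rule mat_bij_inverse[OF \<phi>c]) (use B[OF n] x in \<open>simp_all add: top_bij_def \<phi>x\<close>)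
  then have "ALL v:verts Q \<times> {..t}. EX B. B : carrier_mat (dims M' (snd v) (fst v)) (dims N0 (snd v) (fst v)) &
      \<phi> v * B = 1\<^sub>m (dims N0 (snd v) (fst v)) & B * \<phi> v = 1\<^sub>m (dims M' (snd v) (fst v))" by auto
  from bchoice[OF this] obtain \<psi> where "ALL v:verts Q \<times> {..t}. \<psi> v : carrier_mat (dims M' (snd v) (fst v)) (dims N0 (snd v) (fst v)) &
      \<phi> v * \<psi> v = 1\<^sub>m (dims N0 (snd v) (fst v)) & \<psi> v * \<phi> v = 1\<^sub>m (dims M' (snd v) (fst v))" ..
  then have \<psi>: "\<psi> (x, n) : carrier_mat (dims M' n x) (dims N0 n x)" "\<phi> (x, n) * \<psi> (x, n) = 1\<^sub>m (dims N0 n x)"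
    "\<psi> (x, n) * \<phi> (x, n) = 1\<^sub>m (dims M' n x)" if "x : verts Q" "n <= t" for x n using that by auto
  have d: "dims M n = dims N0 n" "!!q. q : arcs Q ==> Mat M (q, n) = Mat N0 (q, n)" if "n <= t" for n
    using ag that unfolding agree_upto_def by simp_all
  show ?thesis
  proof (rule isomorphic_of_upto[OF M' M coM' co])
    show "hom_upto t M' M \<phi>" unfolding hom_upto_def using \<phi>c \<phi>m d by simp
    show "hom_upto t M M' \<psi>" unfolding hom_upto_def
    proof (intro conjI ballI allI impI)
      show "\<psi> (x, n) : carrier_mat (dims M' n x) (dims M n x)" if "x : verts Q" "n <= t" for x n
        using \<psi>(1)[OF that] d(1)[OF that(2)] by simp
      fix q n assume q: "q : arcs Q" and n: "n <= t"
      have v: "tail Q q : verts Q" "head Q q : verts Q" and n': "n - 1 <= t" using q n by simp_all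
      show "\<psi> (tail Q q, n - 1) * Mat M (q, n) = Mat M' (q, n) * \<psi> (head Q q, n)" unfolding d(2)[OF n q]
        by (rule mat_inverse_comm[OF \<phi>c \<psi>(1)[OF v(1) n'] loc_rep_dims[OF lM' q] loc_rep_dims[OF lN0 q] \<phi>c \<psi>(1)[OF v(2) n]
              \<psi>(3)[OF v(1) n'] \<psi>(2)[OF v(2) n] \<phi>m[OF n q]])
    qed
  qed (use \<psi> d in simp_all)
qed

end

section \<open>Identification of the chosen minimal resolutions\<close>

lemma min_model:
  assumes P: "P : KS" and min: "minimal_complex scale A P"
  obtains M where "lrep M" "isomorphic (ccat KS) P (FC M)"
proof -
  obtain M where M: "loc_rep M" and i: "isomorphic (ccat fgp_complexes) P (FC M)" using minimal_dense[of P] P min by blast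
  interpret cc: preadditive "ccat fgp_complexes" by (rule preadditive_complexes[OF fgp_complex])
  have z: "supp (dims M n) = {}" if "is_zero_amod A (Tm P n)" for n
    using isomorphic_complexes_zero[OF fgp_complex cc.isomorphic_sym[OF i] that] by (simp add: FC_Tm zero_FT)
  have PF: "P : fgp_complexes" "FC M : fgp_complexes" using i unfolding isomorphic_def by simp_all
  have ih: "isomorphic (hcat fgp_complexes) P (FC M)" by (rule isomorphic_complexes_homotopy[OF fgp_complex i PF])
  have "exact_at P n \<longleftrightarrow> exact_at (FC M) n" for n by (rule isomorphic_homotopy_exact[OF fgp_complex ih])
  then have "finite {n. \<not> exact_at (FC M) n}" using P by (simp add: bounded_homology_iff)
  moreover have "EX b. ALL n<b. supp (dims M n) = {}" using P z unfolding right_bounded_def by blast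
  ultimately have "lrep M" using M unfolding lrep_def by blast
  then show ?thesis using that isomorphic_complexes_mono[OF i P] FC_KS[OF M] by blast
qed

lemma isomorphic_KS: "isomorphic (ccat KS) P X ==> isomorphic (hcat KS) P X"
  using isomorphic_complexes_homotopy[of KS KS P X, OF KS_complex] unfolding isomorphic_def[of "ccat KS"] by simp

lemma resolution_model:
  assumes P: "is_min_proj_resolution scale A X P"
  obtains M f where "lrep M" "isomorphic (ccat KS) P (FC M)" "f : chain (FC M) X" "quasi_iso A (FC M) X f"
proof -
  have PK: "P : KS" and min: "minimal_complex scale A P"
    using P unfolding is_min_proj_resolution_def K_minus_b_eq homotopy_category_simps by blast+
  obtain f where f: "f : chain P X" and qi: "quasi_iso A P X f" using P unfolding is_min_proj_resolution_def by blast
  obtain M where M: "lrep M" and i: "isomorphic (ccat KS) P (FC M)" using min_model[OF PK min] .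
  obtain u w where u: "u : chain P (FC M)" and w: "w : chain (FC M) P"
    and wu: "ALL n x v. x : Obj A --> v : Sp (Tm P n) x --> w n x (u n x v) = v"
    and uw: "ALL n x v. x : Obj A --> v : Sp (Tm (FC M) n) x --> u n x (w n x v) = v"
    using isomorphic_complexesD[OF i] by metis
  define g where "g n = (%x v. f n x (w n x v))" for n
  have "g : chain (FC M) X"
  proof (rule chain_raw)
    show "g n : mhom (Tm (FC M) n) (Tm X n)" for n unfolding g_def by (rule mhom_comp[OF chain_hom[OF w] chain_hom[OF f]])
    show "Df X n x (g n x v) = g (n - 1) x (Df (FC M) n x v)" for n x v unfolding g_def chain_comm[OF f] chain_comm[OF w] ..
  qed
  moreover have "quasi_iso A (FC M) X g" unfolding quasi_iso_def
  proof (intro allI ballI conjI impI)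
    fix n x v assume x: "x : Obj A" and v: "v : cycles (FC M) n x" and B: "g n x v : boundaries X n x"
    have vS: "v : Sp (Tm (FC M) n) x" and v0: "Df (FC M) n x v = 0" using v unfolding cycles_def by blast+
    have "Df P n x (w n x v) = 0" unfolding chain_comm[OF w] v0 by (rule mhom_0[OF chain_hom[OF w]])
    then have "w n x v : cycles P n x" using mhom_in[OF chain_hom[OF w] x vS] unfolding cycles_def by blast
    then have "w n x v : boundaries P n x" using qi x B unfolding quasi_iso_def g_def by blast
    then obtain p where p: "p : Sp (Tm P (n + 1)) x" "w n x v = Df P (n + 1) x p" unfolding boundaries_def by blast
    have "v = u n x (Df P (n + 1) x p)" using uw x vS p(2) by metis
    also have "... = Df (FC M) (n + 1) x (u (n + 1) x p)" using chain_comm[OF u, of "n + 1" x p] by simp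
    finally show "v : boundaries (FC M) n x" unfolding boundaries_def using mhom_in[OF chain_hom[OF u] x p(1)] by blast
  next
    fix n x y assume x: "x : Obj A" and y: "y : cycles X n x"
    then obtain v where v: "v : cycles P n x" "y - f n x v : boundaries X n x" using qi unfolding quasi_iso_def by blast
    have vS: "v : Sp (Tm P n) x" and v0: "Df P n x v = 0" using v(1) unfolding cycles_def by blast+
    have "Df (FC M) n x (u n x v) = 0" unfolding chain_comm[OF u] v0 by (rule mhom_0[OF chain_hom[OF u]])
    then have "u n x v : cycles (FC M) n x" using mhom_in[OF chain_hom[OF u] x vS] unfolding cycles_def by blast
    moreover have "g n x (u n x v) = f n x v" unfolding g_def using wu x vS by simp
    ultimately show "EX v:cycles (FC M) n x. y - g n x v : boundaries X n x" using v(2) by metis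
  qed
  ultimately show ?thesis using that M i by blast
qed

lemma isomorphic_qrep:
  assumes "isomorphic LRep M M'" "is_qrep QB M" shows "is_qrep QB M'"
proof -
  have "lrep M'" using assms(1) unfolding isomorphic_def by simp
  moreover obtain t where "ALL n>t. supp (dims M n) = {}" using assms(2) unfolding is_qrep_iff by blast
  ultimately show ?thesis using isomorphic_LRep_supp[OF assms(1)] unfolding is_qrep_iff lrep_def by blast
qed

text \<open>Homotopy equivalence does not preserve boundedness of the terms, but a minimal complex
  is isomorphic as a complex to some \<open>FC M'\<close>. So it vanishes in the same degrees as
  \<open>M'\<close>, and \<open>M'\<close> is isomorphic to \<open>M\<close>.\<close>

lemma K_b_iff:
  assumes P: "P : KS" and min: "minimal_complex scale A P" and M: "lrep M" and i: "isomorphic (hcat KS) P (FC M)"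
  shows "P : Obj (K_b scale A) \<longleftrightarrow> is_qrep QB M"
proof -
  interpret K: functor_pair "hcat KS" LRep FC Gmap Umap by (rule functor_pair_K)
  interpret cc: preadditive "ccat KS" by (rule preadditive_complexes[OF KS_complex])
  obtain M' where M': "lrep M'" and i': "isomorphic (ccat KS) P (FC M')" using min_model[OF P min] .
  have z: "is_zero_amod A (Tm P n) \<longleftrightarrow> supp (dims M' n) = {}" for n
    using isomorphic_complexes_zero[OF KS_complex cc.isomorphic_sym[OF i'], of n] isomorphic_complexes_zero[OF KS_complex i', of n]
    by (auto simp: FC_Tm zero_FT)
  have "isomorphic (hcat KS) (FC M') (FC M)" using K.isomorphic_trans[OF K.isomorphic_sym[OF isomorphic_KS[OF i']] i] .
  then have ii: "isomorphic LRep M' M" "isomorphic LRep M M'"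
    using K.isomorphic_iff[of M' M] K.isomorphic_iff[of M M'] K.isomorphic_sym M M' by simp_all
  have "P : Obj (K_b scale A) \<longleftrightarrow> bounded_complex A P" using P unfolding K_b_def homotopy_category_simps by blast
  also have "... \<longleftrightarrow> is_qrep QB M'" unfolding bounded_complex_def z is_qrep_iff using M' unfolding lrep_def by blast
  finally show ?thesis using isomorphic_qrep[OF ii(1)] isomorphic_qrep[OF ii(2)] by blast
qed

lemma min_proj_resolution_props:
  assumes "is_min_proj_resolution scale A X (FC M)"
  defines "P \<equiv> min_proj_resolution scale A X"
  shows "is_min_proj_resolution scale A X P" "P : KS" "minimal_complex scale A P"
proof -
  show 1: "is_min_proj_resolution scale A X P" unfolding P_def min_proj_resolution_def by (rule someI) (rule assms(1))
  show "P : KS" "minimal_complex scale A P"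
    using 1 unfolding is_min_proj_resolution_def K_minus_b_eq homotopy_category_simps by blast+
qed

text \<open>\<open>beta_resolution\<close> shows that a minimal resolution exists, so that the
  choice operator returns one, and \<open>resolution_isomorphic\<close> identifies the one
  returned.\<close>

lemma truncation_resolution:
  assumes i: "isomorphic (ccat PS) N (FC N0)" and q: "is_qrep QB N0"
    and nz: "supp (dims N0 t) ~= {}" and zt: "ALL n>t. supp (dims N0 n) = {}" and j: "jinj N0 t"
    and M: "lrep M" and co: "coinduced t M" and ag: "agree_upto t M N0"
  defines "P \<equiv> min_proj_resolution scale A (\<beta> A N)"
  shows "P : KS" "minimal_complex scale A P" "isomorphic (hcat KS) P (FC M)"
proof -
  interpret K: functor_pair "hcat KS" LRep FC Gmap Umap by (rule functor_pair_K)
  have cN: "cpx N" using i PS_complex unfolding isomorphic_def by simp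
  obtain a b where a: "a : chain N (FC N0)" and b: "b : chain (FC N0) N"
    and ba: "ALL n. ALL x:Obj A. ALL v:Sp (Tm N n) x. b n x (a n x v) = v"
    and ab: "ALL n. ALL x:Obj A. ALL v:Sp (Tm (FC N0) n) x. a n x (b n x v) = v" using isomorphic_complexesD[OF i] by metis
  note ctx = cN q a b ba ab
  note tN = top_N[OF ctx nz zt]
  note res = beta_resolution[OF ctx nz zt j M co ag]
  show "P : KS" "minimal_complex scale A P" unfolding P_def by (rule min_proj_resolution_props[OF res])+
  obtain M' f where M': "lrep M'" and i': "isomorphic (ccat KS) P (FC M')"
    and f: "f : chain (FC M') (\<beta> A N)" and qi: "quasi_iso A (FC M') (\<beta> A N) f"
    by (rule resolution_model[OF min_proj_resolution_props(1)[OF res], folded P_def]) (rule that)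
  have "isomorphic LRep M' M" by (rule resolution_isomorphic[OF ctx tN j M co ag M' f qi])
  then have "isomorphic (hcat KS) (FC M') (FC M)" using K.isomorphic_iff[of M' M] M M' by simp
  then show "isomorphic (hcat KS) P (FC M)" using K.isomorphic_trans[OF isomorphic_KS[OF i']] by blast
qed

text \<open>The truncation is exact, so the zero complex resolves it and the chosen resolution is
  exact as well as minimal. Its representation then has injective joint maps in all degrees and
  vanishes far below, hence everywhere.\<close>

lemma concentrated_resolution:
  assumes i: "isomorphic (ccat PS) N (FC N0)" and q: "is_qrep QB N0"
    and nz: "supp (dims N0 t) ~= {}" and z: "ALL n. n ~= t --> supp (dims N0 n) = {}"
  shows "min_proj_resolution scale A (\<beta> A N) : Obj (K_b scale A)"
proof -
  let ?P = "min_proj_resolution scale A (\<beta> A N)"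
  have cN: "cpx N" using i PS_complex unfolding isomorphic_def by simp
  have zt: "ALL n>t. supp (dims N0 n) = {}" using z by simp
  obtain a b where a: "a : chain N (FC N0)" and b: "b : chain (FC N0) N"
    and ba: "ALL n. ALL x:Obj A. ALL v:Sp (Tm N n) x. b n x (a n x v) = v"
    and ab: "ALL n. ALL x:Obj A. ALL v:Sp (Tm (FC N0) n) x. a n x (b n x v) = v" using isomorphic_complexesD[OF i] by metis
  note ctx = cN q a b ba ab nz zt
  note tN = top_N[OF ctx]
  have zN: "is_zero_amod A (Tm N n)" if n: "n < t" for n
  proof -
    have "n ~= t" using n by simp
    then have "supp (dims N0 n) = {}" using z by blast
    then show ?thesis unfolding zero_N_iff[OF ctx] .
  qed
  have ex: "ALL x:Obj A. cycles (\<beta> A N) n x = boundaries (\<beta> A N) n x" for n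
    using beta_exact_everywhere[OF cN tN zN] by blast
  define Z :: "('o, 'a, 'k) brep" where "Z = \<lparr>Dim = (%_. 0), Mat = (%_. 0\<^sub>m 0 0)\<rparr>"
  have dZ: "supp (dims Z n) = {}" for n by (simp add: Z_def dims_def supp_def)
  have lZ: "loc_rep Z" unfolding loc_rep_def using dZ by (simp add: Z_def)
  then have qZ: "is_qrep QB Z" unfolding is_qrep_iff using dZ by blast
  note cZ = FC_complex[OF lZ]
  have zZ: "Sp (Tm (FC Z) n) x = {0}" if "x : Obj A" for n x
    using dZ[of n] that unfolding FC_Tm zero_FT[symmetric] is_zero_amod_def by blast
  have "czero : chain (FC Z) (\<beta> A N)"
  proof (rule chain_raw)
    show "czero n : mhom (Tm (FC Z) n) (Tm (\<beta> A N) n)" for n unfolding czero_def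
    proof (cases "n <= t")
      case True
      then show "(%x v. 0) : mhom (Tm (FC Z) n) (Tm (\<beta> A N) n)"
        unfolding beta_Tm[OF cN tN True] by (intro mhom_zero_map[OF complex_amod[OF cN]])
    next
      case False
      show "(%x v. 0) : mhom (Tm (FC Z) n) (Tm (\<beta> A N) n)"
      proof (cases "n = t + 1")
        case True
        show ?thesis
          unfolding True by (rule beta_top_hom[OF cN tN mhom_zero_map[OF complex_amod[OF cN]] mhom_0[OF complex_Df[OF cN]]])
      qed (use False beta_zero_hom[OF cN tN] in simp)
    qed
    show "Df (\<beta> A N) n x (czero n x v) = czero (n - 1) x (Df (FC Z) n x v)" for n x v
      unfolding czero_def by (rule beta_Df_0[OF cN tN])
  qed
  moreover have "quasi_iso A (FC Z) (\<beta> A N) czero" unfolding quasi_iso_def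
  proof (intro allI ballI conjI impI)
    fix n x v assume x: "x : Obj A" and v: "v : cycles (FC Z) n x"
    then have "v = 0" using zZ[OF x, of n] unfolding cycles_def by blast
    then show "v : boundaries (FC Z) n x" using boundaries_0[OF cZ x] by simp
  next
    fix n x w assume x: "x : Obj A" and w: "w : cycles (\<beta> A N) n x"
    then have "w - czero n x 0 : boundaries (\<beta> A N) n x" using ex[of n] unfolding czero_def by simp
    then show "EX v:cycles (FC Z) n x. w - czero n x v : boundaries (\<beta> A N) n x" using cycles_0[OF cZ x, of n] by blast
  qed
  moreover have "FC Z : Obj (K_minus_b scale A)"
    unfolding K_minus_b_eq homotopy_category_simps using FC_KS[OF lZ] qrep_lrep[OF qZ] by blast
  ultimately have res: "is_min_proj_resolution scale A (\<beta> A N) (FC Z)"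
    unfolding is_min_proj_resolution_def using FC_minimal[OF lZ] by blast
  obtain M f where M: "lrep M" and i': "isomorphic (ccat KS) ?P (FC M)"
    and f: "f : chain (FC M) (\<beta> A N)" and qi: "quasi_iso A (FC M) (\<beta> A N) f"
    by (rule resolution_model[OF min_proj_resolution_props(1)[OF res]]) (rule that)
  note lM = lrep_loc[OF M]
  have exM: "exact_at (FC M) n" for n by (rule quasi_iso_exact[OF FC_complex[OF lM] f qi ex])
  then have jM: "jinj M n" for n unfolding exact_FC_iff[OF lM] by blast
  obtain b where "!!n. n < b ==> supp (dims M n) = {}" using M unfolding lrep_def by blast
  then have b: "supp (dims M (b - 1)) = {}" "!!n. n < b ==> supp (dims M n) = {}" by simp_all
  have "supp (dims M n) = {}" for n
  proof (cases "n < b")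
    case False
    show ?thesis by (rule coinduced_supp[OF lM _ b(1)]) (use jM False in auto)
  qed (rule b(2))
  then have "is_qrep QB M" using lM unfolding is_qrep_iff by blast
  then show ?thesis using K_b_iff[OF min_proj_resolution_props(2,3)[OF res] M isomorphic_KS[OF i']] by blast
qed

lemma top_supp:
  assumes q: "is_qrep QB M" and nz: "\<not> vanish M"
  obtains t where "supp (dims M t) ~= {}" "ALL n>t. supp (dims M n) = {}"
proof -
  let ?S = "{n. supp (dims M n) ~= {}}"
  obtain b t where bt: "!!n. n < b ==> supp (dims M n) = {}" "!!n. n > t ==> supp (dims M n) = {}"
    using q unfolding is_qrep_iff by blast
  have "?S \<subseteq> {b..t}" using bt by (auto simp: not_less[symmetric])
  then have fin: "finite ?S" by (rule finite_subset) simp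
  have ne: "?S ~= {}" using nz unfolding vanish_def by blast
  have "Max ?S : ?S" by (rule Max_in[OF fin ne])
  then have 1: "supp (dims M (Max ?S)) ~= {}" by simp
  have "supp (dims M n) = {}" if "n > Max ?S" for n
  proof (rule ccontr)
    assume "supp (dims M n) ~= {}"
    then have "n <= Max ?S" using fin by (intro Max_ge) simp_all
    then show False using that by simp
  qed
  then show ?thesis using that 1 by blast
qed

text \<open>Up to isomorphism \<open>N\<close> is \<open>FC N0\<close> with \<open>N0\<close>
  indecomposable, and the resolution comes from the coinduced extension of \<open>N0\<close>, which
  stays indecomposable.\<close>

lemma X_bar_resolution:
  assumes N: "indecomposable (ccat PS) N"
  defines "P \<equiv> min_proj_resolution scale A (\<beta> A N)"
  assumes P: "P ~: Obj (K_b scale A)"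
  shows "P : KS & minimal_complex scale A P & indecomposable (hcat KS) P"
proof -
  interpret K: functor_pair "hcat KS" LRep FC Gmap Umap by (rule functor_pair_K)
  interpret P: functor_pair "ccat PS" "Rep QB" FC cphi ctop by (rule functor_pair_P)
  obtain N0 where N0: "N0 : Obj (Rep QB)" and i: "isomorphic (ccat PS) N (FC N0)"
    using P.dense[of N] N unfolding indecomposable_def by blast
  have ind: "indecomposable (Rep QB) N0" using P.indecomposable_iff[OF N0] P.indecomposable_isomorphic[OF i N] by blast
  then have q: "is_qrep QB N0" and nv: "\<not> vanish N0" unfolding indecomposable_Rep_iff by blast+
  then have lN0: "loc_rep N0" and bN0: "EX b. ALL n<b. supp (dims N0 n) = {}" unfolding is_qrep_iff by blast+
  obtain t where t: "supp (dims N0 t) ~= {}" "ALL n>t. supp (dims N0 n) = {}" using top_supp[OF q nv] .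
  \<comment> \<open>Otherwise \<open>N0\<close> would be concentrated in degree \<open>t\<close> and
    the resolution would be bounded.\<close>
  have j: "jinj N0 t"
  proof (rule ccontr)
    assume "\<not> jinj N0 t"
    then have "ALL n. n ~= t --> supp (dims N0 n) = {}" using not_jinj_concentrated[OF ind t(2)] by blast
    from concentrated_resolution[OF i q t(1) this] show False using P unfolding P_def by blast
  qed
  obtain M where M: "loc_rep M" "coinduced t M" "agree_upto t M N0" using coinduced_exists[OF lN0] .
  have L: "lrep M" by (rule coinduced_lrep[OF M bN0])
  note tr = truncation_resolution[OF i q t j L M(2,3), folded P_def]
  have "indecomposable LRep M" by (rule indecomposable_coinduced[OF L M(2,3) t(2) ind])
  then have "indecomposable (hcat KS) (FC M)" using K.indecomposable_iff[of M] L by simp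
  then have "indecomposable (hcat KS) P" using K.indecomposable_isomorphic[OF K.isomorphic_sym[OF tr(3)]] by blast
  then show ?thesis using tr by blast
qed

lemma unbounded_resolution:
  assumes M: "indecomposable LRep M" and nq: "\<not> is_qrep QB M" and S: "is_ind (ccat PS) S"
  shows "EX N:S. min_proj_resolution scale A (\<beta> A N) ~: Obj (K_b scale A) &
    isomorphic (hcat KS) (min_proj_resolution scale A (\<beta> A N)) (FC M)"
proof -
  interpret P: functor_pair "ccat PS" "Rep QB" FC cphi ctop by (rule functor_pair_P)
  have L: "lrep M" using M unfolding indecomposable_LRep_iff by blast
  note lM = lrep_loc[OF L]
  have fin: "finite {n. \<not> exact_at (FC M) n}" using L unfolding lrep_def by blast
  obtain t0 where t0: "!!n. n > t0 ==> exact_at (FC M) n"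
  proof -
    have "bdd_above {n. \<not> exact_at (FC M) n}" by (rule bdd_above_finite[OF fin])
    then obtain t0 where "!!n. \<not> exact_at (FC M) n ==> n <= t0" unfolding bdd_above_def by blast
    then show ?thesis using that[of t0] by force
  qed
  \<comment> \<open>Unboundedness provides a degree beyond all homology in which \<open>M\<close> is
    nonzero. This makes \<open>t\<close> the top degree of the truncation, and exactness from
    \<open>t\<close> on recovers \<open>M\<close> from it.\<close>
  obtain t where t: "t > t0" "supp (dims M t) ~= {}" using nq L unfolding is_qrep_iff lrep_def by blast
  have ex: "ALL n>=t. exact_at (FC M) n" using t0 t(1) by simp
  have co: "coinduced t M" by (rule exact_coinduced[OF lM ex])
  have jM: "jinj M t" using ex exact_FC_iff[OF lM, of t] by blast
  let ?N = "trunc t M"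
  have ind: "indecomposable (Rep QB) ?N" by (rule trunc_indecomposable[OF L co M t(2)])
  have q: "is_qrep QB ?N" by (rule trunc_qrep[OF L])
  have "indecomposable (ccat PS) (FC ?N)" using P.indecomposable_iff[of ?N] ind q by simp
  then obtain N where N: "N : S" "isomorphic (ccat PS) (FC ?N) N"
    using S unfolding is_ind_def exhaustive_list_of_indecomposables_def by blast
  have nz: "supp (dims ?N t) ~= {}" using t(2) trunc_dims[OF order_refl, of t M] by simp
  have zt: "ALL n>t. supp (dims ?N n) = {}" using trunc_supp by blast
  have j: "jinj ?N t" by (rule jinj_agree[OF trunc_agree(2) order_refl jM])
  note tr = truncation_resolution[OF P.isomorphic_sym[OF N(2)] q nz zt j L co trunc_agree(1)]
  show ?thesis using N(1) tr(3) K_b_iff[OF tr(1,2) L tr(3)] nq by blast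
qed

theorem derived_category_indecomposables:
  assumes R: "is_ind (Rep QB) R" and S: "is_ind (P_b_min scale A) S" and X: "is_X scale A S X"
  shows "exhaustive_list_of_indecomposables (K_minus_b scale A) (R <+> X)
    (case_sum FC (%N. min_proj_resolution scale A (\<beta> A N)))"
proof -
  let ?K = "hcat KS"
  let ?P = "%N. min_proj_resolution scale A (\<beta> A N)"
  let ?L = "case_sum FC ?P"
  interpret K: functor_pair ?K LRep FC Gmap Umap by (rule functor_pair_K)
  have Rq: "is_qrep QB M" and Ri: "indecomposable LRep M" and Rl: "lrep M" if "M : R" for M
  proof -
    have *: "indecomposable (Rep QB) M" using R that unfolding is_ind_def exhaustive_list_of_indecomposables_def by blast
    then show q: "is_qrep QB M" unfolding indecomposable_Rep_iff by blast
    show "indecomposable LRep M" using * indecomposable_bounded[OF q] by blast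
    show "lrep M" by (rule qrep_lrep[OF q])
  qed
  have XX: "N : S" "?P N ~: Obj (K_b scale A)" if "N : X" for N using X that unfolding is_X_def X_bar_def by blast+
  have XP: "?P N : KS" "minimal_complex scale A (?P N)" "indecomposable ?K (?P N)" if N: "N : X" for N
  proof -
    have "indecomposable (ccat PS) N"
      using S XX(1)[OF N] unfolding P_b_min_eq is_ind_def exhaustive_list_of_indecomposables_def by blast
    from X_bar_resolution[OF this XX(2)[OF N]] show "?P N : KS" "minimal_complex scale A (?P N)" "indecomposable ?K (?P N)" by blast+
  qed
  \<comment> \<open>Boundedness separates the two families: a minimal complex isomorphic in the
    homotopy category to \<open>FC M\<close> with bounded \<open>M\<close> is itself
    bounded.\<close>
  have RX: "\<not> isomorphic ?K (?P N) (FC M)" if "M : R" "N : X" for M N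
    using K_b_iff[OF XP(1,2)[OF that(2)] Rl[OF that(1)]] Rq[OF that(1)] XX(2)[OF that(2)] by blast
  have eqv: "X_equiv scale A N N' \<longleftrightarrow> isomorphic ?K (?P N) (?P N')" for N N' unfolding X_equiv_def K_minus_b_eq ..
  show ?thesis unfolding K_minus_b_eq exhaustive_list_of_indecomposables_def
  proof (intro conjI ballI impI allI)
    fix j assume "j : R <+> X"
    then show "indecomposable ?K (?L j)" using K.indecomposable_iff Ri Rl XP(3) by (auto simp del: homotopy_category_simps)
  next
    fix i j assume i: "i : R <+> X" and j: "j : R <+> X" and ne: "i ~= j"
    show "\<not> isomorphic ?K (?L i) (?L j)"
    proof
      assume iso: "isomorphic ?K (?L i) (?L j)"
      show False
      proof (cases i; cases j)
        fix M M' assume e: "i = Inl M" "j = Inl M'"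
        then have m: "M : R" "M' : R" using i j by auto
        have "isomorphic LRep M M'" using iso K.isomorphic_iff[of M M'] Rl[OF m(1)] Rl[OF m(2)] unfolding e by simp
        \<comment> \<open>\<open>Rep\<close> and \<open>LRep\<close> have the same morphisms, so for
          bounded representations isomorphism means the same in both.\<close>
        then have "isomorphic (Rep QB) M M'" unfolding isomorphic_def LRep_simps Rep_simps(1,2) using Rq[OF m(1)] Rq[OF m(2)] by blast
        then show False using R m ne e unfolding is_ind_def exhaustive_list_of_indecomposables_def by blast
      next
        fix M N assume e: "i = Inl M" "j = Inr N"
        then have "M : R" "N : X" using i j by auto
        then show False using RX K.isomorphic_sym[OF iso] unfolding e by simp
      next
        fix N M assume e: "i = Inr N" "j = Inl M"
        then have "M : R" "N : X" using i j by auto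
        then show False using RX iso unfolding e by simp
      next
        fix N N' assume e: "i = Inr N" "j = Inr N'"
        then have m: "N : X" "N' : X" using i j by auto
        have "X_equiv scale A N N'" using iso unfolding e eqv by simp
        \<comment> \<open>Both \<open>N\<close> and \<open>N'\<close> represent the class of
          \<open>N\<close>, which has a unique representative in \<open>X\<close>.\<close>
        moreover have "X_equiv scale A N N" unfolding eqv by (rule K.isomorphic_refl) (use XP(1)[OF m(1)] in simp)
        moreover have "N : X_bar scale A S" using X m unfolding is_X_def by blast
        ultimately have "N = N'" using X m unfolding is_X_def by blast
        then show False using ne e by simp
      qed
    qed
  next
    fix Y assume Y: "indecomposable ?K Y"
    then obtain M where M: "M : Obj LRep" and i: "isomorphic ?K Y (FC M)" using K.dense[of Y] unfolding indecomposable_def by blast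
    have ind: "indecomposable LRep M" using K.indecomposable_iff[OF M] K.indecomposable_isomorphic[OF i Y] by blast
    show "EX j:R <+> X. isomorphic ?K Y (?L j)"
    proof (cases "is_qrep QB M")
      case True
      then obtain M' where M': "M' : R" "isomorphic (Rep QB) M M'"
        using R ind indecomposable_bounded unfolding is_ind_def exhaustive_list_of_indecomposables_def by blast
      have "isomorphic LRep M M'" using M'(2) M Rl[OF M'(1)] unfolding isomorphic_def LRep_simps Rep_simps(1,2) by blast
      then have "isomorphic ?K (FC M) (FC M')" using K.isomorphic_iff[of M M'] M Rl[OF M'(1)] by simp
      then have "isomorphic ?K Y (?L (Inl M'))" using K.isomorphic_trans[OF i] by simp
      then show ?thesis using M'(1) by blast
    next
      case False
      obtain N where N: "N : S" "?P N ~: Obj (K_b scale A)" "isomorphic ?K (?P N) (FC M)"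
        using unbounded_resolution[OF ind False S[unfolded P_b_min_eq]] by blast
      then have "N : X_bar scale A S" unfolding X_bar_def by blast
      then obtain N' where N': "N' : X" "isomorphic ?K (?P N) (?P N')" using X unfolding is_X_def eqv by blast
      have "isomorphic ?K Y (?L (Inr N'))"
        using K.isomorphic_trans[OF i K.isomorphic_trans[OF K.isomorphic_sym[OF N(3)] N'(2)]] by simp
      then show ?thesis using N'(1) by blast
    qed
  qed
qed

end

theorem theorem4p1:
  fixes scale :: "'k::alg_closed_field \<Rightarrow> 'm::ab_group_add \<Rightarrow> 'm"
    and A :: "('o, 'm) precat"
    and Q :: "('o, 'a) pre_digraph"
    and \<rho> :: "'a \<Rightarrow> 'm"
    and R :: "('o \<times> int, 'a \<times> int, 'k) qrep set"
    and S X :: "('o, 'm) cplx set"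
  assumes "lofd_category scale A"
    and "radical_square_zero scale A"
    and "is_quiver_of scale A Q \<rho>"
    and "is_ind (Rep (box_quiver Q)) R"
    and "is_ind (P_b_min scale A) S"
    and "is_X scale A S X"
  shows "exhaustive_list_of_indecomposables (K_minus_b scale A) (R <+> X)
           (case_sum (F_complex scale A Q \<rho>) (\<lambda>N. min_proj_resolution scale A (\<beta> A N)))"
proof -
  interpret lofd_category scale A by (rule assms(1))
  interpret radical_square_zero_category scale A Q \<rho>
    by (intro radical_square_zero_category.intro lofd_category_alg_closed.intro
      radical_square_zero_category_axioms.intro assms)
  show ?thesis by (rule derived_category_indecomposables[OF assms(4-6)])
qed

end
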